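(* Let $n\ge2$ be an integer, $a\in\mathbb C^*$ and $b\in\mathbb R$ with $|a|^2-b<0$. Let $\tilde C\subset Q$ be the curve $$\zeta\eta+a\zeta+\bar a\eta+b=0,$$ and put $C:=\Phi(\tilde C)\subset Q/\mathbb Z_n$. Then the restriction $\Phi|_{\tilde C}:\tilde C\to C$ is the normalization map. Moreover, $C$ is a rational curve having exactly $n-1$ ordinary nodes as its only singularities, all of which lie away from the four singular points of $Q/\mathbb Z_n$. If $n$ is odd, all these nodes are non-real, whereas if $n$ is even, exactly one of them is real.
   Context: $Q=\mathbb P^1\times\mathbb P^1$ (over $\mathbb C$) with affine coordinates $(\zeta,\eta)$; curves given by affine equations are understood to be closed up in $Q$. The real structure is the anti-holomorphic involution $\sigma(\zeta,\eta)=(\bar\eta,\bar\zeta)$. The group $\mathbb Z_n$ acts on $Q$, generated by $R(\zeta,\eta)=(e^{2\pi i/n}\zeta,e^{-2\pi i/n}\eta)$; $\Phi:Q\to Q/\mathbb Z_n$ is the quotient map, and $\sigma$ induces a real structure, also denoted $\sigma$, on $Q/\mathbb Z_n$. A point is real if it is fixed by $\sigma$. The four singular points of $Q/\mathbb Z_n$ are the images of the fixed points $(0,0),(\infty,\infty),(0,\infty),(\infty,0)$ of the action. *)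

theory Defs
  imports "HOL-Analysis.Analysis"
begin

section \<open>Spaces with functions\<close>

text \<open>
  Varieties over the complex numbers are handled classically: a Zariski topology together with
  a sheaf of complex-valued functions. A section over \<open>U\<close> is a total function of which only the
  values on \<open>U\<close> matter, and \<open>sections X U\<close> is only meaningful for open \<open>U\<close>.
\<close>

record 'a fspace =
  zar :: "'a topology"
  sections :: "'a set \<Rightarrow> ('a \<Rightarrow> complex) set"

text \<open>
  The induced (reduced) structure on a subset: functions that locally extend to sections of the
  ambient space. It is used for open subsets, closed subsets and open subsets of closed ones.
\<close>

definition sub :: "'a fspace \<Rightarrow> 'a set \<Rightarrow> 'a fspace" where
  "sub X S = \<lparr>zar = subtopology (zar X) S,
     sections = (\<lambda>U. {f. \<forall>p\<in>U. \<exists>W g. openin (zar X) W \<and> p \<in> W \<and> g \<in> sections X W \<and>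
                                     (\<forall>q\<in>W \<inter> U. f q = g q)})\<rparr>"

definition morphism :: "'a fspace \<Rightarrow> 'b fspace \<Rightarrow> ('a \<Rightarrow> 'b) \<Rightarrow> bool" where
  "morphism X Y \<phi> \<longleftrightarrow> continuous_map (zar X) (zar Y) \<phi> \<and>
     (\<forall>V f. openin (zar Y) V \<and> f \<in> sections Y V \<longrightarrow>
        f \<circ> \<phi> \<in> sections X {x \<in> topspace (zar X). \<phi> x \<in> V})"

definition isomorphism :: "'a fspace \<Rightarrow> 'b fspace \<Rightarrow> ('a \<Rightarrow> 'b) \<Rightarrow> bool" where
  "isomorphism X Y \<phi> \<longleftrightarrow> bij_betw \<phi> (topspace (zar X)) (topspace (zar Y)) \<and>
     morphism X Y \<phi> \<and> morphism Y X (inv_into (topspace (zar X)) \<phi>)"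

definition irreducible_in :: "'a topology \<Rightarrow> 'a set \<Rightarrow> bool" where
  "irreducible_in T S \<longleftrightarrow> S \<subseteq> topspace T \<and> S \<noteq> {} \<and>
     (\<forall>A B. closedin T A \<and> closedin T B \<and> S \<subseteq> A \<union> B \<longrightarrow> S \<subseteq> A \<or> S \<subseteq> B)"

definition irreducible_chain :: "'a topology \<Rightarrow> nat \<Rightarrow> (nat \<Rightarrow> 'a set) \<Rightarrow> bool" where
  "irreducible_chain T d Z \<longleftrightarrow>
     (\<forall>i\<le>d. closedin T (Z i) \<and> irreducible_in T (Z i)) \<and> (\<forall>i<d. Z i \<subset> Z (Suc i))"

definition krull_dim :: "'a topology \<Rightarrow> nat \<Rightarrow> bool" where
  "krull_dim T d \<longleftrightarrow> (\<exists>Z. irreducible_chain T d Z) \<and> (\<nexists>Z. irreducible_chain T (Suc d) Z)"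


section \<open>Local rings\<close>

text \<open>
  Elements of the local ring at \<open>p\<close> are represented by functions that are sections near \<open>p\<close>;
  two of them are the same element iff they agree eventually in \<open>nhdsin (zar X) p\<close>.
\<close>

definition germs :: "'a fspace \<Rightarrow> 'a \<Rightarrow> ('a \<Rightarrow> complex) set" where
  "germs X p = {f. \<exists>U. openin (zar X) U \<and> p \<in> U \<and> f \<in> sections X U}"

definition germ_eq :: "'a fspace \<Rightarrow> 'a \<Rightarrow> ('a \<Rightarrow> complex) \<Rightarrow> ('a \<Rightarrow> complex) \<Rightarrow> bool" where
  "germ_eq X p f g \<longleftrightarrow> (\<forall>\<^sub>F x in nhdsin (zar X) p. f x = g x)"

definition max_ideal :: "'a fspace \<Rightarrow> 'a \<Rightarrow> ('a \<Rightarrow> complex) set" where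
  "max_ideal X p = {f \<in> germs X p. f p = 0}"

definition max_ideal_power :: "'a fspace \<Rightarrow> 'a \<Rightarrow> nat \<Rightarrow> ('a \<Rightarrow> complex) set" where
  "max_ideal_power X p k = {f \<in> germs X p. \<exists>r c g.
     (\<forall>i<r. c i \<in> germs X p) \<and> (\<forall>i<r. \<forall>j<k. g i j \<in> max_ideal X p) \<and>
     germ_eq X p f (\<lambda>x. \<Sum>i<(r::nat). c i x * (\<Prod>j<k. g i j x))}"

text \<open>The classes of \<open>t 0, \<dots>, t (d - 1)\<close> form a basis of the cotangent space
  \<open>\<mm> / \<mm>\<^sup>2\<close> over the residue field.\<close>

definition cotangent_basis :: "'a fspace \<Rightarrow> 'a \<Rightarrow> nat \<Rightarrow> (nat \<Rightarrow> 'a \<Rightarrow> complex) \<Rightarrow> bool" where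
  "cotangent_basis X p d t \<longleftrightarrow> (\<forall>i<d. t i \<in> max_ideal X p) \<and>
     (\<forall>f\<in>max_ideal X p. \<exists>!c. c \<in> {..<d} \<rightarrow>\<^sub>E UNIV \<and>
        (\<lambda>x. f x - (\<Sum>i<d. c i * t i x)) \<in> max_ideal_power X p 2)"

text \<open>Regularity of the local ring. It is applied to irreducible \<open>X\<close> only, where the
  dimension of every local ring at a (closed) point is the dimension of \<open>X\<close>.\<close>

definition nonsingular_at :: "'a fspace \<Rightarrow> 'a \<Rightarrow> bool" where
  "nonsingular_at X p \<longleftrightarrow> (\<exists>d t. krull_dim (zar X) d \<and> cotangent_basis X p d t)"

definition singular_points :: "'a fspace \<Rightarrow> 'a set" where
  "singular_points X = {p \<in> topspace (zar X). \<not> nonsingular_at X p}"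

text \<open>The local ring is a domain, and it is integrally closed: every fraction \<open>f / g\<close> that
  satisfies a monic equation (written here after clearing denominators) lies in the ring.\<close>

definition normal_at :: "'a fspace \<Rightarrow> 'a \<Rightarrow> bool" where
  "normal_at X p \<longleftrightarrow>
     (\<forall>f\<in>germs X p. \<forall>g\<in>germs X p. germ_eq X p (\<lambda>x. f x * g x) (\<lambda>x. 0) \<longrightarrow>
        germ_eq X p f (\<lambda>x. 0) \<or> germ_eq X p g (\<lambda>x. 0)) \<and>
     (\<forall>f\<in>germs X p. \<forall>g\<in>germs X p. \<forall>k c.
        \<not> germ_eq X p g (\<lambda>x. 0) \<and> (\<forall>i<k. c i \<in> germs X p) \<and>
        germ_eq X p (\<lambda>x. f x ^ k + (\<Sum>i<k. c i x * f x ^ i * g x ^ (k - i))) (\<lambda>x. 0) \<longrightarrow>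
        (\<exists>h\<in>germs X p. germ_eq X p f (\<lambda>x. h x * g x)))"

text \<open>
  \<open>p\<close> is an ordinary node of the curve \<open>D\<close> on the surface \<open>S\<close>: the surface is nonsingular at
  \<open>p\<close> (its cotangent space is two-dimensional), and a local equation \<open>f\<close> of \<open>D\<close> has
  multiplicity two with two distinct tangents, that is, its leading form is the product of two
  independent linear forms.
\<close>

definition ordinary_node :: "'a fspace \<Rightarrow> 'a set \<Rightarrow> 'a \<Rightarrow> bool" where
  "ordinary_node S D p \<longleftrightarrow> p \<in> D \<and>
     (\<exists>t f. cotangent_basis S p 2 t \<and> f \<in> germs S p \<and>
        (\<forall>g\<in>germs S p. (\<forall>\<^sub>F q in nhdsin (zar S) p. q \<in> D \<longrightarrow> g q = 0) \<longleftrightarrow>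
                        (\<exists>h\<in>germs S p. germ_eq S p g (\<lambda>q. h q * f q))) \<and>
        (\<lambda>q. f q - t 0 q * t 1 q) \<in> max_ideal_power S p 3)"


section \<open>Affine space, affine varieties and finite morphisms\<close>

inductive_set polyfuns :: "nat \<Rightarrow> ((nat \<Rightarrow> complex) \<Rightarrow> complex) set" for N :: nat where
  const: "(\<lambda>x. c) \<in> polyfuns N"
| coord: "i < N \<Longrightarrow> (\<lambda>x. x i) \<in> polyfuns N"
| add: "F \<in> polyfuns N \<Longrightarrow> G \<in> polyfuns N \<Longrightarrow> (\<lambda>x. F x + G x) \<in> polyfuns N"
| mult: "F \<in> polyfuns N \<Longrightarrow> G \<in> polyfuns N \<Longrightarrow> (\<lambda>x. F x * G x) \<in> polyfuns N"

definition zar_affine :: "nat \<Rightarrow> (nat \<Rightarrow> complex) topology" where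
  "zar_affine N = topology_generated_by
     {{x \<in> {..<N} \<rightarrow>\<^sub>E UNIV. F x \<noteq> 0} | F. F \<in> polyfuns N}"

definition affine_nspace :: "nat \<Rightarrow> (nat \<Rightarrow> complex) fspace" where
  "affine_nspace N = \<lparr>zar = zar_affine N,
     sections = (\<lambda>U. {f. \<forall>p\<in>U. \<exists>W F G. openin (zar_affine N) W \<and> p \<in> W \<and> W \<subseteq> U \<and>
        F \<in> polyfuns N \<and> G \<in> polyfuns N \<and> (\<forall>x\<in>W. G x \<noteq> 0 \<and> f x = F x / G x)})\<rparr>"

definition affine_variety :: "'a fspace \<Rightarrow> bool" where
  "affine_variety X \<longleftrightarrow>
     (\<exists>N Z \<phi>. closedin (zar_affine N) Z \<and> isomorphism X (sub (affine_nspace N) Z) \<phi>)"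

text \<open>Locally on the target, a morphism of affine varieties that makes the upper coordinate
  ring a finitely generated module over the lower one.\<close>

definition finite_morphism :: "'a fspace \<Rightarrow> 'b fspace \<Rightarrow> ('a \<Rightarrow> 'b) \<Rightarrow> bool" where
  "finite_morphism X Y \<nu> \<longleftrightarrow> morphism X Y \<nu> \<and>
     (\<forall>y\<in>topspace (zar Y). \<exists>V. openin (zar Y) V \<and> y \<in> V \<and> affine_variety (sub Y V) \<and>
        (let U = {x \<in> topspace (zar X). \<nu> x \<in> V} in
           affine_variety (sub X U) \<and>
           (\<exists>B. finite B \<and> B \<subseteq> sections X U \<and>
              (\<forall>f\<in>sections X U. \<exists>h. (\<forall>b\<in>B. h b \<in> sections Y V) \<and>
                 (\<forall>x\<in>U. f x = (\<Sum>b\<in>B. h b (\<nu> x) * b x))))))"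

definition birational_morphism :: "'a fspace \<Rightarrow> 'b fspace \<Rightarrow> ('a \<Rightarrow> 'b) \<Rightarrow> bool" where
  "birational_morphism X Y \<nu> \<longleftrightarrow> morphism X Y \<nu> \<and>
     (\<exists>U V. openin (zar X) U \<and> U \<noteq> {} \<and> openin (zar Y) V \<and> V \<noteq> {} \<and>
        isomorphism (sub X U) (sub Y V) \<nu>)"

definition birational :: "'a fspace \<Rightarrow> 'b fspace \<Rightarrow> bool" where
  "birational X Y \<longleftrightarrow>
     (\<exists>U V \<phi>. openin (zar X) U \<and> U \<noteq> {} \<and> openin (zar Y) V \<and> V \<noteq> {} \<and>
        isomorphism (sub X U) (sub Y V) \<phi>)"

definition normalization_map :: "'a fspace \<Rightarrow> 'b fspace \<Rightarrow> ('a \<Rightarrow> 'b) \<Rightarrow> bool" where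
  "normalization_map X Y \<nu> \<longleftrightarrow>
     irreducible_in (zar X) (topspace (zar X)) \<and> irreducible_in (zar Y) (topspace (zar Y)) \<and>
     (\<forall>p\<in>topspace (zar X). normal_at X p) \<and> finite_morphism X Y \<nu> \<and> birational_morphism X Y \<nu>"


section \<open>The projective line and \<open>Q\<close>, the product of two projective lines\<close>

datatype P1 = Aff complex | Infty

text \<open>Homogeneous coordinates \<open>(z0, z1)\<close> of a point, where the affine coordinate is \<open>z1 / z0\<close>.
  Only zeros of (bi)homogeneous forms, and quotients of forms of equal (bi)degree, are used
  below; these do not depend on the chosen representative.\<close>

fun hom :: "P1 \<Rightarrow> complex \<times> complex" where
  "hom (Aff z) = (1, z)"
| "hom Infty = (0, 1)"

definition form :: "nat \<Rightarrow> (nat \<Rightarrow> complex) \<Rightarrow> complex \<times> complex \<Rightarrow> complex" where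
  "form d c z = (\<Sum>i\<le>d. c i * fst z ^ (d - i) * snd z ^ i)"

definition biform ::
  "nat \<Rightarrow> nat \<Rightarrow> (nat \<Rightarrow> nat \<Rightarrow> complex) \<Rightarrow> complex \<times> complex \<Rightarrow> complex \<times> complex \<Rightarrow> complex" where
  "biform d e c z w =
     (\<Sum>i\<le>d. \<Sum>j\<le>e. c i j * (fst z ^ (d - i) * snd z ^ i) * (fst w ^ (e - j) * snd w ^ j))"

lemma form_scale: "form d c (l * x, l * y) = l ^ d * form d c (x, y)"
proof -
  have "c i * (l * x) ^ (d - i) * (l * y) ^ i = l ^ d * (c i * x ^ (d - i) * y ^ i)" if "i \<le> d" for i
  proof -
    have "l ^ d = l ^ (d - i) * l ^ i"
      using that by (simp flip: power_add)
    then show ?thesis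
      by (simp add: power_mult_distrib)
  qed
  then show ?thesis
    unfolding form_def fst_conv snd_conv sum_distrib_left by (intro sum.cong) auto
qed

lemma biform_eq_form: "biform d e c z w = form d (\<lambda>i. form e (c i) w) z"
  unfolding biform_def form_def sum_distrib_right
  by (intro sum.cong refl) (simp add: mult_ac)

lemma biform_scale:
  "biform d e c (l * x, l * y) (m * u, m * v) = l ^ d * m ^ e * biform d e c (x, y) (u, v)"
proof -
  have "form d (\<lambda>i. k * C i) z = k * form d C z" for k C z
    by (simp add: form_def sum_distrib_left mult.assoc)
  then show ?thesis
    by (simp add: biform_eq_form form_scale mult.assoc)
qed

definition zar_P1 :: "P1 topology" where
  "zar_P1 = topology_generated_by {{p. form d c (hom p) \<noteq> 0} | d c. True}"

definition P1_space :: "P1 fspace" where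
  "P1_space = \<lparr>zar = zar_P1,
     sections = (\<lambda>U. {f. \<forall>p\<in>U. \<exists>W d c c'. openin zar_P1 W \<and> p \<in> W \<and> W \<subseteq> U \<and>
        (\<forall>x\<in>W. form d c' (hom x) \<noteq> 0 \<and> f x = form d c (hom x) / form d c' (hom x))})\<rparr>"

definition biform_at :: "nat \<Rightarrow> nat \<Rightarrow> (nat \<Rightarrow> nat \<Rightarrow> complex) \<Rightarrow> P1 \<times> P1 \<Rightarrow> complex" where
  "biform_at d e c q = biform d e c (hom (fst q)) (hom (snd q))"

definition zar_Q :: "(P1 \<times> P1) topology" where
  "zar_Q = topology_generated_by {{q. biform_at d e c q \<noteq> 0} | d e c. True}"

definition Q_space :: "(P1 \<times> P1) fspace" where
  "Q_space = \<lparr>zar = zar_Q,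
     sections = (\<lambda>U. {f. \<forall>p\<in>U. \<exists>W d e c c'. openin zar_Q W \<and> p \<in> W \<and> W \<subseteq> U \<and>
        (\<forall>x\<in>W. biform_at d e c' x \<noteq> 0 \<and> f x = biform_at d e c x / biform_at d e c' x)})\<rparr>"

lemma topspace_zar_Q [simp]: "topspace zar_Q = UNIV"
proof -
  have *: "{q. biform_at 0 0 (\<lambda>_ _. 1) q \<noteq> 0} = UNIV"
    by (simp add: biform_at_def biform_def)
  have "{q. biform_at 0 0 (\<lambda>_ _. 1) q \<noteq> 0} \<in> {{q. biform_at d e c q \<noteq> 0} | d e c. True}"
    by (intro CollectI exI conjI TrueI) (rule refl)
  from Sup_upper[OF this] show ?thesis
    unfolding zar_Q_def topology_generated_by_topspace * by (rule top_le)
qed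

text \<open>An integral closed curve in the ambient space \<open>S\<close> that is birational to the projective line.\<close>

definition rational_curve :: "'a fspace \<Rightarrow> 'a set \<Rightarrow> bool" where
  "rational_curve S D \<longleftrightarrow> closedin (zar S) D \<and> irreducible_in (zar S) D \<and>
     krull_dim (zar (sub S D)) 1 \<and> birational (sub S D) P1_space"


section \<open>The cyclic action, its quotient and the real structure\<close>

fun scale_P1 :: "complex \<Rightarrow> P1 \<Rightarrow> P1" where
  "scale_P1 l (Aff z) = Aff (l * z)"
| "scale_P1 l Infty = Infty"

fun cnj_P1 :: "P1 \<Rightarrow> P1" where
  "cnj_P1 (Aff z) = Aff (cnj z)"
| "cnj_P1 Infty = Infty"

definition rot :: "nat \<Rightarrow> P1 \<times> P1 \<Rightarrow> P1 \<times> P1" where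
  "rot n q = (scale_P1 (exp (2 * of_real pi * \<i> / of_nat n)) (fst q),
              scale_P1 (exp (- (2 * of_real pi * \<i> / of_nat n))) (snd q))"

text \<open>Points of the quotient are orbits. Since \<open>rot n\<close> has order \<open>n\<close>, natural powers suffice.\<close>

definition Phi :: "nat \<Rightarrow> P1 \<times> P1 \<Rightarrow> (P1 \<times> P1) set" where
  "Phi n q = range (\<lambda>k. (rot n ^^ k) q)"

text \<open>The quotient as a variety: the quotient topology, and the functions whose pullback
  to \<open>Q\<close> is regular.\<close>

definition zar_quot :: "nat \<Rightarrow> (P1 \<times> P1) set topology" where
  "zar_quot n = topology (\<lambda>V. V \<subseteq> range (Phi n) \<and> openin zar_Q (Phi n -` V))"

definition Q_quot :: "nat \<Rightarrow> (P1 \<times> P1) set fspace" where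
  "Q_quot n = \<lparr>zar = zar_quot n,
     sections = (\<lambda>V. {f. f \<circ> Phi n \<in> sections Q_space (Phi n -` V)})\<rparr>"

lemma openin_zar_quot:
  "openin (zar_quot n) V \<longleftrightarrow> V \<subseteq> range (Phi n) \<and> openin zar_Q (Phi n -` V)"
proof -
  have "istopology (\<lambda>V. V \<subseteq> range (Phi n) \<and> openin zar_Q (Phi n -` V))"
    unfolding istopology_def
  proof (intro conjI allI impI)
    fix S T
    assume "S \<subseteq> range (Phi n) \<and> openin zar_Q (Phi n -` S)"
      and "T \<subseteq> range (Phi n) \<and> openin zar_Q (Phi n -` T)"
    then show "S \<inter> T \<subseteq> range (Phi n)" and "openin zar_Q (Phi n -` (S \<inter> T))"
      unfolding vimage_Int by (blast, blast intro: openin_Int)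
  next
    fix K
    assume "\<forall>S\<in>K. S \<subseteq> range (Phi n) \<and> openin zar_Q (Phi n -` S)"
    then show "\<Union> K \<subseteq> range (Phi n)" and "openin zar_Q (Phi n -` \<Union> K)"
      unfolding vimage_Union by (blast, blast intro: openin_Union)
  qed
  then show ?thesis
    unfolding zar_quot_def by (simp add: topology_inverse')
qed

lemma topspace_zar_quot: "topspace (zar_quot n) = range (Phi n)"
proof -
  have "Phi n -` range (Phi n) = topspace zar_Q"
    by auto
  then have *: "openin (zar_quot n) (range (Phi n))"
    unfolding openin_zar_quot using openin_topspace[of zar_Q] by simp
  then show ?thesis
    using openin_subset[OF *] openin_topspace[of "zar_quot n"] unfolding openin_zar_quot
    by (intro subset_antisym) simp_all
qed

lemma quotient_map_Phi: "quotient_map zar_Q (zar_quot n) (Phi n)"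
  by (auto simp: quotient_map_def topspace_zar_quot openin_zar_quot vimage_def)

definition sigma_Q :: "P1 \<times> P1 \<Rightarrow> P1 \<times> P1" where
  "sigma_Q q = (cnj_P1 (snd q), cnj_P1 (fst q))"

text \<open>The real structure induced on the quotient sends an orbit to its image.\<close>

definition sigma_quot :: "(P1 \<times> P1) set \<Rightarrow> (P1 \<times> P1) set" where
  "sigma_quot p = sigma_Q ` p"

lemma cnj_scale_P1: "cnj_P1 (scale_P1 l p) = scale_P1 (cnj l) (cnj_P1 p)"
  by (cases p) auto

lemma sigma_rot: "sigma_Q (rot n q) = rot n (sigma_Q q)"
  by (simp add: sigma_Q_def rot_def cnj_scale_P1 exp_cnj)

lemma sigma_quot_Phi: "sigma_quot (Phi n q) = Phi n (sigma_Q q)"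
proof -
  have "sigma_Q ((rot n ^^ k) q) = (rot n ^^ k) (sigma_Q q)" for k
    by (induction k) (simp_all add: sigma_rot)
  then show ?thesis
    by (simp add: sigma_quot_def Phi_def image_image)
qed

definition real_point :: "(P1 \<times> P1) set \<Rightarrow> bool" where
  "real_point p \<longleftrightarrow> sigma_quot p = p"

definition quot_singular_points :: "nat \<Rightarrow> (P1 \<times> P1) set set" where
  "quot_singular_points n =
     Phi n ` {(Aff 0, Aff 0), (Infty, Infty), (Aff 0, Infty), (Infty, Aff 0)}"


section \<open>The curves\<close>

definition C_tilde :: "complex \<Rightarrow> real \<Rightarrow> (P1 \<times> P1) set" where
  "C_tilde a b = zar_Q closure_of
     {(Aff \<zeta>, Aff \<eta>) | \<zeta> \<eta>. \<zeta> * \<eta> + a * \<zeta> + cnj a * \<eta> + of_real b = 0}"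

definition C_curve :: "nat \<Rightarrow> complex \<Rightarrow> real \<Rightarrow> (P1 \<times> P1) set set" where
  "C_curve n a b = Phi n ` C_tilde a b"

end

theory Submission
  imports Defs "HOL-Computational_Algebra.Fundamental_Theorem_Algebra"
begin

text \<open>
  The curve upstairs is the graph of a Moebius map, hence a projective line with coordinate
  \<open>t = \<zeta>\<close>. The invariants \<open>x = \<zeta> \<eta>\<close> and \<open>y = \<zeta>\<^sup>n\<close> are coordinates of the quotient
  where \<open>\<zeta>\<close> and \<open>\<eta>\<close> are finite and non-zero. Two points \<open>t, t'\<close> of the curve share the same \<open>x\<close>
  when they are the roots of \<open>t\<^sup>2 - s(x) t + p(x)\<close>, and the powers of a root satisfy
  \<open>t\<^sup>n = A(x) t + B(x)\<close> with \<open>A\<close> the Lucas polynomial of the pair \<open>s, p\<close>. Hence \<open>t\<close> and \<open>t'\<close> are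
  identified in the quotient exactly when \<open>A(x) = 0\<close>. Explicitly, the roots of \<open>A\<close> are the squares of
  \<open>v k = |a| cos (\<pi> k / n) + \<i> sqrt (b - |a|\<^sup>2 cos\<^sup>2 (\<pi> k / n))\<close> for \<open>1 \<le> k < n\<close>; they are
  \<open>n - 1\<close> distinct numbers, so all are simple. Each gives a node because the image has the equation
  \<open>(2 y - S(x))\<^sup>2 = A(x)\<^sup>2 D(x)\<close>, where \<open>S = t\<^sup>n + t'\<^sup>n\<close>, \<open>D = s\<^sup>2 - 4 p\<close>, and \<open>D \<noteq> 0\<close> at the roots of \<open>A\<close>.
  Away from these points the quotient map restricts to an isomorphism onto its image, which is read off
  from averages over the group; near them the ring upstairs is generated by \<open>1\<close> and \<open>t\<close>
  over the ring downstairs. Finally the involution maps \<open>x\<close> to its conjugate, and \<open>(v k)\<^sup>2\<close> is real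
  only for \<open>2 k = n\<close>.
\<close>

section \<open>Germs of rational functions in one variable\<close>

text \<open>The numbers \<open>v k\<close> arise as follows. Two non-zero roots \<open>t\<close>,
  \<open>t'\<close> with equal \<open>n\<close>-th powers have ratio
  \<open>exp (2 \<pi> \<i> k / n)\<close>, so
  \<open>s\<^sup>2 = 4 cos\<^sup>2 (\<pi> k / n) p\<close>. With \<open>x = v\<^sup>2\<close> and a
  suitable sign of \<open>v\<close> this is
  \<open>v\<^sup>2 + b = 2 |a| cos (\<pi> k / n) v\<close>. The hypothesis
  \<open>|a|\<^sup>2 < b\<close> makes the discriminant negative for every \<open>k\<close>, so a
  root in the upper half plane can be selected, and its real part still determines \<open>k\<close>.
  The obstacle is that normality, finiteness and nodes are stated for sheaves of total functions on
  a quotient topology. Curves are therefore described by \<open>param_curve\<close>: a finite-to-one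
  parameter for which sections are the functions regular in the parameter on every branch. Group
  averages establish this away from the double points. They fail at a double point, because a form
  isolating one translate of the curve vanishes where two translates meet. There \<open>x\<close>
  and \<open>y\<close> take over, and the simplicity of the roots of \<open>A\<close> makes them
  generate every function with equal values on the two branches.\<close>

lemma eventually_poly_nonzero:
  fixes P :: "complex poly"
  assumes "P \<noteq> 0"
  shows "\<forall>\<^sub>F t in cofinite. poly P t \<noteq> 0"
  using poly_roots_finite[OF assms] by (simp add: eventually_cofinite)

lemma poly_eqI_cofinite:
  fixes P Q :: "complex poly"
  assumes "\<forall>\<^sub>F t in cofinite. poly P t = poly Q t"
  shows "P = Q"
proof (rule ccontr)
  assume "P \<noteq> Q"
  then have "\<forall>\<^sub>F t in cofinite. poly (P - Q) t \<noteq> 0"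
    by (intro eventually_poly_nonzero) simp
  with assms have "\<forall>\<^sub>F t::complex in cofinite. False"
    by eventually_elim simp
  then show False
    by (simp add: eventually_cofinite infinite_UNIV_char_0)
qed

lemma eventually_cofinite_neq: "\<forall>\<^sub>F t in cofinite. t \<noteq> a"
  by (simp add: eventually_cofinite)

lemma eventually_cofinite_ex:
  fixes Q :: "complex \<Rightarrow> bool"
  assumes "\<forall>\<^sub>F t in cofinite. Q t"
  obtains t where "Q t"
proof -
  have "infinite {t. Q t}"
    using assms infinite_UNIV_char_0[where 'a=complex] finite_UnI[of "{t. Q t}" "{t. \<not> Q t}"]
    by (auto simp: eventually_cofinite Collect_neg_eq)
  then show thesis
    using that infinite_imp_nonempty by blast
qed

text \<open>The local ring of the affine line at \<open>t0\<close>, represented by total functions.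
  The value at \<open>t0\<close> is tied to the fraction, while finitely many exceptions elsewhere
  are harmless because finite sets are closed.\<close>

definition reg_at :: "complex \<Rightarrow> (complex \<Rightarrow> complex) set" where
  "reg_at t0 = {\<phi>. \<exists>P H. poly H t0 \<noteq> 0 \<and> \<phi> t0 = poly P t0 / poly H t0 \<and>
     (\<forall>\<^sub>F t in cofinite. \<phi> t = poly P t / poly H t)}"

lemma reg_atI:
  assumes "poly H t0 \<noteq> 0" "\<phi> t0 = poly P t0 / poly H t0"
    "\<forall>\<^sub>F t in cofinite. \<phi> t = poly P t / poly H t"
  shows "\<phi> \<in> reg_at t0"
  using assms unfolding reg_at_def by blast

lemma reg_atE:
  assumes "\<phi> \<in> reg_at t0"
  obtains P H where "poly H t0 \<noteq> 0" "\<phi> t0 = poly P t0 / poly H t0"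
    "\<forall>\<^sub>F t in cofinite. poly H t \<noteq> 0 \<and> \<phi> t = poly P t / poly H t"
proof -
  obtain P H where *: "poly H t0 \<noteq> 0" "\<phi> t0 = poly P t0 / poly H t0"
    "\<forall>\<^sub>F t in cofinite. \<phi> t = poly P t / poly H t"
    using assms unfolding reg_at_def by blast
  moreover have "H \<noteq> 0"
    using *(1) by auto
  ultimately show thesis
    using that eventually_conj[OF eventually_poly_nonzero] by blast
qed

lemma reg_at_cong:
  assumes "\<phi> \<in> reg_at t0" "\<psi> t0 = \<phi> t0" "\<forall>\<^sub>F t in cofinite. \<psi> t = \<phi> t"
  shows "\<psi> \<in> reg_at t0"
proof -
  obtain P H where "poly H t0 \<noteq> 0" "\<phi> t0 = poly P t0 / poly H t0"
    "\<forall>\<^sub>F t in cofinite. poly H t \<noteq> 0 \<and> \<phi> t = poly P t / poly H t"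
    using reg_atE[OF assms(1)] .
  then show ?thesis
    using assms(2,3) by (intro reg_atI[of H _ _ P]) (auto elim: eventually_elim2)
qed

text \<open>The cross-multiplied numerators agree as polynomials because they agree at almost all
  points, and this identity can be evaluated at \<open>t0\<close>. Values at a point are therefore
  determined by generic behaviour.\<close>

lemma reg_at_eqI:
  assumes "\<phi> \<in> reg_at t0" "\<psi> \<in> reg_at t0" "\<forall>\<^sub>F t in cofinite. \<phi> t = \<psi> t"
  shows "\<phi> t0 = \<psi> t0"
proof -
  obtain P H where 1: "poly H t0 \<noteq> 0" "\<phi> t0 = poly P t0 / poly H t0"
    "\<forall>\<^sub>F t in cofinite. poly H t \<noteq> 0 \<and> \<phi> t = poly P t / poly H t"
    using reg_atE[OF assms(1)] .
  obtain P' H' where 2: "poly H' t0 \<noteq> 0" "\<psi> t0 = poly P' t0 / poly H' t0"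
    "\<forall>\<^sub>F t in cofinite. poly H' t \<noteq> 0 \<and> \<psi> t = poly P' t / poly H' t"
    using reg_atE[OF assms(2)] .
  have "P * H' = P' * H"
    using 1(3) 2(3) assms(3)
    by (intro poly_eqI_cofinite, eventually_elim) (auto simp: field_simps)
  then have "poly P t0 * poly H' t0 = poly P' t0 * poly H t0"
    by (metis poly_mult)
  then show ?thesis
    unfolding 1(2) 2(2) using 1(1) 2(1) by (simp add: frac_eq_eq)
qed

lemma reg_at_poly: "poly P \<in> reg_at t0"
  by (rule reg_atI[of 1 _ _ P]) auto

lemma reg_at_const: "(\<lambda>t. c) \<in> reg_at t0"
  by (rule reg_atI[of 1 _ _ "[:c:]"]) auto

lemma reg_at_id: "(\<lambda>t. t) \<in> reg_at t0"
  by (rule reg_atI[of 1 _ _ "[:0, 1:]"]) auto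

lemma reg_at_add:
  assumes "\<phi> \<in> reg_at t0" "\<psi> \<in> reg_at t0"
  shows "(\<lambda>t. \<phi> t + \<psi> t) \<in> reg_at t0"
proof -
  obtain P H where 1: "poly H t0 \<noteq> 0" "\<phi> t0 = poly P t0 / poly H t0"
    "\<forall>\<^sub>F t in cofinite. poly H t \<noteq> 0 \<and> \<phi> t = poly P t / poly H t"
    using reg_atE[OF assms(1)] .
  obtain P' H' where 2: "poly H' t0 \<noteq> 0" "\<psi> t0 = poly P' t0 / poly H' t0"
    "\<forall>\<^sub>F t in cofinite. poly H' t \<noteq> 0 \<and> \<psi> t = poly P' t / poly H' t"
    using reg_atE[OF assms(2)] .
  have "\<forall>\<^sub>F t in cofinite. \<phi> t + \<psi> t = poly (P * H' + P' * H) t / poly (H * H') t"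
    using 1(3) 2(3) by eventually_elim (auto simp: field_simps)
  then show ?thesis
    using 1 2 by (intro reg_atI[of "H * H'" _ _ "P * H' + P' * H"]) (auto simp: field_simps)
qed

lemma reg_at_mult:
  assumes "\<phi> \<in> reg_at t0" "\<psi> \<in> reg_at t0"
  shows "(\<lambda>t. \<phi> t * \<psi> t) \<in> reg_at t0"
proof -
  obtain P H where 1: "poly H t0 \<noteq> 0" "\<phi> t0 = poly P t0 / poly H t0"
    "\<forall>\<^sub>F t in cofinite. poly H t \<noteq> 0 \<and> \<phi> t = poly P t / poly H t"
    using reg_atE[OF assms(1)] .
  obtain P' H' where 2: "poly H' t0 \<noteq> 0" "\<psi> t0 = poly P' t0 / poly H' t0"
    "\<forall>\<^sub>F t in cofinite. poly H' t \<noteq> 0 \<and> \<psi> t = poly P' t / poly H' t"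
    using reg_atE[OF assms(2)] .
  have "\<forall>\<^sub>F t in cofinite. \<phi> t * \<psi> t = poly (P * P') t / poly (H * H') t"
    using 1(3) 2(3) by eventually_elim (auto simp: field_simps)
  then show ?thesis
    using 1 2 by (intro reg_atI[of "H * H'" _ _ "P * P'"]) auto
qed

lemma reg_at_inverse:
  assumes "\<phi> \<in> reg_at t0" "\<phi> t0 \<noteq> 0"
  shows "(\<lambda>t. inverse (\<phi> t)) \<in> reg_at t0"
proof -
  obtain P H where 1: "poly H t0 \<noteq> 0" "\<phi> t0 = poly P t0 / poly H t0"
    "\<forall>\<^sub>F t in cofinite. poly H t \<noteq> 0 \<and> \<phi> t = poly P t / poly H t"
    using reg_atE[OF assms(1)] .
  have "\<forall>\<^sub>F t in cofinite. inverse (\<phi> t) = poly H t / poly P t"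
    using 1(3) by eventually_elim (auto simp: field_simps)
  then show ?thesis
    using 1 assms(2) by (intro reg_atI[of P _ _ H]) (auto simp: field_simps)
qed

lemma reg_at_divide:
  "\<phi> \<in> reg_at t0 \<Longrightarrow> \<psi> \<in> reg_at t0 \<Longrightarrow> \<psi> t0 \<noteq> 0 \<Longrightarrow> (\<lambda>t. \<phi> t / \<psi> t) \<in> reg_at t0"
  using reg_at_mult[OF _ reg_at_inverse] by (simp add: divide_inverse)

lemma reg_at_diff:
  assumes "\<phi> \<in> reg_at t0" "\<psi> \<in> reg_at t0"
  shows "(\<lambda>t. \<phi> t - \<psi> t) \<in> reg_at t0"
  using reg_at_add[OF assms(1) reg_at_mult[OF reg_at_const[of "-1"] assms(2)]] by simp

lemma reg_at_sum:
  "(\<And>i. i \<in> I \<Longrightarrow> \<phi> i \<in> reg_at t0) \<Longrightarrow> (\<lambda>t. \<Sum>i\<in>I. \<phi> i t) \<in> reg_at t0"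
  by (induction I rule: infinite_finite_induct) (auto intro: reg_at_add reg_at_const)

lemma reg_at_power: "\<phi> \<in> reg_at t0 \<Longrightarrow> (\<lambda>t. \<phi> t ^ k) \<in> reg_at t0"
  by (induction k) (auto intro: reg_at_mult reg_at_const)

lemma reg_at_zero_or_nonzero:
  assumes "\<phi> \<in> reg_at t0"
  shows "(\<forall>\<^sub>F t in cofinite. \<phi> t = 0) \<or> (\<forall>\<^sub>F t in cofinite. \<phi> t \<noteq> 0)"
proof -
  obtain P H where 1: "poly H t0 \<noteq> 0" "\<phi> t0 = poly P t0 / poly H t0"
    "\<forall>\<^sub>F t in cofinite. poly H t \<noteq> 0 \<and> \<phi> t = poly P t / poly H t"
    using reg_atE[OF assms] .
  show ?thesis
  proof (cases "P = 0")
    case True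
    then show ?thesis
      using 1(3) by (simp add: eventually_conj_iff)
  next
    case False
    have "\<forall>\<^sub>F t in cofinite. \<phi> t \<noteq> 0"
      using eventually_poly_nonzero[OF False] 1(3) by eventually_elim simp
    then show ?thesis ..
  qed
qed

text \<open>The discrete valuation of the local ring: \<open>m\<close> is the multiplicity of
  \<open>t0\<close> as a root of the numerator. Taking \<open>\<psi>\<close> to be the actual
  quotient off \<open>t0\<close> makes the factorisation valid at every \<open>t\<close>,
  exceptional points included.\<close>

lemma reg_at_order:
  assumes "\<phi> \<in> reg_at t0" "\<not> (\<forall>\<^sub>F t in cofinite. \<phi> t = 0)"
  obtains m \<psi> where "\<psi> \<in> reg_at t0" "\<psi> t0 \<noteq> 0" "\<And>t. \<phi> t = (t - t0) ^ m * \<psi> t"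
proof -
  obtain P H where 1: "poly H t0 \<noteq> 0" "\<phi> t0 = poly P t0 / poly H t0"
    "\<forall>\<^sub>F t in cofinite. poly H t \<noteq> 0 \<and> \<phi> t = poly P t / poly H t"
    using reg_atE[OF assms(1)] .
  have "P \<noteq> 0"
    proof
    assume "P = 0"
    then have "\<forall>\<^sub>F t in cofinite. \<phi> t = 0"
      using 1(3) by (simp add: eventually_conj_iff)
    with assms(2) show False ..
  qed
  then obtain Q where Q: "P = [:- t0, 1:] ^ order t0 P * Q" "\<not> [:- t0, 1:] dvd Q"
    using order_decomp by blast
  define m where "m = order t0 P"
  define \<psi> where "\<psi> t = (if t = t0 then poly Q t0 / poly H t0 else \<phi> t / (t - t0) ^ m)" for t
  have eq: "poly P t = (t - t0) ^ m * poly Q t" for t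
    by (subst Q(1)) (simp add: m_def)
  have "\<forall>\<^sub>F t in cofinite. \<psi> t = poly Q t / poly H t"
    using 1(3) eventually_cofinite_neq[of t0]
    by eventually_elim (auto simp: \<psi>_def eq)
  then have "\<psi> \<in> reg_at t0"
    using 1(1) by (intro reg_atI[of H _ _ Q]) (auto simp: \<psi>_def)
  moreover have "\<psi> t0 \<noteq> 0"
    using Q(2) 1(1) by (simp add: \<psi>_def poly_eq_0_iff_dvd)
  moreover have "\<phi> t = (t - t0) ^ m * \<psi> t" for t
    using 1 by (auto simp: \<psi>_def eq)
  ultimately show thesis
    using that by blast
qed

lemma reg_at_factor:
  assumes "\<phi> \<in> reg_at t0" "\<phi> t0 = 0"
  obtains \<psi> where "\<psi> \<in> reg_at t0" "\<And>t. \<phi> t = (t - t0) * \<psi> t"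
proof -
  obtain P H where 1: "poly H t0 \<noteq> 0" "\<phi> t0 = poly P t0 / poly H t0"
    "\<forall>\<^sub>F t in cofinite. poly H t \<noteq> 0 \<and> \<phi> t = poly P t / poly H t"
    using reg_atE[OF assms(1)] .
  then have "poly P t0 = 0"
    using assms(2) by simp
  then obtain Q where Q: "P = [:- t0, 1:] * Q"
    by (auto simp: poly_eq_0_iff_dvd)
  define \<psi> where "\<psi> t = (if t = t0 then poly Q t0 / poly H t0 else \<phi> t / (t - t0))" for t
  have eq: "poly P t = (t - t0) * poly Q t" for t
    by (simp add: Q algebra_simps)
  have "\<forall>\<^sub>F t in cofinite. \<psi> t = poly Q t / poly H t"
    using 1(3) eventually_cofinite_neq[of t0]
    by eventually_elim (auto simp: \<psi>_def eq)
  then have "\<psi> \<in> reg_at t0"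
    using 1(1) by (intro reg_atI[of H _ _ Q]) (auto simp: \<psi>_def)
  moreover have "\<phi> t = (t - t0) * \<psi> t" for t
    using assms(2) by (auto simp: \<psi>_def)
  ultimately show thesis
    using that by blast
qed

text \<open>Each point of \<open>A\<close> supplies only its own fraction. Among all denominators
  representing \<open>\<phi>\<close> generically, one of least degree cannot vanish on
  \<open>A\<close>: at a zero the numerator would vanish too, and the common linear factor could be
  cancelled.\<close>

lemma reg_at_global:
  assumes A: "t1 \<in> A" and reg: "\<And>t. t \<in> A \<Longrightarrow> \<phi> \<in> reg_at t"
  obtains P H where "\<And>t. t \<in> A \<Longrightarrow> poly H t \<noteq> 0 \<and> \<phi> t = poly P t / poly H t"
    "\<forall>\<^sub>F t in cofinite. \<phi> t = poly P t / poly H t"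
proof -
  define R where "R P H \<longleftrightarrow> H \<noteq> 0 \<and> (\<forall>\<^sub>F t in cofinite. \<phi> t * poly H t = poly P t)" for P H
  obtain P0 H0 where "poly H0 t1 \<noteq> 0"
    "\<forall>\<^sub>F t in cofinite. poly H0 t \<noteq> 0 \<and> \<phi> t = poly P0 t / poly H0 t"
    using reg_atE[OF reg[OF A]] by metis
  then have "R P0 H0"
    unfolding R_def using eventually_mono[where P="\<lambda>t. poly H0 t \<noteq> 0 \<and> \<phi> t = poly P0 t / poly H0 t"] by fastforce
  then obtain H where "\<exists>P. R P H" and min: "\<And>P' H'. R P' H' \<Longrightarrow> degree H \<le> degree H'"
    using ex_has_least_nat[of "\<lambda>H. \<exists>P. R P H" H0 degree] by blast
  then obtain P where R: "R P H"
    by blast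
  have "poly H t \<noteq> 0 \<and> \<phi> t = poly P t / poly H t" if tA: "t \<in> A" for t
  proof -
    obtain Q K where 2: "poly K t \<noteq> 0" "\<phi> t = poly Q t / poly K t"
      "\<forall>\<^sub>F t in cofinite. poly K t \<noteq> 0 \<and> \<phi> t = poly Q t / poly K t"
      using reg_atE[OF reg[OF tA]] .
    have "\<forall>\<^sub>F t in cofinite. \<phi> t * poly H t = poly P t"
      using R by (simp add: R_def)
    then have "Q * H = P * K"
      using 2(3)
      by (intro poly_eqI_cofinite, eventually_elim) (auto simp: field_simps)
    then have eq: "poly Q t * poly H t = poly P t * poly K t"
      by (metis poly_mult)
    have "poly H t \<noteq> 0"
    proof
      assume 0: "poly H t = 0"
      then have "poly P t = 0"
        using eq 2(1) by auto
      with 0 obtain P1 H1 where PH: "P = [:- t, 1:] * P1" "H = [:- t, 1:] * H1"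
        by (metis dvdE poly_eq_0_iff_dvd)
      have "H1 \<noteq> 0"
        using R PH by (auto simp: R_def)
      moreover have "\<forall>\<^sub>F u in cofinite. \<phi> u * poly H1 u = poly P1 u"
        using R[unfolded R_def, THEN conjunct2] eventually_cofinite_neq[of t]
      proof eventually_elim
        case (elim u)
        then have "(u - t) * (\<phi> u * poly H1 u) = (u - t) * poly P1 u"
          unfolding PH by (simp add: algebra_simps)
        then show ?case
          using elim by simp
      qed
      ultimately have "degree H \<le> degree H1"
        by (intro min) (simp add: R_def)
      moreover have "degree H = Suc (degree H1)"
        using \<open>H1 \<noteq> 0\<close> unfolding PH by (subst degree_mult_eq) auto
      ultimately show False
        by simp
    qed
    then show ?thesis
      unfolding 2(2) using eq 2(1) by (simp add: frac_eq_eq)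
  qed
  moreover have "\<forall>\<^sub>F t in cofinite. \<phi> t = poly P t / poly H t"
    using R[unfolded R_def, THEN conjunct2] eventually_poly_nonzero[OF R[unfolded R_def, THEN conjunct1]]
    by eventually_elim (simp add: field_simps)
  ultimately show thesis
    using that by blast
qed

section \<open>Cofinite topologies\<close>

text \<open>The shape of the Zariski topology on an irreducible curve. On an infinite space it
  already yields irreducibility and dimension one.\<close>

definition cofinite_topology :: "'a topology \<Rightarrow> bool" where
  "cofinite_topology T \<longleftrightarrow>
     (\<forall>W. openin T W \<longleftrightarrow> W \<subseteq> topspace T \<and> (W = {} \<or> finite (topspace T - W)))"

lemma closedin_cofinite_topology:
  assumes "cofinite_topology T"
  shows "closedin T F \<longleftrightarrow> F \<subseteq> topspace T \<and> (F = topspace T \<or> finite F)"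
  using assms unfolding cofinite_topology_def closedin_def
  by (auto simp: double_diff)

lemma irreducible_in_cofinite_topology:
  assumes "cofinite_topology T" "infinite (topspace T)"
  shows "irreducible_in T (topspace T)"
  unfolding irreducible_in_def
proof (intro conjI allI impI)
  fix A B assume AB: "closedin T A \<and> closedin T B \<and> topspace T \<subseteq> A \<union> B"
  then have "infinite (A \<union> B)"
    using assms(2) infinite_super by blast
  then show "topspace T \<subseteq> A \<or> topspace T \<subseteq> B"
    using AB unfolding closedin_cofinite_topology[OF assms(1)] by auto
qed (use assms(2) in auto)

lemma irreducible_in_finite:
  assumes "irreducible_in T F" "finite F" "\<And>p. p \<in> F \<Longrightarrow> closedin T {p}"
  obtains p where "F = {p}"
proof -
  obtain p where p: "p \<in> F"
    using assms(1) by (auto simp: irreducible_in_def)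
  have "closedin T (\<Union>q\<in>F - {p}. {q})"
    using assms(2,3) by (intro closedin_Union) auto
  moreover have "(\<Union>q\<in>F - {p}. {q}) = F - {p}"
    by auto
  ultimately have "closedin T (F - {p})"
    by simp
  moreover have "closedin T {p}" "F \<subseteq> {p} \<union> (F - {p})"
    using assms(3) p by auto
  ultimately have "F \<subseteq> {p} \<or> F \<subseteq> F - {p}"
    using assms(1) unfolding irreducible_in_def by blast
  then show thesis
    using p that by blast
qed

text \<open>A proper closed subset is finite, and a finite irreducible set is a single point. In a
  chain with two strict inclusions the middle member would be such a point and leave only the empty
  set below it.\<close>

lemma krull_dim_cofinite_topology:
  assumes "cofinite_topology T" "infinite (topspace T)"
  shows "krull_dim T 1"
  unfolding krull_dim_def
proof
  note cl = closedin_cofinite_topology[OF assms(1)]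
  obtain p where p: "p \<in> topspace T"
    using assms(2) infinite_imp_nonempty by blast
  have "irreducible_in T {p}"
    using p by (auto simp: irreducible_in_def)
  moreover have "{p} \<subset> topspace T"
    using p assms(2) by (metis finite.emptyI finite.insertI insert_subset psubsetI empty_subsetI)
  ultimately have "irreducible_chain T 1 (\<lambda>i. if i = 0 then {p} else topspace T)"
    using p irreducible_in_cofinite_topology[OF assms] by (auto simp: irreducible_chain_def cl)
  then show "\<exists>Z. irreducible_chain T 1 Z"
    by blast
  show "\<nexists>Z. irreducible_chain T (Suc 1) Z"
  proof
    assume "\<exists>Z. irreducible_chain T (Suc 1) Z"
    then obtain Z where Z: "irreducible_chain T (Suc 1) Z" ..
    then have "closedin T (Z 1)" "irreducible_in T (Z 1)" "Z 0 \<subset> Z 1" "Z 1 \<subset> Z 2"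
      and Z0: "irreducible_in T (Z 0)" and "closedin T (Z 2)"
      by (auto simp: irreducible_chain_def numeral_2_eq_2)
    then have fin: "finite (Z 1)"
      unfolding cl by auto
    obtain q where "Z 1 = {q}"
      using irreducible_in_finite[OF \<open>irreducible_in T (Z 1)\<close> fin] \<open>closedin T (Z 1)\<close>
      unfolding cl by blast
    then have "Z 0 = {}"
      using \<open>Z 0 \<subset> Z 1\<close> by auto
    then show False
      using Z0 by (simp add: irreducible_in_def)
  qed
qed

lemma krull_dim_unique:
  assumes "krull_dim T d" "krull_dim T d'"
  shows "d = d'"
proof -
  have chain: "irreducible_chain T k Z" if "irreducible_chain T m Z" "k \<le> m" for k m Z
    using that by (auto simp: irreducible_chain_def)
  have "\<not> d < d'" if "krull_dim T d" "krull_dim T d'" for d d'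
    using that chain[of d' _ "Suc d"] unfolding krull_dim_def by (metis Suc_leI)
  then show ?thesis
    using assms by (metis linorder_neqE_nat)
qed

section \<open>Curves parametrised by the affine line minus finitely many points\<close>

text \<open>A curve all of whose branches are seen by \<open>\<delta>\<close> and whose functions are exactly those
  that are regular on every branch. Points with several preimages under \<open>\<delta>\<close> are ordinary
  multiple points.\<close>

definition param_curve :: "'a fspace \<Rightarrow> complex set \<Rightarrow> (complex \<Rightarrow> 'a) \<Rightarrow> bool" where
  "param_curve X T \<delta> \<longleftrightarrow> finite (- T) \<and> \<delta> ` T = topspace (zar X) \<and>
     (\<forall>p. finite {t \<in> T. \<delta> t = p}) \<and> cofinite_topology (zar X) \<and>
     (\<forall>W. openin (zar X) W \<longrightarrow>
        sections X W = {f. \<forall>t\<in>T. \<delta> t \<in> W \<longrightarrow> f \<circ> \<delta> \<in> reg_at t})"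

lemma param_curve_infinite:
  assumes "param_curve X T \<delta>"
  shows "infinite (topspace (zar X))"
proof
  assume "finite (topspace (zar X))"
  then have "finite (\<delta> ` T)"
    using assms by (simp add: param_curve_def)
  moreover have "finite {t \<in> T. \<delta> t = p}" for p
    using assms by (simp add: param_curve_def)
  ultimately have "finite (\<Union>p\<in>\<delta> ` T. {t \<in> T. \<delta> t = p})"
    by blast
  moreover have "(\<Union>p\<in>\<delta> ` T. {t \<in> T. \<delta> t = p}) = T"
    by blast
  ultimately have "finite T"
    by simp
  moreover have "finite (- T)"
    using assms by (simp add: param_curve_def)
  ultimately have "finite (T \<union> - T)"
    by blast
  then show False
    by (simp add: infinite_UNIV_char_0)
qed

lemma param_curve_cofinite:
  assumes "param_curve X T \<delta>" "openin (zar X) W" "W \<noteq> {}"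
  shows "\<forall>\<^sub>F t in cofinite. t \<in> T \<and> \<delta> t \<in> W"
proof -
  have "finite (topspace (zar X) - W)"
    using assms unfolding param_curve_def cofinite_topology_def by metis
  then have "finite (\<Union>p\<in>topspace (zar X) - W. {t \<in> T. \<delta> t = p})"
    using assms(1) by (intro finite_UN_I) (auto simp: param_curve_def)
  moreover have "finite (- T)"
    using assms(1) by (simp add: param_curve_def)
  ultimately have "finite ((\<Union>p\<in>topspace (zar X) - W. {t \<in> T. \<delta> t = p}) \<union> - T)"
    by blast
  moreover have "{t. \<not> (t \<in> T \<and> \<delta> t \<in> W)} \<subseteq> (\<Union>p\<in>topspace (zar X) - W. {t \<in> T. \<delta> t = p}) \<union> - T"
    using assms(1) by (auto simp: param_curve_def)
  ultimately show ?thesis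
    unfolding eventually_cofinite by (rule rev_finite_subset)
qed

text \<open>Sections on both sides are tested by pulling back to the same parameter, and there
  \<open>f \<circ> \<phi> \<circ> \<delta>\<close> and \<open>f \<circ> \<delta>'\<close> agree.
  Used in both directions, this yields isomorphisms.\<close>

lemma param_curve_morphism:
  assumes X: "param_curve X T \<delta>" and X': "param_curve X' T \<delta>'"
    and eq: "\<And>t. t \<in> T \<Longrightarrow> \<phi> (\<delta> t) = \<delta>' t"
  shows "morphism X X' \<phi>"
proof -
  have T: "\<forall>\<^sub>F t in cofinite. t \<in> T"
    using X by (simp add: param_curve_def eventually_cofinite Compl_eq)
  have top: "topspace (zar X) = \<delta> ` T" "topspace (zar X') = \<delta>' ` T"
    using X X' by (auto simp: param_curve_def)
  have op: "openin (zar X) {x \<in> topspace (zar X). \<phi> x \<in> W}" if "openin (zar X') W" for W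
  proof (cases "W = {}")
    case False
    have "finite {t. \<not> (t \<in> T \<and> \<delta>' t \<in> W)}"
      using param_curve_cofinite[OF X' that False] by (simp add: eventually_cofinite)
    then have "finite (\<delta> ` {t. \<not> (t \<in> T \<and> \<delta>' t \<in> W)})"
      by (rule finite_imageI)
    moreover have "topspace (zar X) - {x \<in> topspace (zar X). \<phi> x \<in> W} \<subseteq> \<delta> ` {t. \<not> (t \<in> T \<and> \<delta>' t \<in> W)}"
      by (auto simp: top eq)
    ultimately have "finite (topspace (zar X) - {x \<in> topspace (zar X). \<phi> x \<in> W})"
      by (rule rev_finite_subset)
    then show ?thesis
      using X unfolding param_curve_def cofinite_topology_def by auto
  qed auto
  have "continuous_map (zar X) (zar X') \<phi>"
    using op unfolding continuous_map_def by (auto simp: top eq)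
  moreover have "f \<circ> \<phi> \<in> sections X {x \<in> topspace (zar X). \<phi> x \<in> V}"
    if "openin (zar X') V" "f \<in> sections X' V" for V f
  proof -
    have "f \<circ> \<phi> \<circ> \<delta> \<in> reg_at t" if "t \<in> T" "\<delta>' t \<in> V" for t
    proof (rule reg_at_cong)
      show "f \<circ> \<delta>' \<in> reg_at t"
        using X' \<open>f \<in> _\<close> \<open>openin _ V\<close> that unfolding param_curve_def by blast
      show "\<forall>\<^sub>F t in cofinite. (f \<circ> \<phi> \<circ> \<delta>) t = (f \<circ> \<delta>') t"
        using T by eventually_elim (simp add: eq)
    qed (use that eq in simp)
    then have "\<forall>t\<in>T. \<delta> t \<in> {x \<in> topspace (zar X). \<phi> x \<in> V} \<longrightarrow> f \<circ> \<phi> \<circ> \<delta> \<in> reg_at t"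
      by (auto simp: eq)
    then show ?thesis
      using X op[OF that(1)] unfolding param_curve_def by blast
  qed
  ultimately show ?thesis
    unfolding morphism_def by blast
qed

lemma param_curve_isomorphism:
  assumes X: "param_curve X T \<delta>" and X': "param_curve X' T \<delta>'"
    and eq: "\<And>t. t \<in> T \<Longrightarrow> \<phi> (\<delta> t) = \<delta>' t"
    and fib: "\<And>t u. t \<in> T \<Longrightarrow> u \<in> T \<Longrightarrow> \<delta>' t = \<delta>' u \<Longrightarrow> \<delta> t = \<delta> u"
  shows "isomorphism X X' \<phi>"
proof -
  have top: "topspace (zar X) = \<delta> ` T" "topspace (zar X') = \<delta>' ` T"
    using X X' by (auto simp: param_curve_def)
  have inj: "inj_on \<phi> (topspace (zar X))"
    using fib unfolding inj_on_def top by (metis (no_types, lifting) eq imageE)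
  have "bij_betw \<phi> (topspace (zar X)) (topspace (zar X'))"
    using inj unfolding bij_betw_def top image_image by (simp add: eq cong: image_cong)
  moreover have "inv_into (topspace (zar X)) \<phi> (\<delta>' t) = \<delta> t" if "t \<in> T" for t
    using inv_into_f_f[OF inj, of "\<delta> t"] that by (simp add: eq top)
  ultimately show ?thesis
    unfolding isomorphism_def
    using param_curve_morphism[OF X X' eq] param_curve_morphism[OF X' X] by blast
qed

text \<open>Up to isomorphism a parametrised curve depends only on the parameter set and on which
  parameters it identifies. Affine models are found by matching these two data.\<close>

lemma param_curve_isomorphism_inverse:
  assumes X: "param_curve X T \<delta>" and X': "param_curve X' T \<delta>'"
    and fib: "\<And>t u. t \<in> T \<Longrightarrow> u \<in> T \<Longrightarrow> \<delta>' t = \<delta>' u \<longleftrightarrow> \<delta> t = \<delta> u"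
  shows "\<exists>\<phi>. isomorphism X X' \<phi>"
proof
  define \<phi> where "\<phi> x = \<delta>' (inv_into T \<delta> x)" for x
  have "\<phi> (\<delta> t) = \<delta>' t" if "t \<in> T" for t
    unfolding \<phi>_def using that fib inv_into_into[of "\<delta> t" \<delta> T] f_inv_into_f[of "\<delta> t" \<delta> T] by auto
  then show "isomorphism X X' \<phi>"
    using param_curve_isomorphism[OF X X'] fib by blast
qed

subsection \<open>Local rings at simple points\<close>

text \<open>Injectivity leaves one branch over the point. Regularity there spreads to a
  neighbourhood once the zeros of the denominator and the finitely many exceptional parameters are
  deleted.\<close>

lemma germs_param_curve:
  assumes X: "param_curve X T \<delta>" and inj: "inj_on \<delta> T" and t: "t \<in> T"
  shows "f \<in> germs X (\<delta> t) \<longleftrightarrow> f \<circ> \<delta> \<in> reg_at t"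
proof
  assume "f \<in> germs X (\<delta> t)"
  then show "f \<circ> \<delta> \<in> reg_at t"
    using X t unfolding germs_def param_curve_def by blast
next
  assume "f \<circ> \<delta> \<in> reg_at t"
  then obtain P H where PH: "poly H t \<noteq> 0" "(f \<circ> \<delta>) t = poly P t / poly H t"
    and ev: "\<forall>\<^sub>F t in cofinite. poly H t \<noteq> 0 \<and> (f \<circ> \<delta>) t = poly P t / poly H t"
    using reg_atE by blast
  define G where "G = {u \<in> T. poly H u \<noteq> 0 \<and> (f \<circ> \<delta>) u = poly P u / poly H u}"
  have fin: "finite (- G)"
    using ev X by (auto simp: G_def eventually_cofinite param_curve_def Compl_eq
        intro: rev_finite_subset[of "- T \<union> {x. poly H x = 0 \<or> (f \<circ> \<delta>) x \<noteq> poly P x / poly H x}"])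
  have "topspace (zar X) = \<delta> ` T"
    using X by (simp add: param_curve_def)
  then have "topspace (zar X) - \<delta> ` G \<subseteq> \<delta> ` (- G)"
    by blast
  then have "finite (topspace (zar X) - \<delta> ` G)"
    using fin finite_surj by blast
  moreover have "\<delta> ` G \<subseteq> topspace (zar X)"
    using \<open>topspace (zar X) = \<delta> ` T\<close> by (auto simp: G_def)
  ultimately have op: "openin (zar X) (\<delta> ` G)"
    using X unfolding param_curve_def cofinite_topology_def by blast
  have "f \<circ> \<delta> \<in> reg_at u" if "u \<in> T" "\<delta> u \<in> \<delta> ` G" for u
  proof -
    have "u \<in> G"
      using that inj by (auto simp: G_def inj_on_def)
    moreover have "\<forall>\<^sub>F t in cofinite. (f \<circ> \<delta>) t = poly P t / poly H t"
      using ev by eventually_elim simp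
    ultimately show ?thesis
      by (intro reg_atI[of H _ _ P]) (auto simp: G_def)
  qed
  then have "f \<in> sections X (\<delta> ` G)"
    using X op unfolding param_curve_def by blast
  moreover have "t \<in> G"
    using PH t by (simp add: G_def)
  ultimately show "f \<in> germs X (\<delta> t)"
    using op unfolding germs_def by blast
qed

lemma germ_eq_param_curve:
  assumes X: "param_curve X T \<delta>" and inj: "inj_on \<delta> T" and t: "t \<in> T"
  shows "germ_eq X (\<delta> t) f g \<longleftrightarrow> f (\<delta> t) = g (\<delta> t) \<and> (\<forall>\<^sub>F t in cofinite. f (\<delta> t) = g (\<delta> t))"
proof -
  have top: "topspace (zar X) = \<delta> ` T"
    using X by (simp add: param_curve_def)
  show ?thesis
    unfolding germ_eq_def
  proof (subst eventually_nhdsin, intro iffI)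
    assume "\<delta> t \<notin> topspace (zar X) \<or> (\<exists>S. openin (zar X) S \<and> \<delta> t \<in> S \<and> (\<forall>x\<in>S. f x = g x))"
    then obtain S where S: "openin (zar X) S" "\<delta> t \<in> S" "\<forall>x\<in>S. f x = g x"
      using t top by auto
    have "\<forall>\<^sub>F t in cofinite. t \<in> T \<and> \<delta> t \<in> S"
      by (rule param_curve_cofinite[OF X S(1)]) (use S(2) in auto)
    then have "\<forall>\<^sub>F t in cofinite. f (\<delta> t) = g (\<delta> t)"
      by eventually_elim (use S(3) in auto)
    then show "f (\<delta> t) = g (\<delta> t) \<and> (\<forall>\<^sub>F t in cofinite. f (\<delta> t) = g (\<delta> t))"
      using S by auto
  next
    assume eq: "f (\<delta> t) = g (\<delta> t) \<and> (\<forall>\<^sub>F t in cofinite. f (\<delta> t) = g (\<delta> t))"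
    define S where "S = {x \<in> topspace (zar X). f x = g x}"
    have "topspace (zar X) - S \<subseteq> \<delta> ` {t. f (\<delta> t) \<noteq> g (\<delta> t)}"
      by (auto simp: S_def top)
    then have "finite (topspace (zar X) - S)"
      using eq finite_surj unfolding eventually_cofinite by blast
    then have "openin (zar X) S"
      using X unfolding param_curve_def cofinite_topology_def by (auto simp: S_def)
    moreover have "\<delta> t \<in> S"
      using eq t by (auto simp: S_def top)
    ultimately show "\<delta> t \<notin> topspace (zar X) \<or> (\<exists>S. openin (zar X) S \<and> \<delta> t \<in> S \<and> (\<forall>x\<in>S. f x = g x))"
      by (auto simp: S_def)
  qed
qed

lemma germ_eq_param_curve_reg:
  assumes "param_curve X T \<delta>" "inj_on \<delta> T" "t \<in> T" "f \<circ> \<delta> \<in> reg_at t" "g \<circ> \<delta> \<in> reg_at t"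
  shows "germ_eq X (\<delta> t) f g \<longleftrightarrow> (\<forall>\<^sub>F t in cofinite. f (\<delta> t) = g (\<delta> t))"
  using germ_eq_param_curve[OF assms(1-3)] reg_at_eqI[OF assms(4,5)] by auto

text \<open>The exponent count for dividing an integral equation of \<open>f / g\<close> by
  \<open>(u - t) ^ (l * k)\<close>, where \<open>l\<close> and \<open>m\<close> are the orders of
  \<open>f\<close> and \<open>g\<close> at \<open>t\<close>.\<close>

lemma exponent_identity:
  fixes i k l m :: nat
  assumes "i \<le> k" "l \<le> m"
  shows "l * k + (m - l) * (k - i) = l * i + m * (k - i)"
proof -
  obtain j d where "k = i + j" "m = l + d"
    using assms by (meson le_iff_add)
  then show ?thesis
    by (simp add: algebra_simps)
qed

text \<open>A discrete valuation ring is integrally closed: if \<open>f\<close> had smaller order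
  than \<open>g\<close>, the leading term \<open>f ^ k\<close> of the monic equation would have
  strictly smaller order than all the others. Hence \<open>f / g\<close> has non-negative
  order.\<close>

lemma normal_at_param_curve:
  assumes X: "param_curve X T \<delta>" and inj: "inj_on \<delta> T" and t: "t \<in> T"
  shows "normal_at X (\<delta> t)"
  unfolding normal_at_def
proof (intro conjI ballI allI impI)
  note gm = germs_param_curve[OF X inj t]
  note ge = germ_eq_param_curve_reg[OF X inj t]
  have comp: "(\<lambda>x. 0) \<circ> \<delta> \<in> reg_at t"
    using reg_at_const[of 0 t] by (simp add: o_def)
  {
    fix f g assume f: "f \<in> germs X (\<delta> t)" and g: "g \<in> germs X (\<delta> t)"
    then have fg: "f \<circ> \<delta> \<in> reg_at t" "g \<circ> \<delta> \<in> reg_at t"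
      by (auto simp: gm)
    assume "germ_eq X (\<delta> t) (\<lambda>x. f x * g x) (\<lambda>x. 0)"
    moreover have "(\<lambda>x. f x * g x) \<circ> \<delta> \<in> reg_at t"
      using reg_at_mult[OF fg] by (simp add: o_def)
    ultimately have ev: "\<forall>\<^sub>F t in cofinite. f (\<delta> t) * g (\<delta> t) = 0"
      using ge comp by auto
    have "\<forall>\<^sub>F u in cofinite. g (\<delta> u) = 0" if "\<forall>\<^sub>F u in cofinite. f (\<delta> u) \<noteq> 0"
      using ev that by eventually_elim auto
    then have "(\<forall>\<^sub>F u in cofinite. f (\<delta> u) = 0) \<or> (\<forall>\<^sub>F u in cofinite. g (\<delta> u) = 0)"
      using reg_at_zero_or_nonzero[OF fg(1)] by auto
    then show "germ_eq X (\<delta> t) f (\<lambda>x. 0) \<or> germ_eq X (\<delta> t) g (\<lambda>x. 0)"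
      using ge fg comp by auto
  }
  fix f g and k :: nat and c
  assume f: "f \<in> germs X (\<delta> t)" and g: "g \<in> germs X (\<delta> t)"
  then have fg: "f \<circ> \<delta> \<in> reg_at t" "g \<circ> \<delta> \<in> reg_at t"
    by (auto simp: gm)
  assume "\<not> germ_eq X (\<delta> t) g (\<lambda>x. 0) \<and> (\<forall>i<k. c i \<in> germs X (\<delta> t)) \<and>
    germ_eq X (\<delta> t) (\<lambda>x. f x ^ k + (\<Sum>i<k. c i x * f x ^ i * g x ^ (k - i))) (\<lambda>x. 0)"
  then have g0: "\<not> germ_eq X (\<delta> t) g (\<lambda>x. 0)" and c: "\<And>i. i < k \<Longrightarrow> c i \<circ> \<delta> \<in> reg_at t"
    and eq: "\<forall>\<^sub>F u in cofinite. f (\<delta> u) ^ k + (\<Sum>i<k. c i (\<delta> u) * f (\<delta> u) ^ i * g (\<delta> u) ^ (k - i)) = 0"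
    using germ_eq_param_curve[OF X inj t] by (auto simp: gm)
  have g0': "\<not> (\<forall>\<^sub>F u in cofinite. (g \<circ> \<delta>) u = 0)"
    using g0 ge[OF fg(2) comp] by simp
  obtain m \<psi> where \<psi>: "\<psi> \<in> reg_at t" "\<psi> t \<noteq> 0" "\<And>u. (g \<circ> \<delta>) u = (u - t) ^ m * \<psi> u"
    using reg_at_order[OF fg(2) g0'] by metis
  have lift: "(h \<circ> inv_into T \<delta>) \<circ> \<delta> \<in> reg_at t" if "h \<in> reg_at t" for h
  proof (rule reg_at_cong[OF that])
    show "((h \<circ> inv_into T \<delta>) \<circ> \<delta>) t = h t"
      using inj t by simp
    have "\<forall>\<^sub>F u in cofinite. u \<in> T"
      using X by (simp add: param_curve_def eventually_cofinite Compl_eq)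
    then show "\<forall>\<^sub>F u in cofinite. ((h \<circ> inv_into T \<delta>) \<circ> \<delta>) u = h u"
      by eventually_elim (use inj in simp)
  qed
  have "\<exists>h\<in>reg_at t. \<forall>\<^sub>F u in cofinite. f (\<delta> u) = h u * g (\<delta> u)"
  proof (cases "\<forall>\<^sub>F u in cofinite. (f \<circ> \<delta>) u = 0")
    case True
    then show ?thesis
      by (intro bexI[OF _ reg_at_const[of 0]]) simp
  next
    case False
    obtain l \<xi> where \<xi>: "\<xi> \<in> reg_at t" "\<xi> t \<noteq> 0" "\<And>u. (f \<circ> \<delta>) u = (u - t) ^ l * \<xi> u"
      using reg_at_order[OF fg(1) False] by metis
    have "m \<le> l"
    proof (rule ccontr)
      assume "\<not> m \<le> l"
      then have lm: "l < m" by simp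
      \<comment> \<open>The left side of the integral equation divided by
        \<open>(u - t) ^ (l * k)\<close>. Every exponent \<open>(m - l) * (k - i)\<close> is
        positive, so at \<open>t\<close> only \<open>\<xi> t ^ k\<close> survives.\<close>
      define r where "r u = \<xi> u ^ k + (\<Sum>i<k. c i (\<delta> u) * (u - t) ^ ((m - l) * (k - i)) * \<xi> u ^ i * \<psi> u ^ (k - i))" for u
      have c': "(\<lambda>u. c i (\<delta> u)) \<in> reg_at t" if "i < k" for i
        using c[OF that] by (simp add: o_def)
      have "r \<in> reg_at t"
        unfolding r_def
        by (intro reg_at_add reg_at_power reg_at_sum reg_at_mult reg_at_diff reg_at_id reg_at_const \<xi> \<psi> c') auto
      moreover have "\<forall>\<^sub>F u in cofinite. r u = 0"
        using eq eventually_cofinite_neq[of t]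
      proof eventually_elim
        case (elim u)
        have "(u - t) ^ (l * k) * r u =
          f (\<delta> u) ^ k + (\<Sum>i<k. c i (\<delta> u) * f (\<delta> u) ^ i * g (\<delta> u) ^ (k - i))"
          unfolding r_def distrib_left sum_distrib_left
        proof (intro arg_cong2[where f="(+)"] sum.cong refl)
          show "(u - t) ^ (l * k) * \<xi> u ^ k = f (\<delta> u) ^ k"
            using \<xi>(3)[of u] by (simp add: power_mult_distrib power_mult)
          fix i assume "i \<in> {..<k}"
          then have "l * k + (m - l) * (k - i) = l * i + m * (k - i)"
            using exponent_identity[of i k l m] lm by simp
          then have "(u - t) ^ (l * k) * (u - t) ^ ((m - l) * (k - i)) =
            ((u - t) ^ l) ^ i * ((u - t) ^ m) ^ (k - i)"
            by (simp flip: power_add power_mult)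
          then show "(u - t) ^ (l * k) * (c i (\<delta> u) * (u - t) ^ ((m - l) * (k - i)) * \<xi> u ^ i * \<psi> u ^ (k - i)) =
            c i (\<delta> u) * f (\<delta> u) ^ i * g (\<delta> u) ^ (k - i)"
            using \<xi>(3)[of u] \<psi>(3)[of u] by (simp add: power_mult_distrib mult_ac)
        qed
        then show "r u = 0"
          using elim by simp
      qed
      ultimately have "r t = 0"
        using reg_at_eqI[OF _ reg_at_const] by blast
      moreover have "r t = \<xi> t ^ k"
        using lm by (simp add: r_def power_0_left)
      ultimately show False
        using \<xi>(2) by simp
    qed
    define h where "h u = (u - t) ^ (l - m) * (\<xi> u / \<psi> u)" for u
    have "h \<in> reg_at t"
      unfolding h_def by (intro reg_at_power reg_at_mult reg_at_divide reg_at_diff reg_at_id reg_at_const \<xi> \<psi>)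
    moreover have "\<forall>\<^sub>F u in cofinite. \<psi> u \<noteq> 0"
      using reg_at_zero_or_nonzero[OF \<psi>(1)] reg_at_eqI[OF \<psi>(1) reg_at_const[of 0]] \<psi>(2) by blast
    then have "\<forall>\<^sub>F u in cofinite. f (\<delta> u) = h u * g (\<delta> u)"
    proof eventually_elim
      case (elim u)
      have "(u - t) ^ l = (u - t) ^ (l - m) * (u - t) ^ m"
        using \<open>m \<le> l\<close> by (simp flip: power_add)
      then show ?case
        using elim \<xi>(3)[of u] \<psi>(3)[of u] by (simp add: h_def)
    qed
    ultimately show ?thesis
      by blast
  qed
  then obtain h where h: "h \<in> reg_at t" and ev: "\<forall>\<^sub>F u in cofinite. f (\<delta> u) = h u * g (\<delta> u)"
    by blast
  show "\<exists>h\<in>germs X (\<delta> t). germ_eq X (\<delta> t) f (\<lambda>x. h x * g x)"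
  proof
    show "h \<circ> inv_into T \<delta> \<in> germs X (\<delta> t)"
      using lift[OF h] by (simp add: gm)
    have "(\<lambda>x. (h \<circ> inv_into T \<delta>) x * g x) \<circ> \<delta> \<in> reg_at t"
      using reg_at_mult[OF lift[OF h] fg(2)] by (simp add: o_def)
    moreover have "\<forall>\<^sub>F u in cofinite. u \<in> T"
      using X by (simp add: param_curve_def eventually_cofinite Compl_eq)
    then have "\<forall>\<^sub>F u in cofinite. f (\<delta> u) = (h \<circ> inv_into T \<delta>) (\<delta> u) * g (\<delta> u)"
      using ev by eventually_elim (use inj in simp)
    ultimately show "germ_eq X (\<delta> t) f (\<lambda>x. (h \<circ> inv_into T \<delta>) x * g x)"
      using ge[OF fg(1)] by blast
  qed
qed

lemma max_ideal_powerE: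
  assumes "f \<in> max_ideal_power X p k"
  obtains r c g where "\<And>i. i < r \<Longrightarrow> c i \<in> germs X p"
    "\<And>i j. i < r \<Longrightarrow> j < k \<Longrightarrow> g i j \<in> max_ideal X p"
    "germ_eq X p f (\<lambda>x. \<Sum>i<(r::nat). c i x * (\<Prod>j<k. g i j x))"
proof -
  from assms obtain r c g where "\<forall>i<r. c i \<in> germs X p" "\<forall>i<r. \<forall>j<k. g i j \<in> max_ideal X p"
     "germ_eq X p f (\<lambda>x. \<Sum>i<(r::nat). c i x * (\<Prod>j<k. g i j x))"
    unfolding max_ideal_power_def mem_Collect_eq by (elim conjE exE)
  then show thesis
    by (intro that[of r c g]) auto
qed

text \<open>The parameter, recentred at \<open>t\<close>, is a uniformiser. The coefficient of a
  germ is its first Taylor coefficient, and it is unique because elements of the square of the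
  maximal ideal are divisible by \<open>(u - t)\<^sup>2\<close>.\<close>

lemma cotangent_basis_param_curve:
  assumes X: "param_curve X T \<delta>" and inj: "inj_on \<delta> T" and t: "t \<in> T"
  shows "cotangent_basis X (\<delta> t) 1 (\<lambda>i x. inv_into T \<delta> x - t)"
proof -
  note gm = germs_param_curve[OF X inj t]
  have evT: "\<forall>\<^sub>F u in cofinite. u \<in> T"
    using X by (simp add: param_curve_def eventually_cofinite Compl_eq)
  have lift: "h \<circ> inv_into T \<delta> \<in> germs X (\<delta> t)" if "h \<in> reg_at t" for h
    unfolding gm
  proof (rule reg_at_cong[OF that])
    show "((h \<circ> inv_into T \<delta>) \<circ> \<delta>) t = h t"
      using inj t by simp
    show "\<forall>\<^sub>F u in cofinite. ((h \<circ> inv_into T \<delta>) \<circ> \<delta>) u = h u"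
      using evT by eventually_elim (use inj in simp)
  qed
  define \<tau> where "\<tau> x = inv_into T \<delta> x - t" for x
  have \<tau>: "\<tau> \<in> max_ideal X (\<delta> t)"
    using lift[OF reg_at_diff[OF reg_at_id reg_at_const[of t]]] inj t
    by (simp add: max_ideal_def \<tau>_def[abs_def] o_def)
  have sq: "\<exists>\<psi>\<in>reg_at t. \<forall>\<^sub>F u in cofinite. F (\<delta> u) = (u - t)\<^sup>2 * \<psi> u"
    if F: "F \<in> max_ideal_power X (\<delta> t) 2" for F
  proof -
    obtain r c g where c: "\<And>i. i < r \<Longrightarrow> c i \<in> germs X (\<delta> t)"
      and g: "\<And>i j. i < r \<Longrightarrow> j < (2::nat) \<Longrightarrow> g i j \<in> max_ideal X (\<delta> t)"
      and eq: "germ_eq X (\<delta> t) F (\<lambda>x. \<Sum>i<(r::nat). c i x * (\<Prod>j<2. g i j x))"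
      using max_ideal_powerE[OF F] by blast
    have "\<exists>\<psi>\<in>reg_at t. \<forall>u. g i j (\<delta> u) = (u - t) * \<psi> u" if "i < r" "j < 2" for i j
      using g[OF that] reg_at_factor[of "g i j \<circ> \<delta>" t] by (auto simp: max_ideal_def gm)
    then obtain \<psi> where \<psi>: "\<And>i j. i < r \<Longrightarrow> j < 2 \<Longrightarrow> \<psi> i j \<in> reg_at t"
      "\<And>i j u. i < r \<Longrightarrow> j < 2 \<Longrightarrow> g i j (\<delta> u) = (u - t) * \<psi> i j u"
      by metis
    have c': "(\<lambda>u. c i (\<delta> u)) \<in> reg_at t" if "i < r" for i
      using c[OF that] by (simp add: gm o_def)
    define \<rho> where "\<rho> u = (\<Sum>i<r. c i (\<delta> u) * (\<psi> i 0 u * \<psi> i 1 u))" for u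
    have "\<rho> \<in> reg_at t"
      unfolding \<rho>_def using c' \<psi>(1) by (intro reg_at_sum reg_at_mult) simp_all
    moreover have "\<forall>\<^sub>F u in cofinite. F (\<delta> u) = (u - t)\<^sup>2 * \<rho> u"
    proof -
      have "\<forall>\<^sub>F u in cofinite. F (\<delta> u) = (\<Sum>i<r. c i (\<delta> u) * (\<Prod>j<2. g i j (\<delta> u)))"
        using eq germ_eq_param_curve[OF X inj t] by simp
      then show ?thesis
      proof eventually_elim
        case (elim u)
        show ?case
          unfolding elim \<rho>_def sum_distrib_left
          by (intro sum.cong refl) (simp add: \<psi>(2) numeral_2_eq_2 power2_eq_square)
      qed
    qed
    ultimately show ?thesis by blast
  qed
  show ?thesis
    unfolding cotangent_basis_def \<tau>_def[symmetric]
  proof (intro conjI ballI allI impI)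
    show "\<tau> \<in> max_ideal X (\<delta> t)"
      by (rule \<tau>)
    fix f assume f: "f \<in> max_ideal X (\<delta> t)"
    then obtain \<phi> where \<phi>: "\<phi> \<in> reg_at t" "\<And>u. f (\<delta> u) = (u - t) * \<phi> u"
      using reg_at_factor[of "f \<circ> \<delta>" t] by (auto simp: max_ideal_def gm)
    have "(\<lambda>u. \<phi> u - \<phi> t) \<in> reg_at t"
      by (intro reg_at_diff \<phi> reg_at_const)
    then obtain \<xi> where \<xi>: "\<xi> \<in> reg_at t" "\<And>u. \<phi> u - \<phi> t = (u - t) * \<xi> u"
      using reg_at_factor[of "\<lambda>u. \<phi> u - \<phi> t" t] by auto
    define F where "F c x = f x - (\<Sum>i<1::nat. c i * \<tau> x)" for c :: "nat \<Rightarrow> complex" and x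
    have Fg: "F c \<in> germs X (\<delta> t)" for c
    proof -
      have "(\<lambda>u. f (\<delta> u)) \<in> reg_at t" "(\<lambda>u. \<tau> (\<delta> u)) \<in> reg_at t"
        using f \<tau> by (auto simp: max_ideal_def gm o_def)
      then have "(\<lambda>u. f (\<delta> u) - c 0 * \<tau> (\<delta> u)) \<in> reg_at t"
        by (intro reg_at_diff reg_at_mult reg_at_const)
      then show ?thesis
        by (simp add: gm F_def[abs_def] o_def)
    qed
    define c0 where "c0 = (\<lambda>i\<in>{..<1::nat}. \<phi> t)"
    have "F c0 \<in> max_ideal_power X (\<delta> t) 2"
      unfolding max_ideal_power_def mem_Collect_eq
    proof (intro conjI exI)
      show "F c0 \<in> germs X (\<delta> t)"
        by (rule Fg)
      show "\<forall>i<(1::nat). \<xi> \<circ> inv_into T \<delta> \<in> germs X (\<delta> t)"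
        using lift \<xi> by blast
      show "\<forall>i<(1::nat). \<forall>j<2::nat. \<tau> \<in> max_ideal X (\<delta> t)"
        using \<tau> by blast
      show "germ_eq X (\<delta> t) (F c0) (\<lambda>x. \<Sum>i<1::nat. (\<xi> \<circ> inv_into T \<delta>) x * (\<Prod>j<2::nat. \<tau> x))"
        unfolding germ_eq_param_curve[OF X inj t]
      proof
        have *: "F c0 (\<delta> u) = (\<Sum>i<1::nat. (\<xi> \<circ> inv_into T \<delta>) (\<delta> u) * (\<Prod>j<2::nat. \<tau> (\<delta> u)))" if "u \<in> T" for u
        proof -
          have "F c0 (\<delta> u) = (u - t) * (\<phi> u - \<phi> t)"
            using that inj by (simp add: F_def \<phi>(2) c0_def \<tau>_def algebra_simps)
          then show ?thesis
            using that inj by (simp add: \<xi>(2) \<tau>_def numeral_2_eq_2)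
        qed
        show "F c0 (\<delta> t) = (\<Sum>i<1::nat. (\<xi> \<circ> inv_into T \<delta>) (\<delta> t) * (\<Prod>j<2::nat. \<tau> (\<delta> t)))"
          using * t by blast
        show "\<forall>\<^sub>F u in cofinite. F c0 (\<delta> u) = (\<Sum>i<1::nat. (\<xi> \<circ> inv_into T \<delta>) (\<delta> u) * (\<Prod>j<2::nat. \<tau> (\<delta> u)))"
          using evT by (rule eventually_mono) (rule *)
      qed
    qed
    then have 1: "(\<lambda>x. f x - (\<Sum>i<1::nat. c0 i * \<tau> x)) \<in> max_ideal_power X (\<delta> t) 2"
      by (simp only: F_def[abs_def])
    have 2: "c = c0" if c: "c \<in> {..<1::nat} \<rightarrow>\<^sub>E UNIV" and Fc': "(\<lambda>x. f x - (\<Sum>i<1::nat. c i * \<tau> x)) \<in> max_ideal_power X (\<delta> t) 2" for c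
    proof -
      have Fc: "F c \<in> max_ideal_power X (\<delta> t) 2"
        using Fc' by (simp only: F_def[abs_def])
      obtain \<psi> where \<psi>: "\<psi> \<in> reg_at t" "\<forall>\<^sub>F u in cofinite. F c (\<delta> u) = (u - t)\<^sup>2 * \<psi> u"
        using sq[OF Fc] by blast
      have "\<forall>\<^sub>F u in cofinite. \<phi> u - c 0 = (u - t) * \<psi> u"
        using \<psi>(2) evT eventually_cofinite_neq[of t]
      proof eventually_elim
        case (elim u)
        then have "(u - t) * (\<phi> u - c 0) = (u - t) * ((u - t) * \<psi> u)"
          using inj by (simp add: F_def \<phi>(2) \<tau>_def algebra_simps power2_eq_square)
        then show ?case
          using elim by simp
      qed
      then have "\<phi> t - c 0 = (t - t) * \<psi> t"
        using reg_at_eqI[OF reg_at_diff[OF \<phi>(1) reg_at_const]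
            reg_at_mult[OF reg_at_diff[OF reg_at_id reg_at_const] \<psi>(1)]] by blast
      then show ?thesis
        using c by (auto simp: c0_def fun_eq_iff PiE_def extensional_def)
    qed
    have 3: "c0 \<in> {..<1::nat} \<rightarrow>\<^sub>E UNIV"
      by (auto simp: c0_def)
    show "\<exists>!c. c \<in> {..<1::nat} \<rightarrow>\<^sub>E UNIV \<and> (\<lambda>x. f x - (\<Sum>i<1::nat. c i * \<tau> x)) \<in> max_ideal_power X (\<delta> t) 2"
      by (rule ex1I[of _ c0], rule conjI[OF 3 1], elim conjE, rule 2)
  qed
qed

section \<open>Induced structures\<close>

text \<open>The record type \<open>fspace\<close> imposes no sheaf axioms, so closure under
  restriction has to be established for each space.\<close>

definition restricts :: "'a fspace \<Rightarrow> bool" where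
  "restricts X \<longleftrightarrow> (\<forall>W W' f. openin (zar X) W \<and> openin (zar X) W' \<and> W' \<subseteq> W \<and>
     f \<in> sections X W \<longrightarrow> f \<in> sections X W')"

lemma topspace_sub [simp]: "topspace (zar (sub X S)) = topspace (zar X) \<inter> S"
  by (simp add: sub_def)

lemma openin_sub: "openin (zar (sub X S)) W \<longleftrightarrow> (\<exists>V. openin (zar X) V \<and> W = V \<inter> S)"
  by (simp add: sub_def openin_subtopology)

lemma sections_sub:
  "f \<in> sections (sub X S) U \<longleftrightarrow>
     (\<forall>p\<in>U. \<exists>W g. openin (zar X) W \<and> p \<in> W \<and> g \<in> sections X W \<and> (\<forall>q\<in>W \<inter> U. f q = g q))"
  by (simp add: sub_def)

lemma zar_sub_sub: "U \<subseteq> S \<Longrightarrow> zar (sub (sub X S) U) = zar (sub X U)"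
  by (simp add: sub_def subtopology_subtopology Int_absorb1)

lemma sections_sub_sub:
  assumes "restricts X" "W \<subseteq> S"
  shows "sections (sub (sub X S) U) W = sections (sub X S) W"
proof (intro set_eqI iffI)
  fix f assume f: "f \<in> sections (sub (sub X S) U) W"
  show "f \<in> sections (sub X S) W"
    unfolding sections_sub
  proof
    fix p assume p: "p \<in> W"
    then obtain W1 g1 where 1: "openin (zar (sub X S)) W1" "p \<in> W1" "g1 \<in> sections (sub X S) W1"
      "\<forall>q\<in>W1 \<inter> W. f q = g1 q"
      using f unfolding sections_sub[of f "sub X S"] by blast
    obtain V where V: "openin (zar X) V" "W1 = V \<inter> S"
      using 1(1) unfolding openin_sub by blast
    obtain W2 g2 where 2: "openin (zar X) W2" "p \<in> W2" "g2 \<in> sections X W2" "\<forall>q\<in>W2 \<inter> W1. g1 q = g2 q"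
      using 1(2,3) unfolding sections_sub by blast
    have op: "openin (zar X) (W2 \<inter> V)"
      using V 2 by blast
    then have "g2 \<in> sections X (W2 \<inter> V)"
      using assms(1) 2(1,3) unfolding restricts_def by blast
    moreover have "\<forall>q\<in>W2 \<inter> V \<inter> W. f q = g2 q"
      using 1(4) 2(4) V(2) assms(2) by auto
    ultimately show "\<exists>W' g. openin (zar X) W' \<and> p \<in> W' \<and> g \<in> sections X W' \<and> (\<forall>q\<in>W' \<inter> W. f q = g q)"
      using op 2(2) 1(2) V(2) by blast
  qed
next
  fix f assume f: "f \<in> sections (sub X S) W"
  show "f \<in> sections (sub (sub X S) U) W"
    unfolding sections_sub[of f "sub X S"]
  proof
    fix p assume p: "p \<in> W"
    then obtain V g where V: "openin (zar X) V" "p \<in> V" "g \<in> sections X V" "\<forall>q\<in>V \<inter> W. f q = g q"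
      using f unfolding sections_sub by blast
    have "openin (zar (sub X S)) (V \<inter> S)"
      using V(1) unfolding openin_sub by blast
    moreover have "g \<in> sections (sub X S) (V \<inter> S)"
      using V unfolding sections_sub by blast
    ultimately show "\<exists>W' g. openin (zar (sub X S)) W' \<and> p \<in> W' \<and> g \<in> sections (sub X S) W' \<and> (\<forall>q\<in>W' \<inter> W. f q = g q)"
      using V p assms(2) by blast
  qed
qed

lemma sections_sub_mono:
  assumes "f \<in> sections (sub X S) W" "W' \<subseteq> W"
  shows "f \<in> sections (sub X S) W'"
  unfolding sections_sub
proof
  fix p assume "p \<in> W'"
  then obtain V g where "openin (zar X) V" "p \<in> V" "g \<in> sections X V" "\<forall>q\<in>V \<inter> W. f q = g q"
    using assms unfolding sections_sub by (metis subsetD)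
  then show "\<exists>V g. openin (zar X) V \<and> p \<in> V \<and> g \<in> sections X V \<and> (\<forall>q\<in>V \<inter> W'. f q = g q)"
    using assms(2) by (intro exI[of _ V] exI[of _ g]) auto
qed

lemma sections_sub_smaller:
  assumes "W \<subseteq> U" "W \<subseteq> S"
  shows "sections (sub X U) W = sections (sub X S) W"
  by (simp add: sub_def)

lemma param_curve_sub_sub:
  assumes "restricts X" "U \<subseteq> S" "param_curve (sub X U) T \<delta>"
  shows "param_curve (sub (sub X S) U) T \<delta>"
proof -
  have "sections (sub (sub X S) U) W = sections (sub X U) W" if "openin (zar (sub X U)) W" for W
  proof -
    have "W \<subseteq> U"
      using that unfolding openin_sub by blast
    then show ?thesis
      using sections_sub_sub[OF assms(1)] assms(2) sections_sub_smaller by (metis subset_trans)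
  qed
  then show ?thesis
    using assms(2,3) unfolding param_curve_def by (simp add: zar_sub_sub)
qed

text \<open>Local rings do not change on passing to a relatively open subset. With the two lemmas
  after it, this carries local statements from a chart to the whole curve.\<close>

lemma germs_sub_open:
  assumes "restricts X" "openin (zar X) V" "p \<in> V" "V \<inter> S = U"
  shows "germs (sub (sub X S) U) p = germs (sub X S) p"
proof (intro set_eqI iffI)
  fix f assume "f \<in> germs (sub (sub X S) U) p"
  then obtain W where W: "openin (zar (sub (sub X S) U)) W" "p \<in> W" "f \<in> sections (sub (sub X S) U) W"
    unfolding germs_def by blast
  then obtain W' where W': "openin (zar X) W'" "W = W' \<inter> (V \<inter> S)"
    using assms(4) by (auto simp: zar_sub_sub openin_sub)
  then have "openin (zar X) (W' \<inter> V)" "W = (W' \<inter> V) \<inter> S"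
    using assms(2) by blast+
  then have "openin (zar (sub X S)) W" "W \<subseteq> S"
    unfolding openin_sub by blast+
  then show "f \<in> germs (sub X S) p"
    using W sections_sub_sub[OF assms(1)] unfolding germs_def by blast
next
  fix f assume "f \<in> germs (sub X S) p"
  then obtain W where W: "openin (zar (sub X S)) W" "p \<in> W" "f \<in> sections (sub X S) W"
    unfolding germs_def by blast
  then obtain W' where W': "openin (zar X) W'" "W = W' \<inter> S"
    by (auto simp: openin_sub)
  have "f \<in> sections (sub X S) (W' \<inter> U)"
    using W(3) by (rule sections_sub_mono) (use W'(2) assms(4) in auto)
  then have "f \<in> sections (sub (sub X S) U) (W' \<inter> U)"
    using assms(4) by (subst sections_sub_sub[OF assms(1)]) auto
  moreover have "openin (zar (sub (sub X S) U)) (W' \<inter> U)"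
    using W'(1) assms(4) by (subst zar_sub_sub) (auto simp: openin_sub)
  ultimately show "f \<in> germs (sub (sub X S) U) p"
    using W(2) W'(2) assms(3,4) unfolding germs_def by blast
qed

lemma germ_eq_sub_open:
  assumes "openin (zar X) V" "p \<in> V" "V \<inter> S = U"
  shows "germ_eq (sub (sub X S) U) p = germ_eq (sub X S) p"
proof (intro ext)
  fix f g :: "'a \<Rightarrow> complex"
  have "(\<exists>W. openin (zar (sub X U)) W \<and> p \<in> W \<and> (\<forall>x\<in>W. f x = g x)) \<longleftrightarrow>
        (\<exists>W. openin (zar (sub X S)) W \<and> p \<in> W \<and> (\<forall>x\<in>W. f x = g x))" (is "?l \<longleftrightarrow> ?r")
  proof
    assume ?l
    then obtain W' where "openin (zar X) W'" "p \<in> W' \<inter> U" "\<forall>x\<in>W' \<inter> U. f x = g x"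
      unfolding openin_sub by blast
    then have "openin (zar X) (W' \<inter> V)" "p \<in> (W' \<inter> V) \<inter> S" "\<forall>x\<in>(W' \<inter> V) \<inter> S. f x = g x"
      using assms by auto
    then show ?r
      unfolding openin_sub by blast
  next
    assume ?r
    then obtain W' where "openin (zar X) W'" "p \<in> W' \<inter> S" "\<forall>x\<in>W' \<inter> S. f x = g x"
      unfolding openin_sub by blast
    then have "openin (zar X) W'" "p \<in> W' \<inter> U" "\<forall>x\<in>W' \<inter> U. f x = g x"
      using assms by auto
    then show ?l
      unfolding openin_sub by blast
  qed
  moreover have "p \<in> topspace (zar (sub X U)) \<longleftrightarrow> p \<in> topspace (zar (sub X S))"
    using assms by auto
  ultimately show "germ_eq (sub (sub X S) U) p f g = germ_eq (sub X S) p f g"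
    using assms(3) unfolding germ_eq_def eventually_nhdsin
    by (subst (1 2) zar_sub_sub) auto
qed

lemma max_ideal_power_sub_open:
  assumes "restricts X" "openin (zar X) V" "p \<in> V" "V \<inter> S = U"
  shows "max_ideal_power (sub (sub X S) U) p k = max_ideal_power (sub X S) p k"
  unfolding max_ideal_power_def max_ideal_def germs_sub_open[OF assms] germ_eq_sub_open[OF assms(2-4)] ..

lemma normal_at_sub_open:
  assumes "restricts X" "openin (zar X) V" "p \<in> V" "V \<inter> S = U"
  shows "normal_at (sub (sub X S) U) p \<longleftrightarrow> normal_at (sub X S) p"
  unfolding normal_at_def germs_sub_open[OF assms] germ_eq_sub_open[OF assms(2-4)] ..

lemma cotangent_basis_sub_open:
  assumes "restricts X" "openin (zar X) V" "p \<in> V" "V \<inter> S = U"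
  shows "cotangent_basis (sub (sub X S) U) p d t \<longleftrightarrow> cotangent_basis (sub X S) p d t"
  unfolding cotangent_basis_def max_ideal_power_sub_open[OF assms]
  unfolding max_ideal_def germs_sub_open[OF assms] ..

lemma morphism_sub:
  assumes "morphism X Y \<phi>" "\<phi> ` (topspace (zar X) \<inter> S) \<subseteq> S'"
  shows "morphism (sub X S) (sub Y S') \<phi>"
  unfolding morphism_def
proof (intro conjI allI impI)
  have cont: "continuous_map (zar X) (zar Y) \<phi>"
    using assms(1) by (simp add: morphism_def)
  then show "continuous_map (zar (sub X S)) (zar (sub Y S')) \<phi>"
    using assms(2) unfolding sub_def
    by (auto simp: continuous_map_in_subtopology continuous_map_from_subtopology)
  fix V f assume Vf: "openin (zar (sub Y S')) V \<and> f \<in> sections (sub Y S') V"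
  show "f \<circ> \<phi> \<in> sections (sub X S) {x \<in> topspace (zar (sub X S)). \<phi> x \<in> V}"
    unfolding sections_sub
  proof
    fix p assume p: "p \<in> {x \<in> topspace (zar (sub X S)). \<phi> x \<in> V}"
    then obtain W g where W: "openin (zar Y) W" "\<phi> p \<in> W" "g \<in> sections Y W" "\<forall>q\<in>W \<inter> V. f q = g q"
      using Vf unfolding sections_sub by blast
    let ?W = "{x \<in> topspace (zar X). \<phi> x \<in> W}"
    have "openin (zar X) ?W"
      using cont W(1) unfolding continuous_map_def by blast
    moreover have "g \<circ> \<phi> \<in> sections X ?W"
      using assms(1) W unfolding morphism_def by blast
    ultimately show "\<exists>W' g'. openin (zar X) W' \<and> p \<in> W' \<and> g' \<in> sections X W' \<and>
      (\<forall>q\<in>W' \<inter> {x \<in> topspace (zar (sub X S)). \<phi> x \<in> V}. (f \<circ> \<phi>) q = g' q)"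
      using p W by (intro exI[of _ ?W] exI[of _ "g \<circ> \<phi>"]) auto
  qed
qed

text \<open>The criterion behind all charts. The real content is \<open>ext\<close>: a function
  regular on all branches through a point must extend to an ambient section, with agreement required
  at the point and generically only.\<close>

lemma param_curve_subI:
  assumes restr: "restricts X" and T: "finite (- T)" and sub: "\<delta> ` T \<subseteq> topspace (zar X)"
    and fib: "\<And>p. finite {t \<in> T. \<delta> t = p}"
    and cont: "\<And>W t. openin (zar X) W \<Longrightarrow> t \<in> T \<Longrightarrow> \<delta> t \<in> W \<Longrightarrow> \<forall>\<^sub>F u in cofinite. \<delta> u \<in> W"
    and pt: "\<And>p. p \<in> \<delta> ` T \<Longrightarrow> closedin (zar X) {p}"
    and pull: "\<And>W g t. openin (zar X) W \<Longrightarrow> g \<in> sections X W \<Longrightarrow> t \<in> T \<Longrightarrow> \<delta> t \<in> W \<Longrightarrow> g \<circ> \<delta> \<in> reg_at t"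
    and ext: "\<And>f t. t \<in> T \<Longrightarrow> (\<And>u. u \<in> T \<Longrightarrow> \<delta> u = \<delta> t \<Longrightarrow> f \<circ> \<delta> \<in> reg_at u) \<Longrightarrow>
      \<exists>W g. openin (zar X) W \<and> \<delta> t \<in> W \<and> g \<in> sections X W \<and> f (\<delta> t) = g (\<delta> t) \<and>
            (\<forall>\<^sub>F u in cofinite. u \<in> T \<longrightarrow> \<delta> u \<in> W \<longrightarrow> f (\<delta> u) = g (\<delta> u))"
  shows "param_curve (sub X (\<delta> ` T)) T \<delta>"
proof -
  let ?S = "\<delta> ` T"
  have top: "topspace (zar (sub X ?S)) = ?S"
    using sub by auto
  have fin: "closedin (zar X) F" if "finite F" "F \<subseteq> ?S" for F
  proof -
    have "closedin (zar X) (\<Union>p\<in>F. {p})"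
      using that pt by (intro closedin_Union) auto
    then show ?thesis by simp
  qed
  have evT: "\<forall>\<^sub>F u in cofinite. u \<in> T"
    using T by (simp add: eventually_cofinite Compl_eq)
  have cof: "finite (?S - W)" if "openin (zar (sub X ?S)) W" and ne: "W \<noteq> {}" for W
  proof -
    obtain V where V: "openin (zar X) V" "W = V \<inter> ?S"
      using \<open>openin _ W\<close> unfolding openin_sub by blast
    then obtain t where "t \<in> T" "\<delta> t \<in> V"
      using ne by auto
    then have "finite {u. \<delta> u \<notin> V}"
      using cont V(1) by (simp add: eventually_cofinite)
    then have "finite (\<delta> ` {u. \<delta> u \<notin> V})"
      by simp
    then show ?thesis
      by (rule rev_finite_subset) (auto simp: V)
  qed
  have op: "openin (zar (sub X ?S)) W" if "W \<subseteq> ?S" "finite (?S - W)" for W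
  proof -
    have "openin (zar X) (topspace (zar X) - (?S - W))"
      using fin[OF that(2)] by (intro openin_diff) auto
    moreover have "W = (topspace (zar X) - (?S - W)) \<inter> ?S"
      using that sub by blast
    ultimately show ?thesis
      unfolding openin_sub by blast
  qed
  have "cofinite_topology (zar (sub X ?S))"
    unfolding cofinite_topology_def top using cof op openin_subset[of "zar (sub X ?S)"] top
    by (metis openin_empty)
  moreover have "sections (sub X ?S) W = {f. \<forall>t\<in>T. \<delta> t \<in> W \<longrightarrow> f \<circ> \<delta> \<in> reg_at t}"
    if W: "openin (zar (sub X ?S)) W" for W
  proof (intro set_eqI iffI)
    fix f assume f: "f \<in> sections (sub X ?S) W"
    have "f \<circ> \<delta> \<in> reg_at t" if t: "t \<in> T" "\<delta> t \<in> W" for t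
    proof -
      obtain V g where V: "openin (zar X) V" "\<delta> t \<in> V" "g \<in> sections X V" "\<forall>q\<in>V \<inter> W. f q = g q"
        using f t unfolding sections_sub by blast
      obtain V' where V': "openin (zar X) V'" "W = V' \<inter> ?S"
        using W unfolding openin_sub by blast
      have "\<forall>\<^sub>F u in cofinite. \<delta> u \<in> V" "\<forall>\<^sub>F u in cofinite. \<delta> u \<in> V'"
        using cont V V' t by blast+
      then have "\<forall>\<^sub>F u in cofinite. (f \<circ> \<delta>) u = (g \<circ> \<delta>) u"
        using evT by eventually_elim (use V(4) V'(2) in auto)
      moreover have "(f \<circ> \<delta>) t = (g \<circ> \<delta>) t"
        using V t by auto
      ultimately show ?thesis
        using reg_at_cong[OF pull[OF V(1,3) t(1) V(2)]] by blast
    qed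
    then show "f \<in> {f. \<forall>t\<in>T. \<delta> t \<in> W \<longrightarrow> f \<circ> \<delta> \<in> reg_at t}"
      by blast
  next
    fix f assume f: "f \<in> {f. \<forall>t\<in>T. \<delta> t \<in> W \<longrightarrow> f \<circ> \<delta> \<in> reg_at t}"
    show "f \<in> sections (sub X ?S) W"
      unfolding sections_sub
    proof
      fix p assume p: "p \<in> W"
      then obtain t where t: "t \<in> T" "p = \<delta> t"
        using W unfolding openin_sub by auto
      have "f \<circ> \<delta> \<in> reg_at u" if "u \<in> T" "\<delta> u = \<delta> t" for u
        using f that p t by auto
      from ext[OF t(1) this] obtain V g where V: "openin (zar X) V" "\<delta> t \<in> V" "g \<in> sections X V"
        "f (\<delta> t) = g (\<delta> t)" "\<forall>\<^sub>F u in cofinite. u \<in> T \<longrightarrow> \<delta> u \<in> V \<longrightarrow> f (\<delta> u) = g (\<delta> u)"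
        by blast
      \<comment> \<open>The extension may differ from \<open>f\<close> at finitely many points of
        the curve. They form a closed set that avoids \<open>p\<close>, so the neighbourhood can be
        shrunk.\<close>
      define E where "E = {q \<in> ?S. q \<in> V \<and> f q \<noteq> g q}"
      have "E \<subseteq> \<delta> ` {u. \<not> (u \<in> T \<longrightarrow> \<delta> u \<in> V \<longrightarrow> f (\<delta> u) = g (\<delta> u))}"
        by (auto simp: E_def)
      then have "finite E"
        using V(5) finite_surj unfolding eventually_cofinite by blast
      then have "closedin (zar X) E"
        by (rule fin) (auto simp: E_def)
      then have "openin (zar X) (V - E)"
        using V(1) by blast
      moreover have "g \<in> sections X (V - E)"
        using restr V(1,3) \<open>openin _ (V - E)\<close> unfolding restricts_def by blast
      moreover have "p \<in> V - E"
        using V t by (auto simp: E_def)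
      moreover have "\<forall>q\<in>(V - E) \<inter> W. f q = g q"
        using W unfolding openin_sub by (auto simp: E_def)
      ultimately show "\<exists>W' g. openin (zar X) W' \<and> p \<in> W' \<and> g \<in> sections X W' \<and> (\<forall>q\<in>W' \<inter> W. f q = g q)"
        by blast
    qed
  qed
  ultimately show ?thesis
    unfolding param_curve_def top using T fib by blast
qed

section \<open>Bihomogeneous forms and the geometry of the quadric\<close>

text \<open>Treating forms as a set of functions graded by bidegree lets them be built by closure
  rules, so that only degrees have to be tracked and never coefficient families.\<close>

definition BF :: "nat \<Rightarrow> nat \<Rightarrow> (complex \<times> complex \<Rightarrow> complex \<times> complex \<Rightarrow> complex) set" where
  "BF d e = range (biform d e)"

definition bimonom :: "nat \<Rightarrow> nat \<Rightarrow> nat \<Rightarrow> nat \<Rightarrow> complex \<times> complex \<Rightarrow> complex \<times> complex \<Rightarrow> complex" where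
  "bimonom d e i j z w = (fst z ^ (d - i) * snd z ^ i) * (fst w ^ (e - j) * snd w ^ j)"

lemma biform_bimonom: "biform d e c z w = (\<Sum>i\<le>d. \<Sum>j\<le>e. c i j * bimonom d e i j z w)"
  by (simp add: biform_def bimonom_def mult.assoc)

lemma BF_add:
  assumes "F \<in> BF d e" "G \<in> BF d e"
  shows "(\<lambda>z w. F z w + G z w) \<in> BF d e"
proof -
  obtain c c' where "F = biform d e c" "G = biform d e c'"
    using assms unfolding BF_def by blast
  then have "(\<lambda>z w. F z w + G z w) = biform d e (\<lambda>i j. c i j + c' i j)"
    by (simp add: fun_eq_iff biform_bimonom sum.distrib distrib_right)
  then show ?thesis
    unfolding BF_def by blast
qed

lemma BF_cmult:
  assumes "F \<in> BF d e"
  shows "(\<lambda>z w. k * F z w) \<in> BF d e"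
proof -
  obtain c where "F = biform d e c"
    using assms unfolding BF_def by blast
  then have "(\<lambda>z w. k * F z w) = biform d e (\<lambda>i j. k * c i j)"
    by (simp add: fun_eq_iff biform_bimonom sum_distrib_left mult.assoc)
  then show ?thesis
    unfolding BF_def by blast
qed

lemma BF_zero: "(\<lambda>z w. 0) \<in> BF d e"
proof -
  have "(\<lambda>z w. 0) = biform d e (\<lambda>i j. 0)"
    by (simp add: fun_eq_iff biform_bimonom)
  then show ?thesis
    unfolding BF_def by blast
qed

lemma BF_sum:
  "(\<And>i. i \<in> I \<Longrightarrow> F i \<in> BF d e) \<Longrightarrow> (\<lambda>z w. \<Sum>i\<in>I. F i z w) \<in> BF d e"
  by (induction I rule: infinite_finite_induct) (auto intro: BF_add BF_zero)

lemma BF_bimonom: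
  assumes "i \<le> d" "j \<le> e"
  shows "bimonom d e i j \<in> BF d e"
proof -
  have inner: "(\<Sum>j'\<le>e. (if i' = i \<and> j' = j then 1 else 0) * bimonom d e i' j' z w) =
    (if i' = i then bimonom d e i j z w else 0)" for i' z w
    using assms by (cases "i' = i") (simp_all add: if_distrib[of "\<lambda>x. x * _"] sum.delta cong: if_cong)
  have "bimonom d e i j = biform d e (\<lambda>i' j'. if i' = i \<and> j' = j then 1 else 0)"
    using assms by (intro ext) (simp add: biform_bimonom inner sum.delta)
  then show ?thesis
    unfolding BF_def by blast
qed

lemma BF_mult:
  assumes "F \<in> BF d e" "G \<in> BF d' e'"
  shows "(\<lambda>z w. F z w * G z w) \<in> BF (d + d') (e + e')"
proof -
  obtain c c' where FG: "F = biform d e c" "G = biform d' e' c'"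
    using assms unfolding BF_def by blast
  have mono: "bimonom d e i j z w * bimonom d' e' i' j' z w = bimonom (d + d') (e + e') (i + i') (j + j') z w"
    if "i \<le> d" "j \<le> e" "i' \<le> d'" "j' \<le> e'" for i j i' j' z w
  proof -
    have "d + d' - (i + i') = (d - i) + (d' - i')" "e + e' - (j + j') = (e - j) + (e' - j')"
      using that by auto
    then show ?thesis
      unfolding bimonom_def by (simp add: power_add mult_ac)
  qed
  have "(\<lambda>z w. F z w * G z w) =
    (\<lambda>z w. \<Sum>i\<le>d. \<Sum>j\<le>e. \<Sum>i'\<le>d'. \<Sum>j'\<le>e'. c i j * c' i' j' * bimonom (d + d') (e + e') (i + i') (j + j') z w)"
    unfolding FG biform_bimonom sum_distrib_right
    unfolding sum_distrib_left
    by (intro ext sum.cong refl) (simp add: mono[symmetric] mult_ac)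
  also have "\<dots> \<in> BF (d + d') (e + e')"
    by (intro BF_sum BF_cmult BF_bimonom) auto
  finally show ?thesis .
qed

lemma BF_const: "(\<lambda>z w. k) \<in> BF 0 0"
proof -
  have "(\<lambda>z w. k) = biform 0 0 (\<lambda>i j. k)"
    by (simp add: fun_eq_iff biform_bimonom bimonom_def)
  then show ?thesis
    unfolding BF_def by blast
qed

lemma BF_prod:
  "finite I \<Longrightarrow> (\<And>i. i \<in> I \<Longrightarrow> F i \<in> BF d e) \<Longrightarrow>
    (\<lambda>z w. \<Prod>i\<in>I. F i z w) \<in> BF (card I * d) (card I * e)"
proof (induction I rule: finite_induct)
  case empty
  then show ?case by (simp add: BF_const)
next
  case (insert x I)
  then show ?case
    using BF_mult[of "F x" d e "\<lambda>z w. \<Prod>i\<in>I. F i z w" "card I * d" "card I * e"] by simp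
qed

lemma BF_power: "F \<in> BF d e \<Longrightarrow> (\<lambda>z w. F z w ^ k) \<in> BF (k * d) (k * e)"
  using BF_prod[of "{..<k}" "\<lambda>_. F" d e] by simp

lemma BF_fst_z: "(\<lambda>z w. fst z) \<in> BF 1 0"
  using BF_bimonom[of 0 1 0 0] by (simp add: bimonom_def[abs_def])

lemma BF_snd_z: "(\<lambda>z w. snd z) \<in> BF 1 0"
  using BF_bimonom[of 1 1 0 0] by (simp add: bimonom_def[abs_def])

lemma BF_fst_w: "(\<lambda>z w. fst w) \<in> BF 0 1"
  using BF_bimonom[of 0 0 0 1] by (simp add: bimonom_def[abs_def])

lemma BF_snd_w: "(\<lambda>z w. snd w) \<in> BF 0 1"
  using BF_bimonom[of 0 0 1 1] by (simp add: bimonom_def[abs_def])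

lemma BF_diagonal:
  assumes "F \<in> BF d e"
  shows "(\<lambda>z w. F (fst z, l * snd z) (fst w, m * snd w)) \<in> BF d e"
proof -
  obtain c where "F = biform d e c"
    using assms unfolding BF_def by blast
  then have "(\<lambda>z w. F (fst z, l * snd z) (fst w, m * snd w)) = biform d e (\<lambda>i j. c i j * l ^ i * m ^ j)"
    by (simp add: fun_eq_iff biform_bimonom bimonom_def power_mult_distrib mult_ac)
  then show ?thesis
    unfolding BF_def by blast
qed

lemma BF_scale:
  assumes "F \<in> BF d e"
  shows "F (l * x, l * y) (m * u, m * v) = l ^ d * m ^ e * F (x, y) (u, v)"
  using assms biform_scale unfolding BF_def by auto

definition at_Q :: "(complex \<times> complex \<Rightarrow> complex \<times> complex \<Rightarrow> complex) \<Rightarrow> P1 \<times> P1 \<Rightarrow> complex" where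
  "at_Q F q = F (hom (fst q)) (hom (snd q))"

lemma openin_at_Q: "F \<in> BF d e \<Longrightarrow> openin zar_Q {q. at_Q F q \<noteq> 0}"
  unfolding zar_Q_def BF_def at_Q_def
  by (rule topology_generated_by_Basis) (auto simp: biform_at_def)

text \<open>The generating sets already form a basis: the intersection of two non-vanishing loci is
  the non-vanishing locus of the product of the forms.\<close>

lemma zar_Q_basis:
  assumes "openin zar_Q W" "q \<in> W"
  obtains d e F where "F \<in> BF d e" "at_Q F q \<noteq> 0" "\<And>x. at_Q F x \<noteq> 0 \<Longrightarrow> x \<in> W"
proof -
  have "generate_topology_on {{q. biform_at d e c q \<noteq> 0} | d e c. True} W"
    using assms(1) unfolding zar_Q_def by (simp add: openin_topology_generated_by_iff)
  then have "q \<in> W \<longrightarrow> (\<exists>d e. \<exists>F\<in>BF d e. at_Q F q \<noteq> 0 \<and> (\<forall>x. at_Q F x \<noteq> 0 \<longrightarrow> x \<in> W))"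
  proof induction
    case (Int A B)
    show ?case
    proof
      assume "q \<in> A \<inter> B"
      then obtain d e F d' e' G where F: "F \<in> BF d e" "at_Q F q \<noteq> 0" "\<forall>x. at_Q F x \<noteq> 0 \<longrightarrow> x \<in> A"
        and G: "G \<in> BF d' e'" "at_Q G q \<noteq> 0" "\<forall>x. at_Q G x \<noteq> 0 \<longrightarrow> x \<in> B"
        using Int.IH by auto
      show "\<exists>d e. \<exists>F\<in>BF d e. at_Q F q \<noteq> 0 \<and> (\<forall>x. at_Q F x \<noteq> 0 \<longrightarrow> x \<in> A \<inter> B)"
        using F G BF_mult[OF F(1) G(1)]
        by (intro exI[of _ "d + d'"] exI[of _ "e + e'"] bexI[of _ "\<lambda>z w. F z w * G z w"]) (auto simp: at_Q_def)
    qed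
  next
    case (UN K)
    then show ?case by blast
  next
    case (Basis S)
    then obtain d e c where "S = {q. biform_at d e c q \<noteq> 0}"
      by blast
    moreover have "biform d e c \<in> BF d e"
      by (simp add: BF_def)
    ultimately show ?case
      by (auto simp: at_Q_def biform_at_def)
  qed auto
  then show thesis
    using assms(2) that by blast
qed

lemma hom_nonzero: "hom p \<noteq> (0, 0)"
  by (cases p) auto

definition pt :: "complex \<times> complex \<Rightarrow> P1" where
  "pt z = (if fst z = 0 then Infty else Aff (snd z / fst z))"

lemma hom_pt:
  assumes "z \<noteq> (0, 0)"
  obtains l where "l \<noteq> 0" "z = (l * fst (hom (pt z)), l * snd (hom (pt z)))"
proof (cases "fst z = 0")
  case True
  then show ?thesis
    using assms that[of "snd z"] by (cases z) (simp add: pt_def)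
next
  case False
  then show ?thesis
    using that[of "fst z"] by (simp add: pt_def)
qed

lemma pt_hom [simp]: "pt (hom p) = p"
  by (cases p) (auto simp: pt_def)

lemma pt_eq_iff:
  assumes "z \<noteq> (0, 0)" "w \<noteq> (0, 0)"
  shows "pt z = pt w \<longleftrightarrow> fst z * snd w = snd z * fst w"
  using assms by (cases z; cases w) (auto simp: pt_def field_simps)

text \<open>The scalar \<open>k\<close> depends on the representatives and the bidegree only, not on
  the form. This is why quotients of forms of equal bidegree may be evaluated on arbitrary
  representatives.\<close>

lemma at_Q_pt:
  assumes "F \<in> BF d e" "z \<noteq> (0, 0)" "w \<noteq> (0, 0)"
  obtains k where "k \<noteq> 0" "F z w = k * at_Q F (pt z, pt w)"
    "\<And>G. G \<in> BF d e \<Longrightarrow> G z w = k * at_Q G (pt z, pt w)"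
proof -
  obtain l where l: "l \<noteq> 0" "z = (l * fst (hom (pt z)), l * snd (hom (pt z)))"
    using hom_pt[OF assms(2)] .
  obtain m where m: "m \<noteq> 0" "w = (m * fst (hom (pt w)), m * snd (hom (pt w)))"
    using hom_pt[OF assms(3)] .
  have "G z w = (l ^ d * m ^ e) * at_Q G (pt z, pt w)" if "G \<in> BF d e" for G
    using BF_scale[OF that, of l "fst (hom (pt z))" "snd (hom (pt z))" m "fst (hom (pt w))" "snd (hom (pt w))"]
    unfolding l(2)[symmetric] m(2)[symmetric] at_Q_def by simp
  moreover have "l ^ d * m ^ e \<noteq> 0"
    using l m by simp
  ultimately show thesis
    using that assms(1) by blast
qed

lemma closedin_zar_Q_point: "closedin zar_Q {q}"
proof -
  obtain p r where q: "q = (p, r)"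
    by (cases q)
  define F where "F z w = fst z * snd (hom p) - snd z * fst (hom p)" for z w :: "complex \<times> complex"
  define G where "G z w = fst w * snd (hom r) - snd w * fst (hom r)" for z w :: "complex \<times> complex"
  have "(\<lambda>z w. snd (hom p) * fst z + (- fst (hom p)) * snd z) \<in> BF 1 0"
    by (intro BF_add BF_cmult BF_fst_z BF_snd_z)
  then have F: "F \<in> BF 1 0"
    by (simp add: F_def[abs_def] algebra_simps)
  have "(\<lambda>z w. snd (hom r) * fst w + (- fst (hom r)) * snd w) \<in> BF 0 1"
    by (intro BF_add BF_cmult BF_fst_w BF_snd_w)
  then have G: "G \<in> BF 0 1"
    by (simp add: G_def[abs_def] algebra_simps)
  have "at_Q F x = 0 \<longleftrightarrow> fst x = p" for x
    using pt_eq_iff[OF hom_nonzero hom_nonzero, of "fst x" p] by (simp add: at_Q_def F_def)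
  moreover have "at_Q G x = 0 \<longleftrightarrow> snd x = r" for x
    using pt_eq_iff[OF hom_nonzero hom_nonzero, of "snd x" r] by (simp add: at_Q_def G_def)
  ultimately have "topspace zar_Q - {q} = {x. at_Q F x \<noteq> 0} \<union> {x. at_Q G x \<noteq> 0}"
    by (auto simp: q)
  then show ?thesis
    using openin_Un[OF openin_at_Q[OF F] openin_at_Q[OF G]] by (simp add: closedin_def)
qed

definition polynomial_fun :: "(complex \<Rightarrow> complex) \<Rightarrow> bool" where
  "polynomial_fun \<phi> \<longleftrightarrow> (\<exists>P. \<forall>u. \<phi> u = poly P u)"

lemma polynomial_fun_const [intro]: "polynomial_fun (\<lambda>u. c)"
  unfolding polynomial_fun_def by (rule exI[of _ "[:c:]"]) simp

lemma polynomial_fun_id [intro]: "polynomial_fun (\<lambda>u. u)"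
  unfolding polynomial_fun_def by (rule exI[of _ "[:0, 1:]"]) simp

lemma polynomial_fun_add [intro]:
  "polynomial_fun \<phi> \<Longrightarrow> polynomial_fun \<psi> \<Longrightarrow> polynomial_fun (\<lambda>u. \<phi> u + \<psi> u)"
  unfolding polynomial_fun_def by (metis poly_add)

lemma polynomial_fun_mult [intro]:
  "polynomial_fun \<phi> \<Longrightarrow> polynomial_fun \<psi> \<Longrightarrow> polynomial_fun (\<lambda>u. \<phi> u * \<psi> u)"
  unfolding polynomial_fun_def by (metis poly_mult)

lemma polynomial_fun_diff [intro]:
  "polynomial_fun \<phi> \<Longrightarrow> polynomial_fun \<psi> \<Longrightarrow> polynomial_fun (\<lambda>u. \<phi> u - \<psi> u)"
  unfolding polynomial_fun_def by (metis poly_diff)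

lemma polynomial_fun_minus [intro]:
  "polynomial_fun \<phi> \<Longrightarrow> polynomial_fun (\<lambda>u. - \<phi> u)"
  unfolding polynomial_fun_def by (metis poly_minus)

lemma polynomial_fun_power [intro]: "polynomial_fun \<phi> \<Longrightarrow> polynomial_fun (\<lambda>u. \<phi> u ^ k)"
  by (induction k) auto

lemma polynomial_fun_sum [intro]:
  "(\<And>i. i \<in> I \<Longrightarrow> polynomial_fun (\<phi> i)) \<Longrightarrow> polynomial_fun (\<lambda>u. \<Sum>i\<in>I. \<phi> i u)"
  by (induction I rule: infinite_finite_induct) auto

lemma polynomial_fun_BF:
  assumes "F \<in> BF d e" "polynomial_fun (\<lambda>u. fst (z u))" "polynomial_fun (\<lambda>u. snd (z u))"
    "polynomial_fun (\<lambda>u. fst (w u))" "polynomial_fun (\<lambda>u. snd (w u))"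
  shows "polynomial_fun (\<lambda>u. F (z u) (w u))"
proof -
  obtain c where "F = biform d e c"
    using assms(1) unfolding BF_def by blast
  then show ?thesis
    unfolding biform_def using assms by (auto intro!: polynomial_fun_sum polynomial_fun_mult polynomial_fun_power)
qed

text \<open>Irreducibility of \<open>Q\<close>: restricted to a straight line in the space of
  homogeneous coordinates, a form is a polynomial in one variable, so being non-zero at one
  parameter makes it non-zero at almost all.\<close>

lemma zar_Q_dense:
  assumes "openin zar_Q V" "q \<in> V" "openin zar_Q W" "r \<in> W"
  obtains x where "x \<in> V" "x \<in> W" "\<exists>\<zeta> \<eta>. x = (Aff \<zeta>, Aff \<eta>)"
proof -
  obtain d e F where F: "F \<in> BF d e" "at_Q F q \<noteq> 0" "\<And>x. at_Q F x \<noteq> 0 \<Longrightarrow> x \<in> V"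
    using zar_Q_basis[OF assms(1,2)] by metis
  obtain d' e' G where G: "G \<in> BF d' e'" "at_Q G r \<noteq> 0" "\<And>x. at_Q G x \<noteq> 0 \<Longrightarrow> x \<in> W"
    using zar_Q_basis[OF assms(3,4)] by metis
  have line: "\<forall>\<^sub>F s in cofinite. H ((1 - s) * fst z + s * fst z', (1 - s) * snd z + s * snd z')
      ((1 - s) * fst w + s * fst w', (1 - s) * snd w + s * snd w') \<noteq> 0"
    if "H \<in> BF d e" and H: "H z w \<noteq> 0 \<or> H z' w' \<noteq> 0" for H d e z w z' w'
  proof -
    have "polynomial_fun (\<lambda>s. H ((1 - s) * fst z + s * fst z', (1 - s) * snd z + s * snd z')
      ((1 - s) * fst w + s * fst w', (1 - s) * snd w + s * snd w'))"
      unfolding fst_conv snd_conv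
      by (intro polynomial_fun_BF[OF that(1)]; unfold fst_conv snd_conv;
          intro polynomial_fun_add polynomial_fun_mult polynomial_fun_diff polynomial_fun_const polynomial_fun_id)
    then obtain P where P: "\<And>s. H ((1 - s) * fst z + s * fst z', (1 - s) * snd z + s * snd z')
      ((1 - s) * fst w + s * fst w', (1 - s) * snd w + s * snd w') = poly P s"
      unfolding polynomial_fun_def by blast
    have "P \<noteq> 0"
      using P[of 0] P[of 1] H by auto
    then show ?thesis
      unfolding P by (rule eventually_poly_nonzero)
  qed
  define K where "K z w = fst z * fst w" for z w :: "complex \<times> complex"
  have K: "K \<in> BF 1 1"
    using BF_mult[OF BF_fst_z BF_fst_w] by (simp add: K_def[abs_def])
  \<comment> \<open>The line joins representatives of \<open>q\<close> and \<open>r\<close>;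
    \<open>F\<close> is non-zero at parameter 0 and \<open>G\<close> at parameter 1, so both are
    non-zero at almost every parameter.\<close>
  let ?z = "\<lambda>s. ((1 - s) * fst (hom (fst q)) + s * fst (hom (fst r)), (1 - s) * snd (hom (fst q)) + s * snd (hom (fst r)))"
  let ?w = "\<lambda>s. ((1 - s) * fst (hom (snd q)) + s * fst (hom (snd r)), (1 - s) * snd (hom (snd q)) + s * snd (hom (snd r)))"
  have "\<forall>\<^sub>F s in cofinite. F (?z s) (?w s) \<noteq> 0" "\<forall>\<^sub>F s in cofinite. G (?z s) (?w s) \<noteq> 0"
    using F(1,2) G(1,2) by (auto intro!: line simp: at_Q_def)
  then have "\<forall>\<^sub>F s in cofinite. F (?z s) (?w s) * G (?z s) (?w s) \<noteq> 0"
    by eventually_elim simp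
  then obtain s where s: "F (?z s) (?w s) \<noteq> 0" "G (?z s) (?w s) \<noteq> 0"
    by (rule eventually_cofinite_ex) auto
  \<comment> \<open>A second line runs from this point towards \<open>(1, 0)\<close> in both
    factors. It keeps \<open>F\<close> and \<open>G\<close> generically non-zero and makes the first
    coordinates non-zero, so the point becomes affine.\<close>
  define z w where "z = ?z s" and "w = ?w s"
  have "\<forall>\<^sub>F u in cofinite. F ((1 - u) * fst z + u * 1, (1 - u) * snd z + u * 0)
     ((1 - u) * fst w + u * 1, (1 - u) * snd w + u * 0) \<noteq> 0"
    using line[OF F(1), of z w "(1, 0)" "(1, 0)"] s by (simp add: z_def w_def)
  moreover have "\<forall>\<^sub>F u in cofinite. G ((1 - u) * fst z + u * 1, (1 - u) * snd z + u * 0)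
     ((1 - u) * fst w + u * 1, (1 - u) * snd w + u * 0) \<noteq> 0"
    using line[OF G(1), of z w "(1, 0)" "(1, 0)"] s by (simp add: z_def w_def)
  moreover have "\<forall>\<^sub>F u in cofinite. K ((1 - u) * fst z + u * 1, (1 - u) * snd z + u * 0)
     ((1 - u) * fst w + u * 1, (1 - u) * snd w + u * 0) \<noteq> 0"
    using line[OF K, of z w "(1, 0)" "(1, 0)"] by (simp add: K_def)
  ultimately have "\<forall>\<^sub>F u in cofinite. F ((1 - u) * fst z + u * 1, (1 - u) * snd z + u * 0)
     ((1 - u) * fst w + u * 1, (1 - u) * snd w + u * 0) \<noteq> 0 \<and>
    G ((1 - u) * fst z + u * 1, (1 - u) * snd z + u * 0)
     ((1 - u) * fst w + u * 1, (1 - u) * snd w + u * 0) \<noteq> 0 \<and>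
    K ((1 - u) * fst z + u * 1, (1 - u) * snd z + u * 0)
     ((1 - u) * fst w + u * 1, (1 - u) * snd w + u * 0) \<noteq> 0"
    by eventually_elim auto
  then obtain Z Y where ZY: "F Z Y \<noteq> 0" "G Z Y \<noteq> 0" "K Z Y \<noteq> 0"
    by (rule eventually_cofinite_ex) blast
  then have ne: "fst Z \<noteq> 0" "fst Y \<noteq> 0"
    by (auto simp: K_def)
  then have ne': "Z \<noteq> (0, 0)" "Y \<noteq> (0, 0)"
    by auto
  obtain k where "F Z Y = k * at_Q F (pt Z, pt Y)"
    using at_Q_pt[OF F(1) ne'] by metis
  moreover obtain k' where "G Z Y = k' * at_Q G (pt Z, pt Y)"
    using at_Q_pt[OF G(1) ne'] by metis
  ultimately have "(pt Z, pt Y) \<in> V" "(pt Z, pt Y) \<in> W"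
    using ZY F(3) G(3) by auto
  moreover have "\<exists>\<zeta> \<eta>. (pt Z, pt Y) = (Aff \<zeta>, Aff \<eta>)"
    using ne by (simp add: pt_def)
  ultimately show thesis
    using that by blast
qed

subsection \<open>Regular functions\<close>

lemma sections_Q_germ_iff:
  assumes "openin zar_Q W"
  shows "f \<in> sections Q_space W \<longleftrightarrow> (\<forall>p\<in>W. \<exists>V d e. \<exists>F\<in>BF d e. \<exists>G\<in>BF d e. openin zar_Q V \<and> p \<in> V \<and>
     (\<forall>x\<in>V. at_Q G x \<noteq> 0 \<and> f x = at_Q F x / at_Q G x))"
  (is "?l \<longleftrightarrow> ?r")
proof
  assume l: ?l
  show ?r
  proof
    fix p assume "p \<in> W"
    moreover have "\<forall>p\<in>W. \<exists>V d e c c'. openin zar_Q V \<and> p \<in> V \<and> V \<subseteq> W \<and>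
      (\<forall>x\<in>V. biform_at d e c' x \<noteq> 0 \<and> f x = biform_at d e c x / biform_at d e c' x)"
      using l unfolding Q_space_def by simp
    ultimately obtain V d e c c' where V: "openin zar_Q V" "p \<in> V"
      "\<forall>x\<in>V. biform_at d e c' x \<noteq> 0 \<and> f x = biform_at d e c x / biform_at d e c' x"
      by meson
    show "\<exists>V d e. \<exists>F\<in>BF d e. \<exists>G\<in>BF d e. openin zar_Q V \<and> p \<in> V \<and>
     (\<forall>x\<in>V. at_Q G x \<noteq> 0 \<and> f x = at_Q F x / at_Q G x)"
      using V by (intro exI[of _ V] exI[of _ d] exI[of _ e] bexI[of _ "biform d e c"] bexI[of _ "biform d e c'"])
        (auto simp: at_Q_def biform_at_def BF_def)
  qed
next
  assume r: ?r
  have "\<exists>V d e c c'. openin zar_Q V \<and> p \<in> V \<and> V \<subseteq> W \<and>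
     (\<forall>x\<in>V. biform_at d e c' x \<noteq> 0 \<and> f x = biform_at d e c x / biform_at d e c' x)" if p: "p \<in> W" for p
  proof -
    obtain V d e F G where V: "F \<in> BF d e" "G \<in> BF d e" "openin zar_Q V" "p \<in> V"
      "\<forall>x\<in>V. at_Q G x \<noteq> 0 \<and> f x = at_Q F x / at_Q G x"
      using r p by blast
    obtain c c' where "F = biform d e c" "G = biform d e c'"
      using V(1,2) unfolding BF_def by blast
    then show ?thesis
      using V(3-5) assms p
      by (intro exI[of _ "V \<inter> W"] exI[of _ d] exI[of _ e] exI[of _ c] exI[of _ c'])
        (auto simp: at_Q_def biform_at_def)
  qed
  then show ?l
    unfolding Q_space_def by simp
qed

lemma zar_Q_space [simp]: "zar Q_space = zar_Q"
  by (simp add: Q_space_def)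

lemma germs_Q_iff:
  "f \<in> germs Q_space p \<longleftrightarrow> (\<exists>V d e. \<exists>F\<in>BF d e. \<exists>G\<in>BF d e. openin zar_Q V \<and> p \<in> V \<and>
     (\<forall>x\<in>V. at_Q G x \<noteq> 0 \<and> f x = at_Q F x / at_Q G x))" (is "?l \<longleftrightarrow> ?r")
proof
  assume ?l
  then show ?r
    unfolding germs_def by (auto simp: sections_Q_germ_iff)
next
  assume ?r
  then obtain V d e F G where V: "F \<in> BF d e" "G \<in> BF d e" "openin zar_Q V" "p \<in> V"
      "\<forall>x\<in>V. at_Q G x \<noteq> 0 \<and> f x = at_Q F x / at_Q G x"
    by blast
  then have "f \<in> sections Q_space V"
    by (subst sections_Q_germ_iff) blast+
  then show ?l
    using V unfolding germs_def by auto
qed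

lemma sections_Q_iff: "openin zar_Q W \<Longrightarrow> f \<in> sections Q_space W \<longleftrightarrow> (\<forall>p\<in>W. f \<in> germs Q_space p)"
  by (simp add: sections_Q_germ_iff germs_Q_iff)

lemma restricts_Q: "restricts Q_space"
  unfolding restricts_def by (auto simp: sections_Q_iff)

lemma germs_Q_BF:
  assumes "F \<in> BF d e" "G \<in> BF d e" "at_Q G p \<noteq> 0"
  shows "(\<lambda>x. at_Q F x / at_Q G x) \<in> germs Q_space p"
  unfolding germs_Q_iff using assms openin_at_Q[OF assms(2)]
  by (intro exI[of _ "{q. at_Q G q \<noteq> 0}"] exI[of _ d] exI[of _ e] bexI[of _ F] bexI[of _ G]) auto

lemma germs_Q_add:
  assumes "f \<in> germs Q_space p" "g \<in> germs Q_space p"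
  shows "(\<lambda>x. f x + g x) \<in> germs Q_space p"
proof -
  obtain V d e F G where 1: "F \<in> BF d e" "G \<in> BF d e" "openin zar_Q V" "p \<in> V"
      "\<forall>x\<in>V. at_Q G x \<noteq> 0 \<and> f x = at_Q F x / at_Q G x"
    using assms(1) unfolding germs_Q_iff by blast
  obtain V' d' e' F' G' where 2: "F' \<in> BF d' e'" "G' \<in> BF d' e'" "openin zar_Q V'" "p \<in> V'"
      "\<forall>x\<in>V'. at_Q G' x \<noteq> 0 \<and> g x = at_Q F' x / at_Q G' x"
    using assms(2) unfolding germs_Q_iff by blast
  have "(\<lambda>z w. F z w * G' z w + G z w * F' z w) \<in> BF (d + d') (e + e')"
    "(\<lambda>z w. G z w * G' z w) \<in> BF (d + d') (e + e')"
    using 1 2 by (auto intro!: BF_add BF_mult)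
  then show ?thesis
    unfolding germs_Q_iff using 1(3-5) 2(3-5)
    by (intro exI[of _ "V \<inter> V'"] exI[of _ "d + d'"] exI[of _ "e + e'"]
        bexI[of _ "\<lambda>z w. F z w * G' z w + G z w * F' z w"] bexI[of _ "\<lambda>z w. G z w * G' z w"])
      (auto simp: at_Q_def field_simps)
qed

lemma germs_Q_mult:
  assumes "f \<in> germs Q_space p" "g \<in> germs Q_space p"
  shows "(\<lambda>x. f x * g x) \<in> germs Q_space p"
proof -
  obtain V d e F G where 1: "F \<in> BF d e" "G \<in> BF d e" "openin zar_Q V" "p \<in> V"
      "\<forall>x\<in>V. at_Q G x \<noteq> 0 \<and> f x = at_Q F x / at_Q G x"
    using assms(1) unfolding germs_Q_iff by blast
  obtain V' d' e' F' G' where 2: "F' \<in> BF d' e'" "G' \<in> BF d' e'" "openin zar_Q V'" "p \<in> V'"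
      "\<forall>x\<in>V'. at_Q G' x \<noteq> 0 \<and> g x = at_Q F' x / at_Q G' x"
    using assms(2) unfolding germs_Q_iff by blast
  have "(\<lambda>z w. F z w * F' z w) \<in> BF (d + d') (e + e')"
    "(\<lambda>z w. G z w * G' z w) \<in> BF (d + d') (e + e')"
    using 1 2 by (auto intro!: BF_add BF_mult)
  then show ?thesis
    unfolding germs_Q_iff using 1(3-5) 2(3-5)
    by (intro exI[of _ "V \<inter> V'"] exI[of _ "d + d'"] exI[of _ "e + e'"]
        bexI[of _ "\<lambda>z w. F z w * F' z w"] bexI[of _ "\<lambda>z w. G z w * G' z w"])
      (auto simp: at_Q_def)
qed

lemma germs_Q_const: "(\<lambda>x. c) \<in> germs Q_space p"
  using germs_Q_BF[OF BF_const[of c] BF_const[of 1]] by (simp add: at_Q_def)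

lemma germs_Q_inverse:
  assumes "f \<in> germs Q_space p" "f p \<noteq> 0"
  shows "(\<lambda>x. inverse (f x)) \<in> germs Q_space p"
proof -
  obtain V d e F G where 1: "F \<in> BF d e" "G \<in> BF d e" "openin zar_Q V" "p \<in> V"
      "\<forall>x\<in>V. at_Q G x \<noteq> 0 \<and> f x = at_Q F x / at_Q G x"
    using assms(1) unfolding germs_Q_iff by blast
  have "f p = at_Q F p / at_Q G p"
    using 1 by blast
  then have "at_Q F p \<noteq> 0"
    using assms(2) by auto
  moreover have "openin zar_Q (V \<inter> {q. at_Q F q \<noteq> 0})"
    using openin_at_Q[OF 1(1)] 1(3) by blast
  ultimately show ?thesis
    unfolding germs_Q_iff using 1
    by (intro exI[of _ "V \<inter> {q. at_Q F q \<noteq> 0}"] exI[of _ d] exI[of _ e] bexI[of _ G] bexI[of _ F]) auto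
qed

lemma germs_Q_cong:
  assumes "f \<in> germs Q_space p" "openin zar_Q V" "p \<in> V" "\<And>x. x \<in> V \<Longrightarrow> g x = f x"
  shows "g \<in> germs Q_space p"
proof -
  obtain V' d e F G where 1: "F \<in> BF d e" "G \<in> BF d e" "openin zar_Q V'" "p \<in> V'"
      "\<forall>x\<in>V'. at_Q G x \<noteq> 0 \<and> f x = at_Q F x / at_Q G x"
    using assms(1) unfolding germs_Q_iff by blast
  then show ?thesis
    unfolding germs_Q_iff using assms(2-4)
    by (intro exI[of _ "V \<inter> V'"] exI[of _ d] exI[of _ e] bexI[of _ F] bexI[of _ G]) auto
qed

lemma germs_Q_nonzero_open:
  assumes "openin zar_Q W" "f \<in> sections Q_space W"
  shows "openin zar_Q {x \<in> W. f x \<noteq> 0}"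
proof (subst openin_subopen, intro ballI)
  fix p assume p: "p \<in> {x \<in> W. f x \<noteq> 0}"
  then obtain V d e F G where 1: "F \<in> BF d e" "G \<in> BF d e" "openin zar_Q V" "p \<in> V"
      "\<forall>x\<in>V. at_Q G x \<noteq> 0 \<and> f x = at_Q F x / at_Q G x"
    using assms(2) unfolding sections_Q_germ_iff[OF assms(1)] by blast
  then show "\<exists>T. openin zar_Q T \<and> p \<in> T \<and> T \<subseteq> {x \<in> W. f x \<noteq> 0}"
    using p assms(1) openin_at_Q[OF 1(1)] by (intro exI[of _ "V \<inter> W \<inter> {q. at_Q F q \<noteq> 0}"]) auto
qed

section \<open>The cyclic action\<close>

definition root1 :: "nat \<Rightarrow> complex" where
  "root1 n = exp (2 * of_real pi * \<i> / of_nat n)"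

definition act :: "complex \<Rightarrow> P1 \<times> P1 \<Rightarrow> P1 \<times> P1" where
  "act l q = (scale_P1 l (fst q), scale_P1 (inverse l) (snd q))"

lemma root1_nonzero [simp]: "root1 n \<noteq> 0"
  by (simp add: root1_def)

lemma root1_power_n: "n > 0 \<Longrightarrow> root1 n ^ n = 1"
  by (simp add: root1_def flip: exp_of_nat_mult)

lemma root1_power_eq:
  assumes "n > 0" "i < n" "j < n" "root1 n ^ i = root1 n ^ j"
  shows "i = j"
proof -
  have "exp (2 * of_real pi * \<i> * of_nat i / of_nat n) = exp (2 * of_real pi * \<i> * of_nat j / of_nat n)"
    using assms(4) by (simp add: root1_def mult_ac flip: exp_of_nat_mult)
  then show ?thesis
    using complex_root_unity_eq[of n i j] assms by (simp add: cong_def)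
qed

lemma scale_P1_mult: "scale_P1 l (scale_P1 m p) = scale_P1 (l * m) p"
  by (cases p) auto

lemma scale_P1_1 [simp]: "scale_P1 1 p = p"
  by (cases p) auto

lemma act_act: "act l (act m q) = act (l * m) q"
  by (simp add: act_def scale_P1_mult mult.commute)

lemma act_1 [simp]: "act 1 q = q"
  by (simp add: act_def)

lemma rot_act: "rot n q = act (root1 n) q"
  by (simp add: rot_def act_def root1_def exp_minus)

lemma rot_power: "(rot n ^^ k) q = act (root1 n ^ k) q"
  by (induction k) (simp_all add: rot_act act_act)

lemma Phi_act_range: "Phi n q = range (\<lambda>k. act (root1 n ^ k) q)"
  by (simp add: Phi_def rot_power)

lemma Phi_self: "q \<in> Phi n q"
  unfolding Phi_act_range by (rule range_eqI[of _ _ 0]) simp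

lemma root1_power_mod: "n > 0 \<Longrightarrow> root1 n ^ k = root1 n ^ (k mod n)"
proof -
  assume n: "n > 0"
  have "root1 n ^ k = root1 n ^ (n * (k div n) + k mod n)"
    by simp
  also have "\<dots> = root1 n ^ (k mod n)"
    by (simp only: power_add power_mult root1_power_n[OF n]) simp
  finally show ?thesis .
qed

lemma Phi_finite:
  assumes "n > 0"
  shows "finite (Phi n q)"
proof -
  have "Phi n q \<subseteq> (\<lambda>k. act (root1 n ^ k) q) ` {..<n}"
    unfolding Phi_act_range using root1_power_mod[OF assms] assms
    by (metis (no_types, lifting) image_eqI image_subsetI lessThan_iff mod_less_divisor)
  then show ?thesis
    by (rule finite_subset) simp
qed

lemma Phi_act:
  assumes "n > 0"
  shows "Phi n (act (root1 n ^ k) q) = Phi n q"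
proof
  show "Phi n (act (root1 n ^ k) q) \<subseteq> Phi n q"
    unfolding Phi_act_range by (auto simp: act_act simp flip: power_add)
  have "act (root1 n ^ j) q = act (root1 n ^ (j + (n - 1) * k)) (act (root1 n ^ k) q)" for j
  proof -
    have "(n - 1) * k + k = n * k"
      using assms by (cases n) auto
    then have "j + (n - 1) * k + k = j + n * k"
      by simp
    then have "root1 n ^ (j + (n - 1) * k) * root1 n ^ k = root1 n ^ j"
      by (metis power_add power_mult root1_power_n[OF assms] mult_1_right power_one)
    then show ?thesis
      by (simp add: act_act)
  qed
  then show "Phi n q \<subseteq> Phi n (act (root1 n ^ k) q)"
    unfolding Phi_act_range by blast
qed

lemma Phi_eq_iff:
  assumes "n > 0"
  shows "Phi n q = Phi n r \<longleftrightarrow> (\<exists>k<n. r = act (root1 n ^ k) q)"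
proof
  assume "Phi n q = Phi n r"
  then have "r \<in> Phi n q"
    using Phi_self by simp
  then obtain k where "r = act (root1 n ^ k) q"
    unfolding Phi_act_range by blast
  then show "\<exists>k<n. r = act (root1 n ^ k) q"
    using root1_power_mod[OF assms, of k] assms by (intro exI[of _ "k mod n"]) simp
next
  assume "\<exists>k<n. r = act (root1 n ^ k) q"
  then show "Phi n q = Phi n r"
    using Phi_act[OF assms] by metis
qed

lemma hom_scale:
  assumes "l \<noteq> 0"
  obtains k where "k \<noteq> 0" "(fst (hom p), l * snd (hom p)) = (k * fst (hom (scale_P1 l p)), k * snd (hom (scale_P1 l p)))"
proof (cases p)
  case (Aff z)
  show ?thesis
    by (rule that[of 1]) (simp_all add: Aff)
next
  case Infty
  show ?thesis
    by (rule that[of l]) (simp_all add: Infty assms)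
qed

lemma at_Q_act:
  assumes "l \<noteq> 0"
  obtains k where "k \<noteq> 0" "\<And>F. F \<in> BF d e \<Longrightarrow>
    F (fst (hom (fst q)), l * snd (hom (fst q))) (fst (hom (snd q)), inverse l * snd (hom (snd q))) = k * at_Q F (act l q)"
proof -
  obtain s where s: "s \<noteq> 0" "(fst (hom (fst q)), l * snd (hom (fst q))) =
    (s * fst (hom (scale_P1 l (fst q))), s * snd (hom (scale_P1 l (fst q))))"
    using hom_scale[OF assms] .
  have "inverse l \<noteq> 0"
    using assms by simp
  then obtain r where r: "r \<noteq> 0" "(fst (hom (snd q)), inverse l * snd (hom (snd q))) =
    (r * fst (hom (scale_P1 (inverse l) (snd q))), r * snd (hom (scale_P1 (inverse l) (snd q))))"
    by (rule hom_scale)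
  show thesis
  proof (rule that[of "s ^ d * r ^ e"])
    fix F assume "F \<in> BF d e"
    then show "F (fst (hom (fst q)), l * snd (hom (fst q))) (fst (hom (snd q)), inverse l * snd (hom (snd q))) =
      (s ^ d * r ^ e) * at_Q F (act l q)"
      unfolding s(2) r(2) by (subst BF_scale) (auto simp: at_Q_def act_def)
  qed (use s r in simp)
qed

section \<open>Regular functions on the quotient\<close>

lemma zar_Q_quot [simp]: "zar (Q_quot n) = zar_quot n"
  by (simp add: Q_quot_def)

lemma sections_Q_quot: "f \<in> sections (Q_quot n) V \<longleftrightarrow> f \<circ> Phi n \<in> sections Q_space (Phi n -` V)"
  by (simp add: Q_quot_def)

lemma restricts_Q_quot: "restricts (Q_quot n)"
  unfolding restricts_def
proof (intro allI impI)
  fix W W' f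
  assume "openin (zar (Q_quot n)) W \<and> openin (zar (Q_quot n)) W' \<and> W' \<subseteq> W \<and> f \<in> sections (Q_quot n) W"
  moreover from this have "Phi n -` W' \<subseteq> Phi n -` W"
    by blast
  ultimately show "f \<in> sections (Q_quot n) W'"
    using restricts_Q[unfolded restricts_def, rule_format, of "Phi n -` W" "Phi n -` W'" "f \<circ> Phi n"]
    by (simp add: sections_Q_quot openin_zar_quot)
qed

lemma morphism_Phi: "morphism Q_space (Q_quot n) (Phi n)"
  using quotient_imp_continuous_map[OF quotient_map_Phi[of n]]
  by (simp add: morphism_def sections_Q_quot vimage_def)

lemma closedin_zar_quot_finite:
  assumes "n > 0"
  shows "closedin (zar_quot n) {Phi n q}"
proof -
  have "closedin zar_Q (\<Union>x\<in>Phi n q. {x})"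
    using Phi_finite[OF assms] closedin_zar_Q_point by (intro closedin_Union) auto
  then have "openin zar_Q (UNIV - Phi n q)"
    unfolding closedin_def by simp
  moreover have "Phi n -` (range (Phi n) - {Phi n q}) = UNIV - Phi n q"
  proof -
    have "Phi n x = Phi n q \<longleftrightarrow> x \<in> Phi n q" for x
    proof
      assume "x \<in> Phi n q"
      then obtain k where "x = act (root1 n ^ k) q"
        unfolding Phi_act_range by blast
      then show "Phi n x = Phi n q"
        by (simp add: Phi_act[OF assms])
    qed (metis Phi_self)
    then show ?thesis by auto
  qed
  ultimately show ?thesis
    by (auto simp: closedin_def topspace_zar_quot openin_zar_quot)
qed

lemma quotient_section:
  assumes W: "openin zar_Q W"
    and inv: "\<And>x y. Phi n x = Phi n y \<Longrightarrow> x \<in> W \<Longrightarrow> y \<in> W"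
    and G: "\<And>x y. Phi n x = Phi n y \<Longrightarrow> G x = G y"
    and reg: "\<And>x. x \<in> W \<Longrightarrow> G \<in> germs Q_space x"
  obtains g where "openin (zar_quot n) (Phi n ` W)" "g \<in> sections (Q_quot n) (Phi n ` W)"
    "\<And>x. g (Phi n x) = G x"
proof -
  define g where "g p = G (inv_into UNIV (Phi n) p)" for p
  have g: "g (Phi n x) = G x" for x
    unfolding g_def by (rule G) (simp add: f_inv_into_f)
  have pre: "Phi n -` (Phi n ` W) = W"
  proof
    show "Phi n -` (Phi n ` W) \<subseteq> W"
      using inv by (metis imageE subsetI vimageE)
  qed blast
  have "g \<circ> Phi n = G"
    by (simp add: fun_eq_iff g)
  then have "g \<in> sections (Q_quot n) (Phi n ` W)"
    unfolding sections_Q_quot pre using reg W by (simp add: sections_Q_iff)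
  moreover have "openin (zar_quot n) (Phi n ` W)"
    unfolding openin_zar_quot pre using W by auto
  ultimately show thesis
    using that g by blast
qed

section \<open>The curve upstairs and its parametrisations\<close>

locale hyperbola =
  fixes n :: nat and a :: complex and b :: real
  assumes n2: "n \<ge> 2" and a0: "a \<noteq> 0" and ab: "(cmod a)\<^sup>2 - b < 0"
begin

text \<open>The Moebius map sending \<open>\<zeta>\<close> to
  \<open>- (a \<zeta> + b) / (\<zeta> + cnj a)\<close> in homogeneous coordinates. Its determinant
  is \<open>b - |a|\<^sup>2\<close>, non-zero by hypothesis.\<close>

definition M :: "complex \<times> complex \<Rightarrow> complex \<times> complex" where
  "M z = (snd z + cnj a * fst z, - (a * snd z + of_real b * fst z))"

definition L :: "complex \<times> complex \<Rightarrow> complex \<times> complex \<Rightarrow> complex" where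
  "L z w = snd w * fst (M z) - fst w * snd (M z)"

lemma n0: "n > 0"
  using n2 by simp

lemma norm_a: "a * cnj a = of_real ((cmod a)\<^sup>2)"
  by (metis complex_norm_square mult.commute)

lemma b_pos: "b > 0"
proof -
  have "(cmod a)\<^sup>2 \<ge> 0"
    by (rule zero_le_power2)
  then show ?thesis
    using ab by linarith
qed

lemma det_nonzero: "a * cnj a - of_real b \<noteq> 0"
  unfolding norm_a using ab by (metis less_irrefl of_real_diff of_real_eq_0_iff)

lemma L_BF: "L \<in> BF 1 1"
proof -
  have "(\<lambda>z w. (snd z * snd w + cnj a * (fst z * snd w)) + (a * (snd z * fst w) + of_real b * (fst z * fst w))) \<in> BF (1 + 0) (0 + 1)"
    by (intro BF_add BF_cmult BF_mult BF_fst_z BF_snd_z BF_fst_w BF_snd_w)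
  moreover have "L = (\<lambda>z w. (snd z * snd w + cnj a * (fst z * snd w)) + (a * (snd z * fst w) + of_real b * (fst z * fst w)))"
    by (auto simp: fun_eq_iff L_def M_def algebra_simps)
  ultimately show ?thesis by simp
qed

lemma L_Aff: "L (1, \<zeta>) (1, \<eta>) = \<zeta> * \<eta> + a * \<zeta> + cnj a * \<eta> + of_real b"
  by (simp add: L_def M_def algebra_simps)

lemma L_M [simp]: "L z (M z) = 0"
  by (simp add: L_def mult.commute)

lemma M_nonzero:
  assumes "z \<noteq> (0, 0)"
  shows "M z \<noteq> (0, 0)"
proof
  assume "M z = (0, 0)"
  then have 1: "snd z = - (cnj a * fst z)" and 2: "a * snd z + of_real b * fst z = 0"
    by (auto simp: M_def add_eq_0_iff2)
  have "(a * cnj a - of_real b) * fst z = - (a * snd z + of_real b * fst z)"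
    unfolding 1 by (simp add: algebra_simps)
  then have "(a * cnj a - of_real b) * fst z = 0"
    unfolding 2 by simp
  then have "fst z = 0"
    using det_nonzero by simp
  then show False
    using 1 assms by (cases z) simp
qed

section \<open>The closed curve and its parametrisation by lines\<close>

definition Ct :: "(P1 \<times> P1) set" where
  "Ct = {q. at_Q L q = 0}"

lemma Ct_iff: "(p, r) \<in> Ct \<longleftrightarrow> r = pt (M (hom p))"
proof -
  have "r = pt (M (hom p)) \<longleftrightarrow> pt (hom r) = pt (M (hom p))"
    by simp
  also have "\<dots> \<longleftrightarrow> L (hom p) (hom r) = 0"
    using M_nonzero[OF hom_nonzero, of p] hom_nonzero[of r]
    by (subst pt_eq_iff) (auto simp: L_def)
  finally show ?thesis
    by (simp add: Ct_def at_Q_def)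
qed

definition line :: "complex \<times> complex \<Rightarrow> complex \<times> complex \<Rightarrow> complex \<Rightarrow> complex \<times> complex" where
  "line v v' u = (fst v + u * fst v', snd v + u * snd v')"

text \<open>The parameter along the line from \<open>v\<close> in direction \<open>v'\<close> covers
  the curve except for the single point over \<open>pt v'\<close>. Choosing \<open>v'\<close>
  amounts to choosing which point to omit.\<close>

definition \<delta> :: "complex \<times> complex \<Rightarrow> complex \<times> complex \<Rightarrow> complex \<Rightarrow> P1 \<times> P1" where
  "\<delta> v v' u = (pt (line v v' u), pt (M (line v v' u)))"

definition det2 :: "complex \<times> complex \<Rightarrow> complex \<times> complex \<Rightarrow> complex" where
  "det2 z w = fst z * snd w - snd z * fst w"

lemma det2_line: "det2 v (line v v' u) = u * det2 v v'" "det2 (line v v' u) v' = det2 v v'"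
  by (simp_all add: det2_def line_def algebra_simps)

lemma line_nonzero: "det2 v v' \<noteq> 0 \<Longrightarrow> line v v' u \<noteq> (0, 0)"
  using det2_line(2)[of v v' u] by (auto simp: det2_def)

lemma \<delta>_at_Q:
  assumes "det2 v v' \<noteq> 0"
  obtains k where "k \<noteq> 0" "\<And>F. F \<in> BF d e \<Longrightarrow> F (line v v' u) (M (line v v' u)) = k * at_Q F (\<delta> v v' u)"
  using at_Q_pt[OF BF_zero line_nonzero[OF assms] M_nonzero[OF line_nonzero[OF assms]]]
  unfolding \<delta>_def by metis

lemma \<delta>_Ct:
  assumes "det2 v v' \<noteq> 0"
  shows "\<delta> v v' u \<in> Ct"
  using \<delta>_at_Q[OF assms, of 1 1 u] L_BF by (metis (mono_tags, lifting) Ct_def L_M mem_Collect_eq mult_eq_0_iff)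

lemma \<delta>_inj:
  assumes "det2 v v' \<noteq> 0"
  shows "inj (\<delta> v v')"
proof (rule injI)
  fix s u assume "\<delta> v v' s = \<delta> v v' u"
  then have "fst (line v v' s) * snd (line v v' u) = snd (line v v' s) * fst (line v v' u)"
    using pt_eq_iff[OF line_nonzero[OF assms] line_nonzero[OF assms]] by (simp add: \<delta>_def)
  then have "(u - s) * det2 v v' = 0"
    by (simp add: line_def det2_def algebra_simps)
  then show "s = u"
    using assms by simp
qed

lemma Ct_\<delta>:
  assumes "det2 v v' \<noteq> 0" "q \<in> Ct" "fst q \<noteq> pt v'"
  obtains u where "q = \<delta> v v' u"
proof -
  define h where "h = hom (fst q)"
  have "v' \<noteq> (0, 0)"
    using assms(1) by (auto simp: det2_def)
  then have h: "det2 h v' \<noteq> 0"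
    using assms(3) pt_eq_iff[OF hom_nonzero[of "fst q"], of v'] by (auto simp: det2_def h_def)
  \<comment> \<open>The solution of the linear equation \<open>det2 (line v v' u) h = 0\<close>,
    which says that the line point and \<open>h\<close> are proportional.\<close>
  define u where "u = det2 v h / det2 h v'"
  have "fst (line v v' u) * snd h = snd (line v v' u) * fst h"
    using h by (simp add: u_def line_def det2_def field_simps)
  then have "pt (line v v' u) = pt h"
    using pt_eq_iff[OF line_nonzero[OF assms(1)] hom_nonzero[of "fst q"]] unfolding h_def by blast
  then have fst: "pt (line v v' u) = fst q"
    by (simp add: h_def)
  have "\<delta> v v' u \<in> Ct"
    by (rule \<delta>_Ct[OF assms(1)])
  then have "q = \<delta> v v' u"
    using assms(2) fst Ct_iff unfolding \<delta>_def by (metis prod.collapse)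
  then show thesis
    by (rule that)
qed

lemma \<delta>_poly:
  assumes "det2 v v' \<noteq> 0" "F \<in> BF d e"
  obtains P where "\<And>u. F (line v v' u) (M (line v v' u)) = poly P u"
proof -
  have "polynomial_fun (\<lambda>u. F (line v v' u) (M (line v v' u)))"
    by (intro polynomial_fun_BF[OF assms(2)]; unfold line_def M_def fst_conv snd_conv;
      intro polynomial_fun_minus polynomial_fun_add polynomial_fun_mult polynomial_fun_const polynomial_fun_id)
  then show thesis
    unfolding polynomial_fun_def using that by blast
qed

lemma \<delta>_cont:
  assumes "det2 v v' \<noteq> 0" "openin zar_Q W" "\<delta> v v' t \<in> W"
  shows "\<forall>\<^sub>F u in cofinite. \<delta> v v' u \<in> W"
proof -
  obtain d e F where F: "F \<in> BF d e" "at_Q F (\<delta> v v' t) \<noteq> 0" "\<And>x. at_Q F x \<noteq> 0 \<Longrightarrow> x \<in> W"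
    using zar_Q_basis[OF assms(2,3)] by metis
  obtain P where P: "\<And>u. F (line v v' u) (M (line v v' u)) = poly P u"
    using \<delta>_poly[OF assms(1) F(1)] by metis
  have nz: "at_Q F (\<delta> v v' u) \<noteq> 0 \<longleftrightarrow> poly P u \<noteq> 0" for u
    using \<delta>_at_Q[OF assms(1), of d e u] F(1) P[of u] by (metis mult_eq_0_iff)
  have "P \<noteq> 0"
    using F(2) nz[of t] by auto
  then have "\<forall>\<^sub>F u in cofinite. poly P u \<noteq> 0"
    by (rule eventually_poly_nonzero)
  then show ?thesis
    by eventually_elim (use nz F(3) in blast)
qed

lemma \<delta>_pull:
  assumes d: "det2 v v' \<noteq> 0" and W: "openin zar_Q W" "g \<in> sections Q_space W" and t: "\<delta> v v' t \<in> W"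
  shows "g \<circ> \<delta> v v' \<in> reg_at t"
proof -
  obtain V d' e F G where V: "F \<in> BF d' e" "G \<in> BF d' e" "openin zar_Q V" "\<delta> v v' t \<in> V"
    "\<forall>x\<in>V. at_Q G x \<noteq> 0 \<and> g x = at_Q F x / at_Q G x"
    using W(2) t unfolding sections_Q_germ_iff[OF W(1)] by blast
  obtain P where P: "\<And>u. F (line v v' u) (M (line v v' u)) = poly P u"
    using \<delta>_poly[OF d V(1)] by metis
  obtain H where H: "\<And>u. G (line v v' u) (M (line v v' u)) = poly H u"
    using \<delta>_poly[OF d V(2)] by metis
  have eq: "poly H u \<noteq> 0 \<and> (g \<circ> \<delta> v v') u = poly P u / poly H u" if "\<delta> v v' u \<in> V" for u
  proof -
    obtain k where k: "k \<noteq> 0" "\<And>F. F \<in> BF d' e \<Longrightarrow> F (line v v' u) (M (line v v' u)) = k * at_Q F (\<delta> v v' u)"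
      using \<delta>_at_Q[OF d, of d' e u] by metis
    show ?thesis
      using V(5) that k(1) k(2)[OF V(1)] k(2)[OF V(2)] unfolding P H by simp
  qed
  have "\<forall>\<^sub>F u in cofinite. \<delta> v v' u \<in> V"
    by (rule \<delta>_cont[OF d V(3,4)])
  then have "\<forall>\<^sub>F u in cofinite. (g \<circ> \<delta> v v') u = poly P u / poly H u"
    by eventually_elim (use eq in blast)
  then show ?thesis
    using eq[OF V(4)] by (intro reg_atI[of H _ _ P]) auto
qed

text \<open>The zero set of \<open>L\<close> is closed and contains the affine curve. Conversely a
  parametrised line through any of its points stays in the affine part for almost all parameters, so
  that point lies in the closure.\<close>

lemma C_tilde_eq: "C_tilde a b = Ct"
proof
  let ?A = "{(Aff \<zeta>, Aff \<eta>) | \<zeta> \<eta>. \<zeta> * \<eta> + a * \<zeta> + cnj a * \<eta> + of_real b = 0}"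
  have A: "?A \<subseteq> Ct"
    by (auto simp: Ct_def at_Q_def L_Aff)
  have "UNIV - Ct = {q. at_Q L q \<noteq> 0}"
    by (auto simp: Ct_def)
  then have "closedin zar_Q Ct"
    using openin_at_Q[OF L_BF] by (simp add: closedin_def)
  then show "C_tilde a b \<subseteq> Ct"
    unfolding C_tilde_def using A by (rule closure_of_minimal[rotated])
  show "Ct \<subseteq> C_tilde a b"
  proof
    fix q assume q: "q \<in> Ct"
    define v where "v = hom (fst q)"
    \<comment> \<open>Any vector independent of \<open>v\<close> serves; parameter 0 then
      corresponds to \<open>q\<close>.\<close>
    define v' :: "complex \<times> complex" where "v' = (if fst v = 0 then (1, 0) else (0, 1))"
    have v: "v \<noteq> (0, 0)"
      by (simp add: v_def hom_nonzero)
    then have d: "det2 v v' \<noteq> 0"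
      by (cases v) (auto simp: det2_def v'_def)
    have "\<delta> v v' 0 = (fst q, pt (M (hom (fst q))))"
      by (simp add: \<delta>_def line_def v_def)
    then have q0: "\<delta> v v' 0 = q"
      using q Ct_iff by (metis prod.collapse)
    have "\<forall>\<^sub>F u in cofinite. fst (line v v' u) \<noteq> 0"
    proof -
      have "[:fst v, fst v':] \<noteq> 0"
        using v by (auto simp: v'_def)
      then have "\<forall>\<^sub>F u in cofinite. poly [:fst v, fst v':] u \<noteq> 0"
        by (rule eventually_poly_nonzero)
      then show ?thesis
        by (simp add: line_def)
    qed
    moreover have "\<forall>\<^sub>F u in cofinite. fst (M (line v v' u)) \<noteq> 0"
    proof -
      have "[:fst (M v), fst (M v'):] \<noteq> 0"
      proof
        assume "[:fst (M v), fst (M v'):] = 0"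
        then have "snd v = - (cnj a * fst v)" "snd v' = - (cnj a * fst v')"
          by (auto simp: M_def add_eq_0_iff2)
        then show False
          using d by (simp add: det2_def)
      qed
      then have "\<forall>\<^sub>F u in cofinite. poly [:fst (M v), fst (M v'):] u \<noteq> 0"
        by (rule eventually_poly_nonzero)
      then show ?thesis
        by eventually_elim (simp add: line_def M_def algebra_simps)
    qed
    ultimately have ev: "\<forall>\<^sub>F u in cofinite. \<delta> v v' u \<in> ?A"
    proof eventually_elim
      case (elim u)
      let ?z = "line v v' u"
      have "at_Q L (\<delta> v v' u) = 0"
        using \<delta>_Ct[OF d] by (simp add: Ct_def)
      moreover have "\<delta> v v' u = (Aff (snd ?z / fst ?z), Aff (snd (M ?z) / fst (M ?z)))"
        using elim by (simp add: \<delta>_def pt_def)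
      ultimately obtain \<zeta> \<eta> where "\<delta> v v' u = (Aff \<zeta>, Aff \<eta>)" "L (1, \<zeta>) (1, \<eta>) = 0"
        by (simp add: at_Q_def)
      then show ?case
        by (auto simp: L_Aff)
    qed
    show "q \<in> C_tilde a b"
      unfolding C_tilde_def in_closure_of
    proof (intro conjI allI impI)
      fix W assume W: "q \<in> W \<and> openin zar_Q W"
      have "\<forall>\<^sub>F u in cofinite. \<delta> v v' u \<in> W"
        using W q0 by (intro \<delta>_cont[OF d]) auto
      then have "\<forall>\<^sub>F u in cofinite. \<delta> v v' u \<in> ?A \<and> \<delta> v v' u \<in> W"
        using ev by eventually_elim simp
      then obtain u where "\<delta> v v' u \<in> ?A" "\<delta> v v' u \<in> W"
        by (rule eventually_cofinite_ex) blast
      then show "\<exists>y. y \<in> ?A \<and> y \<in> W"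
        by blast
    qed simp
  qed
qed

text \<open>The homogenisation of \<open>P\<close> to degree \<open>N\<close> in the linear forms
  \<open>det2 v z\<close> and \<open>det2 z v'\<close>, whose ratio on the line is the parameter.
  Division by \<open>det2 v v' ^ N\<close> normalises the second form to 1 there.\<close>

definition homog :: "complex \<times> complex \<Rightarrow> complex \<times> complex \<Rightarrow> nat \<Rightarrow> complex poly \<Rightarrow>
    complex \<times> complex \<Rightarrow> complex \<times> complex \<Rightarrow> complex" where
  "homog v v' N P z w = (\<Sum>i\<le>N. (coeff P i / det2 v v' ^ N) * (det2 v z ^ i * det2 z v' ^ (N - i)))"

lemma homog_BF: "homog v v' N P \<in> BF N 0"
proof -
  have "(\<lambda>z w. fst v * snd z + (- snd v) * fst z) \<in> BF 1 0" "(\<lambda>z w. snd v' * fst z + (- fst v') * snd z) \<in> BF 1 0"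
    by (intro BF_add BF_cmult BF_fst_z BF_snd_z)+
  then have 1: "(\<lambda>z w. det2 v z) \<in> BF 1 0" and 2: "(\<lambda>z w. det2 z v') \<in> BF 1 0"
    by (simp_all add: det2_def algebra_simps)
  have "(\<lambda>z w. det2 v z ^ i * det2 z v' ^ (N - i)) \<in> BF N 0" if "i \<le> N" for i
    using BF_mult[OF BF_power[OF 1, of i] BF_power[OF 2, of "N - i"]] that by simp
  then show ?thesis
    unfolding homog_def[abs_def] by (intro BF_sum BF_cmult) auto
qed

lemma homog_line:
  assumes "det2 v v' \<noteq> 0" "degree P \<le> N"
  shows "homog v v' N P (line v v' u) w = poly P u"
proof -
  have "poly P u = (\<Sum>i\<le>N. coeff P i * u ^ i)"
    unfolding poly_altdef using assms(2)
    by (intro sum.mono_neutral_left) (auto simp: coeff_eq_0)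
  moreover have "(coeff P i / det2 v v' ^ N) * ((u * det2 v v') ^ i * det2 v v' ^ (N - i)) = coeff P i * u ^ i"
    if "i \<le> N" for i
    using assms(1) that by (simp add: power_mult_distrib mult.assoc flip: power_add)
  ultimately show ?thesis
    unfolding homog_def det2_line by (auto intro: sum.cong)
qed

text \<open>A fraction in the parameter homogenises to a quotient of forms of bidegree
  \<open>(N, 0)\<close> in the first factor alone, and this quotient is the required extension to
  \<open>Q\<close>.\<close>

lemma param_curve_upstairs:
  assumes d: "det2 v v' \<noteq> 0" and T: "finite (- T)"
  shows "param_curve (sub Q_space (\<delta> v v' ` T)) T (\<delta> v v')"
proof (rule param_curve_subI)
  show "restricts Q_space"
    by (rule restricts_Q)
  show "finite (- T)"
    by (rule T)
  show "\<delta> v v' ` T \<subseteq> topspace (zar Q_space)"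
    by simp
  show "finite {t \<in> T. \<delta> v v' t = p}" for p
  proof -
    have "finite (\<delta> v v' -` {p})"
      by (rule finite_vimageI) (auto intro: \<delta>_inj[OF d])
    then show ?thesis
      by (rule rev_finite_subset) auto
  qed
  show "\<forall>\<^sub>F u in cofinite. \<delta> v v' u \<in> W" if "openin (zar Q_space) W" "\<delta> v v' t \<in> W" for W t
    using \<delta>_cont[OF d] that by simp
  show "closedin (zar Q_space) {p}" for p
    by (simp add: closedin_zar_Q_point)
  show "g \<circ> \<delta> v v' \<in> reg_at t" if "openin (zar Q_space) W" "g \<in> sections Q_space W" "\<delta> v v' t \<in> W" for W g t
    using \<delta>_pull[OF d] that by simp
  fix f t assume t: "t \<in> T" and f: "\<And>u. u \<in> T \<Longrightarrow> \<delta> v v' u = \<delta> v v' t \<Longrightarrow> f \<circ> \<delta> v v' \<in> reg_at u"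
  obtain P H where PH: "poly H t \<noteq> 0" "(f \<circ> \<delta> v v') t = poly P t / poly H t"
    "\<forall>\<^sub>F u in cofinite. poly H u \<noteq> 0 \<and> (f \<circ> \<delta> v v') u = poly P u / poly H u"
    using reg_atE[OF f[OF t refl]] .
  define N where "N = max (degree P) (degree H)"
  define F G where "F = homog v v' N P" and "G = homog v v' N H"
  have BF: "F \<in> BF N 0" "G \<in> BF N 0"
    by (simp_all add: F_def G_def homog_BF)
  have F: "F (line v v' u) w = poly P u" "G (line v v' u) w = poly H u" for u w
    by (simp_all add: F_def G_def N_def homog_line[OF d])
  have nz: "at_Q G (\<delta> v v' u) \<noteq> 0 \<longleftrightarrow> poly H u \<noteq> 0" for u
    using \<delta>_at_Q[OF d, of N 0 u] BF F by (metis mult_eq_0_iff)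
  have quot: "at_Q F (\<delta> v v' u) / at_Q G (\<delta> v v' u) = poly P u / poly H u" for u
  proof -
    obtain k where k: "k \<noteq> 0" "\<And>F. F \<in> BF N 0 \<Longrightarrow> F (line v v' u) (M (line v v' u)) = k * at_Q F (\<delta> v v' u)"
      using \<delta>_at_Q[OF d, of N 0 u] by metis
    show ?thesis
      using k(1) k(2)[OF BF(1)] k(2)[OF BF(2)] unfolding F by simp
  qed
  let ?W = "{q. at_Q G q \<noteq> 0}"
  show "\<exists>W g. openin (zar Q_space) W \<and> \<delta> v v' t \<in> W \<and> g \<in> sections Q_space W \<and> f (\<delta> v v' t) = g (\<delta> v v' t) \<and>
            (\<forall>\<^sub>F u in cofinite. u \<in> T \<longrightarrow> \<delta> v v' u \<in> W \<longrightarrow> f (\<delta> v v' u) = g (\<delta> v v' u))"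
  proof (intro exI[of _ ?W] exI[of _ "\<lambda>x. at_Q F x / at_Q G x"] conjI)
    show op: "openin (zar Q_space) ?W"
      using openin_at_Q[OF BF(2)] by simp
    show "\<delta> v v' t \<in> ?W"
      using nz PH(1) by simp
    show "(\<lambda>x. at_Q F x / at_Q G x) \<in> sections Q_space ?W"
      using op germs_Q_BF[OF BF] by (simp add: sections_Q_iff)
    show "f (\<delta> v v' t) = at_Q F (\<delta> v v' t) / at_Q G (\<delta> v v' t)"
      using PH(2) quot by simp
    show "\<forall>\<^sub>F u in cofinite. u \<in> T \<longrightarrow> \<delta> v v' u \<in> ?W \<longrightarrow>
      f (\<delta> v v' u) = at_Q F (\<delta> v v' u) / at_Q G (\<delta> v v' u)"
      using PH(3) by eventually_elim (simp add: quot)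
  qed
qed

section \<open>The curve downstairs away from its double points\<close>

text \<open>Composing with \<open>Phi n\<close> preserves closed points, finite fibres and
  pullbacks, since orbits are finite. What remains to be supplied in each chart is the extension of
  functions to the quotient.\<close>

lemma param_curve_quotI:
  assumes d: "det2 v v' \<noteq> 0" and T: "finite (- T)"
    and ext: "\<And>f t. t \<in> T \<Longrightarrow>
      (\<And>u. u \<in> T \<Longrightarrow> Phi n (\<delta> v v' u) = Phi n (\<delta> v v' t) \<Longrightarrow> f \<circ> (Phi n \<circ> \<delta> v v') \<in> reg_at u) \<Longrightarrow>
      \<exists>W g. openin (zar_quot n) W \<and> Phi n (\<delta> v v' t) \<in> W \<and> g \<in> sections (Q_quot n) W \<and>
            f (Phi n (\<delta> v v' t)) = g (Phi n (\<delta> v v' t)) \<and>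
            (\<forall>\<^sub>F u in cofinite. u \<in> T \<longrightarrow> Phi n (\<delta> v v' u) \<in> W \<longrightarrow>
               f (Phi n (\<delta> v v' u)) = g (Phi n (\<delta> v v' u)))"
  shows "param_curve (sub (Q_quot n) ((Phi n \<circ> \<delta> v v') ` T)) T (Phi n \<circ> \<delta> v v')"
proof (rule param_curve_subI)
  show "restricts (Q_quot n)"
    by (rule restricts_Q_quot)
  show "finite (- T)"
    by (rule T)
  show "(Phi n \<circ> \<delta> v v') ` T \<subseteq> topspace (zar (Q_quot n))"
    by (auto simp: topspace_zar_quot)
  show "finite {t \<in> T. (Phi n \<circ> \<delta> v v') t = p}" for p
  proof (cases "\<exists>q. p = Phi n q")
    case True
    then obtain q where p: "p = Phi n q" ..
    have "finite (\<delta> v v' -` Phi n q)"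
      using Phi_finite[OF n0] by (rule finite_vimageI) (rule \<delta>_inj[OF d])
    moreover have "{t \<in> T. (Phi n \<circ> \<delta> v v') t = p} \<subseteq> \<delta> v v' -` Phi n q"
    proof
      fix t assume "t \<in> {t \<in> T. (Phi n \<circ> \<delta> v v') t = p}"
      then have "Phi n (\<delta> v v' t) = Phi n q"
        by (simp add: p)
      then show "t \<in> \<delta> v v' -` Phi n q"
        using Phi_self[of "\<delta> v v' t" n] by simp
    qed
    ultimately show ?thesis
      by (rule rev_finite_subset)
  next
    case False
    then have "{t \<in> T. (Phi n \<circ> \<delta> v v') t = p} = {}"
      by (auto simp del: split_paired_Ex split_paired_All)
    then show ?thesis by (simp only: finite.emptyI)
  qed
  show "\<forall>\<^sub>F u in cofinite. (Phi n \<circ> \<delta> v v') u \<in> W"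
    if "openin (zar (Q_quot n)) W" "(Phi n \<circ> \<delta> v v') t \<in> W" for W t
    using \<delta>_cont[OF d, of "Phi n -` W" t] that by (simp add: openin_zar_quot)
  show "closedin (zar (Q_quot n)) {p}" if pT: "p \<in> (Phi n \<circ> \<delta> v v') ` T" for p
  proof -
    obtain t where "p = Phi n (\<delta> v v' t)"
      using pT by auto
    then show ?thesis
      using closedin_zar_quot_finite[OF n0, of "\<delta> v v' t"] by simp
  qed
  show "g \<circ> (Phi n \<circ> \<delta> v v') \<in> reg_at t"
    if "openin (zar (Q_quot n)) W" "g \<in> sections (Q_quot n) W" "(Phi n \<circ> \<delta> v v') t \<in> W" for W g t
    using \<delta>_pull[OF d, of "Phi n -` W" "g \<circ> Phi n" t] that
    by (simp add: openin_zar_quot sections_Q_quot o_assoc)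
  show "\<exists>W g. openin (zar (Q_quot n)) W \<and> (Phi n \<circ> \<delta> v v') t \<in> W \<and> g \<in> sections (Q_quot n) W \<and>
      f ((Phi n \<circ> \<delta> v v') t) = g ((Phi n \<circ> \<delta> v v') t) \<and>
      (\<forall>\<^sub>F u in cofinite. u \<in> T \<longrightarrow> (Phi n \<circ> \<delta> v v') u \<in> W \<longrightarrow>
        f ((Phi n \<circ> \<delta> v v') u) = g ((Phi n \<circ> \<delta> v v') u))"
    if "t \<in> T" "\<And>u. u \<in> T \<Longrightarrow> (Phi n \<circ> \<delta> v v') u = (Phi n \<circ> \<delta> v v') t \<Longrightarrow> f \<circ> (Phi n \<circ> \<delta> v v') \<in> reg_at u"
    for f t
    using ext[OF that(1), of f] that(2) by simp
qed

section \<open>Averaging forms over the group\<close>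

definition rotform :: "nat \<Rightarrow> (complex \<times> complex \<Rightarrow> complex \<times> complex \<Rightarrow> complex) \<Rightarrow>
    complex \<times> complex \<Rightarrow> complex \<times> complex \<Rightarrow> complex" where
  "rotform k F z w = F (fst z, root1 n ^ k * snd z) (fst w, inverse (root1 n ^ k) * snd w)"

text \<open>The Reynolds operator without the factor \<open>1 / n\<close>. That factor would cancel
  in the quotients of forms formed from it.\<close>

definition orbit_sum :: "(complex \<times> complex \<Rightarrow> complex \<times> complex \<Rightarrow> complex) \<Rightarrow>
    complex \<times> complex \<Rightarrow> complex \<times> complex \<Rightarrow> complex" where
  "orbit_sum F z w = (\<Sum>k<n. rotform k F z w)"

lemma rotform_BF: "F \<in> BF d e \<Longrightarrow> rotform k F \<in> BF d e"
  unfolding rotform_def[abs_def] by (rule BF_diagonal)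

lemma orbit_sum_BF: "F \<in> BF d e \<Longrightarrow> orbit_sum F \<in> BF d e"
  unfolding orbit_sum_def[abs_def] by (intro BF_sum rotform_BF)

lemma rotform_rotform: "rotform j (rotform k F) = rotform (j + k) F"
  by (simp add: rotform_def fun_eq_iff power_add mult_ac)

lemma rotform_mod: "rotform k F = rotform (k mod n) F"
  using root1_power_mod[OF n0, of k] by (simp add: rotform_def fun_eq_iff)

lemma rotform_orbit_sum: "rotform 1 (orbit_sum F) = orbit_sum F"
proof (intro ext)
  fix z w
  have "rotform j (orbit_sum F) z w = (\<Sum>k<n. rotform j (rotform k F) z w)" for j
    by (simp add: rotform_def[of j] orbit_sum_def)
  from this[of 1] have "rotform 1 (orbit_sum F) z w = (\<Sum>k<n. rotform 1 (rotform k F) z w)" .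
  also have "\<dots> = (\<Sum>k<n. rotform (Suc k) F z w)"
    by (simp add: rotform_rotform)
  also have "\<dots> = (\<Sum>k<n. rotform k F z w)"
  proof -
    have "rotform n F z w = rotform 0 F z w"
      using rotform_mod[of n] by simp
    then show ?thesis
      using sum.lessThan_Suc_shift[of "\<lambda>k. rotform k F z w" n] by (simp add: sum.lessThan_Suc)
  qed
  finally show "rotform 1 (orbit_sum F) z w = orbit_sum F z w"
    by (simp add: orbit_sum_def)
qed

text \<open>At infinity the rotation fixes the point but multiplies its representative
  \<open>(0, 1)\<close> by a scalar. The constant \<open>c\<close> accounts for this and is common
  to all forms of the bidegree.\<close>

lemma at_Q_rotform:
  obtains c where "c \<noteq> 0" "\<And>F. F \<in> BF d e \<Longrightarrow> at_Q (rotform k F) q = c * at_Q F (act (root1 n ^ k) q)"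
proof -
  obtain c where "c \<noteq> 0" "\<And>F. F \<in> BF d e \<Longrightarrow>
    F (fst (hom (fst q)), root1 n ^ k * snd (hom (fst q)))
      (fst (hom (snd q)), inverse (root1 n ^ k) * snd (hom (snd q))) = c * at_Q F (act (root1 n ^ k) q)"
    by (rule at_Q_act[of "root1 n ^ k" d e q]) simp_all
  then show thesis
    using that[of c] by (simp add: at_Q_def rotform_def)
qed

lemma Phi_invariantI:
  assumes "\<And>x. P x \<longleftrightarrow> P (act (root1 n) x)" "Phi n x = Phi n y"
  shows "P x \<longleftrightarrow> P y"
proof -
  have "P q \<longleftrightarrow> P (act (root1 n ^ k) q)" for q k
  proof (induction k)
    case (Suc k)
    then show ?case
      using assms(1)[of "act (root1 n ^ k) q"] by (simp add: act_act)
  qed simp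
  then show ?thesis
    using assms(2) Phi_eq_iff[OF n0] by metis
qed

text \<open>Invariance of a form gives equality along orbits only up to a scalar. Numerator and
  denominator share that scalar, so their quotient is invariant and descends.\<close>

lemma invariant_quotient:
  assumes F: "F \<in> BF d e" "rotform 1 F = F" and G: "G \<in> BF d e" "rotform 1 G = G"
  obtains g W where "openin (zar_quot n) W" "g \<in> sections (Q_quot n) W"
    "\<And>x. Phi n x \<in> W \<longleftrightarrow> at_Q G x \<noteq> 0" "\<And>x. g (Phi n x) = at_Q F x / at_Q G x"
proof -
  let ?W = "{x. at_Q G x \<noteq> 0}"
  have step: "at_Q G x \<noteq> 0 \<longleftrightarrow> at_Q G (act (root1 n) x) \<noteq> 0"
    "at_Q F x / at_Q G x = at_Q F (act (root1 n) x) / at_Q G (act (root1 n) x)" for x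
  proof -
    obtain c where c: "c \<noteq> 0" "\<And>F. F \<in> BF d e \<Longrightarrow> at_Q (rotform 1 F) x = c * at_Q F (act (root1 n ^ 1) x)"
      using at_Q_rotform by blast
    then have "at_Q F x = c * at_Q F (act (root1 n) x)" "at_Q G x = c * at_Q G (act (root1 n) x)"
      using c(2)[OF F(1)] c(2)[OF G(1)] unfolding F(2) G(2) by simp_all
    then show "at_Q G x \<noteq> 0 \<longleftrightarrow> at_Q G (act (root1 n) x) \<noteq> 0"
      "at_Q F x / at_Q G x = at_Q F (act (root1 n) x) / at_Q G (act (root1 n) x)"
      using c(1) by simp_all
  qed
  have inv: "at_Q G x \<noteq> 0 \<longleftrightarrow> at_Q G y \<noteq> 0" if "Phi n x = Phi n y" for x y
    by (rule Phi_invariantI[where P="\<lambda>x. at_Q G x \<noteq> 0", OF step(1) that])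
  have val: "at_Q F x / at_Q G x = at_Q F y / at_Q G y" if "Phi n x = Phi n y" for x y
    using Phi_invariantI[where P="\<lambda>z. at_Q F z / at_Q G z = at_Q F y / at_Q G y", OF _ that] step(2) by simp
  have "\<exists>g. openin (zar_quot n) (Phi n ` ?W) \<and> g \<in> sections (Q_quot n) (Phi n ` ?W) \<and>
    (\<forall>x. g (Phi n x) = at_Q F x / at_Q G x)"
  proof (rule quotient_section[where W="?W" and G="\<lambda>x. at_Q F x / at_Q G x"])
    show "openin zar_Q ?W"
      by (rule openin_at_Q[OF G(1)])
    show "y \<in> ?W" if "Phi n x = Phi n y" "x \<in> ?W" for x y
      using inv[OF that(1)] that(2) by simp
    show "at_Q F x / at_Q G x = at_Q F y / at_Q G y" if "Phi n x = Phi n y" for x y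
      by (rule val[OF that])
    show "(\<lambda>x. at_Q F x / at_Q G x) \<in> germs Q_space x" if "x \<in> ?W" for x
      using germs_Q_BF[OF F(1) G(1)] that by simp
  qed blast
  then obtain g where g: "openin (zar_quot n) (Phi n ` ?W)" "g \<in> sections (Q_quot n) (Phi n ` ?W)"
    "\<forall>x. g (Phi n x) = at_Q F x / at_Q G x"
    by blast
  have "Phi n x \<in> Phi n ` ?W \<longleftrightarrow> at_Q G x \<noteq> 0" for x
    using inv by (metis (mono_tags, lifting) imageE imageI mem_Collect_eq)
  then show thesis
    using that g by blast
qed

text \<open>The bump form vanishes on every translate of the curve other than the curve itself, so
  that averaging over the group does not disturb the restriction to the curve.\<close>

definition bump :: "complex \<times> complex \<Rightarrow> complex \<times> complex \<Rightarrow> complex" where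
  "bump z w = (\<Prod>k\<in>{1..<n}. rotform k L z w)"

lemma bump_BF: "bump \<in> BF (n - 1) (n - 1)"
  using BF_prod[of "{1..<n}" "\<lambda>k. rotform k L" 1 1] rotform_BF[OF L_BF] by (simp add: bump_def[abs_def])

text \<open>For \<open>0 < k < n\<close> the \<open>k\<close>-th translate of \<open>bump\<close>
  contains the factor with index \<open>k + (n - k) = n\<close>, which is \<open>L\<close> itself
  and vanishes on the curve. Only the term with \<open>k = 0\<close> survives.\<close>

lemma orbit_sum_bump: "orbit_sum (\<lambda>z w. bump z w * F z w) z (M z) = bump z (M z) * F z (M z)"
proof -
  have vanish: "rotform k bump z (M z) = 0" if "k \<in> {..<n} - {0}" for k
  proof -
    have eq: "rotform k bump z (M z) = (\<Prod>j\<in>{1..<n}. rotform (k + j) L z (M z))"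
      unfolding rotform_rotform[symmetric] by (simp add: rotform_def[of k] bump_def)
    have "rotform (k + (n - k)) L z (M z) = 0"
      using rotform_mod[of n L] that by (simp add: rotform_def)
    moreover have "n - k \<in> {1..<n}"
      using that by auto
    ultimately have "\<exists>j\<in>{1..<n}. rotform (k + j) L z (M z) = 0"
      by blast
    then have "(\<Prod>j\<in>{1..<n}. rotform (k + j) L z (M z)) = 0"
      by (intro prod_zero) simp_all
    with eq show ?thesis
      by simp
  qed
  have rot_mult: "rotform k (\<lambda>z w. bump z w * F z w) z (M z) = rotform k bump z (M z) * rotform k F z (M z)" for k
    by (simp add: rotform_def)
  have "rotform k (\<lambda>z w. bump z w * F z w) z (M z) = 0" if "k \<in> {..<n} - {0}" for k
    by (rule trans[OF rot_mult]) (simp only: vanish[OF that] mult_zero_left)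
  then have "(\<Sum>k\<in>{..<n} - {0}. rotform k (\<lambda>z w. bump z w * F z w) z (M z)) = 0"
    by (rule sum.neutral[OF ballI])
  then have "(\<Sum>k<n. rotform k (\<lambda>z w. bump z w * F z w) z (M z)) =
    rotform 0 (\<lambda>z w. bump z w * F z w) z (M z)"
    using sum.remove[of "{..<n}" 0 "\<lambda>k. rotform k (\<lambda>z w. bump z w * F z w) z (M z)"] n0 by simp
  then show ?thesis
    by (simp add: orbit_sum_def rotform_def)
qed

text \<open>By \<open>simple\<close>, no other translate of the curve passes through its points, so
  \<open>bump\<close> is non-zero there. The averages of \<open>bump\<close> times the homogenised
  numerator and denominator then restrict to the given fraction.\<close>

lemma param_curve_downstairs:
  assumes d: "det2 v v' \<noteq> 0" and T: "finite (- T)"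
    and simple: "\<And>u k. u \<in> T \<Longrightarrow> 0 < k \<Longrightarrow> k < n \<Longrightarrow> act (root1 n ^ k) (\<delta> v v' u) \<notin> Ct"
  shows "param_curve (sub (Q_quot n) ((Phi n \<circ> \<delta> v v') ` T)) T (Phi n \<circ> \<delta> v v')"
proof (rule param_curve_quotI[OF d T])
  fix f t assume t: "t \<in> T"
    and "\<And>u. u \<in> T \<Longrightarrow> Phi n (\<delta> v v' u) = Phi n (\<delta> v v' t) \<Longrightarrow> f \<circ> (Phi n \<circ> \<delta> v v') \<in> reg_at u"
  then have f: "f \<circ> (Phi n \<circ> \<delta> v v') \<in> reg_at t"
    by simp
  obtain P H where PH: "poly H t \<noteq> 0" "(f \<circ> (Phi n \<circ> \<delta> v v')) t = poly P t / poly H t"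
    "\<forall>\<^sub>F u in cofinite. poly H u \<noteq> 0 \<and> (f \<circ> (Phi n \<circ> \<delta> v v')) u = poly P u / poly H u"
    using reg_atE[OF f] .
  define N where "N = max (degree P) (degree H)"
  define F where "F = orbit_sum (\<lambda>z w. bump z w * homog v v' N P z w)"
  define G where "G = orbit_sum (\<lambda>z w. bump z w * homog v v' N H z w)"
  have F: "F \<in> BF (n - 1 + N) (n - 1)" "rotform 1 F = F"
    using orbit_sum_BF[OF BF_mult[OF bump_BF homog_BF]] rotform_orbit_sum by (simp_all add: F_def)
  have G: "G \<in> BF (n - 1 + N) (n - 1)" "rotform 1 G = G"
    using orbit_sum_BF[OF BF_mult[OF bump_BF homog_BF]] rotform_orbit_sum by (simp_all add: G_def)
  obtain W g where W: "openin (zar_quot n) W" "g \<in> sections (Q_quot n) W"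
    "\<And>x. Phi n x \<in> W \<longleftrightarrow> at_Q G x \<noteq> 0" and g: "\<And>x. g (Phi n x) = at_Q F x / at_Q G x"
    using invariant_quotient[OF F G] by metis
  let ?e = "\<lambda>u. bump (line v v' u) (M (line v v' u))"
  have FG: "F (line v v' u) (M (line v v' u)) = ?e u * poly P u"
    "G (line v v' u) (M (line v v' u)) = ?e u * poly H u" for u
    unfolding F_def G_def orbit_sum_bump by (simp_all add: homog_line[OF d] N_def)
  have val: "(at_Q G (\<delta> v v' u) \<noteq> 0 \<longleftrightarrow> ?e u \<noteq> 0 \<and> poly H u \<noteq> 0) \<and>
     (?e u \<noteq> 0 \<longrightarrow> g (Phi n (\<delta> v v' u)) = poly P u / poly H u)" for u
  proof -
    obtain k where k: "k \<noteq> 0" "\<And>F. F \<in> BF (n - 1 + N) (n - 1) \<Longrightarrow>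
        F (line v v' u) (M (line v v' u)) = k * at_Q F (\<delta> v v' u)"
      using \<delta>_at_Q[OF d, of "n - 1 + N" "n - 1" u] by metis
    have "at_Q F (\<delta> v v' u) = ?e u * poly P u / k" "at_Q G (\<delta> v v' u) = ?e u * poly H u / k"
      using k(1) k(2)[OF F(1)] k(2)[OF G(1)] FG[of u] by (simp_all add: field_simps)
    then show ?thesis
      using k(1) g by simp
  qed
  have et: "?e t \<noteq> 0"
  proof
    assume "?e t = 0"
    then obtain k where "k \<in> {1..<n}" and kL: "rotform k L (line v v' t) (M (line v v' t)) = 0"
      by (auto simp: bump_def)
    then have k: "0 < k" "k < n"
      by auto
    obtain c where "c \<noteq> 0" "rotform k L (line v v' t) (M (line v v' t)) = c * at_Q (rotform k L) (\<delta> v v' t)"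
      using \<delta>_at_Q[OF d, of 1 1 t] rotform_BF[OF L_BF] by metis
    then have "at_Q (rotform k L) (\<delta> v v' t) = 0"
      using kL by simp
    then have "at_Q L (act (root1 n ^ k) (\<delta> v v' t)) = 0"
      using at_Q_rotform[of 1 1 k "\<delta> v v' t"] L_BF by (metis mult_eq_0_iff)
    then show False
      using simple[OF t k(1,2)] by (simp add: Ct_def)
  qed
  show "\<exists>W g. openin (zar_quot n) W \<and> Phi n (\<delta> v v' t) \<in> W \<and> g \<in> sections (Q_quot n) W \<and>
            f (Phi n (\<delta> v v' t)) = g (Phi n (\<delta> v v' t)) \<and>
            (\<forall>\<^sub>F u in cofinite. u \<in> T \<longrightarrow> Phi n (\<delta> v v' u) \<in> W \<longrightarrow>
               f (Phi n (\<delta> v v' u)) = g (Phi n (\<delta> v v' u)))"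
  proof (intro exI[of _ W] exI[of _ g] conjI)
    show "Phi n (\<delta> v v' t) \<in> W"
      using W(3) val et PH(1) by blast
    show "f (Phi n (\<delta> v v' t)) = g (Phi n (\<delta> v v' t))"
      using val[of t] et PH(2) by simp
    show "\<forall>\<^sub>F u in cofinite. u \<in> T \<longrightarrow> Phi n (\<delta> v v' u) \<in> W \<longrightarrow>
               f (Phi n (\<delta> v v' u)) = g (Phi n (\<delta> v v' u))"
      using PH(3)
    proof eventually_elim
      case (elim u)
      then show ?case
        using val[of u] W(3) by simp
    qed
  qed (use W in auto)
qed

end

section \<open>Affine models\<close>

lemma polyfuns_diff: "F \<in> polyfuns N \<Longrightarrow> G \<in> polyfuns N \<Longrightarrow> (\<lambda>x. F x - G x) \<in> polyfuns N"
  using polyfuns.add[of F N "\<lambda>x. (-1) * G x"] polyfuns.mult[OF polyfuns.const[of "-1"]] by simp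

lemma polyfuns_poly: "F \<in> polyfuns N \<Longrightarrow> (\<lambda>x. poly P (F x)) \<in> polyfuns N"
proof (induction P)
  case 0
  then show ?case by (simp add: polyfuns.const)
next
  case (pCons c P)
  then show ?case
    using polyfuns.add[OF polyfuns.const[of c] polyfuns.mult[of F N "\<lambda>x. poly P (F x)"]] by simp
qed

lemma openin_polyfun: "F \<in> polyfuns N \<Longrightarrow> openin (zar_affine N) {x \<in> {..<N} \<rightarrow>\<^sub>E UNIV. F x \<noteq> 0}"
  unfolding zar_affine_def by (rule topology_generated_by_Basis) auto

lemma topspace_zar_affine [simp]: "topspace (zar_affine N) = {..<N} \<rightarrow>\<^sub>E UNIV"
proof
  show "topspace (zar_affine N) \<subseteq> {..<N} \<rightarrow>\<^sub>E UNIV"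
    unfolding zar_affine_def topology_generated_by_topspace by auto
  show "{..<N} \<rightarrow>\<^sub>E UNIV \<subseteq> topspace (zar_affine N)"
    using openin_subset[OF openin_polyfun[OF polyfuns.const[of 1 N]]] by simp
qed

lemma closedin_polyfun:
  assumes "F \<in> polyfuns N"
  shows "closedin (zar_affine N) {x \<in> {..<N} \<rightarrow>\<^sub>E UNIV. F x = 0}"
proof -
  have "topspace (zar_affine N) - {x \<in> {..<N} \<rightarrow>\<^sub>E UNIV. F x = 0} = {x \<in> {..<N} \<rightarrow>\<^sub>E UNIV. F x \<noteq> 0}"
    by auto
  then show ?thesis
    using openin_polyfun[OF assms] unfolding closedin_def by auto
qed

lemma zar_affine_basis:
  assumes "openin (zar_affine N) W" "q \<in> W"
  obtains F where "F \<in> polyfuns N" "F q \<noteq> 0" "\<And>x. x \<in> {..<N} \<rightarrow>\<^sub>E UNIV \<Longrightarrow> F x \<noteq> 0 \<Longrightarrow> x \<in> W"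
proof -
  have "generate_topology_on {{x \<in> {..<N} \<rightarrow>\<^sub>E UNIV. F x \<noteq> 0} | F. F \<in> polyfuns N} W"
    using assms(1) unfolding zar_affine_def by (simp add: openin_topology_generated_by_iff)
  then have "q \<in> W \<longrightarrow> (\<exists>F\<in>polyfuns N. F q \<noteq> 0 \<and> (\<forall>x. x \<in> {..<N} \<rightarrow>\<^sub>E UNIV \<longrightarrow> F x \<noteq> 0 \<longrightarrow> x \<in> W))"
  proof induction
    case (Int A B)
    show ?case
    proof
      assume "q \<in> A \<inter> B"
      then obtain F G where F: "F \<in> polyfuns N" "F q \<noteq> 0" "\<forall>x. x \<in> {..<N} \<rightarrow>\<^sub>E UNIV \<longrightarrow> F x \<noteq> 0 \<longrightarrow> x \<in> A"
        and G: "G \<in> polyfuns N" "G q \<noteq> 0" "\<forall>x. x \<in> {..<N} \<rightarrow>\<^sub>E UNIV \<longrightarrow> G x \<noteq> 0 \<longrightarrow> x \<in> B"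
        using Int.IH by blast
      then show "\<exists>F\<in>polyfuns N. F q \<noteq> 0 \<and> (\<forall>x. x \<in> {..<N} \<rightarrow>\<^sub>E UNIV \<longrightarrow> F x \<noteq> 0 \<longrightarrow> x \<in> A \<inter> B)"
        by (intro bexI[OF _ polyfuns.mult[OF F(1) G(1)]]) auto
    qed
  next
    case (UN K)
    show ?case
    proof
      assume "q \<in> \<Union> K"
      then obtain S where "S \<in> K" "q \<in> S"
        by blast
      then obtain F where "F \<in> polyfuns N" "F q \<noteq> 0" "\<forall>x. x \<in> {..<N} \<rightarrow>\<^sub>E UNIV \<longrightarrow> F x \<noteq> 0 \<longrightarrow> x \<in> S"
        using UN.IH by meson
      then show "\<exists>F\<in>polyfuns N. F q \<noteq> 0 \<and> (\<forall>x. x \<in> {..<N} \<rightarrow>\<^sub>E UNIV \<longrightarrow> F x \<noteq> 0 \<longrightarrow> x \<in> \<Union> K)"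
        using \<open>S \<in> K\<close> by (intro bexI[of _ F]) auto
    qed
  next
    case (Basis S)
    then obtain F where "F \<in> polyfuns N" "S = {x \<in> {..<N} \<rightarrow>\<^sub>E UNIV. F x \<noteq> 0}"
      by blast
    then show ?case
      by (intro impI bexI[of _ F]) auto
  qed auto
  then obtain F where "F \<in> polyfuns N" "F q \<noteq> 0" "\<forall>x. x \<in> {..<N} \<rightarrow>\<^sub>E UNIV \<longrightarrow> F x \<noteq> 0 \<longrightarrow> x \<in> W"
    using assms(2) by meson
  then show thesis
    by (intro that[of F]) simp_all
qed

lemma zar_affine_nspace [simp]: "zar (affine_nspace N) = zar_affine N"
  by (simp add: affine_nspace_def)

lemma sections_affine:
  "f \<in> sections (affine_nspace N) U \<longleftrightarrow>
    (\<forall>p\<in>U. \<exists>W F G. openin (zar_affine N) W \<and> p \<in> W \<and> W \<subseteq> U \<and>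
        F \<in> polyfuns N \<and> G \<in> polyfuns N \<and> (\<forall>x\<in>W. G x \<noteq> 0 \<and> f x = F x / G x))"
  by (simp add: affine_nspace_def)

lemma restricts_affine: "restricts (affine_nspace N)"
  unfolding restricts_def
proof (intro allI impI)
  fix W W' f
  assume A: "openin (zar (affine_nspace N)) W \<and> openin (zar (affine_nspace N)) W' \<and> W' \<subseteq> W \<and>
    f \<in> sections (affine_nspace N) W"
  show "f \<in> sections (affine_nspace N) W'"
    unfolding sections_affine
  proof
    fix p assume p: "p \<in> W'"
    with A have "p \<in> W" "f \<in> sections (affine_nspace N) W"
      by auto
    then obtain V F G where "openin (zar_affine N) V" "p \<in> V" "F \<in> polyfuns N" "G \<in> polyfuns N"
      "\<forall>x\<in>V. G x \<noteq> 0 \<and> f x = F x / G x"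
      unfolding sections_affine by meson
    with A p show "\<exists>W F G. openin (zar_affine N) W \<and> p \<in> W \<and> W \<subseteq> W' \<and>
        F \<in> polyfuns N \<and> G \<in> polyfuns N \<and> (\<forall>x\<in>W. G x \<noteq> 0 \<and> f x = F x / G x)"
      by (intro exI[of _ "V \<inter> W'"] exI[of _ F] exI[of _ G]) auto
  qed
qed

lemma closedin_zar_affine_point:
  assumes "p \<in> {..<N} \<rightarrow>\<^sub>E UNIV"
  shows "closedin (zar_affine N) {p}"
proof -
  have "openin (zar_affine N) (\<Union>i\<in>{..<N}. {x \<in> {..<N} \<rightarrow>\<^sub>E UNIV. x i - p i \<noteq> 0})"
    by (intro openin_Union) (auto intro!: openin_polyfun polyfuns_diff polyfuns.coord polyfuns.const simp del: right_minus_eq)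
  moreover have "(\<Union>i\<in>{..<N}. {x \<in> {..<N} \<rightarrow>\<^sub>E UNIV. x i - p i \<noteq> 0}) = topspace (zar_affine N) - {p}"
    using assms by (auto intro: PiE_ext)
  ultimately show ?thesis
    using assms by (simp add: closedin_def)
qed

lemma param_curve_affineI:
  assumes T: "finite (- T)" and mem: "\<And>t. t \<in> T \<Longrightarrow> \<delta> t \<in> {..<N} \<rightarrow>\<^sub>E UNIV"
    and reg: "\<And>i t. i < N \<Longrightarrow> t \<in> T \<Longrightarrow> (\<lambda>u. \<delta> u i) \<in> reg_at t"
    and fib: "\<And>p. finite {t \<in> T. \<delta> t = p}"
    and ext: "\<And>f t. t \<in> T \<Longrightarrow> (\<And>u. u \<in> T \<Longrightarrow> \<delta> u = \<delta> t \<Longrightarrow> f \<circ> \<delta> \<in> reg_at u) \<Longrightarrow>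
      \<exists>F\<in>polyfuns N. \<exists>G\<in>polyfuns N. G (\<delta> t) \<noteq> 0 \<and> f (\<delta> t) = F (\<delta> t) / G (\<delta> t) \<and>
        (\<forall>\<^sub>F u in cofinite. u \<in> T \<longrightarrow> G (\<delta> u) \<noteq> 0 \<longrightarrow> f (\<delta> u) = F (\<delta> u) / G (\<delta> u))"
  shows "param_curve (sub (affine_nspace N) (\<delta> ` T)) T \<delta>"
proof (rule param_curve_subI)
  have poly: "(\<lambda>u. F (\<delta> u)) \<in> reg_at t" if "F \<in> polyfuns N" "t \<in> T" for F t
    using that(1)
  proof induction
    case (coord i)
    then show ?case using reg that(2) by blast
  qed (auto intro: reg_at_const reg_at_add reg_at_mult)
  have evT: "\<forall>\<^sub>F u in cofinite. u \<in> T"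
    using T by (simp add: eventually_cofinite Compl_eq)
  have ev: "\<forall>\<^sub>F u in cofinite. F (\<delta> u) \<noteq> 0" if "F \<in> polyfuns N" "t \<in> T" "F (\<delta> t) \<noteq> 0" for F t
    using reg_at_zero_or_nonzero[OF poly[OF that(1,2)]] reg_at_eqI[OF poly[OF that(1,2)] reg_at_const[of 0]] that(3)
    by blast
  show cont: "\<forall>\<^sub>F u in cofinite. \<delta> u \<in> W" if W: "openin (zar (affine_nspace N)) W" "t \<in> T" "\<delta> t \<in> W" for W t
  proof -
    obtain F where F: "F \<in> polyfuns N" "F (\<delta> t) \<noteq> 0" "\<And>x. x \<in> {..<N} \<rightarrow>\<^sub>E UNIV \<Longrightarrow> F x \<noteq> 0 \<Longrightarrow> x \<in> W"
      using zar_affine_basis[of N W "\<delta> t"] W by auto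
    from ev[OF F(1) W(2) F(2)] evT show ?thesis
      by eventually_elim (use F(3) mem in blast)
  qed
  show "g \<circ> \<delta> \<in> reg_at t"
    if W: "openin (zar (affine_nspace N)) W" "g \<in> sections (affine_nspace N) W" "t \<in> T" "\<delta> t \<in> W" for W g t
  proof -
    obtain V F G where V: "openin (zar_affine N) V" "\<delta> t \<in> V" "F \<in> polyfuns N" "G \<in> polyfuns N"
      "\<forall>x\<in>V. G x \<noteq> 0 \<and> g x = F x / G x"
      using W(2,4) unfolding sections_affine by meson
    have r: "(\<lambda>u. F (\<delta> u) / G (\<delta> u)) \<in> reg_at t"
      using V W(3) by (intro reg_at_divide poly) auto
    have "\<forall>\<^sub>F u in cofinite. \<delta> u \<in> V"
      using cont V W(3) by simp
    then have "\<forall>\<^sub>F u in cofinite. (g \<circ> \<delta>) u = F (\<delta> u) / G (\<delta> u)"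
      by eventually_elim (use V(5) in simp)
    then show ?thesis
      using reg_at_cong[OF r] V by simp
  qed
  show "\<exists>W g. openin (zar (affine_nspace N)) W \<and> \<delta> t \<in> W \<and> g \<in> sections (affine_nspace N) W \<and> f (\<delta> t) = g (\<delta> t) \<and>
            (\<forall>\<^sub>F u in cofinite. u \<in> T \<longrightarrow> \<delta> u \<in> W \<longrightarrow> f (\<delta> u) = g (\<delta> u))"
    if t: "t \<in> T" and f: "\<And>u. u \<in> T \<Longrightarrow> \<delta> u = \<delta> t \<Longrightarrow> f \<circ> \<delta> \<in> reg_at u" for f t
  proof -
    obtain F G where FG: "F \<in> polyfuns N" "G \<in> polyfuns N" "G (\<delta> t) \<noteq> 0" "f (\<delta> t) = F (\<delta> t) / G (\<delta> t)"
      "\<forall>\<^sub>F u in cofinite. u \<in> T \<longrightarrow> G (\<delta> u) \<noteq> 0 \<longrightarrow> f (\<delta> u) = F (\<delta> u) / G (\<delta> u)"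
      using ext[OF t f] by blast
    let ?W = "{x \<in> {..<N} \<rightarrow>\<^sub>E UNIV. G x \<noteq> 0}"
    have "openin (zar_affine N) ?W"
      by (rule openin_polyfun[OF FG(2)])
    moreover from this have "(\<lambda>x. F x / G x) \<in> sections (affine_nspace N) ?W"
      unfolding sections_affine using FG(1,2) by (intro ballI exI[of _ ?W] exI[of _ F] exI[of _ G] conjI) simp_all
    moreover have "\<forall>\<^sub>F u in cofinite. u \<in> T \<longrightarrow> \<delta> u \<in> ?W \<longrightarrow> f (\<delta> u) = F (\<delta> u) / G (\<delta> u)"
      using FG(5) by eventually_elim simp
    ultimately show ?thesis
      using FG(3,4) mem[OF t] by (intro exI[of _ ?W] exI[of _ "\<lambda>x. F x / G x"]) simp
  qed
  show "\<delta> ` T \<subseteq> topspace (zar (affine_nspace N))"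
    using mem by auto
  show "closedin (zar (affine_nspace N)) {p}" if "p \<in> \<delta> ` T" for p
    using that mem closedin_zar_affine_point by auto
qed (use T fib restricts_affine in auto)

text \<open>The line minus finitely many points is the closed plane curve
  \<open>y * h(t) = 1\<close>, where \<open>h\<close> vanishes exactly at the omitted
  parameters.\<close>

lemma affine_variety_param_curve:
  assumes X: "param_curve X T \<gamma>" and inj: "inj_on \<gamma> T"
  shows "affine_variety X"
proof -
  have T: "finite (- T)"
    using X by (simp add: param_curve_def)
  define h where "h = (\<Prod>c\<in>- T. [:- c, 1:])"
  have h: "poly h t = 0 \<longleftrightarrow> t \<notin> T" for t
    using T by (auto simp: h_def poly_prod)
  define \<delta> where "\<delta> t = (\<lambda>i\<in>{..<2::nat}. if i = 0 then t else inverse (poly h t))" for t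
  have [simp]: "\<delta> t 0 = t" "\<delta> t (Suc 0) = inverse (poly h t)" for t
    by (simp_all add: \<delta>_def)
  have inj': "t = u" if "\<delta> t = \<delta> u" for t u
    using fun_cong[OF that, of 0] by simp
  have pc: "param_curve (sub (affine_nspace 2) (\<delta> ` T)) T \<delta>"
  proof (rule param_curve_affineI)
    show "\<delta> t \<in> {..<2} \<rightarrow>\<^sub>E UNIV" for t
      by (simp add: \<delta>_def)
    show "(\<lambda>u. \<delta> u i) \<in> reg_at t" if "i < 2" "t \<in> T" for i t
    proof (cases "i = 0")
      case True
      then show ?thesis by (simp add: reg_at_id)
    next
      case False
      then have "i = Suc 0" using that by simp
      then show ?thesis
        using h[of t] that by (simp add: reg_at_inverse reg_at_poly)
    qed
    show "finite {t \<in> T. \<delta> t = p}" for p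
    proof -
      have "{t \<in> T. \<delta> t = p} \<subseteq> {p 0}"
        by auto
      then show ?thesis
        by (rule finite_subset) simp
    qed
    fix f t assume t: "t \<in> T" and "\<And>u. u \<in> T \<Longrightarrow> \<delta> u = \<delta> t \<Longrightarrow> f \<circ> \<delta> \<in> reg_at u"
    then have "f \<circ> \<delta> \<in> reg_at t"
      by simp
    then obtain P H where PH: "poly H t \<noteq> 0" "(f \<circ> \<delta>) t = poly P t / poly H t"
      "\<forall>\<^sub>F u in cofinite. poly H u \<noteq> 0 \<and> (f \<circ> \<delta>) u = poly P u / poly H u"
      by (rule reg_atE)
    have "(\<lambda>x. poly P (x 0)) \<in> polyfuns 2" "(\<lambda>x. poly H (x 0)) \<in> polyfuns 2"
      by (intro polyfuns_poly polyfuns.coord; simp)+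
    moreover have "\<forall>\<^sub>F u in cofinite. u \<in> T \<longrightarrow> poly H (\<delta> u 0) \<noteq> 0 \<longrightarrow> f (\<delta> u) = poly P (\<delta> u 0) / poly H (\<delta> u 0)"
      using PH(3) by eventually_elim simp
    ultimately show "\<exists>F\<in>polyfuns 2. \<exists>G\<in>polyfuns 2. G (\<delta> t) \<noteq> 0 \<and> f (\<delta> t) = F (\<delta> t) / G (\<delta> t) \<and>
        (\<forall>\<^sub>F u in cofinite. u \<in> T \<longrightarrow> G (\<delta> u) \<noteq> 0 \<longrightarrow> f (\<delta> u) = F (\<delta> u) / G (\<delta> u))"
      using PH(1,2) by (intro bexI[of _ "\<lambda>x. poly P (x 0)"] bexI[of _ "\<lambda>x. poly H (x 0)"]) simp_all
  qed (rule T)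
  have "(\<lambda>x. x 1 * poly h (x 0) - 1) \<in> polyfuns 2"
    by (intro polyfuns_diff polyfuns.mult polyfuns_poly polyfuns.coord polyfuns.const) auto
  then have "closedin (zar_affine 2) {x \<in> {..<2} \<rightarrow>\<^sub>E UNIV. x 1 * poly h (x 0) - 1 = 0}"
    by (rule closedin_polyfun)
  moreover have "{x \<in> {..<2} \<rightarrow>\<^sub>E UNIV. x 1 * poly h (x 0) - 1 = 0} = \<delta> ` T"
  proof (intro set_eqI iffI)
    fix x :: "nat \<Rightarrow> complex" assume x: "x \<in> {x \<in> {..<2} \<rightarrow>\<^sub>E UNIV. x 1 * poly h (x 0) - 1 = 0}"
    then have eq: "x 1 * poly h (x 0) = 1"
      by simp
    then have nz: "poly h (x 0) \<noteq> 0"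
      by (metis mult_zero_right zero_neq_one)
    have "x 1 = inverse (poly h (x 0))"
      using nz eq by (simp add: field_simps)
    then have "x = \<delta> (x 0)"
      using x by (intro PiE_ext[of x "{..<2}" "\<lambda>_. UNIV"]) (auto simp: \<delta>_def less_2_cases_iff)
    then show "x \<in> \<delta> ` T"
      using nz h by (intro image_eqI[of x \<delta> "x 0"]) auto
  next
    fix x assume "x \<in> \<delta> ` T"
    then obtain t where t: "t \<in> T" "x = \<delta> t"
      by blast
    then have "poly h t \<noteq> 0"
      using h by blast
    then have "x 1 * poly h (x 0) - 1 = 0"
      unfolding t(2) by simp
    moreover have "x \<in> {..<2} \<rightarrow>\<^sub>E UNIV"
      unfolding t(2) by (simp add: \<delta>_def)
    ultimately show "x \<in> {x \<in> {..<2} \<rightarrow>\<^sub>E UNIV. x 1 * poly h (x 0) - 1 = 0}"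
      by blast
  qed
  ultimately have "closedin (zar_affine 2) (\<delta> ` T)"
    by simp
  moreover have "\<exists>\<phi>. isomorphism X (sub (affine_nspace 2) (\<delta> ` T)) \<phi>"
    using inj inj' by (intro param_curve_isomorphism_inverse[OF X pc]) (auto simp: inj_on_def)
  ultimately show ?thesis
    unfolding affine_variety_def by blast
qed

section \<open>Ordinary nodes are singular points\<close>

text \<open>Germs are total functions, so closure under \<open>germ_eq\<close> has to be recorded
  next to the ring operations.\<close>

definition ring_at :: "'a fspace \<Rightarrow> 'a \<Rightarrow> bool" where
  "ring_at S p \<longleftrightarrow> p \<in> topspace (zar S) \<and> (\<forall>c. (\<lambda>x. c) \<in> germs S p) \<and>
     (\<forall>f\<in>germs S p. \<forall>g\<in>germs S p. (\<lambda>x. f x + g x) \<in> germs S p \<and> (\<lambda>x. f x * g x) \<in> germs S p) \<and>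
     (\<forall>f\<in>germs S p. \<forall>g. germ_eq S p f g \<longrightarrow> g \<in> germs S p)"

lemma germ_eq_refl: "germ_eq S p f f"
  by (simp add: germ_eq_def)

lemma germ_eq_sym: "germ_eq S p f g \<Longrightarrow> germ_eq S p g f"
  by (simp add: germ_eq_def eq_commute)

lemma germ_eq_trans: "germ_eq S p f g \<Longrightarrow> germ_eq S p g h \<Longrightarrow> germ_eq S p f h"
  unfolding germ_eq_def by (erule (1) eventually_elim2) simp

lemma sum_lessThan_add: "(\<Sum>i<r + r'. h i) = (\<Sum>i<r. h i) + (\<Sum>i<r'. h (r + i))"
  for h :: "nat \<Rightarrow> complex"
  by (induction r') (simp_all add: add.assoc)

context
  fixes S :: "'a fspace" and p :: 'a
  assumes ring: "ring_at S p"
begin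

lemma ring_at_const: "(\<lambda>x. c) \<in> germs S p"
  using ring by (simp add: ring_at_def)

lemma ring_at_add: "f \<in> germs S p \<Longrightarrow> g \<in> germs S p \<Longrightarrow> (\<lambda>x. f x + g x) \<in> germs S p"
  using ring by (simp add: ring_at_def)

lemma ring_at_mult: "f \<in> germs S p \<Longrightarrow> g \<in> germs S p \<Longrightarrow> (\<lambda>x. f x * g x) \<in> germs S p"
  using ring by (simp add: ring_at_def)

lemma ring_at_diff: "f \<in> germs S p \<Longrightarrow> g \<in> germs S p \<Longrightarrow> (\<lambda>x. f x - g x) \<in> germs S p"
  using ring_at_add[OF _ ring_at_mult[OF ring_at_const[of "-1"]], of f g] by simp

lemma ring_at_sum: "(\<And>i. i \<in> I \<Longrightarrow> f i \<in> germs S p) \<Longrightarrow> (\<lambda>x. \<Sum>i\<in>I. f i x) \<in> germs S p"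
  by (induction I rule: infinite_finite_induct) (auto intro: ring_at_add ring_at_const)

lemma ring_at_prod: "(\<And>i. i \<in> I \<Longrightarrow> f i \<in> germs S p) \<Longrightarrow> (\<lambda>x. \<Prod>i\<in>I. f i x) \<in> germs S p"
  by (induction I rule: infinite_finite_induct) (auto intro: ring_at_mult ring_at_const)

lemma ring_at_cong: "f \<in> germs S p \<Longrightarrow> germ_eq S p f g \<Longrightarrow> g \<in> germs S p"
  using ring by (auto simp: ring_at_def)

lemma ring_at_top: "p \<in> topspace (zar S)"
  using ring by (simp add: ring_at_def)

lemma max_ideal_powerI:
  assumes "\<And>i. i < r \<Longrightarrow> c i \<in> germs S p" "\<And>i j. i < r \<Longrightarrow> j < k \<Longrightarrow> g i j \<in> max_ideal S p"
    and eq: "germ_eq S p f (\<lambda>x. \<Sum>i<(r::nat). c i x * (\<Prod>j<k. g i j x))"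
  shows "f \<in> max_ideal_power S p k"
proof -
  have "(\<lambda>x. \<Sum>i<(r::nat). c i x * (\<Prod>j<k. g i j x)) \<in> germs S p"
    using assms(1,2) by (intro ring_at_sum ring_at_mult ring_at_prod) (auto simp: max_ideal_def)
  then have "f \<in> germs S p"
    using ring_at_cong germ_eq_sym[OF eq] by blast
  then show ?thesis
    unfolding max_ideal_power_def using assms by blast
qed

lemma max_ideal_power_add:
  assumes "f \<in> max_ideal_power S p k" "f' \<in> max_ideal_power S p k"
  shows "(\<lambda>x. f x + f' x) \<in> max_ideal_power S p k"
proof -
  obtain r c g where 1: "\<And>i. i < r \<Longrightarrow> c i \<in> germs S p"
    "\<And>i j. i < r \<Longrightarrow> j < k \<Longrightarrow> g i j \<in> max_ideal S p"
    "germ_eq S p f (\<lambda>x. \<Sum>i<(r::nat). c i x * (\<Prod>j<k. g i j x))"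
    using max_ideal_powerE[OF assms(1)] by blast
  obtain r' c' g' where 2: "\<And>i. i < r' \<Longrightarrow> c' i \<in> germs S p"
    "\<And>i j. i < r' \<Longrightarrow> j < k \<Longrightarrow> g' i j \<in> max_ideal S p"
    "germ_eq S p f' (\<lambda>x. \<Sum>i<(r'::nat). c' i x * (\<Prod>j<k. g' i j x))"
    using max_ideal_powerE[OF assms(2)] by blast
  define C where "C i = (if i < r then c i else c' (i - r))" for i
  define G where "G i = (if i < r then g i else g' (i - r))" for i
  have split: "(\<Sum>i<r + r'. C i x * (\<Prod>j<k. G i j x)) =
    (\<Sum>i<r. c i x * (\<Prod>j<k. g i j x)) + (\<Sum>i<r'. c' i x * (\<Prod>j<k. g' i j x))" for x
    unfolding sum_lessThan_add by (simp add: C_def G_def)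
  have eq: "germ_eq S p (\<lambda>x. f x + f' x) (\<lambda>x. \<Sum>i<r + r'. C i x * (\<Prod>j<k. G i j x))"
    using 1(3) 2(3) unfolding germ_eq_def split by eventually_elim simp
  have C: "C i \<in> germs S p" if "i < r + r'" for i
    using that 1(1) 2(1) by (simp add: C_def)
  have G: "G i j \<in> max_ideal S p" if "i < r + r'" "j < k" for i j
    using that 1(2) 2(2) by (simp add: G_def)
  show ?thesis
    by (rule max_ideal_powerI[OF C G eq])
qed

lemma max_ideal_power_mult:
  assumes "h \<in> germs S p" "f \<in> max_ideal_power S p k"
  shows "(\<lambda>x. h x * f x) \<in> max_ideal_power S p k"
proof -
  obtain r c g where 1: "\<And>i. i < r \<Longrightarrow> c i \<in> germs S p"
    "\<And>i j. i < r \<Longrightarrow> j < k \<Longrightarrow> g i j \<in> max_ideal S p"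
    "germ_eq S p f (\<lambda>x. \<Sum>i<(r::nat). c i x * (\<Prod>j<k. g i j x))"
    using max_ideal_powerE[OF assms(2)] by blast
  have C: "(\<lambda>x. h x * c i x) \<in> germs S p" if "i < r" for i
    using ring_at_mult[OF assms(1) 1(1)[OF that]] .
  have eq: "germ_eq S p (\<lambda>x. h x * f x) (\<lambda>x. \<Sum>i<r. (h x * c i x) * (\<Prod>j<k. g i j x))"
    using 1(3) unfolding germ_eq_def by eventually_elim (simp add: sum_distrib_left mult.assoc)
  show ?thesis
    by (rule max_ideal_powerI[OF C 1(2) eq])
qed

lemma max_ideal_power_cong:
  assumes "f \<in> max_ideal_power S p k" "germ_eq S p f f'"
  shows "f' \<in> max_ideal_power S p k"
proof -
  obtain r c g where 1: "\<And>i. i < r \<Longrightarrow> c i \<in> germs S p"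
    "\<And>i j. i < r \<Longrightarrow> j < k \<Longrightarrow> g i j \<in> max_ideal S p"
    "germ_eq S p f (\<lambda>x. \<Sum>i<(r::nat). c i x * (\<Prod>j<k. g i j x))"
    using max_ideal_powerE[OF assms(1)] by blast
  show ?thesis
    by (rule max_ideal_powerI[OF 1(1,2) germ_eq_trans[OF germ_eq_sym[OF assms(2)] 1(3)]])
qed

lemma max_ideal_power_Suc:
  assumes "f \<in> max_ideal_power S p (Suc k)"
  shows "f \<in> max_ideal_power S p k"
proof -
  obtain r c g where 1: "\<And>i. i < r \<Longrightarrow> c i \<in> germs S p"
    "\<And>i j. i < r \<Longrightarrow> j < Suc k \<Longrightarrow> g i j \<in> max_ideal S p"
    "germ_eq S p f (\<lambda>x. \<Sum>i<(r::nat). c i x * (\<Prod>j<Suc k. g i j x))"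
    using max_ideal_powerE[OF assms] by blast
  have C: "(\<lambda>x. c i x * g i k x) \<in> germs S p" if "i < r" for i
    using 1(1)[OF that] 1(2)[OF that, of k] by (intro ring_at_mult) (auto simp: max_ideal_def)
  have G: "g i j \<in> max_ideal S p" if "i < r" "j < k" for i j
    using 1(2) that by simp
  have eq: "germ_eq S p f (\<lambda>x. \<Sum>i<r. (c i x * g i k x) * (\<Prod>j<k. g i j x))"
    using 1(3) by (simp add: prod.lessThan_Suc mult_ac)
  show ?thesis
    by (rule max_ideal_powerI[OF C G eq])
qed

lemma max_ideal_power_cmult:
  "f \<in> max_ideal_power S p k \<Longrightarrow> (\<lambda>x. c * f x) \<in> max_ideal_power S p k"
  by (rule max_ideal_power_mult[OF ring_at_const])

lemma max_ideal_power_prod: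
  assumes "\<And>j. j < k \<Longrightarrow> g j \<in> max_ideal S p"
  shows "(\<lambda>x. \<Prod>j<k. g j x) \<in> max_ideal_power S p k"
  by (rule max_ideal_powerI[where r=1 and c="\<lambda>_ _. 1" and g="\<lambda>_. g"])
    (use assms ring_at_const in \<open>auto simp: germ_eq_refl\<close>)

lemma max_ideal_power_2:
  assumes "g \<in> max_ideal S p" "h \<in> max_ideal S p"
  shows "(\<lambda>x. g x * h x) \<in> max_ideal_power S p 2"
  using max_ideal_power_prod[of 2 "\<lambda>j. if j = 0 then g else h"] assms
  by (simp add: numeral_2_eq_2)

lemma max_ideal_power_3:
  assumes "f \<in> max_ideal S p" "g \<in> max_ideal S p" "h \<in> max_ideal S p"
  shows "(\<lambda>x. f x * g x * h x) \<in> max_ideal_power S p 3"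
  using max_ideal_power_prod[of 3 "\<lambda>j. if j = 0 then f else if j = 1 then g else h"] assms
  by (simp add: numeral_3_eq_3)

lemma max_ideal_lin:
  assumes "g \<in> max_ideal S p" "h \<in> max_ideal S p"
  shows "(\<lambda>x. \<alpha> * g x + \<beta> * h x) \<in> max_ideal S p"
  using assms by (auto simp: max_ideal_def intro!: ring_at_add ring_at_mult ring_at_const)

section \<open>Comparing local rings of the surface with those of the curve\<close>

lemma germ_sub_lift:
  assumes "f \<in> germs (sub S D) p" "p \<in> D"
  obtains g where "g \<in> germs S p" "g p = f p" "\<forall>\<^sub>F q in nhdsin (zar S) p. q \<in> D \<longrightarrow> f q = g q"
proof -
  obtain U where U: "openin (zar (sub S D)) U" "p \<in> U" "f \<in> sections (sub S D) U"
    using assms(1) unfolding germs_def by blast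
  obtain V where V: "openin (zar S) V" "U = V \<inter> D"
    using U(1) unfolding openin_sub by blast
  obtain W g where W: "openin (zar S) W" "p \<in> W" "g \<in> sections S W" "\<forall>q\<in>W \<inter> U. f q = g q"
    using U(2,3) unfolding sections_sub by blast
  have "g \<in> germs S p"
    using W unfolding germs_def by blast
  moreover have "\<forall>\<^sub>F q in nhdsin (zar S) p. q \<in> D \<longrightarrow> f q = g q"
    unfolding eventually_nhdsin using V W U(2) by (intro disjI2 exI[of _ "W \<inter> V"]) auto
  ultimately show thesis
    using that W(2,4) U(2) by auto
qed

lemma germ_sub_restrict:
  assumes "g \<in> germs S p" "p \<in> D"
  shows "g \<in> germs (sub S D) p"
proof -
  obtain W where W: "openin (zar S) W" "p \<in> W" "g \<in> sections S W"
    using assms unfolding germs_def by blast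
  then have "openin (zar (sub S D)) (W \<inter> D)" "g \<in> sections (sub S D) (W \<inter> D)"
    unfolding openin_sub sections_sub by blast+
  then show ?thesis
    using W assms(2) unfolding germs_def by blast
qed

lemma germ_eq_sub:
  assumes "p \<in> D"
  shows "germ_eq (sub S D) p f g \<longleftrightarrow> (\<forall>\<^sub>F q in nhdsin (zar S) p. q \<in> D \<longrightarrow> f q = g q)"
proof -
  have "(\<exists>W. openin (zar (sub S D)) W \<and> p \<in> W \<and> (\<forall>x\<in>W. f x = g x)) \<longleftrightarrow>
        (\<exists>W. openin (zar S) W \<and> p \<in> W \<and> (\<forall>x\<in>W. x \<in> D \<longrightarrow> f x = g x))"
    using assms unfolding openin_sub by (metis IntE IntI)
  then show ?thesis
    using ring_at_top assms unfolding germ_eq_def eventually_nhdsin by simp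
qed

lemma max_ideal_power_sub_lift:
  assumes "F \<in> max_ideal_power (sub S D) p k" "p \<in> D"
  obtains E where "E \<in> max_ideal_power S p k" "\<forall>\<^sub>F q in nhdsin (zar S) p. q \<in> D \<longrightarrow> F q = E q"
proof -
  obtain r c g where 1: "\<And>i. i < r \<Longrightarrow> c i \<in> germs (sub S D) p"
    "\<And>i j. i < r \<Longrightarrow> j < k \<Longrightarrow> g i j \<in> max_ideal (sub S D) p"
    "germ_eq (sub S D) p F (\<lambda>x. \<Sum>i<(r::nat). c i x * (\<Prod>j<k. g i j x))"
    using max_ideal_powerE[OF assms(1)] by blast
  have "\<exists>C. C \<in> germs S p \<and> (\<forall>\<^sub>F q in nhdsin (zar S) p. q \<in> D \<longrightarrow> c i q = C q)" if i: "i < r" for i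
    using germ_sub_lift[OF 1(1)[OF i] assms(2)] by blast
  then obtain C where C: "\<And>i. i < r \<Longrightarrow> C i \<in> germs S p"
    "\<And>i. i < r \<Longrightarrow> \<forall>\<^sub>F q in nhdsin (zar S) p. q \<in> D \<longrightarrow> c i q = C i q"
    by metis
  have "\<exists>G. G \<in> max_ideal S p \<and> (\<forall>\<^sub>F q in nhdsin (zar S) p. q \<in> D \<longrightarrow> g i j q = G q)"
    if ij: "i < r" "j < k" for i j
  proof -
    have gij: "g i j \<in> germs (sub S D) p" "g i j p = 0"
      using 1(2)[OF ij] by (auto simp: max_ideal_def)
    obtain G where "G \<in> germs S p" "G p = g i j p" "\<forall>\<^sub>F q in nhdsin (zar S) p. q \<in> D \<longrightarrow> g i j q = G q"
      using germ_sub_lift[OF gij(1) assms(2)] .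
    then show ?thesis
      using gij(2) by (intro exI[of _ G]) (simp add: max_ideal_def)
  qed
  then obtain G where G: "\<And>i j. i < r \<Longrightarrow> j < k \<Longrightarrow> G i j \<in> max_ideal S p"
    "\<And>i j. i < r \<Longrightarrow> j < k \<Longrightarrow> \<forall>\<^sub>F q in nhdsin (zar S) p. q \<in> D \<longrightarrow> g i j q = G i j q"
    by metis
  show thesis
  proof (rule that)
    show "(\<lambda>x. \<Sum>i<r. C i x * (\<Prod>j<k. G i j x)) \<in> max_ideal_power S p k"
      by (rule max_ideal_powerI[OF C(1) G(1) germ_eq_refl])
    have "\<forall>\<^sub>F q in nhdsin (zar S) p. \<forall>i\<in>{..<r}. q \<in> D \<longrightarrow> c i q = C i q"
      using C(2) by (intro eventually_ball_finite) auto
    moreover have "\<forall>\<^sub>F q in nhdsin (zar S) p. \<forall>i\<in>{..<r}. \<forall>j\<in>{..<k}. q \<in> D \<longrightarrow> g i j q = G i j q"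
      using G(2) by (intro eventually_ball_finite ballI) auto
    moreover have "\<forall>\<^sub>F q in nhdsin (zar S) p. q \<in> D \<longrightarrow> F q = (\<Sum>i<r. c i q * (\<Prod>j<k. g i j q))"
      using 1(3) unfolding germ_eq_sub[OF assms(2)] .
    ultimately show "\<forall>\<^sub>F q in nhdsin (zar S) p. q \<in> D \<longrightarrow> F q = (\<Sum>i<r. C i q * (\<Prod>j<k. G i j q))"
      by eventually_elim simp
  qed
qed

text \<open>If the curve had a one-dimensional cotangent space, some non-trivial combination of the
  two tangent coordinates would lie in the square of the maximal ideal plus the ideal of the curve.
  The equation \<open>f\<close> has multiplicity two, so this combination would lie in the square
  itself, contradicting independence on the surface.\<close>

lemma ordinary_node_not_simple:
  assumes node: "ordinary_node S D p"
  shows "\<not> cotangent_basis (sub S D) p 1 s"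
proof
  assume s: "cotangent_basis (sub S D) p 1 s"
  obtain t f where pD: "p \<in> D" and t: "cotangent_basis S p 2 t" and f: "f \<in> germs S p"
    and ideal: "\<And>g. g \<in> germs S p \<Longrightarrow> (\<forall>\<^sub>F q in nhdsin (zar S) p. q \<in> D \<longrightarrow> g q = 0) \<longleftrightarrow>
                        (\<exists>h\<in>germs S p. germ_eq S p g (\<lambda>q. h q * f q))"
    and lead: "(\<lambda>q. f q - t 0 q * t 1 q) \<in> max_ideal_power S p 3"
    using node unfolding ordinary_node_def by blast
  have t01: "t 0 \<in> max_ideal S p" "t 1 \<in> max_ideal S p"
    using t by (auto simp: cotangent_basis_def)
  have "(\<lambda>q. f q - t 0 q * t 1 q) \<in> max_ideal_power S p 2"
    using lead max_ideal_power_Suc[of _ 2] by simp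
  from max_ideal_power_add[OF this max_ideal_power_2[OF t01]] have f2: "f \<in> max_ideal_power S p 2"
    by simp
  have ex: "\<exists>c E. E \<in> max_ideal_power S p 2 \<and> (\<forall>\<^sub>F q in nhdsin (zar S) p. q \<in> D \<longrightarrow> u q - c * s 0 q = E q)"
    if u: "u \<in> max_ideal S p" for u
  proof -
    have "u \<in> max_ideal (sub S D) p"
      using u germ_sub_restrict[OF _ pD] by (auto simp: max_ideal_def)
    then obtain c :: "nat \<Rightarrow> complex" where "(\<lambda>x. u x - (\<Sum>i<1. c i * s i x)) \<in> max_ideal_power (sub S D) p 2"
      using s unfolding cotangent_basis_def by meson
    then have "(\<lambda>x. u x - c 0 * s 0 x) \<in> max_ideal_power (sub S D) p 2"
      by simp
    then show ?thesis
      using max_ideal_power_sub_lift[OF _ pD] by metis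
  qed
  obtain c0 E0 where E0: "E0 \<in> max_ideal_power S p 2"
    "\<forall>\<^sub>F q in nhdsin (zar S) p. q \<in> D \<longrightarrow> t 0 q - c0 * s 0 q = E0 q"
    using ex[OF t01(1)] by blast
  obtain c1 E1 where E1: "E1 \<in> max_ideal_power S p 2"
    "\<forall>\<^sub>F q in nhdsin (zar S) p. q \<in> D \<longrightarrow> t 1 q - c1 * s 0 q = E1 q"
    using ex[OF t01(2)] by blast
  \<comment> \<open>A non-trivial relation between the two coefficients of \<open>s 0\<close>,
    chosen so that \<open>s 0\<close> cancels in the combination \<open>u\<close>.\<close>
  obtain \<alpha> \<beta> where ab: "\<alpha> * c0 + \<beta> * c1 = 0" "\<alpha> \<noteq> 0 \<or> \<beta> \<noteq> 0"
  proof (cases "c0 = 0 \<and> c1 = 0")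
    case True
    then show ?thesis using that[of 1 0] by simp
  next
    case False
    then show ?thesis using that[of c1 "- c0"] by auto
  qed
  define u where "u q = \<alpha> * t 0 q + \<beta> * t 1 q" for q
  have u: "u \<in> max_ideal S p"
    unfolding u_def by (rule max_ideal_lin[OF t01])
  have E2: "(\<lambda>x. \<alpha> * E0 x + \<beta> * E1 x) \<in> max_ideal_power S p 2"
    by (intro max_ideal_power_add max_ideal_power_cmult E0 E1)
  have "\<forall>\<^sub>F q in nhdsin (zar S) p. q \<in> D \<longrightarrow> u q - (\<alpha> * E0 q + \<beta> * E1 q) = 0"
    using E0(2) E1(2)
  proof eventually_elim
    case (elim q)
    have "u q - (\<alpha> * (t 0 q - c0 * s 0 q) + \<beta> * (t 1 q - c1 * s 0 q)) = (\<alpha> * c0 + \<beta> * c1) * s 0 q"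
      by (simp add: u_def algebra_simps)
    then show ?case
      using elim ab(1) by auto
  qed
  moreover have "(\<lambda>q. u q - (\<alpha> * E0 q + \<beta> * E1 q)) \<in> germs S p"
    using u E2 by (intro ring_at_diff) (auto simp: max_ideal_def max_ideal_power_def)
  ultimately obtain h where h: "h \<in> germs S p" "germ_eq S p (\<lambda>q. u q - (\<alpha> * E0 q + \<beta> * E1 q)) (\<lambda>q. h q * f q)"
    using ideal by blast
  have "(\<lambda>q. u q - (\<alpha> * E0 q + \<beta> * E1 q)) \<in> max_ideal_power S p 2"
    by (rule max_ideal_power_cong[OF max_ideal_power_mult[OF h(1) f2] germ_eq_sym[OF h(2)]])
  from max_ideal_power_add[OF this E2] have u2: "u \<in> max_ideal_power S p 2"
    by simp
  \<comment> \<open>Since \<open>u\<close> lies in the square, \<open>c'\<close> and the zero vector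
    \<open>c''\<close> are both coordinate vectors of \<open>u\<close>, and uniqueness forces them
    to be equal.\<close>
  define c' where "c' = (\<lambda>i\<in>{..<2::nat}. if i = 0 then \<alpha> else \<beta>)"
  define c'' where "c'' = (\<lambda>i\<in>{..<2::nat}. 0 :: complex)"
  have ex1: "\<exists>!c. c \<in> {..<2} \<rightarrow>\<^sub>E UNIV \<and> (\<lambda>x. u x - (\<Sum>i<2. c i * t i x)) \<in> max_ideal_power S p 2"
    using t u unfolding cotangent_basis_def by blast
  have "(\<lambda>x. u x - (\<Sum>i<2. c' i * t i x)) = (\<lambda>x. 0 * u x)"
    by (simp add: c'_def u_def numeral_2_eq_2)
  then have "(\<lambda>x. u x - (\<Sum>i<2. c' i * t i x)) \<in> max_ideal_power S p 2"
    using max_ideal_power_cmult[OF u2] by metis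
  moreover have "(\<lambda>x. u x - (\<Sum>i<2. c'' i * t i x)) \<in> max_ideal_power S p 2"
    using u2 by (simp add: c''_def)
  moreover have "c' \<in> {..<2} \<rightarrow>\<^sub>E UNIV" "c'' \<in> {..<2} \<rightarrow>\<^sub>E UNIV"
    by (simp_all add: c'_def c''_def)
  ultimately have "c' = c''"
    using ex1 by blast
  then have "c' 0 = c'' 0" "c' 1 = c'' 1"
    by simp_all
  then show False
    using ab(2) by (simp add: c'_def c''_def)
qed

end

section \<open>Local rings of the quotient\<close>

lemma germs_quot_iff:
  "f \<in> germs (Q_quot n) p \<longleftrightarrow>
    (\<exists>V. openin (zar_quot n) V \<and> p \<in> V \<and> (\<forall>x. Phi n x \<in> V \<longrightarrow> f \<circ> Phi n \<in> germs Q_space x))"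
proof -
  have "f \<in> sections (Q_quot n) V \<longleftrightarrow> (\<forall>x. Phi n x \<in> V \<longrightarrow> f \<circ> Phi n \<in> germs Q_space x)"
    if "openin (zar_quot n) V" for V
    using that by (auto simp: sections_Q_quot openin_zar_quot sections_Q_iff simp del: split_paired_All)
  then show ?thesis
    unfolding germs_def by auto
qed

lemma germs_quot_const: "p \<in> range (Phi n) \<Longrightarrow> (\<lambda>x. c) \<in> germs (Q_quot n) p"
  unfolding germs_quot_iff using openin_topspace[of "zar_quot n"] germs_Q_const[of c]
  by (intro exI[of _ "range (Phi n)"]) (auto simp: topspace_zar_quot o_def)

lemma germs_quot_binop:
  assumes "f \<in> germs (Q_quot n) p" "g \<in> germs (Q_quot n) p"
    and op: "\<And>x f g. f \<in> germs Q_space x \<Longrightarrow> g \<in> germs Q_space x \<Longrightarrow> (\<lambda>y. F (f y) (g y)) \<in> germs Q_space x"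
  shows "(\<lambda>x. F (f x) (g x)) \<in> germs (Q_quot n) p"
proof -
  obtain V where V: "openin (zar_quot n) V" "p \<in> V" "\<And>x. Phi n x \<in> V \<Longrightarrow> f \<circ> Phi n \<in> germs Q_space x"
    using assms(1) unfolding germs_quot_iff by blast
  obtain V' where V': "openin (zar_quot n) V'" "p \<in> V'" "\<And>x. Phi n x \<in> V' \<Longrightarrow> g \<circ> Phi n \<in> germs Q_space x"
    using assms(2) unfolding germs_quot_iff by blast
  have "(\<lambda>x. F (f x) (g x)) \<circ> Phi n \<in> germs Q_space x" if "Phi n x \<in> V \<inter> V'" for x
    using op[OF V(3) V'(3), of x] that by (simp add: o_def)
  then show ?thesis
    unfolding germs_quot_iff using V(1,2) V'(1,2) by (intro exI[of _ "V \<inter> V'"]) auto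
qed

lemma ring_at_quot:
  assumes "p \<in> range (Phi n)"
  shows "ring_at (Q_quot n) p"
  unfolding ring_at_def
proof (intro conjI allI ballI impI)
  show "p \<in> topspace (zar (Q_quot n))"
    using assms by (simp add: topspace_zar_quot)
  show "(\<lambda>x. c) \<in> germs (Q_quot n) p" for c
    using assms by (rule germs_quot_const)
  show "(\<lambda>x. f x + g x) \<in> germs (Q_quot n) p" if "f \<in> germs (Q_quot n) p" "g \<in> germs (Q_quot n) p" for f g
    using that germs_Q_add by (rule germs_quot_binop)
  show "(\<lambda>x. f x * g x) \<in> germs (Q_quot n) p" if "f \<in> germs (Q_quot n) p" "g \<in> germs (Q_quot n) p" for f g
    using that germs_Q_mult by (rule germs_quot_binop)
  fix f g assume f: "f \<in> germs (Q_quot n) p" and "germ_eq (Q_quot n) p f g"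
  then obtain W where W: "openin (zar_quot n) W" "p \<in> W" "\<forall>x\<in>W. f x = g x"
    using assms unfolding germ_eq_def eventually_nhdsin by (auto simp: topspace_zar_quot)
  obtain V where V: "openin (zar_quot n) V" "p \<in> V" "\<And>x. Phi n x \<in> V \<Longrightarrow> f \<circ> Phi n \<in> germs Q_space x"
    using f unfolding germs_quot_iff by blast
  have "openin zar_Q (Phi n -` (V \<inter> W))"
    using V(1) W(1) openin_zar_quot by blast
  then have "g \<circ> Phi n \<in> germs Q_space x" if "Phi n x \<in> V \<inter> W" for x
    using that by (rule_tac germs_Q_cong[OF V(3)]) (auto simp: W(3)[rule_format])
  then show "g \<in> germs (Q_quot n) p"
    unfolding germs_quot_iff using V W by (intro exI[of _ "V \<inter> W"]) auto
qed

lemma germs_quot_inverse: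
  assumes "f \<in> germs (Q_quot n) p" "f p \<noteq> 0"
  shows "(\<lambda>x. inverse (f x)) \<in> germs (Q_quot n) p"
proof -
  obtain V where V: "openin (zar_quot n) V" "p \<in> V" "\<And>x. Phi n x \<in> V \<Longrightarrow> f \<circ> Phi n \<in> germs Q_space x"
    using assms(1) unfolding germs_quot_iff by blast
  let ?W = "{x \<in> V. f x \<noteq> 0}"
  have op: "openin zar_Q (Phi n -` V)"
    using V(1) by (simp add: openin_zar_quot)
  have "openin zar_Q {x \<in> Phi n -` V. (f \<circ> Phi n) x \<noteq> 0}"
  proof (rule germs_Q_nonzero_open[OF op])
    show "f \<circ> Phi n \<in> sections Q_space (Phi n -` V)"
      unfolding sections_Q_iff[OF op] using V(3) by (metis vimageE)
  qed
  moreover have "{x \<in> Phi n -` V. (f \<circ> Phi n) x \<noteq> 0} = Phi n -` ?W"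
    by auto
  ultimately have "openin (zar_quot n) ?W"
    using V(1) by (auto simp: openin_zar_quot)
  moreover have "(\<lambda>x. inverse (f x)) \<circ> Phi n \<in> germs Q_space x" if "Phi n x \<in> ?W" for x
    using germs_Q_inverse[OF V(3), of x] that by (simp add: o_def)
  ultimately show ?thesis
    unfolding germs_quot_iff using V(2) assms(2) by (intro exI[of _ ?W]) auto
qed

section \<open>Bivariate polynomial functions\<close>

text \<open>Polynomial functions of two variables as an inductive set: Taylor expansion and division
  by the equation of the curve are proved by its induction rule.\<close>

inductive_set poly2 :: "(complex \<Rightarrow> complex \<Rightarrow> complex) set" where
  const: "(\<lambda>x y. c) \<in> poly2"
| fst: "(\<lambda>x y. x) \<in> poly2"
| snd: "(\<lambda>x y. y) \<in> poly2"
| add: "F \<in> poly2 \<Longrightarrow> G \<in> poly2 \<Longrightarrow> (\<lambda>x y. F x y + G x y) \<in> poly2"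
| mult: "F \<in> poly2 \<Longrightarrow> G \<in> poly2 \<Longrightarrow> (\<lambda>x y. F x y * G x y) \<in> poly2"

lemma poly2_diff: "F \<in> poly2 \<Longrightarrow> G \<in> poly2 \<Longrightarrow> (\<lambda>x y. F x y - G x y) \<in> poly2"
  using poly2.add[of F "\<lambda>x y. (-1) * G x y"] poly2.mult[OF poly2.const[of "-1"]] by simp

lemma poly2_poly: "F \<in> poly2 \<Longrightarrow> (\<lambda>x y. poly P (F x y)) \<in> poly2"
proof (induction P)
  case 0
  then show ?case by (simp add: poly2.const)
next
  case (pCons c P)
  then show ?case
    using poly2.add[OF poly2.const[of c] poly2.mult[of F "\<lambda>x y. poly P (F x y)"]] by simp
qed

lemma poly2_power: "F \<in> poly2 \<Longrightarrow> (\<lambda>x y. F x y ^ k) \<in> poly2"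
  by (induction k) (auto intro: poly2.const poly2.mult)

lemma poly2_sum: "(\<And>i. i \<in> I \<Longrightarrow> F i \<in> poly2) \<Longrightarrow> (\<lambda>x y. \<Sum>i\<in>I. F i x y) \<in> poly2"
  by (induction I rule: infinite_finite_induct) (auto intro: poly2.const poly2.add)

lemmas poly2_intros = poly2.const poly2.fst poly2.snd poly2.add poly2.mult poly2_diff poly2_poly poly2_power poly2_sum

section \<open>The double cover given by the invariant product of the coordinates\<close>

text \<open>Both points of the curve with a given value \<open>x\<close> of the invariant \<open>\<zeta> \<eta>\<close> have
  \<open>\<zeta>\<close>-coordinates \<open>t\<close> and \<open>t'\<close> with the following sum and product.\<close>

context hyperbola
begin

text \<open>Clearing the denominator in \<open>x = t * mm t\<close> gives
  \<open>a t\<^sup>2 + (b + x) t + cnj a * x = 0\<close>. The polynomials \<open>sp\<close> and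
  \<open>pp\<close> are the sum and the product of its roots.\<close>

definition sp :: "complex poly" where "sp = [:- of_real b / a, - 1 / a:]"
definition pp :: "complex poly" where "pp = [:0, cnj a / a:]"

definition conj_pair :: "complex \<Rightarrow> complex \<Rightarrow> complex \<Rightarrow> bool" where
  "conj_pair x t t' \<longleftrightarrow> t + t' = poly sp x \<and> t * t' = poly pp x"

fun Ap :: "nat \<Rightarrow> complex poly" where
  "Ap 0 = 0"
| "Ap (Suc 0) = 1"
| "Ap (Suc (Suc k)) = sp * Ap (Suc k) - pp * Ap k"

lemma conj_pair_sym: "conj_pair x t t' \<Longrightarrow> conj_pair x t' t"
  by (simp add: conj_pair_def add.commute mult.commute)

lemma conj_pair_recurrence:
  assumes "conj_pair x t t'"
  shows "t ^ Suc (Suc k) = poly sp x * t ^ Suc k - poly pp x * t ^ k"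
proof -
  have s: "poly sp x = t + t'" "poly pp x = t * t'"
    using assms by (simp_all add: conj_pair_def)
  show ?thesis
    unfolding s by (simp add: algebra_simps)
qed

lemma conj_pair_power:
  assumes "conj_pair x t t'"
  shows "t ^ Suc k = poly (Ap (Suc k)) x * t - poly pp x * poly (Ap k) x"
proof (induction k rule: induct_nat_012)
  case 1
  then show ?case
    using conj_pair_recurrence[OF assms, of 0] by simp
next
  case (ge2 k)
  have "t ^ Suc (Suc (Suc k)) = poly sp x * t ^ Suc (Suc k) - poly pp x * t ^ Suc k"
    by (rule conj_pair_recurrence[OF assms])
  then show ?case
    unfolding ge2 by (simp add: algebra_simps)
qed simp

lemma conj_pair_power_diff:
  assumes "conj_pair x t t'"
  shows "t ^ k - t' ^ k = poly (Ap k) x * (t - t')"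
proof (cases k)
  case (Suc j)
  show ?thesis
    unfolding Suc conj_pair_power[OF assms, of j] conj_pair_power[OF conj_pair_sym[OF assms], of j]
    by (simp add: algebra_simps del: Ap.simps)
qed simp

text \<open>The limit of \<open>(t ^ k - t' ^ k) / (t - t')\<close> as \<open>t'\<close> tends to
  \<open>t\<close>, that is, the derivative of the power. It shows that \<open>A\<close> is non-zero
  where the two roots coincide, unless they are 0.\<close>

lemma conj_pair_double:
  assumes "conj_pair x t t"
  shows "poly (Ap k) x = of_nat k * t ^ (k - 1)"
proof (induction k rule: induct_nat_012)
  case (ge2 k)
  have "poly sp x = t + t" "poly pp x = t * t"
    using assms by (simp_all add: conj_pair_def)
  then show ?case
    using ge2 by (cases k) (simp_all add: algebra_simps)
qed simp_all

lemma Ap_degree: "degree (Ap (Suc k)) \<le> k"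
proof (induction k rule: induct_nat_012)
  case 1
  show ?case by (simp add: sp_def)
next
  case (ge2 k)
  have "degree sp \<le> 1" "degree pp \<le> 1"
    by (simp_all add: sp_def pp_def)
  then have "degree (sp * Ap (Suc (Suc k))) \<le> 1 + Suc k"
    using degree_mult_le[of sp "Ap (Suc (Suc k))"] ge2(2) by linarith
  moreover have "degree (pp * Ap (Suc k)) \<le> 1 + k"
    using degree_mult_le[of pp "Ap (Suc k)"] ge2(1) \<open>degree pp \<le> 1\<close> by linarith
  ultimately have "degree (sp * Ap (Suc (Suc k)) - pp * Ap (Suc k)) \<le> Suc (Suc k)"
    by (intro degree_diff_le) simp_all
  then show ?case
    by simp
qed simp

text \<open>At \<open>x = 0\<close> the product \<open>pp\<close> vanishes and the recurrence
  becomes geometric with ratio \<open>sp(0) = - b / a\<close>. As \<open>b > 0\<close>, this shows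
  that \<open>A\<close> is not the zero polynomial.\<close>

lemma Ap_at_0: "poly (Ap (Suc k)) 0 = (- of_real b / a) ^ k"
  by (induction k rule: induct_nat_012) (simp_all add: sp_def pp_def)

lemma Ap_nonzero: "Ap n \<noteq> 0"
proof -
  obtain k where k: "n = Suc k"
    using n0 gr0_implies_Suc by blast
  have "poly (Ap n) 0 \<noteq> 0"
    unfolding k Ap_at_0 using b_pos a0 by simp
  then show ?thesis
    by auto
qed

definition Bp :: "complex poly" where "Bp = - pp * Ap (n - 1)"
definition Sp :: "complex poly" where "Sp = Ap n * sp + 2 * Bp"
definition Dp :: "complex poly" where "Dp = sp ^ 2 - 4 * pp"

lemma conj_pair_n:
  assumes "conj_pair x t t'"
  shows "t ^ n = poly (Ap n) x * t + poly Bp x"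
    and "t ^ n + t' ^ n = poly Sp x"
    and "(t - t')\<^sup>2 = poly Dp x"
proof -
  have n: "n = Suc (n - 1)"
    using n0 by simp
  have *: "u ^ n = poly (Ap n) x * u + poly Bp x" if "conj_pair x u u'" for u u'
    using conj_pair_power[OF that, of "n - 1"] n by (simp add: Bp_def)
  show "t ^ n = poly (Ap n) x * t + poly Bp x"
    by (rule *[OF assms])
  have "poly sp x = t + t'" "poly pp x = t * t'"
    using assms by (simp_all add: conj_pair_def)
  then show "t ^ n + t' ^ n = poly Sp x" "(t - t')\<^sup>2 = poly Dp x"
    unfolding *[OF assms] *[OF conj_pair_sym[OF assms]]
    by (simp_all add: Sp_def Dp_def algebra_simps power2_eq_square)
qed

definition mm :: "complex \<Rightarrow> complex" where "mm t = - (a * t + of_real b) / (t + cnj a)"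
definition xx :: "complex \<Rightarrow> complex" where "xx t = t * mm t"

lemma xx_mult:
  assumes "t + cnj a \<noteq> 0"
  shows "xx t * (t + cnj a) = - (t * (a * t + of_real b))"
proof -
  have "mm t * (t + cnj a) = - (a * t + of_real b)"
    using assms by (simp add: mm_def)
  then have "xx t * (t + cnj a) = t * - (a * t + of_real b)"
    by (simp only: xx_def mult.assoc)
  then show ?thesis
    by (simp only: mult_minus_right)
qed

lemma xx_reg:
  assumes "t \<noteq> - cnj a"
  shows "mm \<in> reg_at t" "(\<lambda>u. poly Q (xx u)) \<in> reg_at t"
proof -
  have "(\<lambda>u. ((-1) * (a * u + of_real b)) / (u + cnj a)) \<in> reg_at t"
    using assms by (intro reg_at_divide reg_at_mult reg_at_add reg_at_const reg_at_id) (simp add: add_eq_0_iff2)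
  then show "mm \<in> reg_at t"
    by (simp add: mm_def[abs_def])
  then have "(\<lambda>u. xx u) \<in> reg_at t"
    unfolding xx_def by (intro reg_at_mult reg_at_id)
  then show "(\<lambda>u. poly Q (xx u)) \<in> reg_at t"
    by (induction Q) (auto intro!: reg_at_add reg_at_mult reg_at_const)
qed

text \<open>The first component is the quadratic equation multiplied out. At
  \<open>t = - cnj a\<close> the quadratic equals a non-zero constant independent of
  \<open>x\<close>, so the denominator of \<open>mm\<close> never vanishes at a root.\<close>

lemma conj_pair_xx_iff:
  "conj_pair x t (poly sp x - t) \<longleftrightarrow> t \<noteq> - cnj a \<and> xx t = x"
proof -
  have 1: "a * (t * (poly sp x - t) - poly pp x) = - (t * (a * t + of_real b)) - x * (t + cnj a)"
    using a0 by (simp add: sp_def pp_def field_simps)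
  have 2: "t \<noteq> - cnj a" if "- (t * (a * t + of_real b)) - x * (t + cnj a) = 0"
  proof
    assume t: "t = - cnj a"
    have "cnj a * (a * cnj a - of_real b) = - (- (t * (a * t + of_real b)) - x * (t + cnj a))"
      by (simp add: t algebra_simps)
    then have "cnj a * (a * cnj a - of_real b) = 0"
      unfolding that by simp
    then show False
      using a0 det_nonzero by simp
  qed
  have "conj_pair x t (poly sp x - t) \<longleftrightarrow> - (t * (a * t + of_real b)) - x * (t + cnj a) = 0"
    using a0 1 unfolding conj_pair_def by (metis add_diff_cancel_left' diff_add_cancel eq_iff_diff_eq_0 mult_eq_0_iff add.commute)
  also have "\<dots> \<longleftrightarrow> t \<noteq> - cnj a \<and> xx t = x"
  proof
    assume *: "- (t * (a * t + of_real b)) - x * (t + cnj a) = 0"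
    then have ne: "t \<noteq> - cnj a"
      by (rule 2)
    then have ne': "t + cnj a \<noteq> 0"
      by (simp add: add_eq_0_iff2)
    have "xx t * (t + cnj a) = - (t * (a * t + of_real b))"
      by (rule xx_mult[OF ne'])
    also have "\<dots> = x * (t + cnj a)"
      using * by simp
    finally show "t \<noteq> - cnj a \<and> xx t = x"
      using ne ne' by simp
  next
    assume *: "t \<noteq> - cnj a \<and> xx t = x"
    then have ne': "t + cnj a \<noteq> 0"
      by (simp add: add_eq_0_iff2)
    then have "x * (t + cnj a) = - (t * (a * t + of_real b))"
      using xx_mult[OF ne'] * by (simp only:)
    then show "- (t * (a * t + of_real b)) - x * (t + cnj a) = 0"
      by simp
  qed
  finally show ?thesis .
qed

lemma conj_pair_xx:
  assumes "conj_pair x t t'"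
  shows "t \<noteq> - cnj a" "xx t = x"
proof -
  have "t' = poly sp x - t"
    using assms by (simp add: conj_pair_def eq_diff_eq add.commute)
  then show "t \<noteq> - cnj a" "xx t = x"
    using assms conj_pair_xx_iff by auto
qed

definition tt :: "complex \<Rightarrow> complex" where "tt t = poly sp (xx t) - t"

lemma conj_pair_tt: "t \<noteq> - cnj a \<Longrightarrow> conj_pair (xx t) t (tt t)"
  unfolding tt_def conj_pair_xx_iff by simp

text \<open>The partner root is the second coordinate up to a constant, because
  \<open>t * tt t\<close> and \<open>t * mm t\<close> are proportional. Hence \<open>mm t\<close> is
  a polynomial expression in the partner root.\<close>

lemma tt_mm:
  assumes "t \<noteq> - cnj a" "t \<noteq> 0"
  shows "tt t = cnj a / a * mm t"
proof -
  have "t * tt t = t * (cnj a / a * mm t)"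
    using conj_pair_tt[OF assms(1)] by (simp add: conj_pair_def pp_def xx_def mult_ac)
  then show ?thesis
    using mult_left_cancel[OF assms(2)] by blast
qed

lemma conj_pair_ex: "\<exists>t t'. conj_pair x t t'"
proof -
  define t where "t = (poly sp x + csqrt (poly Dp x)) / 2"
  have "t * (poly sp x - t) = ((poly sp x)\<^sup>2 - (csqrt (poly Dp x))\<^sup>2) / 4"
    by (simp add: t_def field_simps power2_eq_square)
  also have "\<dots> = poly pp x"
    by (simp add: Dp_def)
  finally show ?thesis
    unfolding conj_pair_def by (intro exI[of _ t] exI[of _ "poly sp x - t"]) simp
qed

text \<open>The excluded values are \<open>\<zeta> = 0\<close> and the pole of \<open>mm\<close>,
  where \<open>\<eta>\<close> is infinite. The value \<open>\<eta> = 0\<close> is allowed, since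
  \<open>y = \<zeta> ^ n\<close> is still non-zero there.\<close>

definition T1 :: "complex set" where "T1 = {t. t \<noteq> 0 \<and> t \<noteq> - cnj a}"

lemma finite_T1: "finite (- T1)"
proof -
  have "- T1 = {0, - cnj a}"
    by (auto simp: T1_def)
  then show ?thesis by simp
qed

text \<open>A root of \<open>A\<close> gives equal \<open>n\<close>-th powers at both roots of the
  quadratic. The roots are distinct, since at a coincidence \<open>A\<close> would be
  \<open>n * t ^ (n - 1)\<close>, which is non-zero on \<open>T1\<close>.\<close>

lemma tt_double:
  assumes t: "t \<in> T1" and A: "poly (Ap n) (xx t) = 0"
  shows "tt t \<in> T1" "tt t \<noteq> t" "xx (tt t) = xx t" "tt t ^ n = t ^ n"
proof -
  have t': "t \<noteq> - cnj a" "t \<noteq> 0"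
    using t by (auto simp: T1_def)
  note cp = conj_pair_tt[OF t'(1)]
  show eq: "tt t ^ n = t ^ n"
    using conj_pair_power_diff[OF cp, of n] A by simp
  show "xx (tt t) = xx t"
    using conj_pair_xx[OF conj_pair_sym[OF cp]] by simp
  have "tt t \<noteq> 0"
    using eq t'(2) n0 by (metis power_not_zero zero_power)
  then show "tt t \<in> T1"
    using conj_pair_xx[OF conj_pair_sym[OF cp]] by (simp add: T1_def)
  show "tt t \<noteq> t"
  proof
    assume "tt t = t"
    then have "poly (Ap n) (xx t) = of_nat n * t ^ (n - 1)"
      using cp conj_pair_double by metis
    then show False
      using A t'(2) n0 by simp
  qed
qed

lemma same_image:
  assumes t: "t \<in> T1" and u: "u \<in> T1" and eq: "xx u = xx t" "u ^ n = t ^ n"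
  shows "u = t \<or> u = tt t \<and> poly (Ap n) (xx t) = 0"
proof -
  have t': "t \<noteq> - cnj a" "u \<noteq> - cnj a"
    using t u by (auto simp: T1_def)
  note cp = conj_pair_tt[OF t'(1)] conj_pair_tt[OF t'(2)]
  have "u * (poly sp (xx t) - u) = t * (poly sp (xx t) - t)"
    using cp eq by (simp add: conj_pair_def tt_def)
  then have "(u - t) * (u - tt t) = 0"
    by (simp add: tt_def algebra_simps)
  then have "u = t \<or> u = tt t"
    by simp
  moreover have "poly (Ap n) (xx t) = 0" if "u = tt t" "u \<noteq> t"
    using conj_pair_power_diff[OF cp(1), of n] eq(2) that by simp
  ultimately show ?thesis
    by blast
qed

section \<open>The nodes\<close>

definition vk :: "nat \<Rightarrow> complex" where
  "vk k = Complex (cmod a * cos (pi * k / n)) (sqrt (b - (cmod a * cos (pi * k / n))\<^sup>2))"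

text \<open>One of two numbers with product \<open>cnj a / a * (vk k)\<^sup>2\<close> and ratio
  \<open>exp (2 \<pi> \<i> k / n)\<close>; the other carries the opposite exponent. The quadratic
  equation of \<open>vk k\<close> makes their sum equal to \<open>sp\<close>.\<close>

definition tk :: "nat \<Rightarrow> complex" where
  "tk k = - (of_real (cmod a) / a) * vk k * exp (\<i> * of_real (pi * k / n))"

lemma vk_Im_pos: "Im (vk k) > 0"
proof -
  have "(cmod a * cos (pi * k / n))\<^sup>2 = (cmod a)\<^sup>2 * (cos (pi * k / n))\<^sup>2"
    by (simp add: power_mult_distrib)
  also have "\<dots> \<le> (cmod a)\<^sup>2 * 1"
    by (intro mult_left_mono) (auto simp: abs_square_le_1)
  finally show ?thesis
    using ab by (simp add: vk_def)
qed

lemma vk_quadratic: "(vk k)\<^sup>2 + of_real b = 2 * of_real (cmod a * cos (pi * k / n)) * vk k"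
proof -
  have "Im (vk k) ^ 2 = b - (cmod a * cos (pi * k / n))\<^sup>2"
    using vk_Im_pos[of k] by (simp add: vk_def)
  moreover have "Re (vk k) = cmod a * cos (pi * k / n)"
    by (simp add: vk_def)
  ultimately show ?thesis
    by (auto simp: complex_eq_iff power2_eq_square algebra_simps)
qed

lemma tk_pair:
  "conj_pair ((vk k)\<^sup>2) (tk k) (- (of_real (cmod a) / a) * vk k * exp (- (\<i> * of_real (pi * k / n))))"
proof -
  let ?e = "exp (\<i> * of_real (pi * k / n))" and ?e' = "exp (- (\<i> * of_real (pi * k / n)))"
  have "?e + ?e' = 2 * cos (of_real (pi * k / n))"
    unfolding cos_exp_eq by simp
  then have sum: "?e + ?e' = 2 * of_real (cos (pi * k / n))"
    by (simp only: cos_of_real)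
  have prod: "?e * ?e' = 1"
    by (simp flip: exp_add)
  have "tk k + - (of_real (cmod a) / a) * vk k * ?e' = - (of_real (cmod a) / a) * vk k * (?e + ?e')"
    by (simp add: tk_def algebra_simps)
  also have "\<dots> = - ((2 * of_real (cmod a * cos (pi * k / n)) * vk k) / a)"
    unfolding sum by simp
  also have "\<dots> = poly sp ((vk k)\<^sup>2)"
    unfolding vk_quadratic[symmetric] using a0 by (simp add: sp_def field_simps)
  finally have 1: "tk k + - (of_real (cmod a) / a) * vk k * ?e' = poly sp ((vk k)\<^sup>2)" .
  have "tk k * (- (of_real (cmod a) / a) * vk k * ?e') = (of_real (cmod a))\<^sup>2 / a\<^sup>2 * (vk k)\<^sup>2 * (?e * ?e')"
    by (simp add: tk_def power2_eq_square)
  also have "\<dots> = (a * cnj a) / a\<^sup>2 * (vk k)\<^sup>2"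
    unfolding prod norm_a by simp
  also have "\<dots> = poly pp ((vk k)\<^sup>2)"
    using a0 by (simp add: pp_def power2_eq_square)
  finally show ?thesis
    using 1 by (simp add: conj_pair_def)
qed

lemma vk_nonzero [simp]: "vk k \<noteq> 0"
  using vk_Im_pos[of k] by auto

lemma tk_nonzero: "tk k \<noteq> 0"
  using a0 by (simp add: tk_def)

lemma tk_T1: "tk k \<in> T1" and xx_tk: "xx (tk k) = (vk k)\<^sup>2"
  using conj_pair_xx[OF tk_pair[of k]] tk_nonzero[of k] by (auto simp: T1_def)

text \<open>The two roots differ by the factors \<open>exp (\<i> \<pi> k / n)\<close> and its
  inverse, whose \<open>n\<close>-th powers are both \<open>(-1) ^ k\<close>. For
  \<open>0 < k < n\<close> the sine of the angle is positive, so the roots are distinct and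
  \<open>A\<close> must vanish.\<close>

lemma Ap_root:
  assumes "0 < k" "k < n"
  shows "poly (Ap n) ((vk k)\<^sup>2) = 0"
proof -
  define t' where "t' = - (of_real (cmod a) / a) * vk k * exp (- (\<i> * of_real (pi * k / n)))"
  have arg: "of_nat n * (\<i> * of_real (pi * k / n)) = \<i> * of_real (pi * k)"
    using n0 by simp
  have "exp (\<i> * of_real (pi * k / n)) ^ n = exp (- (\<i> * of_real (pi * k / n))) ^ n"
  proof -
    have "exp (\<i> * of_real (pi * k / n)) ^ n = exp (\<i> * of_real (pi * k))"
      unfolding exp_of_nat_mult[symmetric] arg ..
    also have "\<dots> = exp (- (\<i> * of_real (pi * k)) + 2 * of_nat k * of_real pi * \<i>)"
      by (simp add: algebra_simps)
    also have "\<dots> = exp (- (\<i> * of_real (pi * k)))"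
    proof -
      have "exp (2 * of_nat k * of_real pi * \<i>) = (1 :: complex)"
        using exp_integer_2pi[of "of_nat k"] by (simp add: mult_ac)
      then show ?thesis
        by (simp only: exp_add mult_1_right)
    qed
    also have "\<dots> = exp (- (\<i> * of_real (pi * k / n))) ^ n"
      unfolding exp_of_nat_mult[symmetric] mult_minus_right arg ..
    finally show ?thesis .
  qed
  then have "tk k ^ n = t' ^ n"
    by (simp only: tk_def t'_def power_mult_distrib)
  then have "poly (Ap n) ((vk k)\<^sup>2) * (tk k - t') = 0"
    using conj_pair_power_diff[OF tk_pair[of k], of n] by (simp add: t'_def)
  moreover have "tk k \<noteq> t'"
  proof
    assume "tk k = t'"
    then have "exp (\<i> * of_real (pi * k / n)) = exp (- (\<i> * of_real (pi * k / n)))"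
      using a0 by (simp add: tk_def t'_def)
    then have "Im (exp (\<i> * of_real (pi * k / n))) = Im (exp (- (\<i> * of_real (pi * k / n))))"
      by simp
    then have "sin (pi * k / n) = 0"
      by (simp add: Im_exp)
    moreover have "sin (pi * k / n) > 0"
      using assms n0 by (intro sin_gt_zero) (simp_all add: field_simps)
    ultimately show False
      by simp
  qed
  ultimately show ?thesis
    by simp
qed

text \<open>Equal squares leave \<open>vk j = vk k\<close> or its negative. Positive imaginary parts
  exclude the negative, and equal real parts give equal cosines on an interval where the cosine is
  injective.\<close>

lemma vk_inj: "inj_on (\<lambda>k. (vk k)\<^sup>2) {1..<n}"
proof (rule inj_onI)
  fix j k assume jk: "j \<in> {1..<n}" "k \<in> {1..<n}" and "(vk j)\<^sup>2 = (vk k)\<^sup>2"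
  then have "vk j = vk k \<or> vk j = - vk k"
    by (simp add: power2_eq_iff)
  moreover have "vk j \<noteq> - vk k"
    using vk_Im_pos[of j] vk_Im_pos[of k] by (metis less_asym neg_less_0_iff_less uminus_complex.sel(2))
  ultimately have "Re (vk j) = Re (vk k)"
    by auto
  then have "cos (pi * j / n) = cos (pi * k / n)"
    using a0 by (simp add: vk_def)
  moreover have "0 \<le> pi * j / n" "pi * j / n \<le> pi" "0 \<le> pi * k / n" "pi * k / n \<le> pi"
    using jk n0 by (simp_all add: field_simps)
  ultimately have "pi * j / n = pi * k / n"
    by (metis cos_inj_pi)
  then show "j = k"
    using n0 by simp
qed

lemma Ap_degree_n: "degree (Ap n) \<le> n - 1"
  using Ap_degree[of "n - 1"] n0 by simp

lemma Ap_roots: "{x. poly (Ap n) x = 0} = (\<lambda>k. (vk k)\<^sup>2) ` {1..<n}"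
proof (rule sym, rule card_subset_eq)
  show "finite {x. poly (Ap n) x = 0}"
    by (rule poly_roots_finite[OF Ap_nonzero])
  show sub: "(\<lambda>k. (vk k)\<^sup>2) ` {1..<n} \<subseteq> {x. poly (Ap n) x = 0}"
    using Ap_root by auto
  have "card {x. poly (Ap n) x = 0} \<le> n - 1"
    using card_poly_roots_bound[OF Ap_nonzero] Ap_degree_n by simp
  moreover have "card ((\<lambda>k. (vk k)\<^sup>2) ` {1..<n}) = n - 1"
    using card_image[OF vk_inj] by simp
  moreover have "card ((\<lambda>k. (vk k)\<^sup>2) ` {1..<n}) \<le> card {x. poly (Ap n) x = 0}"
    using sub by (intro card_mono poly_roots_finite Ap_nonzero)
  ultimately show "card ((\<lambda>k. (vk k)\<^sup>2) ` {1..<n}) = card {x. poly (Ap n) x = 0}"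
    by simp
qed

lemma Ap_simple_root:
  assumes "poly (Ap n) x0 = 0"
  obtains A1 where "Ap n = [:- x0, 1:] * A1" "poly A1 x0 \<noteq> 0"
proof -
  obtain A1 where A1: "Ap n = [:- x0, 1:] * A1"
    using assms by (auto simp: poly_eq_0_iff_dvd)
  have "A1 \<noteq> 0"
    using Ap_nonzero A1 by auto
  then have "degree (Ap n) = Suc (degree A1)"
    unfolding A1 by (subst degree_mult_eq) auto
  then have deg: "degree A1 < n - 1"
    using Ap_degree_n by simp
  have "poly A1 x0 \<noteq> 0"
  proof
    assume 0: "poly A1 x0 = 0"
    have "poly A1 x = 0" if "poly (Ap n) x = 0" for x
      using that 0 unfolding A1 by auto
    then have "{x. poly (Ap n) x = 0} \<subseteq> {x. poly A1 x = 0}"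
      by blast
    then have "card {x. poly (Ap n) x = 0} \<le> card {x. poly A1 x = 0}"
      by (intro card_mono poly_roots_finite[OF \<open>A1 \<noteq> 0\<close>])
    also have "\<dots> \<le> degree A1"
      by (rule card_poly_roots_bound[OF \<open>A1 \<noteq> 0\<close>])
    finally show False
      unfolding Ap_roots card_image[OF vk_inj] using deg by simp
  qed
  then show thesis
    using that A1 by blast
qed

section \<open>Regular functions in terms of the invariants\<close>

text \<open>Division with remainder by \<open>t\<^sup>2 - s t + p\<close>, with coefficients
  polynomial in \<open>x\<close>: multiplying \<open>\<alpha> + \<beta> t\<close> by
  \<open>t\<close> and reducing gives \<open>- p \<beta> + (\<alpha> + s \<beta>) t\<close>.\<close>

lemma poly_conj_linear:
  obtains \<alpha> \<beta> where "\<And>x t t'. conj_pair x t t' \<Longrightarrow> poly Q t = poly \<alpha> x + poly \<beta> x * t"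
proof -
  have "\<exists>\<alpha> \<beta>. \<forall>x t t'. conj_pair x t t' \<longrightarrow> poly Q t = poly \<alpha> x + poly \<beta> x * t"
  proof (induction Q)
    case 0
    show ?case by (intro exI[of _ 0]) simp
  next
    case (pCons c Q)
    then obtain \<alpha> \<beta> where IH: "\<And>x t t'. conj_pair x t t' \<Longrightarrow> poly Q t = poly \<alpha> x + poly \<beta> x * t"
      by blast
    have "poly (pCons c Q) t = poly ([:c:] - pp * \<beta>) x + poly (\<alpha> + sp * \<beta>) x * t" if "conj_pair x t t'" for x t t'
    proof -
      have s: "poly sp x = t + t'" "poly pp x = t * t'"
        using that by (simp_all add: conj_pair_def)
      show ?thesis
        using IH[OF that] by (simp add: s algebra_simps)
    qed
    then show ?case by blast
  qed
  then show thesis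
    using that by blast
qed

text \<open>Where \<open>A\<close> is non-zero, \<open>t = (y - B) / A\<close> is itself a rational
  function of \<open>x\<close> and \<open>y\<close>.\<close>

lemma rational_in_invariants_simple:
  assumes "poly (Ap n) (xx t0) \<noteq> 0" "t0 \<in> T1" "F \<in> reg_at t0"
  shows "\<exists>G\<in>poly2. \<exists>H\<in>poly2. H (xx t0) (t0 ^ n) \<noteq> 0 \<and> F t0 = G (xx t0) (t0 ^ n) / H (xx t0) (t0 ^ n) \<and>
    (\<forall>\<^sub>F t in cofinite. F t = G (xx t) (t ^ n) / H (xx t) (t ^ n))"
proof -
  obtain P R where PR: "poly R t0 \<noteq> 0" "F t0 = poly P t0 / poly R t0"
    "\<forall>\<^sub>F t in cofinite. poly R t \<noteq> 0 \<and> F t = poly P t / poly R t"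
    using reg_atE[OF assms(3)] .
  \<comment> \<open>Substituting \<open>t = (y - B) / A\<close> into a polynomial and clearing
    powers of \<open>A\<close>. The recursion on coefficients costs one further power of
    \<open>A\<close> at each step.\<close>
  have hom: "\<exists>k. \<exists>G\<in>poly2. \<forall>x t. poly (Ap n) x \<noteq> 0 \<longrightarrow>
     poly Q t * poly (Ap n) x ^ k = G x (poly (Ap n) x * t + poly Bp x)" for Q
  proof (induction Q)
    case 0
    show ?case by (intro exI[of _ 0] bexI[OF _ poly2.const[of 0]]) simp
  next
    case (pCons c Q)
    then obtain k G where G: "G \<in> poly2" "\<And>x t. poly (Ap n) x \<noteq> 0 \<Longrightarrow>
     poly Q t * poly (Ap n) x ^ k = G x (poly (Ap n) x * t + poly Bp x)"
      by blast
    let ?G = "\<lambda>x y. c * poly (Ap n) x ^ Suc k + (y - poly Bp x) * G x y"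
    have "?G \<in> poly2"
      by (intro poly2_intros G(1))
    moreover have "poly (pCons c Q) t * poly (Ap n) x ^ Suc k = ?G x (poly (Ap n) x * t + poly Bp x)"
      if "poly (Ap n) x \<noteq> 0" for x t
      unfolding G(2)[OF that, symmetric] by (simp add: algebra_simps)
    ultimately show ?case
      by (intro exI[of _ "Suc k"] bexI[of _ ?G]) simp_all
  qed
  obtain k G where G: "G \<in> poly2" "\<And>x t. poly (Ap n) x \<noteq> 0 \<Longrightarrow>
     poly P t * poly (Ap n) x ^ k = G x (poly (Ap n) x * t + poly Bp x)"
    using hom by blast
  obtain l H where H: "H \<in> poly2" "\<And>x t. poly (Ap n) x \<noteq> 0 \<Longrightarrow>
     poly R t * poly (Ap n) x ^ l = H x (poly (Ap n) x * t + poly Bp x)"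
    using hom by blast
  define G' where "G' x y = G x y * poly (Ap n) x ^ l" for x y
  define H' where "H' x y = H x y * poly (Ap n) x ^ k" for x y
  have mem: "G' \<in> poly2" "H' \<in> poly2"
    unfolding G'_def[abs_def] H'_def[abs_def] by (intro poly2_intros G(1) H(1))+
  have val: "G' (xx t) (t ^ n) = poly P t * poly (Ap n) (xx t) ^ (k + l) \<and>
     H' (xx t) (t ^ n) = poly R t * poly (Ap n) (xx t) ^ (k + l)"
    if "t \<noteq> - cnj a" "poly (Ap n) (xx t) \<noteq> 0" for t
    using G(2)[OF that(2), of t] H(2)[OF that(2), of t] conj_pair_n(1)[OF conj_pair_tt[OF that(1)]]
    by (simp add: G'_def H'_def power_add mult_ac)
  have eq: "G' (xx t) (t ^ n) / H' (xx t) (t ^ n) = poly P t / poly R t"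
    if "t \<noteq> - cnj a" "poly (Ap n) (xx t) \<noteq> 0" for t
    using val[OF that] that(2) by simp
  have t0: "t0 \<noteq> - cnj a"
    using assms(2) by (simp add: T1_def)
  have "(\<lambda>t. poly (Ap n) (xx t)) \<in> reg_at t0"
    by (rule xx_reg(2)[OF t0])
  then have "\<forall>\<^sub>F t in cofinite. poly (Ap n) (xx t) \<noteq> 0"
    using reg_at_zero_or_nonzero reg_at_eqI[OF _ reg_at_const[of 0]] assms(1) by blast
  then have "\<forall>\<^sub>F t in cofinite. F t = G' (xx t) (t ^ n) / H' (xx t) (t ^ n)"
    using PR(3) eventually_cofinite_neq[of "- cnj a"] by eventually_elim (simp add: eq)
  moreover have "H' (xx t0) (t0 ^ n) \<noteq> 0"
    using val[OF t0 assms(1)] PR(1) assms(1) by simp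
  moreover have "F t0 = G' (xx t0) (t0 ^ n) / H' (xx t0) (t0 ^ n)"
    using eq[OF t0 assms(1)] PR(2) by simp
  ultimately show ?thesis
    using mem by blast
qed

text \<open>Rationalising the denominator gives \<open>F = (\<alpha>' + \<beta>' t) / N\<close> over
  functions of \<open>x\<close>. Equal values at the two branches force \<open>\<beta>'\<close> to
  vanish at \<open>x0\<close>. As \<open>x0\<close> is a simple root of \<open>A\<close>,
  multiplication by the cofactor \<open>A1\<close> turns \<open>\<beta>' t\<close> into a multiple
  of \<open>A t = y - B\<close>.\<close>

lemma rational_in_invariants_double:
  assumes A: "poly (Ap n) (xx t0) = 0" and t0: "t0 \<in> T1"
    and F: "F \<in> reg_at t0" "F \<in> reg_at (tt t0)" "F (tt t0) = F t0"
  shows "\<exists>G\<in>poly2. \<exists>H\<in>poly2. H (xx t0) (t0 ^ n) \<noteq> 0 \<and> F t0 = G (xx t0) (t0 ^ n) / H (xx t0) (t0 ^ n) \<and>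
    (\<forall>\<^sub>F t in cofinite. F t = G (xx t) (t ^ n) / H (xx t) (t ^ n))"
proof -
  have t0': "t0 \<noteq> - cnj a"
    using t0 by (simp add: T1_def)
  note tt = tt_double[OF t0 A]
  have "F \<in> reg_at t" if "t \<in> {t0, tt t0}" for t
    using that F by auto
  \<comment> \<open>One fraction has to serve both branches, since its denominator is about to be
    multiplied by its own conjugate.\<close>
  then obtain P R where PR0: "\<And>t. t \<in> {t0, tt t0} \<Longrightarrow> poly R t \<noteq> 0 \<and> F t = poly P t / poly R t"
    and ev: "\<forall>\<^sub>F t in cofinite. F t = poly P t / poly R t"
    using reg_at_global[of t0 "{t0, tt t0}" F] by blast
  obtain \<alpha> \<beta> where ab: "\<And>x t t'. conj_pair x t t' \<Longrightarrow> poly P t = poly \<alpha> x + poly \<beta> x * t"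
    using poly_conj_linear by blast
  obtain \<gamma> \<epsilon> where ge: "\<And>x t t'. conj_pair x t t' \<Longrightarrow> poly R t = poly \<gamma> x + poly \<epsilon> x * t"
    using poly_conj_linear by blast
  \<comment> \<open>\<open>N\<close> is the norm of the denominator, the product of its values at
    the two roots; \<open>\<alpha>' + \<beta>' t\<close> is the numerator times the conjugate
    denominator, reduced by the quadratic.\<close>
  define N where "N = \<gamma>\<^sup>2 + \<gamma> * \<epsilon> * sp + \<epsilon>\<^sup>2 * pp"
  define \<alpha>' where "\<alpha>' = \<alpha> * \<gamma> + \<alpha> * \<epsilon> * sp + \<beta> * \<epsilon> * pp"
  define \<beta>' where "\<beta>' = \<beta> * \<gamma> - \<alpha> * \<epsilon>"
  have N: "poly R t * poly R t' = poly N x" and num: "poly P t * poly R t' = poly \<alpha>' x + poly \<beta>' x * t"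
    if "conj_pair x t t'" for x t t'
  proof -
    have s: "poly sp x = t + t'" "poly pp x = t * t'"
      using that by (simp_all add: conj_pair_def)
    show "poly R t * poly R t' = poly N x"
      unfolding ge[OF that] ge[OF conj_pair_sym[OF that]] by (simp add: N_def s algebra_simps power2_eq_square)
    show "poly P t * poly R t' = poly \<alpha>' x + poly \<beta>' x * t"
      unfolding ab[OF that] ge[OF conj_pair_sym[OF that]] by (simp add: \<alpha>'_def \<beta>'_def s algebra_simps)
  qed
  note cp = conj_pair_tt[OF t0']
  have nz: "poly R t0 \<noteq> 0" "poly R (tt t0) \<noteq> 0"
    using PR0 by auto
  then have N0: "poly N (xx t0) \<noteq> 0"
    unfolding N[OF cp, symmetric] by simp
  have "poly P t0 / poly R t0 = poly P (tt t0) / poly R (tt t0)"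
    using PR0 F(3) by simp
  then have "poly P t0 * poly R (tt t0) = poly P (tt t0) * poly R t0"
    using nz by (simp add: field_simps)
  then have "poly \<alpha>' (xx t0) + poly \<beta>' (xx t0) * t0 = poly \<alpha>' (xx t0) + poly \<beta>' (xx t0) * tt t0"
    unfolding num[OF cp] num[OF conj_pair_sym[OF cp]] .
  then have b0: "poly \<beta>' (xx t0) = 0"
    using tt(2) by simp
  then obtain \<beta>1 where b1: "\<beta>' = [:- xx t0, 1:] * \<beta>1"
    by (auto simp: poly_eq_0_iff_dvd)
  obtain A1 where A1: "Ap n = [:- xx t0, 1:] * A1" "poly A1 (xx t0) \<noteq> 0"
    using Ap_simple_root[OF A] .
  \<comment> \<open>Numerator and denominator after multiplication by \<open>A1\<close>, with
    \<open>A t\<close> replaced by \<open>y - B\<close>. The new denominator is non-zero at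
    \<open>x0\<close> precisely because the root is simple.\<close>
  define G where "G x y = poly \<alpha>' x * poly A1 x + poly \<beta>1 x * (y - poly Bp x)" for x y
  define H where "H x y = poly N x * poly A1 x" for x y :: complex
  have mem: "G \<in> poly2" "H \<in> poly2"
    unfolding G_def[abs_def] H_def[abs_def] by (intro poly2_intros)+
  have H0: "H (xx t0) (t0 ^ n) \<noteq> 0"
    using N0 A1(2) by (simp add: H_def)
  have key: "F t * (poly N (xx t) * poly A1 (xx t)) = G (xx t) (t ^ n)"
    if "t \<noteq> - cnj a" "poly R t \<noteq> 0" "F t = poly P t / poly R t" for t
  proof -
    note cp = conj_pair_tt[OF that(1)]
    have "F t * poly N (xx t) = poly P t * poly R (tt t)"
      unfolding that(3) N[OF cp, symmetric] using that(2) by simp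
    also have "\<dots> = poly \<alpha>' (xx t) + poly \<beta>' (xx t) * t"
      by (rule num[OF cp])
    finally have "F t * poly N (xx t) * poly A1 (xx t) = (poly \<alpha>' (xx t) + poly \<beta>' (xx t) * t) * poly A1 (xx t)"
      by simp
    also have "\<dots> = poly \<alpha>' (xx t) * poly A1 (xx t) + poly \<beta>1 (xx t) * (poly (Ap n) (xx t) * t)"
      unfolding b1 A1(1) by (simp add: algebra_simps)
    also have "poly (Ap n) (xx t) * t = t ^ n - poly Bp (xx t)"
      using conj_pair_n(1)[OF cp] by simp
    finally show ?thesis
      by (simp add: G_def mult.assoc)
  qed
  have "R \<noteq> 0"
    using nz by auto
  have "(\<lambda>t. poly (N * A1) (xx t)) \<in> reg_at t0"
    by (rule xx_reg(2)[OF t0'])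
  moreover have "poly (N * A1) (xx t0) \<noteq> 0"
    using N0 A1(2) by simp
  ultimately have "\<forall>\<^sub>F t in cofinite. poly (N * A1) (xx t) \<noteq> 0"
    using reg_at_zero_or_nonzero reg_at_eqI[OF _ reg_at_const[of 0]] by blast
  then have "\<forall>\<^sub>F t in cofinite. F t = G (xx t) (t ^ n) / H (xx t) (t ^ n)"
    using ev eventually_poly_nonzero[OF \<open>R \<noteq> 0\<close>] eventually_cofinite_neq[of "- cnj a"]
  proof eventually_elim
    case (elim t)
    then show ?case
      using key[of t] by (simp add: H_def eq_divide_eq)
  qed
  moreover have "F t0 = G (xx t0) (t0 ^ n) / H (xx t0) (t0 ^ n)"
  proof -
    have "poly R t0 \<noteq> 0" "F t0 = poly P t0 / poly R t0"
      using PR0[of t0] by blast+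
    from key[OF t0' this] show ?thesis
      using N0 A1(2) by (simp only: H_def eq_divide_eq mult_eq_0_iff simp_thms if_False if_True)
  qed
  ultimately show ?thesis
    using mem H0 by blast
qed

lemma rational_in_invariants:
  assumes t0: "t0 \<in> T1" and F: "\<And>u. u \<in> T1 \<Longrightarrow> xx u = xx t0 \<Longrightarrow> u ^ n = t0 ^ n \<Longrightarrow> F \<in> reg_at u \<and> F u = F t0"
  shows "\<exists>G\<in>poly2. \<exists>H\<in>poly2. H (xx t0) (t0 ^ n) \<noteq> 0 \<and> F t0 = G (xx t0) (t0 ^ n) / H (xx t0) (t0 ^ n) \<and>
    (\<forall>\<^sub>F t in cofinite. F t = G (xx t) (t ^ n) / H (xx t) (t ^ n))"
proof (cases "poly (Ap n) (xx t0) = 0")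
  case True
  then show ?thesis
    using rational_in_invariants_double[OF True t0] F[OF t0 refl refl] F[OF tt_double(1,3,4)[OF t0 True]] by blast
next
  case False
  then show ?thesis
    using rational_in_invariants_simple[OF False t0] F[OF t0 refl refl] by blast
qed

end

text \<open>Describes the denominators of functions regular on the line minus two points, by
  splitting off roots one at a time.\<close>

lemma poly_two_roots:
  fixes H :: "complex poly"
  assumes "\<And>z. poly H z = 0 \<Longrightarrow> z = r \<or> z = s" "H \<noteq> 0"
  obtains c i j where "c \<noteq> 0" "H = smult c ([:- r, 1:] ^ i * [:- s, 1:] ^ j)"
proof -
  have "\<exists>c i j. c \<noteq> 0 \<and> H = smult c ([:- r, 1:] ^ i * [:- s, 1:] ^ j)"
    using assms
  proof (induction "degree H" arbitrary: H)
    case 0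
    then obtain c where "H = [:c:]"
      by (metis degree_eq_zeroE)
    then show ?case
      using 0(3) by (intro exI[of _ c] exI[of _ 0]) simp
  next
    case (Suc d)
    then have "\<not> constant (poly H)"
      by (simp add: constant_degree)
    then obtain z where z: "poly H z = 0"
      using fundamental_theorem_of_algebra by blast
    then obtain K where K: "H = [:- z, 1:] * K"
      by (auto simp: poly_eq_0_iff_dvd)
    have "K \<noteq> 0"
      using K Suc.prems by auto
    then have "degree H = Suc (degree K)"
      unfolding K by (subst degree_mult_eq) auto
    then have "d = degree K"
      using Suc.hyps(2) by simp
    moreover have "w = r \<or> w = s" if "poly K w = 0" for w
      using Suc.prems(1)[of w] that by (simp add: K)
    ultimately obtain c i j where c: "c \<noteq> 0" "K = smult c ([:- r, 1:] ^ i * [:- s, 1:] ^ j)"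
      using Suc.hyps(1)[of K] \<open>K \<noteq> 0\<close> by blast
    from Suc.prems(1)[OF z] show ?case
    proof
      assume "z = r"
      then have "H = smult c ([:- r, 1:] ^ Suc i * [:- s, 1:] ^ j)"
        unfolding K c(2) by (simp only: power_Suc mult_smult_right mult.assoc)
      then show ?thesis
        using c(1) by blast
    next
      assume "z = s"
      then have "H = smult c ([:- r, 1:] ^ i * [:- s, 1:] ^ Suc j)"
        unfolding K c(2) by (simp only: power_Suc mult_smult_right mult.left_commute)
      then show ?thesis
        using c(1) by blast
    qed
  qed
  then show thesis
    using that by blast
qed

context hyperbola
begin

section \<open>The chart containing all double points\<close>

definition \<gamma> :: "complex \<Rightarrow> P1 \<times> P1" where "\<gamma> = \<delta> (1, 0) (0, 1)"

lemma det2_\<gamma>: "det2 (1, 0) (0, 1) \<noteq> 0"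
  by (simp add: det2_def)

lemma \<gamma>_Aff: "t \<noteq> - cnj a \<Longrightarrow> \<gamma> t = (Aff t, Aff (mm t))"
  by (simp add: \<gamma>_def \<delta>_def line_def M_def pt_def mm_def add_eq_0_iff2)

lemma \<gamma>_Ct: "\<gamma> t \<in> Ct"
  unfolding \<gamma>_def by (rule \<delta>_Ct[OF det2_\<gamma>])

text \<open>The default 0 off the affine part makes \<open>zc\<close> and \<open>wc\<close>
  transform correctly under the action everywhere, and makes \<open>zc q \<noteq> 0\<close> express
  at once that both coordinates are finite and the first is non-zero.\<close>

definition zc :: "P1 \<times> P1 \<Rightarrow> complex" where
  "zc q = (case q of (Aff \<zeta>, Aff \<eta>) \<Rightarrow> \<zeta> | _ \<Rightarrow> 0)"

definition wc :: "P1 \<times> P1 \<Rightarrow> complex" where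
  "wc q = (case q of (Aff \<zeta>, Aff \<eta>) \<Rightarrow> \<eta> | _ \<Rightarrow> 0)"

definition cx :: "P1 \<times> P1 \<Rightarrow> complex" where "cx q = zc q * wc q"
definition cy :: "P1 \<times> P1 \<Rightarrow> complex" where "cy q = zc q ^ n"

definition O1 :: "(P1 \<times> P1) set" where "O1 = {q. zc q \<noteq> 0}"

lemma zc_Aff [simp]: "zc (Aff \<zeta>, Aff \<eta>) = \<zeta>" and wc_Aff [simp]: "wc (Aff \<zeta>, Aff \<eta>) = \<eta>"
  by (simp_all add: zc_def wc_def)

lemma O1_cases:
  assumes "q \<in> O1"
  obtains \<zeta> \<eta> where "q = (Aff \<zeta>, Aff \<eta>)" "\<zeta> \<noteq> 0"
  using assms by (cases q; cases "fst q"; cases "snd q") (auto simp: O1_def zc_def)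

lemma O1_open: "openin zar_Q O1"
proof -
  have "(\<lambda>z w. fst z * snd z * fst w) \<in> BF (1 + 1 + 0) (0 + 0 + 1)"
    by (intro BF_mult BF_fst_z BF_snd_z BF_fst_w)
  then have "openin zar_Q {q. at_Q (\<lambda>z w. fst z * snd z * fst w) q \<noteq> 0}"
    by (rule openin_at_Q)
  moreover have "at_Q (\<lambda>z w. fst z * snd z * fst w) q \<noteq> 0 \<longleftrightarrow> q \<in> O1" for q
    by (cases q; cases "fst q"; cases "snd q") (auto simp: O1_def zc_def at_Q_def)
  ultimately show ?thesis
    by simp
qed

lemma zc_germ: "q \<in> O1 \<Longrightarrow> zc \<in> germs Q_space q" and wc_germ: "q \<in> O1 \<Longrightarrow> wc \<in> germs Q_space q"
proof -
  assume q: "q \<in> O1"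
  have D: "(\<lambda>z w. fst z * fst w) \<in> BF (1 + 0) (0 + 1)"
    by (intro BF_mult BF_fst_z BF_fst_w)
  have N: "(\<lambda>z w. snd z * fst w) \<in> BF (1 + 0) (0 + 1)" "(\<lambda>z w. fst z * snd w) \<in> BF (1 + 0) (0 + 1)"
    by (intro BF_mult BF_fst_z BF_fst_w BF_snd_z BF_snd_w)+
  have nz: "at_Q (\<lambda>z w. fst z * fst w) q \<noteq> 0"
    using q by (auto simp: at_Q_def elim: O1_cases)
  show "zc \<in> germs Q_space q"
    by (rule germs_Q_cong[OF germs_Q_BF[OF N(1) D nz] O1_open q]) (auto simp: at_Q_def elim: O1_cases)
  show "wc \<in> germs Q_space q"
    by (rule germs_Q_cong[OF germs_Q_BF[OF N(2) D nz] O1_open q]) (auto simp: at_Q_def elim: O1_cases)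
qed

lemma germs_Q_power: "f \<in> germs Q_space q \<Longrightarrow> (\<lambda>x. f x ^ k) \<in> germs Q_space q"
  by (induction k) (auto intro: germs_Q_const germs_Q_mult)

lemma poly2_germ_Q:
  assumes "F \<in> poly2" "q \<in> O1"
  shows "(\<lambda>x. F (cx x) (cy x)) \<in> germs Q_space q"
  using assms(1)
proof induction
  case fst
  show ?case
    unfolding cx_def by (intro germs_Q_mult zc_germ wc_germ assms(2))
next
  case snd
  show ?case
    unfolding cy_def by (intro germs_Q_power zc_germ assms(2))
qed (auto intro: germs_Q_const germs_Q_add germs_Q_mult)

lemma c_act:
  assumes "l \<noteq> 0"
  shows "zc (act l q) = l * zc q" "wc (act l q) = inverse l * wc q"
  by (cases q; cases "fst q"; cases "snd q"; simp add: act_def zc_def wc_def)+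

lemma c_Phi:
  assumes "Phi n q = Phi n r"
  shows "cx q = cx r" "cy q = cy r" "q \<in> O1 \<longleftrightarrow> r \<in> O1"
proof -
  obtain k where k: "r = act (root1 n ^ k) q"
    using assms Phi_eq_iff[OF n0] by blast
  have "(root1 n ^ k) ^ n = 1"
    using root1_power_n[OF n0] by (metis power_commutes power_mult power_one mult.commute)
  then show "cx q = cx r" "cy q = cy r" "q \<in> O1 \<longleftrightarrow> r \<in> O1"
    unfolding k by (simp_all add: cx_def cy_def O1_def c_act power_mult_distrib)
qed

definition X :: "(P1 \<times> P1) set \<Rightarrow> complex" where "X p = cx (inv_into UNIV (Phi n) p)"
definition Y :: "(P1 \<times> P1) set \<Rightarrow> complex" where "Y p = cy (inv_into UNIV (Phi n) p)"

lemma X_Phi [simp]: "X (Phi n q) = cx q" and Y_Phi [simp]: "Y (Phi n q) = cy q"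
  unfolding X_def Y_def by (rule c_Phi(1) c_Phi(2); simp add: f_inv_into_f)+

lemma O1_quot_open: "openin (zar_quot n) (Phi n ` O1)" and Phi_O1 [simp]: "Phi n q \<in> Phi n ` O1 \<longleftrightarrow> q \<in> O1"
proof -
  show "Phi n q \<in> Phi n ` O1 \<longleftrightarrow> q \<in> O1" for q
    using c_Phi(3) by (metis imageE imageI)
  then have "Phi n -` (Phi n ` O1) = O1"
    by (intro set_eqI) (simp only: vimage_eq)
  then show "openin (zar_quot n) (Phi n ` O1)"
    unfolding openin_zar_quot using O1_open by auto
qed

lemma poly2_germ_quot:
  assumes "F \<in> poly2" "q \<in> O1"
  shows "(\<lambda>p. F (X p) (Y p)) \<in> germs (Q_quot n) (Phi n q)"
  unfolding germs_quot_iff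
proof (intro exI conjI allI impI)
  show "openin (zar_quot n) (Phi n ` O1)"
    by (rule O1_quot_open)
  show "Phi n q \<in> Phi n ` O1"
    using assms(2) by simp
  fix x assume "Phi n x \<in> Phi n ` O1"
  then have "x \<in> O1"
    by simp
  then show "(\<lambda>p. F (X p) (Y p)) \<circ> Phi n \<in> germs Q_space x"
    using poly2_germ_Q[OF assms(1)] by (simp add: o_def)
qed

lemma ratio_germ_quot:
  assumes "F \<in> poly2" "H \<in> poly2" "q \<in> O1" "H (cx q) (cy q) \<noteq> 0"
  shows "(\<lambda>p. F (X p) (Y p) / H (X p) (Y p)) \<in> germs (Q_quot n) (Phi n q)"
proof -
  have "(\<lambda>p. inverse (H (X p) (Y p))) \<in> germs (Q_quot n) (Phi n q)"
    by (rule germs_quot_inverse[OF poly2_germ_quot[OF assms(2,3)]]) (simp add: assms(4))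
  then show ?thesis
    using ring_at_mult[OF ring_at_quot poly2_germ_quot[OF assms(1,3)]] by (simp add: divide_inverse)
qed

lemma \<gamma>_O1: "t \<in> T1 \<Longrightarrow> \<gamma> t \<in> O1"
  by (auto simp: T1_def \<gamma>_Aff O1_def)

lemma c_\<gamma>: "t \<in> T1 \<Longrightarrow> cx (\<gamma> t) = xx t" "t \<in> T1 \<Longrightarrow> cy (\<gamma> t) = t ^ n"
  by (auto simp: T1_def \<gamma>_Aff cx_def cy_def xx_def)

lemma Ct_O1: "q \<in> Ct \<Longrightarrow> q \<in> O1 \<Longrightarrow> \<exists>t\<in>T1. q = \<gamma> t"
proof -
  assume q: "q \<in> Ct" "q \<in> O1"
  obtain \<zeta> \<eta> where z: "q = (Aff \<zeta>, Aff \<eta>)" "\<zeta> \<noteq> 0"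
    using O1_cases[OF q(2)] .
  have "Aff \<eta> = pt (M (1, \<zeta>))"
    using q(1) Ct_iff unfolding z by simp
  then have "\<zeta> \<noteq> - cnj a"
    by (auto simp: pt_def M_def)
  moreover from this have "q = \<gamma> \<zeta>"
    using \<open>Aff \<eta> = pt (M (1, \<zeta>))\<close> by (simp add: z \<gamma>_Aff pt_def M_def mm_def add_eq_0_iff2)
  ultimately show ?thesis
    using z(2) by (auto simp: T1_def)
qed

lemma root_of_unity_ratio:
  assumes "u ^ n = t ^ n" "t \<noteq> 0"
  obtains k where "k < n" "u = root1 n ^ k * t"
proof -
  have "(u / t) ^ n = 1"
    using assms by (simp add: power_divide)
  then have "u / t \<in> {exp (2 * of_real pi * \<i> * of_nat j / of_nat n) | j. j < n}"
    using complex_roots_unity[of n] n0 by auto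
  then obtain k where "k < n" "u / t = exp (2 * of_real pi * \<i> * of_nat k / of_nat n)"
    by blast
  moreover have "exp (2 * of_real pi * \<i> * of_nat k / of_nat n) = root1 n ^ k"
    by (simp add: root1_def mult_ac flip: exp_of_nat_mult)
  ultimately show thesis
    using that[of k] assms(2) by (simp add: field_simps)
qed

text \<open>Equal \<open>n\<close>-th powers give \<open>u = \<omega> t\<close> with a root of unity
  \<open>\<omega>\<close>; equality of the products then forces the second coordinate to be
  multiplied by the inverse of \<open>\<omega>\<close>.\<close>

lemma same_orbit:
  assumes t: "t \<in> T1" and u: "u \<in> T1" and eq: "xx u = xx t" "u ^ n = t ^ n"
  obtains k where "k < n" "u = root1 n ^ k * t" "\<gamma> u = act (root1 n ^ k) (\<gamma> t)"
proof -
  obtain k where k: "k < n" "u = root1 n ^ k * t"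
    using root_of_unity_ratio[OF eq(2)] t by (auto simp: T1_def)
  have "root1 n ^ k * mm u = mm t"
    using eq(1) t by (auto simp: xx_def k(2) T1_def)
  then have "mm u = inverse (root1 n ^ k) * mm t"
    by (metis root1_nonzero power_not_zero left_inverse mult.assoc mult_1)
  then have "\<gamma> u = act (root1 n ^ k) (\<gamma> t)"
    using t u k(2) by (simp add: T1_def \<gamma>_Aff act_def)
  then show thesis
    using that k by blast
qed

lemma Phi_\<gamma>_eq:
  assumes "t \<in> T1" "u \<in> T1"
  shows "Phi n (\<gamma> t) = Phi n (\<gamma> u) \<longleftrightarrow> xx u = xx t \<and> u ^ n = t ^ n"
proof
  assume "Phi n (\<gamma> t) = Phi n (\<gamma> u)"
  then show "xx u = xx t \<and> u ^ n = t ^ n"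
    using c_Phi(1,2)[of "\<gamma> t" "\<gamma> u"] assms by (simp add: c_\<gamma>)
next
  assume "xx u = xx t \<and> u ^ n = t ^ n"
  then obtain k where "k < n" "\<gamma> u = act (root1 n ^ k) (\<gamma> t)"
    using same_orbit[OF assms] by blast
  then show "Phi n (\<gamma> t) = Phi n (\<gamma> u)"
    using Phi_eq_iff[OF n0] by blast
qed

text \<open>The three points of the curve off the chart cause no coincidence: over
  \<open>\<zeta> = \<infinity>\<close>, \<open>\<eta> = \<infinity>\<close> and
  \<open>\<zeta> = 0\<close> the remaining coordinate is \<open>- a\<close>, \<open>- cnj a\<close>
  and \<open>- b / cnj a\<close>. It is finite and non-zero, so a rotation by
  \<open>l \<noteq> 1\<close> moves it off the curve.\<close>

lemma double_point_iff:
  assumes "q \<in> Ct"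
  shows "(\<exists>k. 0 < k \<and> k < n \<and> act (root1 n ^ k) q \<in> Ct) \<longleftrightarrow> (\<exists>t\<in>T1. q = \<gamma> t \<and> poly (Ap n) (xx t) = 0)"
proof
  assume "\<exists>k. 0 < k \<and> k < n \<and> act (root1 n ^ k) q \<in> Ct"
  then obtain k where k: "0 < k" "k < n" "act (root1 n ^ k) q \<in> Ct"
    by blast
  define l where "l = root1 n ^ k"
  have l: "l \<noteq> 0" "l \<noteq> 1"
    using root1_power_eq[OF n0 k(2) n0] k(1) by (auto simp: l_def)
  obtain p r where q: "q = (p, r)"
    by (cases q)
  have r: "r = pt (M (hom p))"
    using assms Ct_iff q by blast
  have r': "scale_P1 (inverse l) r = pt (M (hom (scale_P1 l p)))"
    using k(3) Ct_iff unfolding q act_def l_def by simp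
  have p: "p \<noteq> Infty"
  proof
    assume "p = Infty"
    then have "Aff (- (inverse l * a)) = Aff (- a)"
      using r r' by (simp add: pt_def M_def)
    then show False
      using a0 l by (auto simp: field_simps)
  qed
  then obtain t where t: "p = Aff t"
    by (cases p) auto
  have t1: "t \<noteq> - cnj a"
  proof
    assume t1: "t = - cnj a"
    then have "r = Infty"
      using r t by (simp add: pt_def M_def)
    then have "pt (M (1, l * t)) = Infty"
      using r' t by simp
    then have "l * t = - cnj a"
      by (simp add: pt_def M_def add_eq_0_iff2 split: if_splits)
    then show False
      using t1 l a0 by simp
  qed
  have t0: "t \<noteq> 0"
  proof
    assume "t = 0"
    then have "inverse l * (of_real b / cnj a) = of_real b / cnj a"
      using r r' t a0 by (simp add: pt_def M_def)
    then show False
      using a0 l b_pos by (simp add: field_simps)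
  qed
  have tT: "t \<in> T1"
    using t0 t1 by (simp add: T1_def)
  have q': "q = \<gamma> t"
    using \<gamma>_Aff[OF t1] r t1 unfolding q t by (simp add: pt_def M_def mm_def add_eq_0_iff2)
  have act: "act l q \<in> O1"
    using \<gamma>_O1[OF tT] l by (simp add: q' O1_def c_act)
  then obtain u where u: "u \<in> T1" "act l q = \<gamma> u"
    using Ct_O1 k(3) unfolding l_def by blast
  have "Phi n (\<gamma> t) = Phi n (\<gamma> u)"
    using Phi_eq_iff[OF n0] k(2) u(2) unfolding q' l_def by metis
  then have "xx u = xx t" "u ^ n = t ^ n"
    using Phi_\<gamma>_eq[OF tT u(1)] by auto
  moreover have "zc (\<gamma> u) = u" "zc (\<gamma> t) = t"
    using u(1) t1 by (auto simp: \<gamma>_Aff T1_def)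
  then have "u = l * t"
    using c_act(1)[OF l(1), of q] u(2) q' by simp
  then have "u \<noteq> t"
    using l t0 by simp
  ultimately have "poly (Ap n) (xx t) = 0"
    using same_image[OF tT u(1)] by blast
  then show "\<exists>t\<in>T1. q = \<gamma> t \<and> poly (Ap n) (xx t) = 0"
    using tT q' by blast
next
  assume "\<exists>t\<in>T1. q = \<gamma> t \<and> poly (Ap n) (xx t) = 0"
  then obtain t where t: "t \<in> T1" "q = \<gamma> t" "poly (Ap n) (xx t) = 0"
    by blast
  note tt = tt_double[OF t(1,3)]
  obtain k where k: "k < n" "tt t = root1 n ^ k * t" "\<gamma> (tt t) = act (root1 n ^ k) (\<gamma> t)"
    using same_orbit[OF t(1) tt(1,3,4)] .
  have "k \<noteq> 0"
    using tt(2) k(2) by (intro notI) simp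
  then show "\<exists>k. 0 < k \<and> k < n \<and> act (root1 n ^ k) q \<in> Ct"
    using k \<gamma>_Ct[of "tt t"] t(2) by (metis gr0I)
qed

text \<open>At a double point \<open>bump\<close> vanishes, so averaging is replaced by the rational
  expression in \<open>x\<close> and \<open>y\<close>, which is defined on the quotient surface
  itself.\<close>

lemma param_curve_chart1: "param_curve (sub (Q_quot n) ((Phi n \<circ> \<gamma>) ` T1)) T1 (Phi n \<circ> \<gamma>)"
  unfolding \<gamma>_def
proof (rule param_curve_quotI[OF det2_\<gamma> finite_T1], fold \<gamma>_def)
  fix f t assume t: "t \<in> T1"
    and f: "\<And>u. u \<in> T1 \<Longrightarrow> Phi n (\<gamma> u) = Phi n (\<gamma> t) \<Longrightarrow> f \<circ> (Phi n \<circ> \<gamma>) \<in> reg_at u"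
  have "\<exists>G\<in>poly2. \<exists>H\<in>poly2. H (xx t) (t ^ n) \<noteq> 0 \<and>
    (f \<circ> (Phi n \<circ> \<gamma>)) t = G (xx t) (t ^ n) / H (xx t) (t ^ n) \<and>
    (\<forall>\<^sub>F u in cofinite. (f \<circ> (Phi n \<circ> \<gamma>)) u = G (xx u) (u ^ n) / H (xx u) (u ^ n))"
  proof (rule rational_in_invariants[OF t])
    fix u assume u: "u \<in> T1" "xx u = xx t" "u ^ n = t ^ n"
    then have "Phi n (\<gamma> u) = Phi n (\<gamma> t)"
      using Phi_\<gamma>_eq[OF u(1) t] by simp
    then show "f \<circ> (Phi n \<circ> \<gamma>) \<in> reg_at u \<and> (f \<circ> (Phi n \<circ> \<gamma>)) u = (f \<circ> (Phi n \<circ> \<gamma>)) t"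
      using f[OF u(1)] by simp
  qed
  then obtain G H where GH: "G \<in> poly2" "H \<in> poly2" "H (xx t) (t ^ n) \<noteq> 0"
    "f (Phi n (\<gamma> t)) = G (xx t) (t ^ n) / H (xx t) (t ^ n)"
    "\<forall>\<^sub>F u in cofinite. f (Phi n (\<gamma> u)) = G (xx u) (u ^ n) / H (xx u) (u ^ n)"
    by auto
  let ?g = "\<lambda>p. G (X p) (Y p) / H (X p) (Y p)"
  have "?g \<in> germs (Q_quot n) (Phi n (\<gamma> t))"
    using ratio_germ_quot[OF GH(1,2) \<gamma>_O1[OF t]] GH(3) by (simp add: c_\<gamma>[OF t])
  then obtain W where W: "openin (zar_quot n) W" "Phi n (\<gamma> t) \<in> W" "?g \<in> sections (Q_quot n) W"
    unfolding germs_def by auto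
  have "\<forall>\<^sub>F u in cofinite. u \<in> T1 \<longrightarrow> Phi n (\<gamma> u) \<in> W \<longrightarrow> f (Phi n (\<gamma> u)) = ?g (Phi n (\<gamma> u))"
    using GH(5) by eventually_elim (simp add: c_\<gamma>)
  moreover have "f (Phi n (\<gamma> t)) = ?g (Phi n (\<gamma> t))"
    using GH(4) t by (simp add: c_\<gamma>)
  ultimately show "\<exists>W g. openin (zar_quot n) W \<and> Phi n (\<gamma> t) \<in> W \<and> g \<in> sections (Q_quot n) W \<and>
            f (Phi n (\<gamma> t)) = g (Phi n (\<gamma> t)) \<and>
            (\<forall>\<^sub>F u in cofinite. u \<in> T1 \<longrightarrow> Phi n (\<gamma> u) \<in> W \<longrightarrow> f (Phi n (\<gamma> u)) = g (Phi n (\<gamma> u)))"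
    using W by blast
qed

section \<open>An affine model of the chart downstairs\<close>

text \<open>The third coordinate \<open>1 / y\<close> turns the condition
  \<open>y \<noteq> 0\<close> into a closed one.\<close>

definition model :: "complex \<Rightarrow> nat \<Rightarrow> complex" where
  "model t = (\<lambda>i\<in>{..<3::nat}. if i = 0 then xx t else if i = 1 then t ^ n else inverse (t ^ n))"

lemma model_nth [simp]: "model t 0 = xx t" "model t 1 = t ^ n" "model t (Suc 0) = t ^ n" "model t 2 = inverse (t ^ n)"
  by (simp_all add: model_def)

lemma model_eq_iff: "model t = model u \<longleftrightarrow> xx t = xx u \<and> t ^ n = u ^ n"
proof
  assume eq: "model t = model u"
  show "xx t = xx u \<and> t ^ n = u ^ n"
    using fun_cong[OF eq, of 0] fun_cong[OF eq, of 1] by simp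
next
  assume "xx t = xx u \<and> t ^ n = u ^ n"
  then show "model t = model u"
    by (intro ext) (simp add: model_def)
qed

lemma poly2_polyfuns: "F \<in> poly2 \<Longrightarrow> (\<lambda>x. F (x 0) (x 1)) \<in> polyfuns 3"
  by (induction rule: poly2.induct) (auto intro: polyfuns.intros)

lemma param_curve_model: "param_curve (sub (affine_nspace 3) (model ` T1)) T1 model"
proof (rule param_curve_affineI[OF finite_T1])
  show "model t \<in> {..<3} \<rightarrow>\<^sub>E UNIV" for t
    by (simp add: model_def)
  show "(\<lambda>u. model u i) \<in> reg_at t" if i: "i < 3" and t: "t \<in> T1" for i t
  proof -
    have t': "t \<noteq> - cnj a" "t \<noteq> 0"
      using t by (auto simp: T1_def)
    have "(\<lambda>u. poly [:0, 1:] (xx u)) \<in> reg_at t"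
      by (rule xx_reg(2)[OF t'(1)])
    then have "(\<lambda>u. xx u) \<in> reg_at t"
      by simp
    moreover have "(\<lambda>u. u ^ n) \<in> reg_at t"
      by (intro reg_at_power reg_at_id)
    moreover from this have "(\<lambda>u. inverse (u ^ n)) \<in> reg_at t"
      using t'(2) by (intro reg_at_inverse) simp_all
    moreover have "i = 0 \<or> i = 1 \<or> i = 2"
      using i by auto
    ultimately show ?thesis
      by auto
  qed
  show "finite {t \<in> T1. model t = p}" for p
  proof -
    have "monom 1 n - [:p 1:] \<noteq> (0 :: complex poly)"
    proof
      assume "monom 1 n - [:p 1:] = (0 :: complex poly)"
      then have "degree (monom 1 n :: complex poly) = degree [:p 1:]"
        by simp
      then show False
        using n0 by (simp add: degree_monom_eq)
    qed
    then have "finite {t. poly (monom 1 n - [:p 1:]) t = 0}"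
      by (rule poly_roots_finite)
    then show ?thesis
      by (rule rev_finite_subset) (auto simp: poly_monom)
  qed
  fix f t assume t: "t \<in> T1" and f: "\<And>u. u \<in> T1 \<Longrightarrow> model u = model t \<Longrightarrow> f \<circ> model \<in> reg_at u"
  have "\<exists>G\<in>poly2. \<exists>H\<in>poly2. H (xx t) (t ^ n) \<noteq> 0 \<and>
    (f \<circ> model) t = G (xx t) (t ^ n) / H (xx t) (t ^ n) \<and>
    (\<forall>\<^sub>F u in cofinite. (f \<circ> model) u = G (xx u) (u ^ n) / H (xx u) (u ^ n))"
  proof (rule rational_in_invariants[OF t])
    fix u assume u: "u \<in> T1" "xx u = xx t" "u ^ n = t ^ n"
    then have "model u = model t"
      by (simp add: model_eq_iff)
    then show "f \<circ> model \<in> reg_at u \<and> (f \<circ> model) u = (f \<circ> model) t"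
      using f[OF u(1)] by simp
  qed
  then obtain G H where GH: "G \<in> poly2" "H \<in> poly2" "H (xx t) (t ^ n) \<noteq> 0"
    "f (model t) = G (xx t) (t ^ n) / H (xx t) (t ^ n)"
    "\<forall>\<^sub>F u in cofinite. f (model u) = G (xx u) (u ^ n) / H (xx u) (u ^ n)"
    by auto
  have "\<forall>\<^sub>F u in cofinite. u \<in> T1 \<longrightarrow> H (model u 0) (model u 1) \<noteq> 0 \<longrightarrow>
      f (model u) = G (model u 0) (model u 1) / H (model u 0) (model u 1)"
    using GH(5) by eventually_elim simp
  then show "\<exists>F\<in>polyfuns 3. \<exists>G\<in>polyfuns 3. G (model t) \<noteq> 0 \<and> f (model t) = F (model t) / G (model t) \<and>
        (\<forall>\<^sub>F u in cofinite. u \<in> T1 \<longrightarrow> G (model u) \<noteq> 0 \<longrightarrow> f (model u) = F (model u) / G (model u))"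
    using GH(3,4) poly2_polyfuns[OF GH(1)] poly2_polyfuns[OF GH(2)]
    by (intro bexI[of _ "\<lambda>x. G (x 0) (x 1)"] bexI[of _ "\<lambda>x. H (x 0) (x 1)"]) simp_all
qed

text \<open>The polynomial \<open>?g\<close> is \<open>(y - t ^ n) * (y - t' ^ n)\<close> for the
  two roots over \<open>x\<close>. Its zeros with \<open>y \<noteq> 0\<close> therefore come from a
  non-zero root, hence from a parameter in \<open>T1\<close>.\<close>

lemma closedin_model: "closedin (zar_affine 3) (model ` T1)"
proof -
  let ?f = "\<lambda>x :: nat \<Rightarrow> complex. x 2 * x 1 - 1"
  let ?g = "\<lambda>x :: nat \<Rightarrow> complex. x 1 * x 1 - poly Sp (x 0) * x 1 + poly (pp ^ n) (x 0)"
  have "?f \<in> polyfuns 3" "?g \<in> polyfuns 3"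
    by (intro polyfuns_diff polyfuns.add polyfuns.mult polyfuns_poly polyfuns.coord polyfuns.const; simp)+
  then have "closedin (zar_affine 3) ({x \<in> {..<3} \<rightarrow>\<^sub>E UNIV. ?f x = 0} \<inter> {x \<in> {..<3} \<rightarrow>\<^sub>E UNIV. ?g x = 0})"
    by (intro closedin_Int closedin_polyfun)
  moreover have "{x \<in> {..<3} \<rightarrow>\<^sub>E UNIV. ?f x = 0} \<inter> {x \<in> {..<3} \<rightarrow>\<^sub>E UNIV. ?g x = 0} = model ` T1"
  proof (intro set_eqI iffI)
    fix x assume "x \<in> {x \<in> {..<3} \<rightarrow>\<^sub>E UNIV. ?f x = 0} \<inter> {x \<in> {..<3} \<rightarrow>\<^sub>E UNIV. ?g x = 0}"
    then have x: "x \<in> {..<3} \<rightarrow>\<^sub>E UNIV" "x 2 * x 1 = 1" "?g x = 0"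
      by auto
    obtain t t' where cp: "conj_pair (x 0) t t'"
      using conj_pair_ex by blast
    have "poly (pp ^ n) (x 0) = t ^ n * t' ^ n"
      using cp by (simp add: conj_pair_def flip: power_mult_distrib)
    then have "(x 1 - t ^ n) * (x 1 - t' ^ n) = 0"
      using x(3) conj_pair_n(2)[OF cp] by (simp add: algebra_simps flip: conj_pair_n(2)[OF cp])
    then obtain u u' where u: "conj_pair (x 0) u u'" "x 1 = u ^ n"
      using cp conj_pair_sym[OF cp] by auto
    have "x 1 \<noteq> 0"
      using x(2) by auto
    then have "u \<noteq> 0"
      using u(2) n0 by auto
    then have "u \<in> T1" "xx u = x 0"
      using conj_pair_xx[OF u(1)] by (auto simp: T1_def)
    moreover have "x 2 = inverse (u ^ n)"
      using x(2) \<open>x 1 \<noteq> 0\<close> unfolding u(2) by (simp add: field_simps)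
    then have "x i = model u i" if "i \<in> {..<3}" for i
    proof -
      have "i = 0 \<or> i = 1 \<or> i = 2"
        using that by auto
      then show ?thesis
        using u(2) \<open>xx u = x 0\<close> \<open>x 2 = inverse (u ^ n)\<close> by auto
    qed
    then have "x = model u"
      by (intro PiE_ext[OF x(1), of "model u"]) (simp_all add: model_def)
    ultimately show "x \<in> model ` T1"
      by blast
  next
    fix x assume "x \<in> model ` T1"
    then obtain t where t: "t \<in> T1" "x = model t"
      by blast
    then have t': "t \<noteq> 0" "t \<noteq> - cnj a"
      by (auto simp: T1_def)
    note cp = conj_pair_tt[OF t'(2)]
    have pn: "poly (pp ^ n) (xx t) = t ^ n * tt t ^ n"
      using cp by (simp add: conj_pair_def flip: power_mult_distrib)
    have "?g x = 0"
      unfolding t(2) model_nth pn conj_pair_n(2)[OF cp, symmetric] by (simp add: algebra_simps)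
    moreover have "?f x = 0"
      using t'(1) unfolding t(2) model_nth by simp
    moreover have "x \<in> {..<3} \<rightarrow>\<^sub>E UNIV"
      by (simp add: t(2) model_def)
    ultimately show "x \<in> {x \<in> {..<3} \<rightarrow>\<^sub>E UNIV. ?f x = 0} \<inter> {x \<in> {..<3} \<rightarrow>\<^sub>E UNIV. ?g x = 0}"
      by blast
  qed
  ultimately show ?thesis
    by simp
qed

lemma affine_variety_chart1:
  assumes "param_curve Z T1 (Phi n \<circ> \<gamma>)"
  shows "affine_variety Z"
proof -
  have "\<exists>\<phi>. isomorphism Z (sub (affine_nspace 3) (model ` T1)) \<phi>"
    by (rule param_curve_isomorphism_inverse[OF assms param_curve_model])
      (auto simp: model_eq_iff Phi_\<gamma>_eq)
  then show ?thesis
    unfolding affine_variety_def using closedin_model by blast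
qed

text \<open>Denominators can only be \<open>t ^ i * (t + cnj a) ^ j\<close>. A power of
  \<open>t\<close> divides a power of the invertible function \<open>y\<close>. Since
  \<open>(mm t + a) * (t + cnj a)\<close> is constant and \<open>mm t\<close> is proportional to the
  partner root, \<open>1 / (t + cnj a)\<close> is linear in the partner root.\<close>

lemma finite_module_chart1:
  assumes "\<And>t. t \<in> T1 \<Longrightarrow> F \<in> reg_at t"
  obtains \<alpha> \<beta> k where "\<And>t. t \<in> T1 \<Longrightarrow> F t = poly \<alpha> (xx t) / (t ^ n) ^ k + poly \<beta> (xx t) / (t ^ n) ^ k * t"
proof -
  have "\<exists>t. t \<in> T1"
  proof -
    have "\<forall>\<^sub>F t in cofinite. t \<noteq> 0 \<and> t \<noteq> - cnj a"
      by (intro eventually_conj eventually_cofinite_neq)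
    then show ?thesis
      unfolding T1_def by (rule eventually_cofinite_ex) blast
  qed
  then obtain t1 where t1: "t1 \<in> T1"
    by blast
  obtain P H where PH: "\<And>t. t \<in> T1 \<Longrightarrow> poly H t \<noteq> 0 \<and> F t = poly P t / poly H t"
    using reg_at_global[OF t1 assms] by blast
  have "z = 0 \<or> z = - cnj a" if "poly H z = 0" for z
    using PH[of z] that by (auto simp: T1_def)
  moreover have "H \<noteq> 0"
    using PH \<open>\<exists>t. t \<in> T1\<close> by auto
  ultimately obtain c i j where H: "c \<noteq> 0" "H = smult c ([:- 0, 1:] ^ i * [:- (- cnj a), 1:] ^ j)"
    using poly_two_roots by metis
  define \<Delta> where "\<Delta> = a * cnj a - of_real b"
  have D: "\<Delta> \<noteq> 0"
    using det_nonzero by (simp add: \<Delta>_def)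
  \<comment> \<open>The factor \<open>t ^ (n * i - i)\<close> completes the denominator
    \<open>t ^ i\<close> to \<open>(t ^ n) ^ i\<close>.\<close>
  define P' where "P' = smult (1 / c) (P * [:0, 1:] ^ (n * i - i))"
  \<comment> \<open>Evaluated at the partner root, this is
    \<open>1 / (t + cnj a) ^ j\<close>.\<close>
  define R where "R = [:a / \<Delta>, a / (cnj a * \<Delta>):] ^ j"
  obtain \<alpha>1 \<beta>1 where 1: "\<And>x t t'. conj_pair x t t' \<Longrightarrow> poly P' t = poly \<alpha>1 x + poly \<beta>1 x * t"
    using poly_conj_linear by blast
  obtain \<alpha>2 \<beta>2 where 2: "\<And>x t t'. conj_pair x t t' \<Longrightarrow> poly R t = poly \<alpha>2 x + poly \<beta>2 x * t"
    using poly_conj_linear by blast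
  \<comment> \<open>The product of \<open>\<alpha>1 + \<beta>1 t\<close> with
    \<open>\<alpha>2 + \<beta>2 t'\<close>, reduced by \<open>t' = s - t\<close> and
    \<open>t t' = p\<close>.\<close>
  define \<alpha> where "\<alpha> = \<alpha>1 * \<alpha>2 + \<alpha>1 * \<beta>2 * sp + \<beta>1 * \<beta>2 * pp"
  define \<beta> where "\<beta> = \<beta>1 * \<alpha>2 - \<alpha>1 * \<beta>2"
  have "F t = poly \<alpha> (xx t) / (t ^ n) ^ i + poly \<beta> (xx t) / (t ^ n) ^ i * t" if "t \<in> T1" for t
  proof -
    have t: "t \<noteq> 0" "t \<noteq> - cnj a"
      using that by (auto simp: T1_def)
    note cp = conj_pair_tt[OF t(2)]
    have ne: "t + cnj a \<noteq> 0"
      using t(2) by (simp add: add_eq_0_iff2)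
    have "mm t * (t + cnj a) = - (a * t + of_real b)"
      using ne by (simp add: mm_def)
    then have "(mm t + a) * (t + cnj a) = \<Delta>"
      unfolding distrib_right[of "mm t"] by (simp add: \<Delta>_def algebra_simps)
    then have inv: "1 / (t + cnj a) = (mm t + a) / \<Delta>"
      using ne D by (simp add: field_simps)
    have "poly [:a / \<Delta>, a / (cnj a * \<Delta>):] (tt t) = (mm t + a) / \<Delta>"
      using tt_mm[OF t(2,1)] a0 D by (simp add: field_simps)
    then have R: "poly R (tt t) = 1 / (t + cnj a) ^ j"
      unfolding R_def poly_power inv[symmetric] by (simp add: power_divide)
    have "i \<le> n * i"
      using n0 by simp
    then have "t ^ (n * i) = t ^ (n * i - i) * t ^ i"
      by (simp flip: power_add)
    then have P': "poly P' t = poly P t * (t ^ n) ^ i / (c * t ^ i)"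
      using t(1) H(1) by (simp add: P'_def field_simps flip: power_mult)
    have s: "poly sp (xx t) = t + tt t" "poly pp (xx t) = t * tt t"
      using cp by (simp_all add: conj_pair_def)
    have "poly P' t * poly R (tt t) = poly \<alpha> (xx t) + poly \<beta> (xx t) * t"
      unfolding 1[OF cp] 2[OF conj_pair_sym[OF cp]] \<alpha>_def \<beta>_def by (simp add: s algebra_simps)
    moreover have "F t * (t ^ n) ^ i = poly P' t * poly R (tt t)"
      using PH[OF that] t(1) unfolding P' R H(2) by (simp add: field_simps add.commute)
    ultimately have "F t * (t ^ n) ^ i = poly \<alpha> (xx t) + poly \<beta> (xx t) * t"
      by simp
    then have "F t = (poly \<alpha> (xx t) + poly \<beta> (xx t) * t) / (t ^ n) ^ i"
      using t(1) by (simp add: eq_divide_eq)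
    then show ?thesis
      by (simp add: add_divide_distrib)
  qed
  then show thesis
    by (rule that)
qed

end

lemma BF_obtain:
  assumes "F \<in> BF d e"
  obtains c where "F = biform d e c"
  using assms unfolding BF_def by blast

context hyperbola
begin

section \<open>Germs of functions on the quotient surface\<close>

lemma root1_dvd:
  assumes "root1 n ^ m = 1"
  shows "n dvd m"
proof -
  have "root1 n ^ (m mod n) = root1 n ^ 0"
    using root1_power_mod[OF n0, of m] assms by simp
  then have "m mod n = 0"
    using root1_power_eq[OF n0, of "m mod n" 0] n0 by simp
  then show ?thesis
    by (simp add: mod_eq_0_iff_dvd)
qed

lemma sum_roots_of_unity:
  fixes r :: complex
  assumes "r ^ n = 1" "r \<noteq> 1"
  shows "(\<Sum>k<n. r ^ k) = 0"
  using sum_gp_strict[of r n] assms by simp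

text \<open>Averaging kills every monomial \<open>\<zeta> ^ i * \<eta> ^ j\<close> with
  \<open>i\<close> and \<open>j\<close> incongruent modulo \<open>n\<close>. The factor
  \<open>\<zeta> ^ (n * e)\<close> makes the exponent of \<open>\<zeta>\<close> left after splitting
  off \<open>(\<zeta> * \<eta>) ^ j\<close> non-negative.\<close>

lemma orbit_sum_invariants:
  assumes "F \<in> BF d e"
  obtains P where "P \<in> poly2" "\<And>\<zeta> \<eta>. \<zeta> ^ (n * e) * orbit_sum F (1, \<zeta>) (1, \<eta>) = P (\<zeta> * \<eta>) (\<zeta> ^ n)"
proof -
  obtain c where c: "F = biform d e c"
    using BF_obtain[OF assms] .
  define s where "s i j = (\<Sum>k<n. (root1 n ^ k) ^ i * inverse (root1 n ^ k) ^ j)" for i j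
  \<comment> \<open>Rounding in \<open>div\<close> does no harm: when \<open>n\<close> does not
    divide the exponent, the character sum \<open>s i j\<close> is zero.\<close>
  define P where "P x y = (\<Sum>i\<le>d. \<Sum>j\<le>e. c i j * s i j * (x ^ j * y ^ ((i + n * e - j) div n)))" for x y
  have "P \<in> poly2"
    unfolding P_def[abs_def] by (intro poly2_intros)
  moreover have "\<zeta> ^ (n * e) * orbit_sum F (1, \<zeta>) (1, \<eta>) = P (\<zeta> * \<eta>) (\<zeta> ^ n)" for \<zeta> \<eta>
  proof -
    have "orbit_sum F (1, \<zeta>) (1, \<eta>) =
      (\<Sum>k<n. \<Sum>i\<le>d. \<Sum>j\<le>e. c i j * ((root1 n ^ k) ^ i * inverse (root1 n ^ k) ^ j) * (\<zeta> ^ i * \<eta> ^ j))"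
      by (simp add: orbit_sum_def rotform_def c biform_def power_mult_distrib mult_ac)
    also have "\<dots> = (\<Sum>i\<le>d. \<Sum>k<n. \<Sum>j\<le>e. c i j * ((root1 n ^ k) ^ i * inverse (root1 n ^ k) ^ j) * (\<zeta> ^ i * \<eta> ^ j))"
      by (rule sum.swap)
    also have "\<dots> = (\<Sum>i\<le>d. \<Sum>j\<le>e. \<Sum>k<n. c i j * ((root1 n ^ k) ^ i * inverse (root1 n ^ k) ^ j) * (\<zeta> ^ i * \<eta> ^ j))"
      by (intro sum.cong refl sum.swap)
    also have "\<dots> = (\<Sum>i\<le>d. \<Sum>j\<le>e. c i j * s i j * (\<zeta> ^ i * \<eta> ^ j))"
      by (simp add: s_def sum_distrib_left sum_distrib_right)
    finally have "\<zeta> ^ (n * e) * orbit_sum F (1, \<zeta>) (1, \<eta>) =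
      (\<Sum>i\<le>d. \<Sum>j\<le>e. c i j * s i j * (\<zeta> ^ (n * e) * (\<zeta> ^ i * \<eta> ^ j)))"
      by (simp add: sum_distrib_left mult_ac)
    also have "\<dots> = P (\<zeta> * \<eta>) (\<zeta> ^ n)"
      unfolding P_def
    proof (intro sum.cong refl)
      fix i j assume "i \<in> {..d}" "j \<in> {..e}"
      then have j: "j \<le> n * e"
        using n0 by (metis atMost_iff le_trans mult_le_mono1 nat_mult_1 One_nat_def Suc_leI)
      show "c i j * s i j * (\<zeta> ^ (n * e) * (\<zeta> ^ i * \<eta> ^ j)) =
        c i j * s i j * ((\<zeta> * \<eta>) ^ j * (\<zeta> ^ n) ^ ((i + n * e - j) div n))"
      proof (cases "n dvd i + n * e - j")
        case True
        then have "(\<zeta> ^ n) ^ ((i + n * e - j) div n) = \<zeta> ^ (i + n * e - j)"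
          by (simp flip: power_mult)
        moreover have "n * e + i = j + (i + n * e - j)"
          using j by simp
        then have "\<zeta> ^ (n * e) * \<zeta> ^ i = \<zeta> ^ j * \<zeta> ^ (i + n * e - j)"
          by (metis power_add)
        ultimately show ?thesis
          by (simp add: power_mult_distrib mult_ac)
      next
        case False
        define r where "r = root1 n ^ i * inverse (root1 n) ^ j"
        have "r ^ n = (root1 n ^ n) ^ i * inverse (root1 n ^ n) ^ j"
          by (simp add: r_def power_mult_distrib power_inverse flip: power_mult) (simp add: mult.commute)
        then have "r ^ n = 1"
          by (simp add: root1_power_n[OF n0])
        moreover have "r \<noteq> 1"
        proof
          assume "r = 1"
          then have "root1 n ^ i = root1 n ^ j"
            by (simp add: r_def power_inverse field_simps)
          moreover have "root1 n ^ (n * e) = 1"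
            by (simp add: power_mult root1_power_n[OF n0])
          moreover have "root1 n ^ j * root1 n ^ (i + n * e - j) = root1 n ^ i * root1 n ^ (n * e)"
            using j by (simp flip: power_add)
          ultimately have "root1 n ^ (i + n * e - j) = 1"
            by simp
          then show False
            using False root1_dvd by blast
        qed
        moreover have "s i j = (\<Sum>k<n. r ^ k)"
          unfolding s_def r_def by (intro sum.cong refl)
            (simp add: power_mult_distrib power_inverse mult.commute flip: power_mult)
        ultimately have "s i j = 0"
          using sum_roots_of_unity by simp
        then show ?thesis
          by simp
      qed
    qed
    finally show ?thesis .
  qed
  ultimately show thesis
    using that by blast
qed

text \<open>Near \<open>q\<close> the germ is a quotient of forms, but averaging the denominator
  could produce 0 at \<open>q\<close>. Multiplication by a form \<open>E\<close> that vanishes at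
  the other points of the orbit prevents this.\<close>

lemma germ_in_invariants:
  assumes g: "g \<in> germs (Q_quot n) (Phi n q)" and q: "q \<in> O1"
  obtains G H V where "G \<in> poly2" "H \<in> poly2" "H (cx q) (cy q) \<noteq> 0"
    "openin (zar_quot n) V" "Phi n q \<in> V"
    "\<And>x. Phi n x \<in> V \<Longrightarrow> x \<in> O1 \<and> H (cx x) (cy x) \<noteq> 0 \<and> g (Phi n x) = G (cx x) (cy x) / H (cx x) (cy x)"
proof -
  obtain V0 where V0: "openin (zar_quot n) V0" "Phi n q \<in> V0"
    "\<And>x. Phi n x \<in> V0 \<Longrightarrow> g \<circ> Phi n \<in> germs Q_space x"
    using g unfolding germs_quot_iff by blast
  obtain W d e F G where W: "F \<in> BF d e" "G \<in> BF d e" "openin zar_Q W" "q \<in> W"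
    "\<And>x. x \<in> W \<Longrightarrow> at_Q G x \<noteq> 0 \<and> g (Phi n x) = at_Q F x / at_Q G x"
  proof -
    have "g \<circ> Phi n \<in> germs Q_space q"
      using V0 by blast
    then show thesis
      unfolding germs_Q_iff using that by fastforce
  qed
  \<comment> \<open>The averages evaluate \<open>F\<close> and \<open>G\<close> at rotated points,
    outside the neighbourhood where the quotient represents \<open>g\<close>. The identity spreads
    to all of \<open>V0\<close> because open sets of \<open>Q\<close> are dense.\<close>
  have ident: "at_Q G x * g (Phi n x) = at_Q F x" if x: "Phi n x \<in> V0" for x
  proof -
    have "g \<circ> Phi n \<in> germs Q_space x"
      using V0(3)[OF x] .
    then obtain W' d' e' F' G' where W': "F' \<in> BF d' e'" "G' \<in> BF d' e'" "openin zar_Q W'" "x \<in> W'"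
      "\<And>x. x \<in> W' \<Longrightarrow> at_Q G' x \<noteq> 0 \<and> g (Phi n x) = at_Q F' x / at_Q G' x"
      unfolding germs_Q_iff by fastforce
    define K where "K z w = F' z w * G z w + (-1) * (G' z w * F z w)" for z w
    have K: "K \<in> BF (d' + d) (e' + e)"
      unfolding K_def[abs_def] by (intro BF_add BF_cmult BF_mult W W')
    have Kx: "at_Q K y = at_Q F' y * at_Q G y - at_Q G' y * at_Q F y" for y
      by (simp add: at_Q_def K_def)
    have "at_Q K x = 0"
    proof (rule ccontr)
      assume "at_Q K x \<noteq> 0"
      then have "openin zar_Q ({y. at_Q K y \<noteq> 0} \<inter> W')" "x \<in> {y. at_Q K y \<noteq> 0} \<inter> W'"
        using openin_at_Q[OF K] W'(3,4) by auto
      then obtain y where y: "y \<in> {y. at_Q K y \<noteq> 0} \<inter> W'" "y \<in> W"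
        using zar_Q_dense[OF _ _ W(3,4)] by metis
      have "at_Q F' y * at_Q G y = at_Q G' y * at_Q F y"
        using W(5)[OF y(2)] W'(5)[of y] y(1) by (auto simp: field_simps)
      then show False
        using y(1) by (simp add: Kx)
    qed
    then show ?thesis
      using W'(5)[OF W'(4)] by (simp add: Kx field_simps)
  qed
  obtain \<zeta>0 \<eta>0 where q': "q = (Aff \<zeta>0, Aff \<eta>0)" "\<zeta>0 \<noteq> 0"
    using O1_cases[OF q] .
  \<comment> \<open>The homogenised quotient
    \<open>(\<zeta> ^ n - \<zeta>0 ^ n) / (\<zeta> - \<zeta>0)\<close>. It equals
    \<open>n * \<zeta>0 ^ (n - 1)\<close> at \<open>\<zeta>0\<close> and vanishes at its other
    multiples by \<open>n\<close>-th roots of unity.\<close>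
  define E :: "complex \<times> complex \<Rightarrow> complex \<times> complex \<Rightarrow> complex"
    where "E z w = (\<Sum>i<n. \<zeta>0 ^ (n - 1 - i) * (fst z ^ (n - 1 - i) * snd z ^ i))" for z w
  have E: "E \<in> BF (n - 1) 0"
  proof -
    have "(\<lambda>z w. fst z ^ (n - 1 - i) * snd z ^ i) \<in> BF (n - 1) 0" if "i < n" for i
      using BF_mult[OF BF_power[OF BF_fst_z, of "n - 1 - i"] BF_power[OF BF_snd_z, of i]] that by simp
    then show ?thesis
      unfolding E_def[abs_def] by (intro BF_sum BF_cmult) auto
  qed
  define EF EG where "EF = (\<lambda>z w. E z w * F z w)" and "EG = (\<lambda>z w. E z w * G z w)"
  have EFG: "EF \<in> BF (n - 1 + d) (0 + e)" "EG \<in> BF (n - 1 + d) (0 + e)"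
    unfolding EF_def EG_def by (intro BF_mult E W)+
  have orb: "orbit_sum K (1, \<zeta>) (1, \<eta>) = (\<Sum>k<n. at_Q K (act (root1 n ^ k) (Aff \<zeta>, Aff \<eta>)))" for K \<zeta> \<eta>
    by (simp add: orbit_sum_def rotform_def at_Q_def act_def)
  obtain PF where PF: "PF \<in> poly2" "\<And>\<zeta> \<eta>. \<zeta> ^ (n * (0 + e)) * orbit_sum EF (1, \<zeta>) (1, \<eta>) = PF (\<zeta> * \<eta>) (\<zeta> ^ n)"
    using orbit_sum_invariants[OF EFG(1)] by blast
  obtain PG where PG: "PG \<in> poly2" "\<And>\<zeta> \<eta>. \<zeta> ^ (n * (0 + e)) * orbit_sum EG (1, \<zeta>) (1, \<eta>) = PG (\<zeta> * \<eta>) (\<zeta> ^ n)"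
    using orbit_sum_invariants[OF EFG(2)] by blast
  have Eval: "at_Q E (act (root1 n ^ k) q) = 0" if "k \<in> {..<n} - {0}" for k
  proof -
    have "at_Q E (act (root1 n ^ k) q) = (\<Sum>i<n. \<zeta>0 ^ (n - 1) * (root1 n ^ k) ^ i)"
      unfolding q' at_Q_def act_def E_def
      by (intro sum.cong refl) (simp add: power_mult_distrib mult_ac flip: power_add)
    also have "\<dots> = \<zeta>0 ^ (n - 1) * (\<Sum>i<n. (root1 n ^ k) ^ i)"
      by (simp add: sum_distrib_left)
    also have "(\<Sum>i<n. (root1 n ^ k) ^ i) = 0"
    proof (rule sum_roots_of_unity)
      show "(root1 n ^ k) ^ n = 1"
        using root1_power_n[OF n0] by (metis power_commutes power_mult power_one mult.commute)
      show "root1 n ^ k \<noteq> 1"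
        using that root1_power_eq[OF n0, of k 0] n0 by auto
    qed
    finally show ?thesis by simp
  qed
  have E0: "at_Q E q \<noteq> 0"
  proof -
    have "at_Q E q = (\<Sum>i<n. \<zeta>0 ^ (n - 1))"
      unfolding q' at_Q_def E_def by (intro sum.cong refl) (simp flip: power_add)
    then show ?thesis
      using q'(2) n0 by simp
  qed
  have "orbit_sum EG (1, \<zeta>0) (1, \<eta>0) = at_Q E q * at_Q G q"
  proof -
    have "(\<Sum>k\<in>{..<n} - {0}. at_Q EG (act (root1 n ^ k) q)) = 0"
      by (intro sum.neutral) (use Eval in \<open>simp add: EG_def at_Q_def\<close>)
    then show ?thesis
      using sum.remove[of "{..<n}" 0 "\<lambda>k. at_Q EG (act (root1 n ^ k) q)"] n0
      unfolding orb q'(1)[symmetric] by (simp add: EG_def at_Q_def)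
  qed
  then have PG0: "PG (cx q) (cy q) \<noteq> 0"
    using PG(2)[of \<zeta>0 \<eta>0, symmetric] E0 W(5)[OF W(4)] q'(2) by (simp add: q'(1) cx_def cy_def)
  have key: "PG (cx x) (cy x) * g (Phi n x) = PF (cx x) (cy x)" if x: "x \<in> O1" "Phi n x \<in> V0" for x
  proof -
    obtain \<zeta> \<eta> where x': "x = (Aff \<zeta>, Aff \<eta>)" "\<zeta> \<noteq> 0"
      using O1_cases[OF x(1)] .
    have "at_Q EG (act (root1 n ^ k) x) * g (Phi n x) = at_Q EF (act (root1 n ^ k) x)" for k
    proof -
      have "at_Q G (act (root1 n ^ k) x) * g (Phi n x) = at_Q F (act (root1 n ^ k) x)"
        using ident[of "act (root1 n ^ k) x"] x(2) by (simp add: Phi_act[OF n0])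
      then show ?thesis
        by (simp add: EG_def EF_def at_Q_def mult.assoc)
    qed
    then have "orbit_sum EG (1, \<zeta>) (1, \<eta>) * g (Phi n x) = orbit_sum EF (1, \<zeta>) (1, \<eta>)"
      unfolding orb x'(1)[symmetric] by (simp add: sum_distrib_right)
    then show ?thesis
      unfolding x'(1) cx_def cy_def zc_Aff wc_Aff PF(2)[symmetric] PG(2)[symmetric] by (simp add: mult.assoc)
  qed
  define V where "V = V0 \<inter> {p \<in> Phi n ` O1. PG (X p) (Y p) \<noteq> 0}"
  have pre: "Phi n -` {p \<in> Phi n ` O1. PG (X p) (Y p) \<noteq> 0} = {x \<in> O1. PG (cx x) (cy x) \<noteq> 0}"
    by (intro set_eqI) (simp only: vimage_eq mem_Collect_eq Phi_O1 X_Phi Y_Phi)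
  have "openin zar_Q {x \<in> O1. PG (cx x) (cy x) \<noteq> 0}"
    by (rule germs_Q_nonzero_open[OF O1_open]) (simp add: sections_Q_iff[OF O1_open] poly2_germ_Q[OF PG(1)])
  then have "openin (zar_quot n) {p \<in> Phi n ` O1. PG (X p) (Y p) \<noteq> 0}"
    unfolding openin_zar_quot pre by auto
  then have "openin (zar_quot n) V"
    unfolding V_def using V0(1) by blast
  moreover have "Phi n q \<in> V"
    using V0(2) q PG0 by (simp add: V_def)
  moreover have "x \<in> O1 \<and> PG (cx x) (cy x) \<noteq> 0 \<and> g (Phi n x) = PF (cx x) (cy x) / PG (cx x) (cy x)"
    if "Phi n x \<in> V" for x
    using that key[of x] by (auto simp: V_def field_simps)
  ultimately show thesis
    using that[OF PF(1) PG(1) PG0] by blast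
qed

text \<open>A second-order expansion with polynomial remainders, so that the remainder visibly lies
  in the square of the maximal ideal of a local ring.\<close>

lemma poly2_taylor:
  assumes "F \<in> poly2"
  obtains \<alpha> \<beta> R1 R2 R3 where "R1 \<in> poly2" "R2 \<in> poly2" "R3 \<in> poly2"
    "\<And>x y. F x y = F x0 y0 + \<alpha> * (x - x0) + \<beta> * (y - y0) +
      (R1 x y * ((x - x0) * (x - x0)) + R2 x y * ((x - x0) * (y - y0)) + R3 x y * ((y - y0) * (y - y0)))"
proof -
  define T where "T F \<longleftrightarrow> (\<exists>\<alpha> \<beta>. \<exists>R1\<in>poly2. \<exists>R2\<in>poly2. \<exists>R3\<in>poly2. \<forall>x y. F x y = F x0 y0 + \<alpha> * (x - x0) + \<beta> * (y - y0) +
      (R1 x y * ((x - x0) * (x - x0)) + R2 x y * ((x - x0) * (y - y0)) + R3 x y * ((y - y0) * (y - y0))))"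
    for F :: "complex \<Rightarrow> complex \<Rightarrow> complex"
  have TI: "T F" if "R1 \<in> poly2" "R2 \<in> poly2" "R3 \<in> poly2"
    "\<And>x y. F x y = F x0 y0 + \<alpha> * (x - x0) + \<beta> * (y - y0) +
      (R1 x y * ((x - x0) * (x - x0)) + R2 x y * ((x - x0) * (y - y0)) + R3 x y * ((y - y0) * (y - y0)))"
    for F R1 R2 R3 \<alpha> \<beta>
    unfolding T_def using that(4) by (intro exI[of _ \<alpha>] exI[of _ \<beta>] bexI[OF _ that(1)] bexI[OF _ that(2)] bexI[OF _ that(3)]) blast
  have "T F"
    using assms
  proof induction
    case (const c)
    show ?case
      by (rule TI[of "\<lambda>_ _. 0" "\<lambda>_ _. 0" "\<lambda>_ _. 0" _ 0 0]) (auto intro: poly2_intros)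
  next
    case fst
    show ?case
      by (rule TI[of "\<lambda>_ _. 0" "\<lambda>_ _. 0" "\<lambda>_ _. 0" _ 1 0]) (auto intro: poly2_intros)
  next
    case snd
    show ?case
      by (rule TI[of "\<lambda>_ _. 0" "\<lambda>_ _. 0" "\<lambda>_ _. 0" _ 0 1]) (auto intro: poly2_intros)
  next
    case (add F G)
    obtain \<alpha> \<beta> R1 R2 R3 where F: "R1 \<in> poly2" "R2 \<in> poly2" "R3 \<in> poly2"
      "\<And>x y. F x y = F x0 y0 + \<alpha> * (x - x0) + \<beta> * (y - y0) +
      (R1 x y * ((x - x0) * (x - x0)) + R2 x y * ((x - x0) * (y - y0)) + R3 x y * ((y - y0) * (y - y0)))"
      using add.IH(1) unfolding T_def by blast
    obtain \<alpha>' \<beta>' R1' R2' R3' where G: "R1' \<in> poly2" "R2' \<in> poly2" "R3' \<in> poly2"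
      "\<And>x y. G x y = G x0 y0 + \<alpha>' * (x - x0) + \<beta>' * (y - y0) +
      (R1' x y * ((x - x0) * (x - x0)) + R2' x y * ((x - x0) * (y - y0)) + R3' x y * ((y - y0) * (y - y0)))"
      using add.IH(2) unfolding T_def by blast
    show ?case
    proof (rule TI[of "\<lambda>x y. R1 x y + R1' x y" "\<lambda>x y. R2 x y + R2' x y" "\<lambda>x y. R3 x y + R3' x y" _ "\<alpha> + \<alpha>'" "\<beta> + \<beta>'"])
      fix x y
      show "F x y + G x y = F x0 y0 + G x0 y0 + (\<alpha> + \<alpha>') * (x - x0) + (\<beta> + \<beta>') * (y - y0) +
        ((R1 x y + R1' x y) * ((x - x0) * (x - x0)) + (R2 x y + R2' x y) * ((x - x0) * (y - y0)) +
         (R3 x y + R3' x y) * ((y - y0) * (y - y0)))"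
      proof -
        define u v where "u = x - x0" and "v = y - y0"
        have F': "F x y = F x0 y0 + \<alpha> * u + \<beta> * v + (R1 x y * (u * u) + R2 x y * (u * v) + R3 x y * (v * v))"
          using F(4)[of x y] by (simp only: u_def v_def)
        have G': "G x y = G x0 y0 + \<alpha>' * u + \<beta>' * v + (R1' x y * (u * u) + R2' x y * (u * v) + R3' x y * (v * v))"
          using G(4)[of x y] by (simp only: u_def v_def)
        show ?thesis
          unfolding F' G' u_def[symmetric] v_def[symmetric] by (simp add: algebra_simps)
      qed
    qed (intro poly2_intros F G)+
  next
    case (mult F G)
    obtain \<alpha> \<beta> R1 R2 R3 where F: "R1 \<in> poly2" "R2 \<in> poly2" "R3 \<in> poly2"
      "\<And>x y. F x y = F x0 y0 + \<alpha> * (x - x0) + \<beta> * (y - y0) +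
      (R1 x y * ((x - x0) * (x - x0)) + R2 x y * ((x - x0) * (y - y0)) + R3 x y * ((y - y0) * (y - y0)))"
      using mult.IH(1) unfolding T_def by blast
    obtain \<alpha>' \<beta>' R1' R2' R3' where G: "R1' \<in> poly2" "R2' \<in> poly2" "R3' \<in> poly2"
      "\<And>x y. G x y = G x0 y0 + \<alpha>' * (x - x0) + \<beta>' * (y - y0) +
      (R1' x y * ((x - x0) * (x - x0)) + R2' x y * ((x - x0) * (y - y0)) + R3' x y * ((y - y0) * (y - y0)))"
      using mult.IH(2) unfolding T_def by blast
    let ?f = "F x0 y0" and ?g = "G x0 y0"
    show ?case
    \<comment> \<open>In the product, a cubic term is assigned to one of the three quadratic
      monomials and its extra linear factor is absorbed into the coefficient.\<close>
    proof (rule TI[of "\<lambda>x y. R1 x y * G x y + ?f * R1' x y + \<alpha> * \<alpha>' + \<alpha> * (R1' x y * (x - x0) + R2' x y * (y - y0)) + \<beta> * (R1' x y * (y - y0))"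
          "\<lambda>x y. R2 x y * G x y + ?f * R2' x y + \<alpha> * \<beta>' + \<beta> * \<alpha>' + \<alpha> * (R3' x y * (y - y0)) + \<beta> * (R2' x y * (y - y0))"
          "\<lambda>x y. R3 x y * G x y + ?f * R3' x y + \<beta> * \<beta>' + \<beta> * (R3' x y * (y - y0))" _ "\<alpha> * ?g + ?f * \<alpha>'" "\<beta> * ?g + ?f * \<beta>'"])
      fix x y
      define u v where "u = x - x0" and "v = y - y0"
      have F': "F x y = ?f + \<alpha> * u + \<beta> * v + (R1 x y * (u * u) + R2 x y * (u * v) + R3 x y * (v * v))"
        using F(4)[of x y] by (simp only: u_def v_def)
      have G': "G x y = ?g + \<alpha>' * u + \<beta>' * v + (R1' x y * (u * u) + R2' x y * (u * v) + R3' x y * (v * v))"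
        using G(4)[of x y] by (simp only: u_def v_def)
      have "F x y * G x y = (?f + \<alpha> * u + \<beta> * v) * G x y + (R1 x y * (u * u) + R2 x y * (u * v) + R3 x y * (v * v)) * G x y"
        by (subst F') (simp only: distrib_right)
      also have "(?f + \<alpha> * u + \<beta> * v) * G x y =
        (?f + \<alpha> * u + \<beta> * v) * (?g + \<alpha>' * u + \<beta>' * v + (R1' x y * (u * u) + R2' x y * (u * v) + R3' x y * (v * v)))"
        by (subst G') (rule refl)
      finally show "F x y * G x y = ?f * ?g + (\<alpha> * ?g + ?f * \<alpha>') * (x - x0) + (\<beta> * ?g + ?f * \<beta>') * (y - y0) +
        ((R1 x y * G x y + ?f * R1' x y + \<alpha> * \<alpha>' + \<alpha> * (R1' x y * (x - x0) + R2' x y * (y - y0)) + \<beta> * (R1' x y * (y - y0))) * ((x - x0) * (x - x0)) +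
         (R2 x y * G x y + ?f * R2' x y + \<alpha> * \<beta>' + \<beta> * \<alpha>' + \<alpha> * (R3' x y * (y - y0)) + \<beta> * (R2' x y * (y - y0))) * ((x - x0) * (y - y0)) +
         (R3 x y * G x y + ?f * R3' x y + \<beta> * \<beta>' + \<beta> * (R3' x y * (y - y0))) * ((y - y0) * (y - y0)))"
        unfolding u_def[symmetric] v_def[symmetric] by (simp add: algebra_simps)
    qed (intro poly2_intros F G mult)+
  qed
  then show thesis
    unfolding T_def using that by blast
qed

section \<open>The double points are ordinary nodes\<close>

text \<open>Four times \<open>(y - t ^ n) * (y - t' ^ n)\<close>, with the square completed. As a
  difference of squares it shows the two tangents \<open>2 y - S \<plusminus> A sqrt D\<close> at a
  root of \<open>A\<close>.\<close>

definition feq :: "complex \<Rightarrow> complex \<Rightarrow> complex" where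
  "feq x y = (2 * y - poly Sp x)\<^sup>2 - (poly (Ap n) x)\<^sup>2 * poly Dp x"

lemma feq_poly2: "feq \<in> poly2"
  unfolding feq_def[abs_def] by (intro poly2_intros)

lemma feq_curve:
  assumes "t \<noteq> - cnj a"
  shows "feq (xx t) (t ^ n) = 0"
proof -
  note cp = conj_pair_tt[OF assms]
  have "2 * t ^ n - poly Sp (xx t) = poly (Ap n) (xx t) * (t - tt t)"
    unfolding conj_pair_n(2)[OF cp, symmetric] conj_pair_power_diff[OF cp, symmetric] by simp
  then show ?thesis
    unfolding feq_def conj_pair_n(3)[OF cp, symmetric] by (simp add: power_mult_distrib)
qed

text \<open>Division in \<open>y\<close> is possible over the polynomials in \<open>x\<close>
  because the leading coefficient of \<open>feq\<close> in \<open>y\<close> is the constant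
  4.\<close>

lemma poly2_division:
  assumes "F \<in> poly2"
  obtains R \<alpha> \<beta> where "R \<in> poly2" "\<And>x y. F x y = feq x y * R x y + poly \<alpha> x + poly \<beta> x * y"
proof -
  define T where "T F \<longleftrightarrow> (\<exists>R\<in>poly2. \<exists>\<alpha> \<beta>. \<forall>x y. F x y = feq x y * R x y + poly \<alpha> x + poly \<beta> x * y)"
    for F :: "complex \<Rightarrow> complex \<Rightarrow> complex"
  have TI: "T F" if "R \<in> poly2" "\<And>x y. F x y = feq x y * R x y + poly \<alpha> x + poly \<beta> x * y" for F R \<alpha> \<beta>
    unfolding T_def using that by blast
  have "T F"
    using assms
  proof induction
    case (const c)
    show ?case by (rule TI[of "\<lambda>_ _. 0" _ "[:c:]" 0]) (auto intro: poly2_intros)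
  next
    case fst
    show ?case by (rule TI[of "\<lambda>_ _. 0" _ "[:0, 1:]" 0]) (auto intro: poly2_intros)
  next
    case snd
    show ?case by (rule TI[of "\<lambda>_ _. 0" _ 0 1]) (auto intro: poly2_intros)
  next
    case (add F G)
    obtain R \<alpha> \<beta> where F: "R \<in> poly2" "\<And>x y. F x y = feq x y * R x y + poly \<alpha> x + poly \<beta> x * y"
      using add.IH(1) unfolding T_def by blast
    obtain R' \<alpha>' \<beta>' where G: "R' \<in> poly2" "\<And>x y. G x y = feq x y * R' x y + poly \<alpha>' x + poly \<beta>' x * y"
      using add.IH(2) unfolding T_def by blast
    show ?case
      by (rule TI[of "\<lambda>x y. R x y + R' x y" _ "\<alpha> + \<alpha>'" "\<beta> + \<beta>'"])
        (auto intro: poly2_intros F(1) G(1) simp: F(2) G(2) algebra_simps)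
  next
    case (mult F G)
    obtain R \<alpha> \<beta> where F: "R \<in> poly2" "\<And>x y. F x y = feq x y * R x y + poly \<alpha> x + poly \<beta> x * y"
      using mult.IH(1) unfolding T_def by blast
    obtain R' \<alpha>' \<beta>' where G: "R' \<in> poly2" "\<And>x y. G x y = feq x y * R' x y + poly \<alpha>' x + poly \<beta>' x * y"
      using mult.IH(2) unfolding T_def by blast
    define C where "C = smult (1/4) (Sp\<^sup>2 - (Ap n)\<^sup>2 * Dp)"
    have y2: "y * y = feq x y / 4 + poly Sp x * y - poly C x" for x y
      by (simp add: feq_def C_def power2_eq_square field_simps)
    show ?case
    proof (rule TI[of "\<lambda>x y. R x y * G x y + (poly \<alpha> x + poly \<beta> x * y) * R' x y + (1/4) * poly (\<beta> * \<beta>') x" _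
          "\<alpha> * \<alpha>' - \<beta> * \<beta>' * C" "\<alpha> * \<beta>' + \<beta> * \<alpha>' + \<beta> * \<beta>' * Sp"])
      show "(\<lambda>x y. R x y * G x y + (poly \<alpha> x + poly \<beta> x * y) * R' x y + (1/4) * poly (\<beta> * \<beta>') x) \<in> poly2"
        by (intro poly2_intros F(1) G(1) mult)
      fix x y
      define r where "r = poly \<alpha> x + poly \<beta> x * y"
      have "F x y * G x y = feq x y * (R x y * G x y) + r * G x y"
        unfolding F(2)[of x y] r_def by (simp add: algebra_simps)
      also have "r * G x y = feq x y * (r * R' x y) + r * (poly \<alpha>' x + poly \<beta>' x * y)"
        unfolding G(2)[of x y] by (simp add: algebra_simps)
      also have "r * (poly \<alpha>' x + poly \<beta>' x * y) =
        poly \<alpha> x * poly \<alpha>' x + (poly \<alpha> x * poly \<beta>' x + poly \<beta> x * poly \<alpha>' x) * y +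
        poly \<beta> x * poly \<beta>' x * (feq x y / 4 + poly Sp x * y - poly C x)"
        unfolding y2[symmetric] by (simp add: r_def algebra_simps)
      finally show "F x y * G x y = feq x y * (R x y * G x y + (poly \<alpha> x + poly \<beta> x * y) * R' x y + (1/4) * poly (\<beta> * \<beta>') x) +
        poly (\<alpha> * \<alpha>' - \<beta> * \<beta>' * C) x + poly (\<alpha> * \<beta>' + \<beta> * \<alpha>' + \<beta> * \<beta>' * Sp) x * y"
        unfolding r_def[symmetric] by (simp add: algebra_simps)
    qed
  qed
  then show thesis
    unfolding T_def using that by blast
qed

lemma Dp_nonzero: "Dp \<noteq> 0"
proof -
  have "poly Dp 0 = (of_real b / a)\<^sup>2"
    by (simp add: Dp_def sp_def pp_def)
  then show ?thesis
    using a0 b_pos by auto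
qed

text \<open>The remainder \<open>\<alpha> + \<beta> y\<close> vanishes at both points over each
  \<open>x\<close>, so \<open>\<beta> A (t - t') = 0\<close>. Squaring turns this into the
  polynomial identity \<open>\<beta>\<^sup>2 A\<^sup>2 D = 0\<close>, and \<open>A\<close> and
  \<open>D\<close> are non-zero. Thus \<open>feq\<close> generates the ideal of the curve.\<close>

lemma poly2_vanishing:
  assumes "F \<in> poly2" "\<forall>\<^sub>F t in cofinite. F (xx t) (t ^ n) = 0"
  obtains R where "R \<in> poly2" "\<And>x y. F x y = feq x y * R x y"
proof -
  obtain R \<alpha> \<beta> where R: "R \<in> poly2" "\<And>x y. F x y = feq x y * R x y + poly \<alpha> x + poly \<beta> x * y"
    using poly2_division[OF assms(1)] by blast
  have ev: "\<forall>\<^sub>F t in cofinite. poly \<alpha> (xx t) + poly \<beta> (xx t) * t ^ n = 0"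
    using assms(2) eventually_cofinite_neq[of "- cnj a"]
    by eventually_elim (simp add: R(2) feq_curve)
  have zero: "poly \<alpha> (xx t) + poly \<beta> (xx t) * t ^ n = 0" if "t \<noteq> - cnj a" for t
  proof -
    have "(\<lambda>t. poly \<alpha> (xx t) + poly \<beta> (xx t) * t ^ n) \<in> reg_at t"
      by (intro reg_at_add reg_at_mult reg_at_power reg_at_id xx_reg(2) that)
    from reg_at_eqI[OF this reg_at_const[of 0]] ev show ?thesis
      by simp
  qed
  have bx: "poly (\<beta>\<^sup>2 * (Ap n)\<^sup>2 * Dp) x = 0" for x
  proof -
    obtain t t' where cp: "conj_pair x t t'"
      using conj_pair_ex by blast
    have "poly \<alpha> x + poly \<beta> x * t ^ n = 0" "poly \<alpha> x + poly \<beta> x * t' ^ n = 0"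
      using zero[of t] zero[of t'] conj_pair_xx[OF cp] conj_pair_xx[OF conj_pair_sym[OF cp]] by auto
    then have "poly \<beta> x * (t ^ n - t' ^ n) = 0"
      by (simp add: right_diff_distrib add_eq_0_iff)
    then have "poly \<beta> x * (poly (Ap n) x * (t - t')) = 0"
      unfolding conj_pair_power_diff[OF cp] .
    then have "(poly \<beta> x * (poly (Ap n) x * (t - t')))\<^sup>2 = 0"
      by simp
    then show ?thesis
      by (simp add: power_mult_distrib conj_pair_n(3)[OF cp] mult.assoc del: power_eq_0_iff)
  qed
  then have "\<beta>\<^sup>2 * (Ap n)\<^sup>2 * Dp = 0"
    by (intro poly_eqI_cofinite) simp
  then have b: "\<beta> = 0"
    using Ap_nonzero Dp_nonzero by simp
  have "poly \<alpha> x = 0" for x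
  proof -
    obtain t t' where cp: "conj_pair x t t'"
      using conj_pair_ex by blast
    then show ?thesis
      using zero[of t] conj_pair_xx[OF cp] b by simp
  qed
  then show thesis
    using that[OF R(1)] R(2) b by simp
qed

subsection \<open>Restriction to lines\<close>

text \<open>Affine lines upstairs serve as test curves through a point of the quotient; derivatives
  along them detect linear independence in the cotangent space.\<close>

definition aline :: "complex \<Rightarrow> complex \<Rightarrow> complex \<Rightarrow> complex \<Rightarrow> complex \<Rightarrow> P1 \<times> P1" where
  "aline \<zeta> \<eta> l m s = (Aff (\<zeta> + l * s), Aff (\<eta> + m * s))"

lemma aline_poly:
  assumes "F \<in> BF d e"
  obtains P where "\<And>s. at_Q F (aline \<zeta> \<eta> l m s) = poly P s"
proof -
  have "polynomial_fun (\<lambda>s. F (1, \<zeta> + l * s) (1, \<eta> + m * s))"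
    by (intro polynomial_fun_BF[OF assms]; unfold fst_conv snd_conv;
      intro polynomial_fun_add polynomial_fun_mult polynomial_fun_const polynomial_fun_id)
  then show thesis
    using that unfolding polynomial_fun_def at_Q_def aline_def by auto
qed

lemma aline_cont:
  assumes "openin zar_Q W" "aline \<zeta> \<eta> l m 0 \<in> W"
  shows "\<forall>\<^sub>F s in cofinite. aline \<zeta> \<eta> l m s \<in> W"
proof -
  obtain d e F where F: "F \<in> BF d e" "at_Q F (aline \<zeta> \<eta> l m 0) \<noteq> 0" "\<And>x. at_Q F x \<noteq> 0 \<Longrightarrow> x \<in> W"
    using zar_Q_basis[OF assms] by metis
  obtain P where P: "\<And>s. at_Q F (aline \<zeta> \<eta> l m s) = poly P s"
    using aline_poly[OF F(1)] by metis
  have "P \<noteq> 0"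
    using F(2) P[of 0] by auto
  then have "\<forall>\<^sub>F s in cofinite. poly P s \<noteq> 0"
    by (rule eventually_poly_nonzero)
  then show ?thesis
    by eventually_elim (use F(3) P in simp)
qed

lemma aline_reg:
  assumes "g \<in> germs (Q_quot n) (Phi n (aline \<zeta> \<eta> l m 0))"
  shows "(\<lambda>s. g (Phi n (aline \<zeta> \<eta> l m s))) \<in> reg_at 0"
proof -
  have "g \<circ> Phi n \<in> germs Q_space (aline \<zeta> \<eta> l m 0)"
    using assms unfolding germs_quot_iff by blast
  then obtain V d e F G where V: "F \<in> BF d e" "G \<in> BF d e" "openin zar_Q V" "aline \<zeta> \<eta> l m 0 \<in> V"
    "\<And>x. x \<in> V \<Longrightarrow> at_Q G x \<noteq> 0 \<and> g (Phi n x) = at_Q F x / at_Q G x"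
    unfolding germs_Q_iff by fastforce
  obtain P where P: "\<And>s. at_Q F (aline \<zeta> \<eta> l m s) = poly P s"
    using aline_poly[OF V(1)] by metis
  obtain H where H: "\<And>s. at_Q G (aline \<zeta> \<eta> l m s) = poly H s"
    using aline_poly[OF V(2)] by metis
  have "\<forall>\<^sub>F s in cofinite. g (Phi n (aline \<zeta> \<eta> l m s)) = poly P s / poly H s"
    using aline_cont[OF V(3,4)] by eventually_elim (use V(5) P H in simp)
  then show ?thesis
    using V(5)[OF V(4)] P H by (intro reg_atI[of H _ _ P]) simp_all
qed

text \<open>A product of two germs vanishing at the point acquires two factors \<open>s\<close>
  along the line, so elements of the square have no first-order term.\<close>

lemma aline_square:
  assumes F: "F \<in> max_ideal_power (Q_quot n) (Phi n (aline \<zeta> \<eta> l m 0)) 2"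
  obtains \<psi> where "\<psi> \<in> reg_at 0" "\<forall>\<^sub>F s in cofinite. F (Phi n (aline \<zeta> \<eta> l m s)) = s * s * \<psi> s"
proof -
  let ?p = "Phi n (aline \<zeta> \<eta> l m 0)" and ?a = "\<lambda>s. Phi n (aline \<zeta> \<eta> l m s)"
  obtain r c g where c: "\<And>i. i < r \<Longrightarrow> c i \<in> germs (Q_quot n) ?p"
    and g: "\<And>i j. i < r \<Longrightarrow> j < (2::nat) \<Longrightarrow> g i j \<in> max_ideal (Q_quot n) ?p"
    and eq: "germ_eq (Q_quot n) ?p F (\<lambda>x. \<Sum>i<(r::nat). c i x * (\<Prod>j<2. g i j x))"
    using max_ideal_powerE[OF F] by blast
  have "\<exists>\<psi>. \<psi> \<in> reg_at 0 \<and> (\<forall>s. g i j (?a s) = s * \<psi> s)" if ij: "i < r" "j < 2" for i j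
  proof -
    have "(\<lambda>s. g i j (?a s)) \<in> reg_at 0" "g i j (?a 0) = 0"
      using g[OF ij] aline_reg by (auto simp: max_ideal_def)
    then show ?thesis
      using reg_at_factor[of "\<lambda>s. g i j (?a s)" 0] by auto
  qed
  then obtain \<psi> where \<psi>: "\<And>i j. i < r \<Longrightarrow> j < (2::nat) \<Longrightarrow> \<psi> i j \<in> reg_at 0"
    "\<And>i j s. i < r \<Longrightarrow> j < 2 \<Longrightarrow> g i j (?a s) = s * \<psi> i j s"
    by metis
  have c': "(\<lambda>s. c i (?a s)) \<in> reg_at 0" if "i < r" for i
    by (rule aline_reg[OF c[OF that]])
  obtain W where W: "openin (zar_quot n) W" "?p \<in> W" "\<forall>x\<in>W. F x = (\<Sum>i<r. c i x * (\<Prod>j<2. g i j x))"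
    using eq unfolding germ_eq_def eventually_nhdsin by (auto simp: topspace_zar_quot)
  have "\<forall>\<^sub>F s in cofinite. aline \<zeta> \<eta> l m s \<in> Phi n -` W"
    using W by (intro aline_cont) (auto simp: openin_zar_quot)
  then have ev: "\<forall>\<^sub>F s in cofinite. F (?a s) = s * s * (\<Sum>i<r. c i (?a s) * (\<psi> i 0 s * \<psi> i 1 s))"
  proof eventually_elim
    case (elim s)
    then have "F (?a s) = (\<Sum>i<r. c i (?a s) * (\<Prod>j<2. g i j (?a s)))"
      using W(3) by blast
    also have "\<dots> = s * s * (\<Sum>i<r. c i (?a s) * (\<psi> i 0 s * \<psi> i 1 s))"
      unfolding sum_distrib_left by (intro sum.cong refl) (simp add: \<psi>(2) numeral_2_eq_2)
    finally show ?case .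
  qed
  show thesis
    by (rule that[OF _ ev]) (use c' \<psi>(1) in \<open>intro reg_at_sum reg_at_mult; simp\<close>)
qed

subsection \<open>The node\<close>

text \<open>The point is off the fixed points, so \<open>x\<close> and \<open>y\<close> give local
  coordinates on the quotient. The tangents are \<open>2 y - S \<plusminus> d A\<close> with
  \<open>d\<close> a square root of \<open>D(x0)\<close>; they are independent since
  \<open>d\<close> is non-zero and \<open>A\<close> has a simple root.\<close>

lemma ordinary_node_double:
  assumes t0: "t0 \<in> T1" and A0: "poly (Ap n) (xx t0) = 0"
  shows "ordinary_node (Q_quot n) (Phi n ` Ct) (Phi n (\<gamma> t0))"
proof -
  let ?S = "Q_quot n"
  define p where "p = Phi n (\<gamma> t0)"
  define x0 where "x0 = xx t0"
  define y0 where "y0 = t0 ^ n"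
  have t0': "t0 \<noteq> - cnj a" "t0 \<noteq> 0"
    using t0 by (auto simp: T1_def)
  have q: "\<gamma> t0 \<in> O1"
    by (rule \<gamma>_O1[OF t0])
  have c0: "cx (\<gamma> t0) = x0" "cy (\<gamma> t0) = y0"
    using c_\<gamma> t0 by (simp_all add: x0_def y0_def)
  have Xp: "X p = x0" "Y p = y0"
    using c0 by (simp_all add: p_def)
  have ring: "ring_at ?S p"
    by (rule ring_at_quot) (simp add: p_def)
  have pO: "openin (zar_quot n) (Phi n ` O1)" "p \<in> Phi n ` O1"
    using O1_quot_open q by (simp_all add: p_def)
  note cp = conj_pair_tt[OF t0'(1), folded x0_def]
  note tt = tt_double[OF t0 A0]
  have A0': "poly (Ap n) x0 = 0"
    using A0 by (simp add: x0_def)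
  obtain A1 where A1: "Ap n = [:- x0, 1:] * A1" "poly A1 x0 \<noteq> 0"
    using Ap_simple_root[OF A0'] .
  have "poly (Sp - [:poly Sp x0:]) x0 = 0"
    by simp
  then obtain S1 where S1': "Sp - [:poly Sp x0:] = [:- x0, 1:] * S1"
    unfolding poly_eq_0_iff_dvd by (elim dvdE)
  have S1: "poly Sp x - poly Sp x0 = (x - x0) * poly S1 x" for x
  proof -
    have "poly Sp x - poly Sp x0 = poly (Sp - [:poly Sp x0:]) x"
      by simp
    also have "\<dots> = (x - x0) * poly S1 x"
      unfolding S1' by (simp add: algebra_simps)
    finally show ?thesis .
  qed
  have Sy: "poly Sp x0 = 2 * y0"
    using conj_pair_n(2)[OF cp] tt(4) by (simp add: y0_def)
  define d where "d = csqrt (poly Dp x0)"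
  have d2: "d\<^sup>2 = poly Dp x0"
    by (simp add: d_def)
  \<comment> \<open>\<open>d\<close> squares to \<open>(t0 - t')\<^sup>2\<close> for the two
    branches \<open>t0\<close>, \<open>t'\<close>, and these are distinct.\<close>
  have d0: "d \<noteq> 0"
    using d2 conj_pair_n(3)[OF cp] tt(2) by auto

  have gm: "(\<lambda>p. F (X p) (Y p)) \<in> germs ?S p" if "F \<in> poly2" for F
    unfolding p_def by (rule poly2_germ_quot[OF that q])
  have mi: "(\<lambda>p. F (X p) (Y p)) \<in> max_ideal ?S p" if "F \<in> poly2" "F x0 y0 = 0" for F
    using gm[OF that(1)] that(2) by (simp add: max_ideal_def Xp)
  define u v where "u p = X p - x0" and "v p = Y p - y0" for p
  have u: "u \<in> max_ideal ?S p"
    unfolding u_def[abs_def] by (rule mi[of "\<lambda>x y. x - x0"]) (intro poly2_intros, simp)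
  have v: "v \<in> max_ideal ?S p"
    unfolding v_def[abs_def] by (rule mi[of "\<lambda>x y. y - y0"]) (intro poly2_intros, simp)
  note m2 = max_ideal_power_add[OF ring] max_ideal_power_cmult[OF ring] max_ideal_power_mult[OF ring]
    max_ideal_power_2[OF ring]
  have geqI: "germ_eq ?S p f g" if V: "openin (zar_quot n) V" "p \<in> V" and eq: "\<And>x. Phi n x \<in> V \<Longrightarrow> f (Phi n x) = g (Phi n x)" for V and f g :: "_ \<Rightarrow> complex"
  proof -
    have "f x = g x" if x: "x \<in> V" for x
    proof -
      have "V \<subseteq> range (Phi n)"
        using openin_subset[OF V(1)] by (simp add: topspace_zar_quot)
      then obtain w where "x = Phi n w"
        using x by blast
      then show ?thesis
        using eq[of w] x by simp
    qed
    then show ?thesis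
      unfolding germ_eq_def eventually_nhdsin using V by auto
  qed

  have linear: "\<exists>\<alpha> \<beta>. (\<lambda>p. f p - (\<alpha> * u p + \<beta> * v p)) \<in> max_ideal_power ?S p 2" if f: "f \<in> max_ideal ?S p" for f
  proof -
    have "f \<in> germs ?S (Phi n (\<gamma> t0))" "f p = 0"
      using f by (auto simp: max_ideal_def p_def)
    then obtain G H V where GH: "G \<in> poly2" "H \<in> poly2" "H (cx (\<gamma> t0)) (cy (\<gamma> t0)) \<noteq> 0"
      "openin (zar_quot n) V" "p \<in> V"
      "\<And>x. Phi n x \<in> V \<Longrightarrow> x \<in> O1 \<and> H (cx x) (cy x) \<noteq> 0 \<and> f (Phi n x) = G (cx x) (cy x) / H (cx x) (cy x)"
      using germ_in_invariants[OF _ q, of f] unfolding p_def by blast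
    define h0 where "h0 = H x0 y0"
    have h0: "h0 \<noteq> 0"
      using GH(3) by (simp add: h0_def c0)
    have "G x0 y0 = 0"
      using GH(6)[of "\<gamma> t0"] GH(5) \<open>f p = 0\<close> h0 by (simp add: p_def c0 h0_def)
    obtain \<alpha> \<beta> R1 R2 R3 where R: "R1 \<in> poly2" "R2 \<in> poly2" "R3 \<in> poly2"
      and T0: "\<And>x y. G x y = G x0 y0 + \<alpha> * (x - x0) + \<beta> * (y - y0) +
      (R1 x y * ((x - x0) * (x - x0)) + R2 x y * ((x - x0) * (y - y0)) + R3 x y * ((y - y0) * (y - y0)))"
      using poly2_taylor[OF GH(1), of x0 y0] by metis
    have T: "G (X p) (Y p) = (\<alpha> * u p + \<beta> * v p) +
      (R1 (X p) (Y p) * (u p * u p) + R2 (X p) (Y p) * (u p * v p) + R3 (X p) (Y p) * (v p * v p))" for p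
      using T0[of "X p" "Y p"] \<open>G x0 y0 = 0\<close> by (simp add: u_def v_def)
    have Q: "(\<lambda>p. R1 (X p) (Y p) * (u p * u p) + R2 (X p) (Y p) * (u p * v p) + R3 (X p) (Y p) * (v p * v p)) \<in> max_ideal_power ?S p 2"
      by (intro m2 gm R u v)
    have hd: "(\<lambda>p. h0 - H (X p) (Y p)) \<in> max_ideal ?S p"
      by (rule mi[of "\<lambda>x y. h0 - H x y"]) (intro poly2_intros GH, simp add: h0_def)
    have lin: "(\<lambda>p. \<alpha> * u p + \<beta> * v p) \<in> max_ideal ?S p"
      by (rule max_ideal_lin[OF ring u v])
    have "(\<lambda>p. inverse (h0 * H (X p) (Y p))) \<in> germs ?S p"
    proof (rule germs_quot_inverse)
      show "(\<lambda>p. h0 * H (X p) (Y p)) \<in> germs ?S p"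
        by (rule gm) (intro poly2_intros GH)
      show "h0 * H (X p) (Y p) \<noteq> 0"
        using h0 by (simp add: Xp h0_def)
    qed
    \<comment> \<open>For \<open>f = G / H\<close> and \<open>G = \<alpha> u + \<beta> v + q\<close>
      with quadratic remainder \<open>q\<close>, this expression is \<open>f\<close> minus its
      linear part divided by \<open>h0\<close>. Its second summand is a product of two vanishing
      germs.\<close>
    then have N: "(\<lambda>p. inverse (h0 * H (X p) (Y p)) *
      (h0 * (R1 (X p) (Y p) * (u p * u p) + R2 (X p) (Y p) * (u p * v p) + R3 (X p) (Y p) * (v p * v p)) +
       (\<alpha> * u p + \<beta> * v p) * (h0 - H (X p) (Y p)))) \<in> max_ideal_power ?S p 2"
      by (intro m2(3) m2(1) m2(2)[OF Q] m2(4) hd lin)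
    have "(\<lambda>p. f p - (\<alpha> / h0 * u p + \<beta> / h0 * v p)) \<in> max_ideal_power ?S p 2"
    proof (rule max_ideal_power_cong[OF ring N geqI[OF GH(4,5)]])
      fix x assume "Phi n x \<in> V"
      then have Hx: "H (cx x) (cy x) \<noteq> 0" and fx: "f (Phi n x) = G (X (Phi n x)) (Y (Phi n x)) / H (cx x) (cy x)"
        using GH(6) by auto
      have alg: "inverse (h0 * h) * (h0 * q + (\<alpha> * s + \<beta> * t) * (h0 - h)) = (\<alpha> * s + \<beta> * t + q) / h - (\<alpha> / h0 * s + \<beta> / h0 * t)"
        if "h \<noteq> 0" for h q s t
        using that h0 by (simp add: field_simps)
      show "inverse (h0 * H (X (Phi n x)) (Y (Phi n x))) *
      (h0 * (R1 (X (Phi n x)) (Y (Phi n x)) * (u (Phi n x) * u (Phi n x)) + R2 (X (Phi n x)) (Y (Phi n x)) * (u (Phi n x) * v (Phi n x)) + R3 (X (Phi n x)) (Y (Phi n x)) * (v (Phi n x) * v (Phi n x))) +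
       (\<alpha> * u (Phi n x) + \<beta> * v (Phi n x)) * (h0 - H (X (Phi n x)) (Y (Phi n x)))) =
       f (Phi n x) - (\<alpha> / h0 * u (Phi n x) + \<beta> / h0 * v (Phi n x))"
        unfolding fx X_Phi Y_Phi T[of "Phi n x", unfolded X_Phi Y_Phi] by (rule alg[OF Hx])
    qed
    then show ?thesis
      by blast
  qed

  \<comment> \<open>The two tangent factors. Freezing \<open>sqrt D\<close> at its value in
    \<open>x0\<close> changes their product only in third order, because it is multiplied by
    \<open>A\<close>.\<close>
  define \<tau> where "\<tau> i p = 2 * Y p - poly Sp (X p) + (if i = 0 then - d else d) * poly (Ap n) (X p)" for i :: nat and p
  have \<tau>: "\<tau> i \<in> max_ideal ?S p" for i
    unfolding \<tau>_def[abs_def]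
    by (rule mi[of "\<lambda>x y. 2 * y - poly Sp x + (if i = 0 then - d else d) * poly (Ap n) x"])
      (intro poly2_intros, simp add: Sy A0')
  \<comment> \<open>From \<open>\<tau> 1 - \<tau> 0 = 2 d A\<close> and
    \<open>A = (x - x0) A1\<close>: to first order \<open>x - x0\<close> is \<open>k\<close> times
    this difference.\<close>
  define k where "k = 1 / (2 * d * poly A1 x0)"
  have e1: "(\<lambda>p. u p - k * (\<tau> 1 p - \<tau> 0 p)) \<in> max_ideal_power ?S p 2"
  proof -
    have "(\<lambda>p. poly A1 x0 - poly A1 (X p)) \<in> max_ideal ?S p"
      by (rule mi[of "\<lambda>x y. poly A1 x0 - poly A1 x"]) (intro poly2_intros, simp)
    then have "(\<lambda>p. (1 / poly A1 x0) * (u p * (poly A1 x0 - poly A1 (X p)))) \<in> max_ideal_power ?S p 2"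
      by (intro m2(2) m2(4) u)
    moreover have "(1 / poly A1 x0) * (u p * (poly A1 x0 - poly A1 (X p))) = u p - k * (\<tau> 1 p - \<tau> 0 p)" for p
    proof -
      have "\<tau> 1 p - \<tau> 0 p = 2 * d * (u p * poly A1 (X p))"
        by (simp add: \<tau>_def A1(1) u_def algebra_simps)
      then show ?thesis
        using A1(2) d0 by (simp add: k_def field_simps)
    qed
    ultimately show ?thesis
      by simp
  qed
  \<comment> \<open>Half the derivative of \<open>S\<close> at \<open>x0\<close>, since
    \<open>y - y0 = (\<tau> 0 + \<tau> 1) / 4 + (S(x) - S(x0)) / 2\<close>.\<close>
  define s where "s = poly S1 x0 / 2"
  have e2: "(\<lambda>p. v p - ((1/4) * (\<tau> 0 p + \<tau> 1 p) + s * k * (\<tau> 1 p - \<tau> 0 p))) \<in> max_ideal_power ?S p 2"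
  proof -
    have "(\<lambda>p. poly S1 (X p) - poly S1 x0) \<in> max_ideal ?S p"
      by (rule mi[of "\<lambda>x y. poly S1 x - poly S1 x0"]) (intro poly2_intros, simp)
    then have "(\<lambda>p. (1/2) * (u p * (poly S1 (X p) - poly S1 x0)) + s * (u p - k * (\<tau> 1 p - \<tau> 0 p))) \<in> max_ideal_power ?S p 2"
      by (intro m2(1) m2(2) m2(4) u e1)
    moreover have "(1/2) * (u p * (poly S1 (X p) - poly S1 x0)) + s * (u p - k * (\<tau> 1 p - \<tau> 0 p)) =
      v p - ((1/4) * (\<tau> 0 p + \<tau> 1 p) + s * k * (\<tau> 1 p - \<tau> 0 p))" for p
    proof -
      have t: "(1/4) * (\<tau> 0 p + \<tau> 1 p) = Y p - poly Sp (X p) / 2"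
        by (simp add: \<tau>_def field_simps)
      have "u p * poly S1 (X p) = poly Sp (X p) - 2 * y0"
        using S1[of "X p"] by (simp add: u_def Sy)
      then have w: "(1/2) * (u p * (poly S1 (X p) - poly S1 x0)) = poly Sp (X p) / 2 - y0 - s * u p"
        by (simp add: s_def right_diff_distrib diff_divide_distrib)
      show ?thesis
        unfolding t w v_def by (simp add: right_diff_distrib)
    qed
    ultimately show ?thesis
      by simp
  qed
  have exist: "\<exists>c0 c1. (\<lambda>p. f p - (c0 * \<tau> 0 p + c1 * \<tau> 1 p)) \<in> max_ideal_power ?S p 2" if f: "f \<in> max_ideal ?S p" for f
  proof -
    obtain \<alpha> \<beta> where ab: "(\<lambda>p. f p - (\<alpha> * u p + \<beta> * v p)) \<in> max_ideal_power ?S p 2"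
      using linear[OF f] by blast
    have "(\<lambda>p. (f p - (\<alpha> * u p + \<beta> * v p)) + (\<alpha> * (u p - k * (\<tau> 1 p - \<tau> 0 p)) +
      \<beta> * (v p - ((1/4) * (\<tau> 0 p + \<tau> 1 p) + s * k * (\<tau> 1 p - \<tau> 0 p))))) \<in> max_ideal_power ?S p 2"
      by (intro m2(1) m2(2) ab e1 e2)
    moreover have "(f p - (\<alpha> * u p + \<beta> * v p)) + (\<alpha> * (u p - k * (\<tau> 1 p - \<tau> 0 p)) +
      \<beta> * (v p - ((1/4) * (\<tau> 0 p + \<tau> 1 p) + s * k * (\<tau> 1 p - \<tau> 0 p)))) =
      f p - ((\<beta> / 4 - \<alpha> * k - \<beta> * s * k) * \<tau> 0 p + (\<beta> / 4 + \<alpha> * k + \<beta> * s * k) * \<tau> 1 p)" for p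
      by (simp add: algebra_simps)
    ultimately have "(\<lambda>p. f p - ((\<beta> / 4 - \<alpha> * k - \<beta> * s * k) * \<tau> 0 p + (\<beta> / 4 + \<alpha> * k + \<beta> * s * k) * \<tau> 1 p)) \<in> max_ideal_power ?S p 2"
      by (simp only:)
    then have "\<exists>c1. (\<lambda>p. f p - ((\<beta> / 4 - \<alpha> * k - \<beta> * s * k) * \<tau> 0 p + c1 * \<tau> 1 p)) \<in> max_ideal_power ?S p 2"
      by (rule exI)
    then show ?thesis
      by (rule exI)
  qed

  have indep: "c0 = 0 \<and> c1 = 0" if c: "(\<lambda>p. c0 * \<tau> 0 p + c1 * \<tau> 1 p) \<in> max_ideal_power ?S p 2" for c0 c1
  proof -
    \<comment> \<open>The derivative of the combination along the line with direction
      \<open>(l, m)\<close>. There \<open>\<zeta> \<eta>\<close> has derivative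
      \<open>l * mm t0 + m * t0\<close> and \<open>\<zeta> ^ n\<close> has derivative
      \<open>n * t0 ^ (n - 1) * l\<close>.\<close>
    have deriv: "(c0 + c1) * (2 * (of_nat n * t0 ^ (n - 1) * l) - poly (pderiv Sp) x0 * (l * mm t0 + m * t0)) +
      (c1 - c0) * d * (poly A1 x0 * (l * mm t0 + m * t0)) = 0" for l m
    proof -
      have p: "p = Phi n (aline t0 (mm t0) l m 0)"
        by (simp add: p_def \<gamma>_Aff[OF t0'(1)] aline_def)
      have c': "(\<lambda>p. c0 * \<tau> 0 p + c1 * \<tau> 1 p) \<in> max_ideal_power ?S (Phi n (aline t0 (mm t0) l m 0)) 2"
        using c by (simp only: p)
      obtain \<psi> where \<psi>: "\<psi> \<in> reg_at 0"
        "\<forall>\<^sub>F r in cofinite. c0 * \<tau> 0 (Phi n (aline t0 (mm t0) l m r)) + c1 * \<tau> 1 (Phi n (aline t0 (mm t0) l m r)) = r * r * \<psi> r"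
        using c' aline_square[of "\<lambda>p. c0 * \<tau> 0 p + c1 * \<tau> 1 p"] by blast
      define Z E where "Z = [:t0, l:]" and "E = [:mm t0, m:]"
      define T where "T = smult (c0 + c1) (smult 2 (Z ^ n) - pcompose Sp (Z * E)) + smult ((c1 - c0) * d) (pcompose (Ap n) (Z * E))"
      have T: "c0 * \<tau> 0 (Phi n (aline t0 (mm t0) l m r)) + c1 * \<tau> 1 (Phi n (aline t0 (mm t0) l m r)) = poly T r" for r
        by (simp add: T_def \<tau>_def aline_def cx_def cy_def Z_def E_def poly_pcompose algebra_simps)
      have ZE: "t0 * mm t0 = x0" "mm t0 * t0 = x0"
        by (simp_all add: x0_def xx_def)
      have "poly T 0 = 0"
        by (simp add: T_def Z_def E_def poly_pcompose ZE Sy A0' y0_def)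
      then obtain T1' where T1': "T = [:0, 1:] * T1'"
        by (auto simp: poly_eq_0_iff_dvd)
      have "\<forall>\<^sub>F r in cofinite. poly T1' r = r * \<psi> r"
        using \<psi>(2) eventually_cofinite_neq[of 0]
      proof eventually_elim
        case (elim r)
        then have "r * poly T1' r = r * (r * \<psi> r)"
          unfolding T T1' by simp
        then show ?case
          using elim(2) by simp
      qed
      then have "poly T1' 0 = 0"
        using reg_at_eqI[OF reg_at_poly reg_at_mult[OF reg_at_id \<psi>(1)]] by fastforce
      then have "poly (pderiv T) 0 = 0"
        unfolding T1' by (simp add: pderiv_mult pderiv_pCons)
      moreover have "poly (pderiv (Ap n)) x0 = poly A1 x0"
        unfolding A1(1) pderiv_mult by (simp add: pderiv_pCons)
      moreover have "poly (pderiv (Z ^ n)) 0 = of_nat n * t0 ^ (n - 1) * l"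
        using n0 by (cases n) (simp_all add: pderiv_power_Suc Z_def pderiv_pCons del: power_Suc)
      ultimately show ?thesis
        by (simp add: T_def pderiv_add pderiv_diff pderiv_smult pderiv_pcompose pderiv_mult poly_pcompose Z_def E_def
            pderiv_pCons ZE mult_ac)
    qed
    \<comment> \<open>Along this direction \<open>x\<close> is stationary to first order while
      \<open>y\<close> moves.\<close>
    have "(c0 + c1) * (2 * (of_nat n * t0 ^ (n - 1))) = 0"
      using deriv[of 1 "- mm t0 / t0"] t0'(2) by simp
    then have sum: "c0 + c1 = 0"
      using t0'(2) n0 by simp
    \<comment> \<open>Along this direction \<open>y\<close> is constant and \<open>x\<close> has
      derivative 1.\<close>
    then have "(c1 - c0) * d * poly A1 x0 = 0"
      using deriv[of 0 "1 / t0"] t0'(2) by simp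
    then have "c1 - c0 = 0"
      using d0 A1(2) by simp
    then show ?thesis
      using sum by simp
  qed

  have basis: "cotangent_basis ?S p 2 \<tau>"
    unfolding cotangent_basis_def
  proof (intro conjI allI impI ballI)
    show "\<tau> i \<in> max_ideal ?S p" for i
      by (rule \<tau>)
    fix f assume f: "f \<in> max_ideal ?S p"
    obtain c0 c1 where c: "(\<lambda>p. f p - (c0 * \<tau> 0 p + c1 * \<tau> 1 p)) \<in> max_ideal_power ?S p 2"
      using exist[OF f] by blast
    have sum2: "(\<Sum>i<(2::nat). c i * \<tau> i p) = c 0 * \<tau> 0 p + c 1 * \<tau> 1 p" for c p
      by (simp add: numeral_2_eq_2)
    let ?e = "\<lambda>i\<in>{..<2::nat}. if i = 0 then c0 else c1"
    show "\<exists>!c. c \<in> {..<2::nat} \<rightarrow>\<^sub>E UNIV \<and> (\<lambda>x. f x - (\<Sum>i<2. c i * \<tau> i x)) \<in> max_ideal_power ?S p 2"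
      unfolding sum2
    proof (rule ex1I[of _ "\<lambda>i\<in>{..<2}. if i = 0 then c0 else c1"])
      show "?e \<in> {..<2} \<rightarrow>\<^sub>E UNIV \<and>
        (\<lambda>x. f x - ((?e 0) * \<tau> 0 x + (?e 1) * \<tau> 1 x)) \<in> max_ideal_power ?S p 2"
        using c by simp
      fix e :: "nat \<Rightarrow> complex" assume e: "e \<in> {..<2} \<rightarrow>\<^sub>E UNIV \<and> (\<lambda>x. f x - (e 0 * \<tau> 0 x + e 1 * \<tau> 1 x)) \<in> max_ideal_power ?S p 2"
      have "(\<lambda>x. (f x - (e 0 * \<tau> 0 x + e 1 * \<tau> 1 x)) + (-1) * (f x - (c0 * \<tau> 0 x + c1 * \<tau> 1 x))) \<in> max_ideal_power ?S p 2"
        by (rule m2(1)[OF conjunct2[OF e] m2(2)[OF c]])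
      moreover have "(f x - (e 0 * \<tau> 0 x + e 1 * \<tau> 1 x)) + (-1) * (f x - (c0 * \<tau> 0 x + c1 * \<tau> 1 x)) =
        (c0 - e 0) * \<tau> 0 x + (c1 - e 1) * \<tau> 1 x" for x
        by (simp add: algebra_simps)
      ultimately have "(\<lambda>x. (c0 - e 0) * \<tau> 0 x + (c1 - e 1) * \<tau> 1 x) \<in> max_ideal_power ?S p 2"
        by (simp only:)
      then have "c0 - e 0 = 0 \<and> c1 - e 1 = 0"
        by (rule indep)
      then have "e 0 = c0" "e 1 = c1"
        by auto
      then show "e = ?e"
        using e by (intro PiE_ext[of e "{..<2}" "\<lambda>_. UNIV"]) (auto simp: less_2_cases_iff)
    qed
  qed

  define f where "f p = feq (X p) (Y p)" for p
  have fg: "f \<in> germs ?S p"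
    unfolding f_def[abs_def] by (rule gm[OF feq_poly2])
  have fC: "f p' = 0" if p1: "p' \<in> Phi n ` O1" and p2: "p' \<in> Phi n ` Ct" for p'
  proof -
    obtain r where r: "r \<in> Ct" "p' = Phi n r"
      using p2 by blast
    then have "r \<in> O1"
      using p1 by simp
    then obtain t where t: "t \<in> T1" "r = \<gamma> t"
      using Ct_O1 r(1) by blast
    then show ?thesis
      using feq_curve[of t] by (simp add: f_def r(2) c_\<gamma> T1_def)
  qed
  \<comment> \<open>For a germ vanishing on the curve, the numerator in \<open>x\<close> and
    \<open>y\<close> vanishes at almost all parameters and is therefore a multiple of
    \<open>feq\<close>; the denominator is invertible at \<open>p\<close>.\<close>
  have ideal: "(\<forall>\<^sub>F q in nhdsin (zar ?S) p. q \<in> Phi n ` Ct \<longrightarrow> g q = 0) \<longleftrightarrow>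
      (\<exists>h\<in>germs ?S p. germ_eq ?S p g (\<lambda>q. h q * f q))" if g: "g \<in> germs ?S p" for g
  proof
    assume "\<exists>h\<in>germs ?S p. germ_eq ?S p g (\<lambda>q. h q * f q)"
    then obtain h where "\<forall>\<^sub>F q in nhdsin (zar ?S) p. g q = h q * f q"
      unfolding germ_eq_def by blast
    moreover have "\<forall>\<^sub>F q in nhdsin (zar ?S) p. q \<in> Phi n ` O1"
      unfolding eventually_nhdsin using pO by auto
    ultimately show "\<forall>\<^sub>F q in nhdsin (zar ?S) p. q \<in> Phi n ` Ct \<longrightarrow> g q = 0"
      by eventually_elim (use fC in auto)
  next
    assume "\<forall>\<^sub>F q in nhdsin (zar ?S) p. q \<in> Phi n ` Ct \<longrightarrow> g q = 0"
    then obtain W where W: "openin (zar_quot n) W" "p \<in> W" "\<forall>q\<in>W. q \<in> Phi n ` Ct \<longrightarrow> g q = 0"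
      unfolding eventually_nhdsin by (auto simp: p_def topspace_zar_quot)
    obtain G H V where GH: "G \<in> poly2" "H \<in> poly2" "H (cx (\<gamma> t0)) (cy (\<gamma> t0)) \<noteq> 0"
      "openin (zar_quot n) V" "p \<in> V"
      "\<And>x. Phi n x \<in> V \<Longrightarrow> x \<in> O1 \<and> H (cx x) (cy x) \<noteq> 0 \<and> g (Phi n x) = G (cx x) (cy x) / H (cx x) (cy x)"
      using germ_in_invariants[OF _ q, of g] g unfolding p_def by blast
    have "openin zar_Q (Phi n -` (V \<inter> W))" "\<gamma> t0 \<in> Phi n -` (V \<inter> W)"
      using openin_Int[OF GH(4) W(1)] GH(5) W(2) by (auto simp: openin_zar_quot p_def)
    then have "\<forall>\<^sub>F t in cofinite. \<gamma> t \<in> Phi n -` (V \<inter> W)"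
      unfolding \<gamma>_def by (rule \<delta>_cont[OF det2_\<gamma>])
    then have "\<forall>\<^sub>F t in cofinite. G (xx t) (t ^ n) = 0"
      using eventually_cofinite_neq[of 0] eventually_cofinite_neq[of "- cnj a"]
    proof eventually_elim
      case (elim t)
      then have "t \<in> T1"
        by (simp add: T1_def)
      moreover have "g (Phi n (\<gamma> t)) = 0"
        using W(3) elim \<gamma>_Ct[of t] by auto
      ultimately show ?case
        using GH(6)[of "\<gamma> t"] elim by (simp add: c_\<gamma>) blast
    qed
    then obtain R where R: "R \<in> poly2" "\<And>x y. G x y = feq x y * R x y"
      using poly2_vanishing[OF GH(1)] by blast
    show "\<exists>h\<in>germs ?S p. germ_eq ?S p g (\<lambda>q. h q * f q)"
    proof
      show "(\<lambda>p. R (X p) (Y p) / H (X p) (Y p)) \<in> germs ?S p"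
        unfolding p_def by (rule ratio_germ_quot[OF R(1) GH(2) q GH(3)])
      show "germ_eq ?S p g (\<lambda>q. R (X q) (Y q) / H (X q) (Y q) * f q)"
      proof (rule geqI[OF GH(4,5)])
        fix x assume "Phi n x \<in> V"
        then have "g (Phi n x) = G (cx x) (cy x) / H (cx x) (cy x)"
          using GH(6) by blast
        then show "g (Phi n x) = R (X (Phi n x)) (Y (Phi n x)) / H (X (Phi n x)) (Y (Phi n x)) * f (Phi n x)"
          by (simp add: f_def R(2))
      qed
    qed
  qed
  \<comment> \<open>The error \<open>f - \<tau> 0 * \<tau> 1\<close> is
    \<open>A\<^sup>2 (D(x0) - D)\<close>, a product of three germs vanishing at
    \<open>p\<close>.\<close>
  have "(\<lambda>p. poly (Ap n) (X p)) \<in> max_ideal ?S p"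
    by (rule mi[of "\<lambda>x y. poly (Ap n) x"]) (intro poly2_intros, simp add: A0')
  moreover have "(\<lambda>p. poly Dp x0 - poly Dp (X p)) \<in> max_ideal ?S p"
    by (rule mi[of "\<lambda>x y. poly Dp x0 - poly Dp x"]) (intro poly2_intros, simp)
  ultimately have "(\<lambda>p. poly (Ap n) (X p) * poly (Ap n) (X p) * (poly Dp x0 - poly Dp (X p))) \<in> max_ideal_power ?S p 3"
    by (intro max_ideal_power_3[OF ring])
  moreover have "poly (Ap n) (X p) * poly (Ap n) (X p) * (poly Dp x0 - poly Dp (X p)) = f p - \<tau> 0 p * \<tau> 1 p" for p
    unfolding d2[symmetric] by (simp add: f_def feq_def \<tau>_def power2_eq_square algebra_simps)
  ultimately have lead: "(\<lambda>p. f p - \<tau> 0 p * \<tau> 1 p) \<in> max_ideal_power ?S p 3"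
    by simp
  have "p \<in> Phi n ` Ct"
    using \<gamma>_Ct by (simp add: p_def)
  then show ?thesis
    unfolding ordinary_node_def p_def[symmetric] using basis fg ideal lead by blast
qed

end

section \<open>The projective line\<close>

lemma topspace_zar_P1 [simp]: "topspace zar_P1 = UNIV"
proof -
  have "UNIV = {p. form 0 (\<lambda>_. 1) (hom p) \<noteq> 0}"
    by (simp add: form_def)
  then have "UNIV \<in> {{p. form d c (hom p) \<noteq> 0} | d c. True}"
    by blast
  then show ?thesis
    unfolding zar_P1_def topology_generated_by_topspace by blast
qed

lemma openin_form: "openin zar_P1 {p. form d c (hom p) \<noteq> 0}"
  unfolding zar_P1_def by (rule topology_generated_by_Basis) blast

lemma closedin_zar_P1_point: "closedin zar_P1 {p}"
proof -
  define c where "c = (\<lambda>i::nat. if i = 0 then snd (hom p) else - fst (hom p))"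
  have "form 1 c (hom q) = 0 \<longleftrightarrow> q = p" for q
    using pt_eq_iff[OF hom_nonzero hom_nonzero, of q p] by (simp add: form_def c_def mult.commute)
  then have "topspace zar_P1 - {p} = {q. form 1 c (hom q) \<noteq> 0}"
    by auto
  then show ?thesis
    using openin_form[of 1 c] by (simp add: closedin_def)
qed

lemma form_poly:
  obtains P where "\<And>t. form d c (hom (Aff t)) = poly P t"
proof -
  have "polynomial_fun (\<lambda>t. form d c (hom (Aff t)))"
    unfolding form_def by (auto intro!: polynomial_fun_sum polynomial_fun_mult polynomial_fun_power)
  then show thesis
    using that unfolding polynomial_fun_def by blast
qed

lemma zar_P1_cont:
  assumes "openin zar_P1 W" "Aff t \<in> W"
  shows "\<forall>\<^sub>F u in cofinite. Aff u \<in> W"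
proof -
  have "generate_topology_on {{p. form d c (hom p) \<noteq> 0} | d c. True} W"
    using assms(1) unfolding zar_P1_def by (simp add: openin_topology_generated_by_iff)
  then have "Aff t \<in> W \<longrightarrow> (\<forall>\<^sub>F u in cofinite. Aff u \<in> W)"
  proof induction
    case (Int A B)
    then show ?case
      by (auto intro: eventually_conj)
  next
    case (UN K)
    show ?case
    proof
      assume "Aff t \<in> \<Union> K"
      then obtain A where A: "A \<in> K" "Aff t \<in> A"
        by blast
      then have "\<forall>\<^sub>F u in cofinite. Aff u \<in> A"
        using UN.IH by blast
      then show "\<forall>\<^sub>F u in cofinite. Aff u \<in> \<Union> K"
        by (rule eventually_mono) (use A in blast)
    qed
  next
    case (Basis A)
    then obtain d c where A: "A = {p. form d c (hom p) \<noteq> 0}"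
      by blast
    obtain P where P: "\<And>t. form d c (hom (Aff t)) = poly P t"
      using form_poly by blast
    have mem: "Aff u \<in> A \<longleftrightarrow> poly P u \<noteq> 0" for u
      unfolding A mem_Collect_eq P ..
    show ?case
    proof
      assume "Aff t \<in> A"
      then have "P \<noteq> 0"
        unfolding mem by auto
      then show "\<forall>\<^sub>F u in cofinite. Aff u \<in> A"
        unfolding mem by (rule eventually_poly_nonzero)
    qed
  qed auto
  then show ?thesis
    using assms(2) by blast
qed

lemma sections_P1:
  "f \<in> sections P1_space U \<longleftrightarrow> (\<forall>p\<in>U. \<exists>W d c c'. openin zar_P1 W \<and> p \<in> W \<and> W \<subseteq> U \<and>
        (\<forall>x\<in>W. form d c' (hom x) \<noteq> 0 \<and> f x = form d c (hom x) / form d c' (hom x)))"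
  by (simp add: P1_space_def)

lemma zar_P1_space [simp]: "zar P1_space = zar_P1"
  by (simp add: P1_space_def)

lemma restricts_P1: "restricts P1_space"
  unfolding restricts_def
proof (intro allI impI)
  fix W W' f
  assume A: "openin (zar P1_space) W \<and> openin (zar P1_space) W' \<and> W' \<subseteq> W \<and> f \<in> sections P1_space W"
  show "f \<in> sections P1_space W'"
    unfolding sections_P1
  proof
    fix p assume p: "p \<in> W'"
    with A have "p \<in> W" "f \<in> sections P1_space W"
      by auto
    then obtain V d c c' where "openin zar_P1 V" "p \<in> V"
      "\<forall>x\<in>V. form d c' (hom x) \<noteq> 0 \<and> f x = form d c (hom x) / form d c' (hom x)"
      unfolding sections_P1 by meson
    with A p have "openin zar_P1 (V \<inter> W') \<and> p \<in> V \<inter> W' \<and> V \<inter> W' \<subseteq> W' \<and>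
        (\<forall>x\<in>V \<inter> W'. form d c' (hom x) \<noteq> 0 \<and> f x = form d c (hom x) / form d c' (hom x))"
      by auto
    then show "\<exists>W d c c'. openin zar_P1 W \<and> p \<in> W \<and> W \<subseteq> W' \<and>
        (\<forall>x\<in>W. form d c' (hom x) \<noteq> 0 \<and> f x = form d c (hom x) / form d c' (hom x))"
      by blast
  qed
qed

lemma form_coeff:
  assumes "degree P \<le> d"
  shows "form d (coeff P) (hom (Aff t)) = poly P t"
  unfolding form_def poly_altdef using assms
  by (intro sum.mono_neutral_cong_right) (auto simp: coeff_eq_0)

lemma param_curve_P1:
  assumes T: "finite (- T)"
  shows "param_curve (sub P1_space (Aff ` T)) T Aff"
proof (rule param_curve_subI)
  show "restricts P1_space"
    by (rule restricts_P1)
  show "finite (- T)"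
    by (rule T)
  show "Aff ` T \<subseteq> topspace (zar P1_space)"
    by simp
  show "finite {t \<in> T. Aff t = p}" for p
  proof -
    have "{t \<in> T. Aff t = p} \<subseteq> {snd (hom p)}"
      by auto
    then show ?thesis
      by (rule finite_subset) simp
  qed
  show "\<forall>\<^sub>F u in cofinite. Aff u \<in> W" if "openin (zar P1_space) W" "Aff t \<in> W" for W t
    using zar_P1_cont that by simp
  show "closedin (zar P1_space) {p}" for p
    by (simp add: closedin_zar_P1_point)
  show "g \<circ> Aff \<in> reg_at t" if W: "openin (zar P1_space) W" "g \<in> sections P1_space W" "Aff t \<in> W" for W g t
  proof -
    obtain V d c c' where V: "openin zar_P1 V" "Aff t \<in> V"
      "\<forall>x\<in>V. form d c' (hom x) \<noteq> 0 \<and> g x = form d c (hom x) / form d c' (hom x)"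
      using W(2,3) unfolding sections_P1 by meson
    obtain P where P: "\<And>t. form d c (hom (Aff t)) = poly P t"
      using form_poly by blast
    obtain H where H: "\<And>t. form d c' (hom (Aff t)) = poly H t"
      using form_poly by blast
    have eq: "poly H u \<noteq> 0 \<and> (g \<circ> Aff) u = poly P u / poly H u" if "Aff u \<in> V" for u
      using V(3)[rule_format, OF that] unfolding P H by simp
    have "\<forall>\<^sub>F u in cofinite. (g \<circ> Aff) u = poly P u / poly H u"
      using zar_P1_cont[OF V(1,2)] by (rule eventually_mono) (use eq in blast)
    then show ?thesis
      using eq[OF V(2)] by (intro reg_atI[of H _ _ P]) auto
  qed
  fix f t assume t: "t \<in> T" and f: "\<And>u. u \<in> T \<Longrightarrow> Aff u = Aff t \<Longrightarrow> f \<circ> Aff \<in> reg_at u"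
  obtain P H where PH: "poly H t \<noteq> 0" "(f \<circ> Aff) t = poly P t / poly H t"
    "\<forall>\<^sub>F u in cofinite. poly H u \<noteq> 0 \<and> (f \<circ> Aff) u = poly P u / poly H u"
    using reg_atE[OF f[OF t refl]] .
  define d where "d = max (degree P) (degree H)"
  have F: "form d (coeff P) (hom (Aff u)) = poly P u" "form d (coeff H) (hom (Aff u)) = poly H u" for u
    by (rule form_coeff; simp add: d_def)+
  let ?W = "{p. form d (coeff H) (hom p) \<noteq> 0}" and ?g = "\<lambda>p. form d (coeff P) (hom p) / form d (coeff H) (hom p)"
  show "\<exists>W g. openin (zar P1_space) W \<and> Aff t \<in> W \<and> g \<in> sections P1_space W \<and> f (Aff t) = g (Aff t) \<and>
            (\<forall>\<^sub>F u in cofinite. u \<in> T \<longrightarrow> Aff u \<in> W \<longrightarrow> f (Aff u) = g (Aff u))"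
  proof (intro exI[of _ ?W] exI[of _ ?g] conjI)
    show op: "openin (zar P1_space) ?W"
      using openin_form by simp
    show "Aff t \<in> ?W"
      unfolding mem_Collect_eq F by (rule PH(1))
    show "?g \<in> sections P1_space ?W"
      unfolding sections_P1
      by (rule ballI, rule exI[of _ ?W], rule exI[of _ d], rule exI[of _ "coeff P"], rule exI[of _ "coeff H"])
        (use op in auto)
    show "f (Aff t) = ?g (Aff t)"
      unfolding F using PH(2) by simp
    show "\<forall>\<^sub>F u in cofinite. u \<in> T \<longrightarrow> Aff u \<in> ?W \<longrightarrow> f (Aff u) = ?g (Aff u)"
      unfolding F using PH(3) by eventually_elim simp
  qed
qed

lemma param_curve_image: "param_curve X T \<delta> \<Longrightarrow> topspace (zar X) = \<delta> ` T"
  unfolding param_curve_def by (elim conjE) (rule sym)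

lemma cofinite_topology_subtopology:
  assumes S: "S \<subseteq> topspace Z" and open_cofinite: "\<And>V. openin Z V \<Longrightarrow> V \<inter> S \<noteq> {} \<Longrightarrow> finite (S - V)"
    and pt: "\<And>p. p \<in> S \<Longrightarrow> closedin Z {p}"
  shows "cofinite_topology (subtopology Z S)"
  unfolding cofinite_topology_def
proof (intro allI iffI)
  have top: "topspace (subtopology Z S) = S"
    using S by auto
  fix W
  {
    assume "openin (subtopology Z S) W"
    then obtain V where V: "openin Z V" "W = V \<inter> S"
      unfolding openin_subtopology by blast
    then have "S - W = S - V"
      by blast
    then show "W \<subseteq> topspace (subtopology Z S) \<and> (W = {} \<or> finite (topspace (subtopology Z S) - W))"
      using open_cofinite[OF V(1)] V(2) unfolding top by auto
  next
    assume W: "W \<subseteq> topspace (subtopology Z S) \<and> (W = {} \<or> finite (topspace (subtopology Z S) - W))"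
    show "openin (subtopology Z S) W"
    proof (cases "W = {}")
      case False
      then have fin: "finite (S - W)"
        using W unfolding top by blast
      have "closedin Z (\<Union>p\<in>S - W. {p})"
        using fin pt by (intro closedin_Union) auto
      then have "openin Z (topspace Z - (S - W))"
        by auto
      moreover have "W = (topspace Z - (S - W)) \<inter> S"
        using W S unfolding top by blast
      ultimately show ?thesis
        unfolding openin_subtopology by blast
    qed simp
  }
qed

context hyperbola
begin

section \<open>Two charts covering the curve\<close>

definition Tdbl :: "complex set" where "Tdbl = {t \<in> T1. poly (Ap n) (xx t) = 0}"

text \<open>The omitted point of this parameter is the double point \<open>tk 1\<close>, so the
  chart reaches every simple point, including \<open>\<zeta> = \<infinity>\<close> at parameter 0.
  This needs \<open>n \<ge> 2\<close>, which makes \<open>tk 1\<close> a double point.\<close>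

definition \<delta>2 :: "complex \<Rightarrow> P1 \<times> P1" where "\<delta>2 = \<delta> (0, 1) (1, tk 1)"

definition T2 :: "complex set" where "T2 = {u. \<delta>2 u \<notin> \<gamma> ` Tdbl}"

definition C :: "(P1 \<times> P1) set set" where "C = Phi n ` Ct"

lemma det2_\<delta>2: "det2 (0, 1) (1, tk 1) \<noteq> 0"
  by (simp add: det2_def)

lemma finite_Tdbl: "finite Tdbl"
proof -
  have "0 \<noteq> - cnj a"
    using a0 by simp
  then have reg: "(\<lambda>t. poly (Ap n) (xx t)) \<in> reg_at 0"
    by (rule xx_reg(2))
  obtain k where k: "n = Suc k"
    using n0 gr0_implies_Suc by blast
  have "poly (Ap n) (xx 0) \<noteq> 0"
    unfolding k using Ap_at_0[of k] b_pos a0 by (simp add: xx_def del: Ap.simps)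
  then have "\<forall>\<^sub>F t in cofinite. poly (Ap n) (xx t) \<noteq> 0"
    using reg_at_zero_or_nonzero[OF reg] reg_at_eqI[OF reg reg_at_const[of 0]] by blast
  then have "finite {t. poly (Ap n) (xx t) = 0}"
    by (simp add: eventually_cofinite)
  then show ?thesis
    by (rule rev_finite_subset) (auto simp: Tdbl_def)
qed

lemma finite_T2: "finite (- T2)"
proof -
  have "- T2 = \<delta>2 -` (\<gamma> ` Tdbl)"
    by (auto simp: T2_def)
  then show ?thesis
    using finite_Tdbl \<delta>_inj[OF det2_\<delta>2] by (simp add: finite_vimageI \<delta>2_def)
qed

lemma tk1_Tdbl: "tk 1 \<in> Tdbl"
  using tk_T1 Ap_root[of 1] n2 by (simp add: Tdbl_def xx_tk)

lemma \<gamma>_image: "\<gamma> ` T1 = O1 \<inter> Ct"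
  using \<gamma>_O1 \<gamma>_Ct Ct_O1 by blast

lemma \<delta>2_image: "\<delta>2 ` T2 = (UNIV - \<gamma> ` Tdbl) \<inter> Ct"
proof (intro set_eqI iffI)
  fix q assume "q \<in> \<delta>2 ` T2"
  then show "q \<in> (UNIV - \<gamma> ` Tdbl) \<inter> Ct"
    using \<delta>_Ct[OF det2_\<delta>2] by (auto simp: T2_def \<delta>2_def)
next
  fix q assume q: "q \<in> (UNIV - \<gamma> ` Tdbl) \<inter> Ct"
  have "fst q \<noteq> pt (1, tk 1)"
  proof
    assume eq: "fst q = pt (1, tk 1)"
    have t1: "tk 1 \<noteq> - cnj a"
      using tk_T1 by (simp add: T1_def)
    have "fst (\<gamma> (tk 1)) = fst q"
      unfolding \<gamma>_Aff[OF t1] eq by (simp add: pt_def)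
    moreover have "snd r = pt (M (hom (fst r)))" if "r \<in> Ct" for r
      using that Ct_iff[of "fst r" "snd r"] by simp
    ultimately have "q = \<gamma> (tk 1)"
      using q \<gamma>_Ct by (metis IntD2 prod_eqI)
    then show False
      using q tk1_Tdbl by blast
  qed
  then obtain u where "q = \<delta>2 u"
    using Ct_\<delta>[OF det2_\<delta>2] q unfolding \<delta>2_def by blast
  then show "q \<in> \<delta>2 ` T2"
    using q by (auto simp: T2_def)
qed

lemma finite_closed_Q: "finite F \<Longrightarrow> openin zar_Q (UNIV - F)"
proof -
  assume "finite F"
  then have "closedin zar_Q (\<Union>q\<in>F. {q})"
    using closedin_zar_Q_point by (intro closedin_Union) auto
  then show ?thesis
    by (simp add: closedin_def)
qed

lemma simple_T2:
  assumes "u \<in> T2" "0 < k" "k < n"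
  shows "act (root1 n ^ k) (\<delta>2 u) \<notin> Ct"
proof
  assume "act (root1 n ^ k) (\<delta>2 u) \<in> Ct"
  then obtain t where "t \<in> T1" "\<delta>2 u = \<gamma> t" "poly (Ap n) (xx t) = 0"
    using double_point_iff[of "\<delta>2 u"] \<delta>_Ct[OF det2_\<delta>2] assms(2,3) unfolding \<delta>2_def by blast
  then show False
    using assms(1) by (auto simp: T2_def Tdbl_def)
qed

lemma upstairs1: "param_curve (sub (sub Q_space Ct) (\<gamma> ` T1)) T1 \<gamma>"
  using param_curve_sub_sub[OF restricts_Q] param_curve_upstairs[OF det2_\<gamma> finite_T1]
  unfolding \<gamma>_def[symmetric] \<gamma>_image by (metis inf_le2)

lemma upstairs2: "param_curve (sub (sub Q_space Ct) (\<delta>2 ` T2)) T2 \<delta>2"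
  using param_curve_sub_sub[OF restricts_Q] param_curve_upstairs[OF det2_\<delta>2 finite_T2]
  unfolding \<delta>2_def[symmetric] \<delta>2_image by (metis inf_le2)

lemma downstairs1: "param_curve (sub (sub (Q_quot n) C) ((Phi n \<circ> \<gamma>) ` T1)) T1 (Phi n \<circ> \<gamma>)"
  by (rule param_curve_sub_sub[OF restricts_Q_quot _ param_curve_chart1]) (use \<gamma>_Ct in \<open>auto simp: C_def\<close>)

lemma downstairs2': "param_curve (sub (Q_quot n) ((Phi n \<circ> \<delta>2) ` T2)) T2 (Phi n \<circ> \<delta>2)"
  unfolding \<delta>2_def by (rule param_curve_downstairs[OF det2_\<delta>2 finite_T2], fold \<delta>2_def) (rule simple_T2)

lemma downstairs2: "param_curve (sub (sub (Q_quot n) C) ((Phi n \<circ> \<delta>2) ` T2)) T2 (Phi n \<circ> \<delta>2)"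
proof (rule param_curve_sub_sub[OF restricts_Q_quot _ downstairs2'])
  show "(Phi n \<circ> \<delta>2) ` T2 \<subseteq> C"
    using \<delta>2_image by (auto simp: C_def)
qed

lemma inj_\<gamma>: "inj_on \<gamma> T1"
  using \<delta>_inj[OF det2_\<gamma>] unfolding \<gamma>_def[symmetric] by (rule inj_on_subset) simp

lemma inj_\<delta>2: "inj_on \<delta>2 T2"
  using \<delta>_inj[OF det2_\<delta>2] unfolding \<delta>2_def[symmetric] by (rule inj_on_subset) simp

text \<open>A non-trivial rotation would take a simple point to another point of the curve, which
  \<open>simple_T2\<close> excludes.\<close>

lemma Phi_\<delta>2_eq:
  assumes "u \<in> T2" "q \<in> Ct" "Phi n (\<delta>2 u) = Phi n q"
  shows "q = \<delta>2 u"
proof -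
  obtain k where k: "k < n" "q = act (root1 n ^ k) (\<delta>2 u)"
    using assms(3) Phi_eq_iff[OF n0] by blast
  then have "k = 0"
    using simple_T2[OF assms(1), of k] assms(2) by (metis gr0I)
  then show ?thesis
    using k(2) by simp
qed

lemma inj_Phi_\<delta>2: "inj_on (Phi n \<circ> \<delta>2) T2"
proof (rule inj_onI)
  fix s u assume su: "s \<in> T2" "u \<in> T2" "(Phi n \<circ> \<delta>2) s = (Phi n \<circ> \<delta>2) u"
  have "\<delta>2 u \<in> Ct"
    using \<delta>2_image su(2) by blast
  then have "\<delta>2 u = \<delta>2 s"
    using Phi_\<delta>2_eq[OF su(1)] su(3) by simp
  then show "s = u"
    using inj_\<delta>2 su(1,2) by (simp add: inj_on_def)
qed

lemma cover: "Ct = \<gamma> ` T1 \<union> \<delta>2 ` T2"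
proof -
  have "\<gamma> ` Tdbl \<subseteq> \<gamma> ` T1"
    by (auto simp: Tdbl_def)
  then show ?thesis
    unfolding \<delta>2_image using \<gamma>_Ct by blast
qed

text \<open>Each parameter sees all of the curve except one point, and an open set met by the
  parametrisation contains its values at almost all parameters.\<close>

lemma Ct_minus_finite:
  assumes "openin zar_Q W" "W \<inter> Ct \<noteq> {}"
  shows "finite (Ct - W)"
proof -
  have chart: "finite (Ct - W)" if d: "det2 v v' \<noteq> 0" and t: "\<delta> v v' t \<in> W" for v v' t
  proof -
    have "finite {u. \<delta> v v' u \<notin> W}"
      using \<delta>_cont[OF d assms(1) t] by (simp add: eventually_cofinite)
    then have "finite (\<delta> v v' ` {u. \<delta> v v' u \<notin> W} \<union> {(pt v', pt (M (hom (pt v'))))})"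
      by simp
    moreover have "Ct - W \<subseteq> \<delta> v v' ` {u. \<delta> v v' u \<notin> W} \<union> {(pt v', pt (M (hom (pt v'))))}"
    proof
      fix q assume q: "q \<in> Ct - W"
      show "q \<in> \<delta> v v' ` {u. \<delta> v v' u \<notin> W} \<union> {(pt v', pt (M (hom (pt v'))))}"
      proof (cases "fst q = pt v'")
        case True
        then show ?thesis
          using q Ct_iff[of "fst q" "snd q"] by (metis DiffD1 UnI2 insertI1 prod.collapse)
      next
        case False
        then obtain u where "q = \<delta> v v' u"
          using Ct_\<delta>[OF d] q by blast
        then show ?thesis
          using q by blast
      qed
    qed
    ultimately show ?thesis
      by (rule rev_finite_subset)
  qed
  obtain q where "q \<in> W" "q \<in> \<gamma> ` T1 \<union> \<delta>2 ` T2"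
    using assms(2) cover by blast
  then show ?thesis
    using chart[OF det2_\<gamma>] chart[OF det2_\<delta>2] unfolding \<gamma>_def \<delta>2_def by blast
qed

lemma cofinite_up: "cofinite_topology (zar (sub Q_space Ct))"
  unfolding sub_def by (simp, rule cofinite_topology_subtopology) (simp_all add: Ct_minus_finite closedin_zar_Q_point)

lemma cofinite_down: "cofinite_topology (zar (sub (Q_quot n) C))"
proof -
  have "cofinite_topology (subtopology (zar_quot n) C)"
  proof (rule cofinite_topology_subtopology)
    show "C \<subseteq> topspace (zar_quot n)"
      by (auto simp: C_def topspace_zar_quot)
    show "closedin (zar_quot n) {p}" if p: "p \<in> C" for p
    proof -
      obtain q where "p = Phi n q"
        using p by (auto simp: C_def)
      then show ?thesis
        using closedin_zar_quot_finite[OF n0, of q] by simp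
    qed
    fix V assume V: "openin (zar_quot n) V" "V \<inter> C \<noteq> {}"
    then have "openin zar_Q (Phi n -` V)" "Phi n -` V \<inter> Ct \<noteq> {}"
      by (auto simp: openin_zar_quot C_def)
    then have "finite (Phi n ` (Ct - Phi n -` V))"
      using Ct_minus_finite by blast
    then show "finite (C - V)"
      by (rule rev_finite_subset) (auto simp: C_def)
  qed
  then show ?thesis
    by (simp add: sub_def)
qed

lemma topspace_up: "topspace (zar (sub Q_space Ct)) = Ct"
  by simp

lemma topspace_down: "topspace (zar (sub (Q_quot n) C)) = C"
  by (auto simp: topspace_zar_quot C_def)

lemma infinite_up: "infinite Ct"
proof -
  have "infinite (\<gamma> ` T1)"
    using param_curve_infinite[OF upstairs1] unfolding param_curve_image[OF upstairs1] .
  then show ?thesis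
    using cover infinite_Un by metis
qed

lemma infinite_down: "infinite C"
proof -
  have "infinite ((Phi n \<circ> \<gamma>) ` T1)"
    using param_curve_infinite[OF downstairs1] unfolding param_curve_image[OF downstairs1] .
  moreover have "(Phi n \<circ> \<gamma>) ` T1 \<subseteq> C"
    using \<gamma>_Ct by (auto simp: C_def)
  ultimately show ?thesis
    using infinite_super by blast
qed

text \<open>The preimage in \<open>Q\<close> is the union of the \<open>n\<close> translates of the
  curve upstairs, each the zero set of a form.\<close>

lemma closedin_C: "closedin (zar_quot n) C"
proof -
  have "x \<in> Phi n -` C \<longleftrightarrow> (\<exists>k<n. act (root1 n ^ k) x \<in> Ct)" for x
    using Phi_eq_iff[OF n0] unfolding C_def vimage_eq image_iff by metis
  moreover have "act (root1 n ^ k) x \<in> Ct \<longleftrightarrow> at_Q (rotform k L) x = 0" for k x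
    using at_Q_rotform[of 1 1 k x] L_BF unfolding Ct_def mem_Collect_eq by (metis mult_eq_0_iff)
  ultimately have "UNIV - Phi n -` C = (\<Inter>k\<in>{..<n}. {x. at_Q (rotform k L) x \<noteq> 0})"
    by blast
  moreover have "openin zar_Q (\<Inter>k\<in>{..<n}. {x. at_Q (rotform k L) x \<noteq> 0})"
    using n0 by (intro openin_INT2) (auto intro: openin_at_Q rotform_BF L_BF)
  moreover have "Phi n -` (range (Phi n) - C) = UNIV - Phi n -` C"
    by blast
  ultimately have "openin (zar_quot n) (range (Phi n) - C)"
    unfolding openin_zar_quot by auto
  then show ?thesis
    by (auto simp: closedin_def topspace_zar_quot C_def)
qed

lemma quot_open1: "openin (zar_quot n) (Phi n ` O1)" "Phi n ` O1 \<inter> C = (Phi n \<circ> \<gamma>) ` T1"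
proof -
  show "openin (zar_quot n) (Phi n ` O1)"
    by (rule O1_quot_open)
  show "Phi n ` O1 \<inter> C = (Phi n \<circ> \<gamma>) ` T1"
  proof (intro set_eqI iffI)
    fix p assume p: "p \<in> Phi n ` O1 \<inter> C"
    then obtain r where r: "r \<in> Ct" "p = Phi n r"
      by (auto simp: C_def)
    then have "r \<in> O1"
      using p by simp
    then show "p \<in> (Phi n \<circ> \<gamma>) ` T1"
      using r Ct_O1[of r] by auto
  next
    fix p assume "p \<in> (Phi n \<circ> \<gamma>) ` T1"
    then obtain t where "t \<in> T1" "p = Phi n (\<gamma> t)"
      by auto
    then show "p \<in> Phi n ` O1 \<inter> C"
      using \<gamma>_O1 \<gamma>_Ct unfolding C_def by blast
  qed
qed

definition N :: "(P1 \<times> P1) set set" where "N = Phi n ` \<gamma> ` Tdbl"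

lemma quot_open2: "openin (zar_quot n) (range (Phi n) - N)" "(range (Phi n) - N) \<inter> C = (Phi n \<circ> \<delta>2) ` T2"
proof -
  have "closedin (zar_quot n) (\<Union>p\<in>N. {p})"
    using finite_Tdbl closedin_zar_quot_finite[OF n0] by (intro closedin_Union) (auto simp: N_def)
  then show "openin (zar_quot n) (range (Phi n) - N)"
    by (simp add: closedin_def topspace_zar_quot)
  show "(range (Phi n) - N) \<inter> C = (Phi n \<circ> \<delta>2) ` T2"
  proof (intro set_eqI iffI)
    fix p assume p: "p \<in> (range (Phi n) - N) \<inter> C"
    then obtain q where q: "q \<in> Ct" "p = Phi n q"
      by (auto simp: C_def)
    then have "q \<notin> \<gamma> ` Tdbl"
      using p by (auto simp: N_def)
    then have "q \<in> \<delta>2 ` T2"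
      using q(1) unfolding \<delta>2_image by blast
    then show "p \<in> (Phi n \<circ> \<delta>2) ` T2"
      using q(2) by auto
  next
    fix p assume "p \<in> (Phi n \<circ> \<delta>2) ` T2"
    then obtain u where u: "u \<in> T2" "p = Phi n (\<delta>2 u)"
      by auto
    have "\<delta>2 u \<in> Ct"
      using \<delta>2_image u(1) by blast
    moreover have "p \<notin> N"
    proof
      assume "p \<in> N"
      then obtain t where t: "t \<in> Tdbl" "p = Phi n (\<gamma> t)"
        by (auto simp: N_def)
      have "Phi n (\<delta>2 u) = Phi n (\<gamma> t)"
        unfolding u(2)[symmetric] t(2)[symmetric] ..
      then have eq: "\<gamma> t = \<delta>2 u"
        by (rule Phi_\<delta>2_eq[OF u(1) \<gamma>_Ct])
      have "\<gamma> t \<in> \<gamma> ` Tdbl"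
        using t(1) by (rule imageI)
      then show False
        using u(1) unfolding T2_def mem_Collect_eq eq by blast
    qed
    ultimately show "p \<in> (range (Phi n) - N) \<inter> C"
      using u(2) by (auto simp: C_def)
  qed
qed

lemma cover_down: "C = (Phi n \<circ> \<gamma>) ` T1 \<union> (Phi n \<circ> \<delta>2) ` T2"
  unfolding C_def by (subst cover) (simp add: image_Un image_comp)

section \<open>The normalization\<close>

text \<open>Normality is local, and both charts upstairs are injectively parametrised, also at the
  points that \<open>Phi n\<close> identifies in pairs.\<close>

lemma normal_up:
  assumes "p \<in> Ct"
  shows "normal_at (sub Q_space Ct) p"
proof -
  consider t where "t \<in> T1" "p = \<gamma> t" | u where "u \<in> T2" "p = \<delta>2 u"
    using assms cover by blast
  then show ?thesis
  proof cases
    case 1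
    have "normal_at (sub (sub Q_space Ct) (\<gamma> ` T1)) p"
      unfolding 1(2) by (rule normal_at_param_curve[OF upstairs1 inj_\<gamma> 1(1)])
    then show ?thesis
      using normal_at_sub_open[OF restricts_Q, of O1 p Ct "\<gamma> ` T1"] O1_open \<gamma>_image \<gamma>_O1[OF 1(1)] 1(2) by simp
  next
    case 2
    have "normal_at (sub (sub Q_space Ct) (\<delta>2 ` T2)) p"
      unfolding 2(2) by (rule normal_at_param_curve[OF upstairs2 inj_\<delta>2 2(1)])
    moreover have "p \<in> UNIV - \<gamma> ` Tdbl"
      using 2 by (simp add: T2_def)
    ultimately show ?thesis
      using normal_at_sub_open[OF restricts_Q, of "UNIV - \<gamma> ` Tdbl" p Ct "\<delta>2 ` T2"]
        finite_closed_Q[OF finite_imageI[OF finite_Tdbl]] \<delta>2_image by simp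
  qed
qed

lemma preimage1: "{x \<in> topspace (zar (sub Q_space Ct)). Phi n x \<in> (Phi n \<circ> \<gamma>) ` T1} = \<gamma> ` T1"
proof -
  have "x \<in> \<gamma> ` T1 \<longleftrightarrow> Phi n x \<in> (Phi n \<circ> \<gamma>) ` T1" if "x \<in> Ct" for x
  proof -
    have "Phi n x \<in> (Phi n \<circ> \<gamma>) ` T1 \<longleftrightarrow> Phi n x \<in> Phi n ` O1 \<inter> C"
      by (simp only: quot_open1)
    also have "\<dots> \<longleftrightarrow> x \<in> O1"
      using that by (simp add: C_def)
    finally show ?thesis
      using that \<gamma>_image by blast
  qed
  then show ?thesis
    using \<gamma>_Ct by auto
qed

lemma preimage2: "{x \<in> topspace (zar (sub Q_space Ct)). Phi n x \<in> (Phi n \<circ> \<delta>2) ` T2} = \<delta>2 ` T2"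
proof (intro set_eqI iffI)
  fix x assume "x \<in> {x \<in> topspace (zar (sub Q_space Ct)). Phi n x \<in> (Phi n \<circ> \<delta>2) ` T2}"
  then obtain u where "x \<in> Ct" "u \<in> T2" "Phi n x = Phi n (\<delta>2 u)"
    by auto
  then show "x \<in> \<delta>2 ` T2"
    using Phi_\<delta>2_eq[of u x] by simp
next
  fix x assume x: "x \<in> \<delta>2 ` T2"
  then obtain u where "u \<in> T2" "x = \<delta>2 u"
    by blast
  moreover have "x \<in> Ct"
    using x \<delta>2_image by blast
  ultimately show "x \<in> {x \<in> topspace (zar (sub Q_space Ct)). Phi n x \<in> (Phi n \<circ> \<delta>2) ` T2}"
    by simp
qed

lemma sections_chart:
  assumes P: "param_curve (sub Z (\<alpha> ` T)) T \<alpha>" and S: "\<alpha> ` T \<subseteq> S"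
  shows "f \<in> sections (sub Z S) (\<alpha> ` T) \<longleftrightarrow> (\<forall>t\<in>T. f \<circ> \<alpha> \<in> reg_at t)"
proof -
  have top: "topspace (zar (sub Z (\<alpha> ` T))) = \<alpha> ` T"
    by (rule param_curve_image[OF P])
  have "openin (zar (sub Z (\<alpha> ` T))) (\<alpha> ` T)"
    using openin_topspace[of "zar (sub Z (\<alpha> ` T))"] unfolding top .
  then have "sections (sub Z (\<alpha> ` T)) (\<alpha> ` T) = {f. \<forall>t\<in>T. \<alpha> t \<in> \<alpha> ` T \<longrightarrow> f \<circ> \<alpha> \<in> reg_at t}"
    using P unfolding param_curve_def by blast
  moreover have "sections (sub Z (\<alpha> ` T)) (\<alpha> ` T) = sections (sub Z S) (\<alpha> ` T)"
    using S by (intro sections_sub_smaller) auto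
  ultimately show ?thesis
    by auto
qed

lemma sections_up1: "f \<in> sections (sub Q_space Ct) (\<gamma> ` T1) \<longleftrightarrow> (\<forall>t\<in>T1. f \<circ> \<gamma> \<in> reg_at t)"
  using param_curve_upstairs[OF det2_\<gamma> finite_T1] \<gamma>_Ct unfolding \<gamma>_def[symmetric] by (intro sections_chart) auto

lemma sections_up2: "f \<in> sections (sub Q_space Ct) (\<delta>2 ` T2) \<longleftrightarrow> (\<forall>t\<in>T2. f \<circ> \<delta>2 \<in> reg_at t)"
  using param_curve_upstairs[OF det2_\<delta>2 finite_T2] \<delta>2_image unfolding \<delta>2_def[symmetric] by (intro sections_chart) auto

lemma sections_down1: "f \<in> sections (sub (Q_quot n) C) ((Phi n \<circ> \<gamma>) ` T1) \<longleftrightarrow> (\<forall>t\<in>T1. f \<circ> (Phi n \<circ> \<gamma>) \<in> reg_at t)"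
  using param_curve_chart1 cover_down by (intro sections_chart) auto

lemma sections_down2: "f \<in> sections (sub (Q_quot n) C) ((Phi n \<circ> \<delta>2) ` T2) \<longleftrightarrow> (\<forall>t\<in>T2. f \<circ> (Phi n \<circ> \<delta>2) \<in> reg_at t)"
  using downstairs2' cover_down by (intro sections_chart) auto

lemma open_down1: "openin (zar (sub (Q_quot n) C)) ((Phi n \<circ> \<gamma>) ` T1)"
  unfolding openin_sub zar_Q_quot using quot_open1 by metis

lemma open_down2: "openin (zar (sub (Q_quot n) C)) ((Phi n \<circ> \<delta>2) ` T2)"
  unfolding openin_sub zar_Q_quot using quot_open2 by metis

lemma open_up2: "openin (zar (sub Q_space Ct)) (\<delta>2 ` T2)"
  unfolding openin_sub zar_Q_space using finite_closed_Q[OF finite_imageI[OF finite_Tdbl]] \<delta>2_image by metis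

lemma evT1: "\<forall>\<^sub>F t in cofinite. t \<in> T1" and evT2: "\<forall>\<^sub>F t in cofinite. t \<in> T2"
  using finite_T1 finite_T2 by (simp_all add: eventually_cofinite Compl_eq)

lemma morphism_Phi_sub: "morphism (sub Q_space Ct) (sub (Q_quot n) C) (Phi n)"
  by (rule morphism_sub[OF morphism_Phi]) (auto simp: C_def)

lemma finite_module1:
  assumes "f \<in> sections (sub Q_space Ct) (\<gamma> ` T1)"
  shows "\<exists>h. (\<forall>b\<in>{\<lambda>_. 1, zc}. h b \<in> sections (sub (Q_quot n) C) ((Phi n \<circ> \<gamma>) ` T1)) \<and>
    (\<forall>x\<in>\<gamma> ` T1. f x = (\<Sum>b\<in>{\<lambda>_. 1, zc}. h b (Phi n x) * b x))"
proof -
  have F: "f \<circ> \<gamma> \<in> reg_at t" if "t \<in> T1" for t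
    using assms that sections_up1 by blast
  obtain \<alpha> \<beta> k where ab: "\<And>t. t \<in> T1 \<Longrightarrow> (f \<circ> \<gamma>) t = poly \<alpha> (xx t) / (t ^ n) ^ k + poly \<beta> (xx t) / (t ^ n) ^ k * t"
    using finite_module_chart1[of "f \<circ> \<gamma>"] F by metis
  define H where "H P p = poly P (X p) / Y p ^ k" for P p
  have HS: "H P \<in> sections (sub (Q_quot n) C) ((Phi n \<circ> \<gamma>) ` T1)" for P
    unfolding sections_down1
  proof
    fix t assume t: "t \<in> T1"
    then have t': "t \<noteq> - cnj a" "t \<noteq> 0"
      by (auto simp: T1_def)
    have "(\<lambda>u. poly P (xx u) / (u ^ n) ^ k) \<in> reg_at t"
      using t' by (intro reg_at_divide xx_reg(2) reg_at_power reg_at_id) simp_all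
    then show "H P \<circ> (Phi n \<circ> \<gamma>) \<in> reg_at t"
    proof (rule reg_at_cong)
      show "(H P \<circ> (Phi n \<circ> \<gamma>)) t = poly P (xx t) / (t ^ n) ^ k"
        using t by (simp add: H_def c_\<gamma>)
      show "\<forall>\<^sub>F u in cofinite. (H P \<circ> (Phi n \<circ> \<gamma>)) u = poly P (xx u) / (u ^ n) ^ k"
        using evT1 by eventually_elim (simp add: H_def c_\<gamma>)
    qed
  qed
  \<comment> \<open>The two generators must be different functions for the sum over the set to have
    two terms.\<close>
  have ne: "(\<lambda>_. 1) \<noteq> zc"
  proof
    assume "(\<lambda>_. 1) = zc"
    then have "(1 :: complex) = zc (Infty, Infty)"
      by metis
    then show False
      by (simp add: zc_def)
  qed
  define h where "h b = (if b = zc then H \<beta> else H \<alpha>)" for b :: "P1 \<times> P1 \<Rightarrow> complex"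
  have "f (\<gamma> t) = (\<Sum>b\<in>{\<lambda>_. 1, zc}. h b (Phi n (\<gamma> t)) * b (\<gamma> t))" if t: "t \<in> T1" for t
  proof -
    have "zc (\<gamma> t) = t"
      using t by (simp add: T1_def \<gamma>_Aff)
    then show ?thesis
      using ab[OF t] ne t by (simp add: h_def H_def c_\<gamma>)
  qed
  then show ?thesis
    using HS by (intro exI[of _ h]) (auto simp: h_def)
qed

text \<open>Over the simple points \<open>Phi n\<close> is a bijection of parametrised curves, so
  each function descends and the constant 1 generates.\<close>

lemma finite_module2:
  assumes "f \<in> sections (sub Q_space Ct) (\<delta>2 ` T2)"
  shows "\<exists>h. (\<forall>b\<in>{\<lambda>_. 1}. h b \<in> sections (sub (Q_quot n) C) ((Phi n \<circ> \<delta>2) ` T2)) \<and>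
    (\<forall>x\<in>\<delta>2 ` T2. f x = (\<Sum>b\<in>{\<lambda>_. 1}. h b (Phi n x) * b x))"
proof -
  define h where "h p = f (\<delta>2 (inv_into T2 (Phi n \<circ> \<delta>2) p))" for p
  have h: "h (Phi n (\<delta>2 u)) = f (\<delta>2 u)" if "u \<in> T2" for u
    using inv_into_f_f[OF inj_Phi_\<delta>2 that] by (simp add: h_def)
  have "h \<circ> (Phi n \<circ> \<delta>2) \<in> reg_at t" if t: "t \<in> T2" for t
  proof (rule reg_at_cong)
    show "f \<circ> \<delta>2 \<in> reg_at t"
      using assms sections_up2 t by blast
    show "(h \<circ> (Phi n \<circ> \<delta>2)) t = (f \<circ> \<delta>2) t"
      using h[OF t] by simp
    show "\<forall>\<^sub>F u in cofinite. (h \<circ> (Phi n \<circ> \<delta>2)) u = (f \<circ> \<delta>2) u"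
      using evT2 by eventually_elim (simp add: h)
  qed
  then have "h \<in> sections (sub (Q_quot n) C) ((Phi n \<circ> \<delta>2) ` T2)"
    unfolding sections_down2 by blast
  then show ?thesis
    using h by (intro exI[of _ "\<lambda>_. h"]) auto
qed

lemma finite_morphism_Phi: "finite_morphism (sub Q_space Ct) (sub (Q_quot n) C) (Phi n)"
  unfolding finite_morphism_def Let_def
proof (intro conjI ballI)
  show "morphism (sub Q_space Ct) (sub (Q_quot n) C) (Phi n)"
    by (rule morphism_Phi_sub)
  fix y assume "y \<in> topspace (zar (sub (Q_quot n) C))"
  then have "y \<in> C"
    unfolding topspace_down .
  then consider "y \<in> (Phi n \<circ> \<gamma>) ` T1" | "y \<in> (Phi n \<circ> \<delta>2) ` T2"
    using cover_down by blast
  then show "\<exists>V. openin (zar (sub (Q_quot n) C)) V \<and> y \<in> V \<and> affine_variety (sub (sub (Q_quot n) C) V) \<and>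
    affine_variety (sub (sub Q_space Ct) {x \<in> topspace (zar (sub Q_space Ct)). Phi n x \<in> V}) \<and>
    (\<exists>B. finite B \<and> B \<subseteq> sections (sub Q_space Ct) {x \<in> topspace (zar (sub Q_space Ct)). Phi n x \<in> V} \<and>
      (\<forall>f\<in>sections (sub Q_space Ct) {x \<in> topspace (zar (sub Q_space Ct)). Phi n x \<in> V}.
        \<exists>h. (\<forall>b\<in>B. h b \<in> sections (sub (Q_quot n) C) V) \<and>
          (\<forall>x\<in>{x \<in> topspace (zar (sub Q_space Ct)). Phi n x \<in> V}. f x = (\<Sum>b\<in>B. h b (Phi n x) * b x))))"
  proof cases
    case 1
    have zc: "zc \<in> sections (sub Q_space Ct) (\<gamma> ` T1)"
      unfolding sections_up1
    proof
      fix t assume t: "t \<in> T1"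
      show "zc \<circ> \<gamma> \<in> reg_at t"
      proof (rule reg_at_cong[OF reg_at_id])
        show "(zc \<circ> \<gamma>) t = t"
          using t by (simp add: T1_def \<gamma>_Aff)
        show "\<forall>\<^sub>F u in cofinite. (zc \<circ> \<gamma>) u = u"
          using evT1 by eventually_elim (simp add: T1_def \<gamma>_Aff)
      qed
    qed
    have one: "(\<lambda>_. 1) \<in> sections (sub Q_space Ct) (\<gamma> ` T1)"
      unfolding sections_up1 by (simp add: o_def reg_at_const)
    show ?thesis
    proof (rule exI[of _ "(Phi n \<circ> \<gamma>) ` T1"], unfold preimage1, intro conjI exI[of _ "{\<lambda>_. 1, zc}"])
      show "affine_variety (sub (sub (Q_quot n) C) ((Phi n \<circ> \<gamma>) ` T1))"
        by (rule affine_variety_chart1[OF downstairs1])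
      show "affine_variety (sub (sub Q_space Ct) (\<gamma> ` T1))"
        by (rule affine_variety_param_curve[OF upstairs1 inj_\<gamma>])
      show "{\<lambda>_. 1, zc} \<subseteq> sections (sub Q_space Ct) (\<gamma> ` T1)"
        using one zc by blast
    qed (use open_down1 1 finite_module1 in blast)+
  next
    case 2
    have one: "(\<lambda>_. 1) \<in> sections (sub Q_space Ct) (\<delta>2 ` T2)"
      unfolding sections_up2 by (simp add: o_def reg_at_const)
    show ?thesis
    proof (rule exI[of _ "(Phi n \<circ> \<delta>2) ` T2"], unfold preimage2, intro conjI exI[of _ "{\<lambda>_. 1}"])
      show "affine_variety (sub (sub (Q_quot n) C) ((Phi n \<circ> \<delta>2) ` T2))"
        by (rule affine_variety_param_curve[OF downstairs2 inj_Phi_\<delta>2])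
      show "affine_variety (sub (sub Q_space Ct) (\<delta>2 ` T2))"
        by (rule affine_variety_param_curve[OF upstairs2 inj_\<delta>2])
      show "{\<lambda>_. 1} \<subseteq> sections (sub Q_space Ct) (\<delta>2 ` T2)"
        using one by blast
    qed (use open_down2 2 finite_module2 in blast)+
  qed
qed

lemma T2_nonempty: "\<exists>u. u \<in> T2"
  using eventually_cofinite_ex[OF evT2] by blast

lemma birational_morphism_Phi: "birational_morphism (sub Q_space Ct) (sub (Q_quot n) C) (Phi n)"
proof -
  have "isomorphism (sub (sub Q_space Ct) (\<delta>2 ` T2)) (sub (sub (Q_quot n) C) ((Phi n \<circ> \<delta>2) ` T2)) (Phi n)"
    by (rule param_curve_isomorphism[OF upstairs2 downstairs2]) (use inj_Phi_\<delta>2 in \<open>auto simp: inj_on_def\<close>)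
  then show ?thesis
    unfolding birational_morphism_def using morphism_Phi_sub open_up2 open_down2 T2_nonempty by blast
qed

lemma normalization_map_Phi: "normalization_map (sub Q_space Ct) (sub (Q_quot n) C) (Phi n)"
  unfolding normalization_map_def
proof (intro conjI ballI)
  show "irreducible_in (zar (sub Q_space Ct)) (topspace (zar (sub Q_space Ct)))"
    by (rule irreducible_in_cofinite_topology[OF cofinite_up]) (unfold topspace_up, rule infinite_up)
  show "irreducible_in (zar (sub (Q_quot n) C)) (topspace (zar (sub (Q_quot n) C)))"
    by (rule irreducible_in_cofinite_topology[OF cofinite_down]) (unfold topspace_down, rule infinite_down)
  show "normal_at (sub Q_space Ct) p" if "p \<in> topspace (zar (sub Q_space Ct))" for p
    using that normal_up unfolding topspace_up by blast
qed (rule finite_morphism_Phi birational_morphism_Phi)+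

lemma krull_dim_C: "krull_dim (zar (sub (Q_quot n) C)) 1"
  by (rule krull_dim_cofinite_topology[OF cofinite_down]) (unfold topspace_down, rule infinite_down)

lemma rational_curve_C: "rational_curve (Q_quot n) C"
  unfolding rational_curve_def
proof (intro conjI)
  show "closedin (zar (Q_quot n)) C"
    using closedin_C by simp
  have cof: "cofinite_topology (subtopology (zar_quot n) C)" and top: "topspace (subtopology (zar_quot n) C) = C"
    using cofinite_down topspace_down by (simp_all add: sub_def)
  show "irreducible_in (zar (Q_quot n)) C"
    unfolding irreducible_in_def
  proof (intro conjI allI impI)
    show "C \<subseteq> topspace (zar (Q_quot n))" "C \<noteq> {}"
      using closedin_subset[OF closedin_C] infinite_down by auto
    fix A B assume AB: "closedin (zar (Q_quot n)) A \<and> closedin (zar (Q_quot n)) B \<and> C \<subseteq> A \<union> B"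
    then have "closedin (subtopology (zar_quot n) C) (A \<inter> C)" "closedin (subtopology (zar_quot n) C) (B \<inter> C)"
      by (auto simp: closedin_subtopology)
    moreover have "irreducible_in (subtopology (zar_quot n) C) C"
      using irreducible_in_cofinite_topology[OF cof] infinite_down unfolding top by blast
    moreover have "C \<subseteq> A \<inter> C \<union> B \<inter> C"
      using AB by blast
    ultimately have "C \<subseteq> A \<inter> C \<or> C \<subseteq> B \<inter> C"
      unfolding irreducible_in_def by blast
    then show "C \<subseteq> A \<or> C \<subseteq> B"
      by blast
  qed
  show "krull_dim (zar (sub (Q_quot n) C)) 1"
    by (rule krull_dim_C)
  obtain \<phi> where "isomorphism (sub (sub (Q_quot n) C) ((Phi n \<circ> \<delta>2) ` T2)) (sub P1_space (Aff ` T2)) \<phi>"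
    using param_curve_isomorphism_inverse[OF downstairs2 param_curve_P1[OF finite_T2]] inj_Phi_\<delta>2
    by (auto simp: inj_on_def)
  moreover have "openin (zar P1_space) (Aff ` T2)"
  proof -
    have "closedin zar_P1 (\<Union>p\<in>insert Infty (Aff ` (- T2)). {p})"
      using finite_T2 closedin_zar_P1_point by (intro closedin_Union) auto
    then have "openin zar_P1 (UNIV - insert Infty (Aff ` (- T2)))"
      by (simp add: closedin_def)
    moreover have "UNIV - insert Infty (Aff ` (- T2)) = Aff ` T2"
    proof -
      have "p = Infty \<or> (\<exists>z. p = Aff z)" for p
        by (cases p) auto
      then show ?thesis
        by auto
    qed
    ultimately show ?thesis
      by simp
  qed
  ultimately show "birational (sub (Q_quot n) C) P1_space"
    unfolding birational_def using open_down2 T2_nonempty by blast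
qed

section \<open>The singular points\<close>

lemma nonsingular_C:
  assumes "p \<in> C" "p \<notin> N"
  obtains t where "cotangent_basis (sub (Q_quot n) C) p 1 t"
proof -
  have pr: "p \<in> range (Phi n) - N"
    using assms by (auto simp: C_def)
  then have "p \<in> (Phi n \<circ> \<delta>2) ` T2"
    using quot_open2(2) assms(1) by blast
  then obtain u where u: "u \<in> T2" "p = (Phi n \<circ> \<delta>2) u"
    by blast
  have "cotangent_basis (sub (sub (Q_quot n) C) ((Phi n \<circ> \<delta>2) ` T2)) p 1
      (\<lambda>i x. inv_into T2 (Phi n \<circ> \<delta>2) x - u)"
    unfolding u(2) by (rule cotangent_basis_param_curve[OF downstairs2 inj_Phi_\<delta>2 u(1)])
  then have "cotangent_basis (sub (Q_quot n) C) p 1 (\<lambda>i x. inv_into T2 (Phi n \<circ> \<delta>2) x - u)"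
    using cotangent_basis_sub_open[OF restricts_Q_quot _ pr quot_open2(2)] quot_open2(1) by simp
  then show thesis
    by (rule that)
qed

text \<open>Regularity would require a cotangent basis whose length is the Krull dimension, which is
  uniquely determined and equals 1.\<close>

lemma ordinary_node_singular:
  assumes "ordinary_node (Q_quot n) C p"
  shows "\<not> nonsingular_at (sub (Q_quot n) C) p"
proof
  have "p \<in> range (Phi n)"
    using assms by (auto simp: ordinary_node_def C_def)
  then have ring: "ring_at (Q_quot n) p"
    by (rule ring_at_quot)
  assume "nonsingular_at (sub (Q_quot n) C) p"
  then obtain d t where "krull_dim (zar (sub (Q_quot n) C)) d" "cotangent_basis (sub (Q_quot n) C) p d t"
    unfolding nonsingular_at_def by blast
  moreover from this have "d = 1"
    using krull_dim_unique krull_dim_C by blast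
  ultimately show False
    using ordinary_node_not_simple[OF ring assms] by simp
qed

lemma nodes_eq: "{p. ordinary_node (Q_quot n) C p} = N"
proof (intro set_eqI iffI)
  fix p assume "p \<in> {p. ordinary_node (Q_quot n) C p}"
  then have p: "ordinary_node (Q_quot n) C p"
    by simp
  then have "p \<in> C"
    by (simp add: ordinary_node_def)
  show "p \<in> N"
  proof (rule ccontr)
    assume "p \<notin> N"
    then obtain t where "cotangent_basis (sub (Q_quot n) C) p 1 t"
      using nonsingular_C \<open>p \<in> C\<close> by blast
    then have "nonsingular_at (sub (Q_quot n) C) p"
      unfolding nonsingular_at_def using krull_dim_C by blast
    then show False
      using ordinary_node_singular[OF p] by blast
  qed
next
  fix p assume "p \<in> N"
  then obtain t where "t \<in> Tdbl" "p = Phi n (\<gamma> t)"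
    by (auto simp: N_def)
  then show "p \<in> {p. ordinary_node (Q_quot n) C p}"
    using ordinary_node_double[of t] by (simp add: Tdbl_def C_def)
qed

lemma singular_points_eq: "singular_points (sub (Q_quot n) C) = N"
proof (intro set_eqI iffI)
  fix p assume "p \<in> singular_points (sub (Q_quot n) C)"
  then have p: "p \<in> C" "\<not> nonsingular_at (sub (Q_quot n) C) p"
    unfolding singular_points_def topspace_down by auto
  show "p \<in> N"
  proof (rule ccontr)
    assume "p \<notin> N"
    then obtain t where "cotangent_basis (sub (Q_quot n) C) p 1 t"
      using nonsingular_C p(1) by blast
    then show False
      using p(2) krull_dim_C unfolding nonsingular_at_def by blast
  qed
next
  fix p assume "p \<in> N"
  then have "ordinary_node (Q_quot n) C p"
    using nodes_eq by blast
  then show "p \<in> singular_points (sub (Q_quot n) C)"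
    using ordinary_node_singular unfolding singular_points_def topspace_down
    by (simp add: ordinary_node_def)
qed

definition node :: "nat \<Rightarrow> (P1 \<times> P1) set" where "node k = Phi n (\<gamma> (tk k))"

lemma X_node: "X (node k) = (vk k)\<^sup>2"
  by (simp add: node_def c_\<gamma> tk_T1 xx_tk)

lemma same_x:
  assumes "t \<noteq> - cnj a" "u \<noteq> - cnj a" "xx u = xx t"
  shows "u = t \<or> u = tt t"
proof -
  have "u * (poly sp (xx t) - u) = t * (poly sp (xx t) - t)"
    using conj_pair_tt[OF assms(1)] conj_pair_tt[OF assms(2)] assms(3) by (simp add: conj_pair_def tt_def)
  then have "(u - t) * (u - tt t) = 0"
    by (simp add: tt_def algebra_simps)
  then show ?thesis
    by simp
qed

lemma N_eq: "N = node ` {1..<n}"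
proof (intro set_eqI iffI)
  fix p assume "p \<in> N"
  then obtain t where t: "t \<in> T1" "poly (Ap n) (xx t) = 0" "p = Phi n (\<gamma> t)"
    by (auto simp: N_def Tdbl_def)
  then obtain k where k: "k \<in> {1..<n}" "xx t = (vk k)\<^sup>2"
    using Ap_roots by blast
  \<comment> \<open>Over one value of \<open>x\<close> there are only two parameters. Both map to
    the same node, so either alternative suffices.\<close>
  have "tk k = t \<or> tk k = tt t"
    using same_x[of t "tk k"] t(1) tk_T1[of k] k(2) by (simp add: T1_def xx_tk)
  then have "tk k ^ n = t ^ n"
    using tt_double(4)[OF t(1,2)] by auto
  then have "Phi n (\<gamma> t) = Phi n (\<gamma> (tk k))"
    using Phi_\<gamma>_eq[OF t(1) tk_T1] k(2) by (simp add: xx_tk)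
  then show "p \<in> node ` {1..<n}"
    using k(1) t(3) by (auto simp: node_def)
next
  fix p assume "p \<in> node ` {1..<n}"
  then obtain k where "k \<in> {1..<n}" "p = Phi n (\<gamma> (tk k))"
    by (auto simp: node_def)
  then show "p \<in> N"
    using Ap_root[of k] tk_T1[of k] by (auto simp: N_def Tdbl_def xx_tk)
qed

lemma node_inj: "inj_on node {1..<n}"
proof (rule inj_onI)
  fix j k assume "j \<in> {1..<n}" "k \<in> {1..<n}" "node j = node k"
  moreover from this have "(vk j)\<^sup>2 = (vk k)\<^sup>2"
    using X_node by metis
  ultimately show "j = k"
    using inj_onD[OF vk_inj] by blast
qed

text \<open>All nodes lie in the chart where \<open>zc\<close> is non-zero, while \<open>zc\<close>
  is 0 at the four fixed points, either as a coordinate or by default.\<close>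

lemma N_avoids_singular: "N \<inter> quot_singular_points n = {}"
proof -
  have "Phi n (\<gamma> t) \<noteq> Phi n q" if "t \<in> T1" "q \<in> {(Aff 0, Aff 0), (Infty, Infty), (Aff 0, Infty), (Infty, Aff 0)}" for t q
  proof
    assume "Phi n (\<gamma> t) = Phi n q"
    then have "q \<in> O1"
      using c_Phi(3) \<gamma>_O1[OF that(1)] by blast
    then show False
      using that(2) by (auto simp: O1_def zc_def)
  qed
  then show ?thesis
    unfolding N_def quot_singular_points_def Tdbl_def by blast
qed

section \<open>The real nodes\<close>

text \<open>The involution conjugates \<open>x\<close>, so a real node has
  \<open>(vk k)\<^sup>2\<close> real. As \<open>vk k\<close> lies in the upper half plane, it is
  then purely imaginary, which means that the cosine vanishes and \<open>k / n\<close> is one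
  half.\<close>

lemma real_node_iff:
  assumes k: "k \<in> {1..<n}"
  shows "real_point (node k) \<longleftrightarrow> 2 * k = n"
proof
  define t where "t = tk k"
  have t: "t \<in> T1" "t \<noteq> - cnj a" "t \<noteq> 0"
    using tk_T1[of k] by (auto simp: t_def T1_def)
  have node: "node k = Phi n (Aff t, Aff (mm t))"
    using \<gamma>_Aff[OF t(2)] by (simp add: node_def t_def)
  have sig: "sigma_quot (node k) = Phi n (Aff (cnj (mm t)), Aff (cnj t))"
    unfolding node sigma_quot_Phi by (simp add: sigma_Q_def)
  have Im: "Im (vk k) > 0"
    by (rule vk_Im_pos)
  {
    assume "real_point (node k)"
    then have "X (sigma_quot (node k)) = X (node k)"
      by (simp add: real_point_def)
    then have "cnj (xx t) = xx t"
      unfolding sig unfolding node by (simp add: cx_def xx_def mult.commute)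
    then have "Im (xx t) = 0"
      by (simp add: complex_eq_iff)
    then have "Im ((vk k)\<^sup>2) = 0"
      by (simp add: t_def xx_tk)
    then have "Re (vk k) = 0"
      using Im by (simp add: power2_eq_square)
    then have "cos (pi * k / n) = cos (pi / 2)"
      using a0 by (simp add: vk_def)
    moreover have "0 \<le> pi * k / n" "pi * k / n \<le> pi" "0 \<le> pi / 2" "pi / 2 \<le> pi"
      using k n0 by (simp_all add: field_simps)
    ultimately have "pi * k / n = pi / 2"
      by (metis cos_inj_pi)
    then have "real (2 * k) = real n"
      using n0 by (simp add: field_simps)
    then show "2 * k = n"
      by (simp only: of_nat_eq_iff)
  next
    \<comment> \<open>Here \<open>x = - b\<close>, so the sum \<open>sp\<close> is zero and the
      partner root is \<open>- t\<close>. This makes the second coordinate \<open>- cnj t\<close>,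
      and the involution acts on the point as the rotation by -1.\<close>
    assume n: "2 * k = n"
    have "real n = 2 * real k" "k > 0"
      using n k by auto
    then have half: "pi * k / n = pi / 2"
      by simp
    define r where "r = sqrt b"
    have v: "vk k = \<i> * of_real r"
      unfolding vk_def half by (simp add: r_def complex_eq_iff)
    have ei: "exp (\<i> * of_real (pi / 2)) = \<i>"
      by (simp add: exp_eq_polar cis_conv_exp[symmetric])
    have teq: "t = of_real (cmod a) * of_real r / a"
      unfolding t_def tk_def half ei v by (simp add: field_simps)
    have "tt t = poly sp ((vk k)\<^sup>2) - t"
      by (simp add: tt_def t_def xx_tk)
    also have "poly sp ((vk k)\<^sup>2) = 0"
    proof -
      have "(of_real r :: complex)\<^sup>2 = of_real b"
        using b_pos by (simp add: r_def flip: of_real_power)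
      then show ?thesis
        by (simp add: sp_def v power_mult_distrib)
    qed
    finally have ttt: "tt t = - t"
      by simp
    have "cnj a / a * mm t = - t"
      using tt_mm[OF t(2,3)] ttt by simp
    then have mmt: "mm t = - (a * t / cnj a)"
      using a0 by (simp add: field_simps)
    have at: "a * t = of_real (cmod a * r)"
      using a0 by (simp add: teq)
    then have ct: "cnj t = of_real (cmod a * r) / cnj a"
      by (simp add: teq)
    have 1: "mm t = - cnj t"
      unfolding mmt at ct ..
    have 2: "cnj (mm t) = - t"
      unfolding 1 by simp
    \<comment> \<open>For \<open>n = 2 * k\<close> the rotation by -1 belongs to the group, which
      closes the argument.\<close>
    have "root1 n ^ k = exp (of_real pi * \<i>)"
    proof -
      have "of_nat k * (2 * of_real pi * \<i> / of_nat n) = (of_real pi * \<i> :: complex)"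
        using n \<open>k > 0\<close> by (simp flip: n)
      then show ?thesis
        unfolding root1_def by (simp flip: exp_of_nat_mult)
    qed
    then have w: "root1 n ^ k = - 1"
      by (simp add: exp_pi_i)
    have "act (root1 n ^ k) (Aff t, Aff (mm t)) = (Aff (cnj (mm t)), Aff (cnj t))"
      unfolding w by (simp add: act_def 1)
    then have "sigma_quot (node k) = Phi n (Aff t, Aff (mm t))"
      unfolding sig using Phi_act[OF n0, of k "(Aff t, Aff (mm t))"] by simp
    then have "sigma_quot (node k) = node k"
      by (simp only: node)
    then show "real_point (node k)"
      by (simp add: real_point_def)
  }
qed

lemma normalization_rational_nodes:
  "normalization_map (sub Q_space (C_tilde a b)) (sub (Q_quot n) (C_curve n a b)) (Phi n) \<and>
    rational_curve (Q_quot n) (C_curve n a b) \<and>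
    (let nodes = {p. ordinary_node (Q_quot n) (C_curve n a b) p} in
       finite nodes \<and> card nodes = n - 1 \<and>
       singular_points (sub (Q_quot n) (C_curve n a b)) = nodes \<and>
       nodes \<inter> quot_singular_points n = {} \<and>
       (odd n \<longrightarrow> (\<forall>p\<in>nodes. \<not> real_point p)) \<and>
       (even n \<longrightarrow> (\<exists>!p. p \<in> nodes \<and> real_point p)))"
proof -
  have CC: "C_curve n a b = C"
    by (simp add: C_curve_def C_def C_tilde_eq)
  have "finite N"
    unfolding N_eq by simp
  moreover have "card N = n - 1"
    unfolding N_eq card_image[OF node_inj] by simp
  moreover have "\<forall>p\<in>N. \<not> real_point p" if "odd n"
    unfolding N_eq using that real_node_iff by auto
  moreover have "\<exists>!p. p \<in> N \<and> real_point p" if even: "even n"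
  proof -
    obtain k where k: "n = 2 * k"
      using even by (rule evenE)
    then have kn: "k \<in> {1..<n}"
      using n2 by auto
    show ?thesis
    proof (rule ex1I[of _ "node k"])
      show "node k \<in> N \<and> real_point (node k)"
        unfolding N_eq using kn real_node_iff[OF kn] k by auto
      fix p assume p: "p \<in> N \<and> real_point p"
      then obtain j where j: "j \<in> {1..<n}" "p = node j"
        unfolding N_eq by blast
      then have "2 * j = n"
        using p real_node_iff by blast
      then show "p = node k"
        using j(2) k by simp
    qed
  qed
  ultimately show ?thesis
    unfolding CC C_tilde_eq Let_def nodes_eq singular_points_eq
    using normalization_map_Phi rational_curve_C N_avoids_singular by blast
qed

end

theorem proposition2p1:
  fixes n :: nat and a :: complex and b :: real
  assumes "n \<ge> 2" and "a \<noteq> 0" and "(cmod a)\<^sup>2 - b < 0"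
  shows "normalization_map (sub Q_space (C_tilde a b)) (sub (Q_quot n) (C_curve n a b)) (Phi n) \<and>
    rational_curve (Q_quot n) (C_curve n a b) \<and>
    (let nodes = {p. ordinary_node (Q_quot n) (C_curve n a b) p} in
       finite nodes \<and> card nodes = n - 1 \<and>
       singular_points (sub (Q_quot n) (C_curve n a b)) = nodes \<and>
       nodes \<inter> quot_singular_points n = {} \<and>
       (odd n \<longrightarrow> (\<forall>p\<in>nodes. \<not> real_point p)) \<and>
       (even n \<longrightarrow> (\<exists>!p. p \<in> nodes \<and> real_point p)))"
proof -
  interpret hyperbola n a b
    using assms by unfold_locales
  show ?thesis
    by (rule normalization_rational_nodes)
qed

end
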